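(* Let $\mathcal{E}$ be a rank $2$ vector bundle on $\mathbb{P}^2$ such that $c_1(\mathcal{E}) = c \leq 0$ and $c_2(\mathcal{E}) = 0$. Then for any smooth conic $C \subset \mathbb{P}^2$ there exists a non-negative integer $r$, depending on $C$, such that the restriction of $\mathcal{E}$ to $C$ splits as $$\mathcal{E}|_{C} \cong \mathcal{O}_{C}\left(\tfrac{r}{2}\right) \oplus \mathcal{O}_{C}\left(c-\tfrac{r}{2}\right),$$ and, more precisely, either $r=0$, in which case $\mathcal{E} \cong \mathcal{O}_{\mathbb{P}^2} \oplus \mathcal{O}_{\mathbb{P}^2}(c)$, or $r \geq 2$.
   Context: $\mathbb{P}^2$ is the complex projective plane; $c_1,c_2$ denote Chern numbers (integers). For a smooth conic $C\subset\mathbb{P}^2$ (so $C\cong\mathbb{P}^1$) and an integer $d$, $\mathcal{O}_C(\tfrac{d}{2})$ denotes the unique line bundle on $C$ of degree $d$; thus for an integer $n$, $\mathcal{O}_C(n)=\mathcal{O}_{\mathbb{P}^2}(n)|_C$ has degree $2n$. *)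

theory Defs
  imports "HOL-Analysis.Analysis" "Jordan_Normal_Form.Matrix"
begin

(* The infix $ is used for the coordinates of complex ^ 3 only; matrices whose size is a
   natural number are those of Jordan_Normal_Form. *)
no_notation vec_index (infixl \<open>$\<close> 100)

section \<open>The complex projective plane and its regular functions\<close>

quotient_type P2 = "complex ^ 3" / partial:
  "\<lambda>v w. v \<noteq> 0 \<and> w \<noteq> 0 \<and> (\<exists>c. w = c *s v)"
proof -
  let ?R = "\<lambda>v w :: complex ^ 3. v \<noteq> 0 \<and> w \<noteq> 0 \<and> (\<exists>c. w = c *s v)"
  have "\<exists>v. ?R v v"
    by (rule exI[of _ "axis 1 1"]) (auto simp: axis_eq_0_iff intro: exI[of _ 1])
  moreover have "symp ?R"
  proof (rule sympI)
    fix v w :: "complex ^ 3"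
    assume *: "?R v w"
    then obtain c where c: "w = c *s v" by blast
    with * have "v = inverse c *s w" by (auto simp: vector_smult_assoc)
    with * show "?R w v" by blast
  qed
  moreover have "transp ?R"
    by (rule transpI) (auto simp: vector_smult_assoc)
  ultimately show "part_equivp ?R" by (rule part_equivpI)
qed

(* Some choice of homogeneous coordinates of the point; it is only ever used in ways that do
   not depend on the choice, up to isomorphism in the case of line_O below. *)
definition coords :: "P2 \<Rightarrow> complex ^ 3" where
  "coords P = rep_P2 P"

lemma coords_nonzero: "coords P \<noteq> 0"
  using Quotient_rep_reflp[OF Quotient_P2, of P] by (simp add: coords_def)

lemma coords_abs: "v \<noteq> 0 \<Longrightarrow> \<exists>c. c \<noteq> 0 \<and> coords (abs_P2 v) = c *s v"
proof -
  assume v: "v \<noteq> 0"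
  then have "v \<noteq> 0 \<and> v \<noteq> 0 \<and> (\<exists>c. v = c *s v)" by (auto intro: exI[of _ 1])
  from rep_abs_rsp[OF Quotient3_P2 this] obtain c where "coords (abs_P2 v) = c *s v"
    unfolding coords_def by auto
  moreover have "c \<noteq> 0" using calculation coords_nonzero[of "abs_P2 v"] by auto
  ultimately show ?thesis by blast
qed

lemma coords_eqI: "coords P = c *s coords R \<Longrightarrow> P = R"
  unfolding coords_def
  using Quotient_rel_rep[OF Quotient_P2, of R P] coords_nonzero[unfolded coords_def] by auto

definition form :: "nat \<Rightarrow> (complex ^ 3 \<Rightarrow> complex) \<Rightarrow> bool" where
  "form d p \<longleftrightarrow> (\<exists>a :: nat \<Rightarrow> nat \<Rightarrow> complex. \<forall>v.
     p v = (\<Sum>i\<le>d. \<Sum>j\<le>d - i. a i j * (v $ 1) ^ i * (v $ 2) ^ j * (v $ 3) ^ (d - i - j)))"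

definition zariski_open :: "P2 set \<Rightarrow> P2 set \<Rightarrow> bool" where
  "zariski_open X U \<longleftrightarrow> (\<exists>S. (\<forall>p\<in>S. \<exists>d. form d p) \<and> U = {P \<in> X. \<exists>p\<in>S. p (coords P) \<noteq> 0})"

(* U is meant to be an open subset of P2 or of a closed subvariety with its reduced structure. *)
definition regular_on :: "P2 set \<Rightarrow> (P2 \<Rightarrow> complex) \<Rightarrow> bool" where
  "regular_on U f \<longleftrightarrow> (\<forall>P\<in>U. \<exists>V d p q. zariski_open U V \<and> P \<in> V \<and> form d p \<and> form d q \<and>
     (\<forall>R\<in>V. q (coords R) \<noteq> 0 \<and> f R = p (coords R) / q (coords R)))"

definition regular_mat_on :: "P2 set \<Rightarrow> nat \<Rightarrow> nat \<Rightarrow> (P2 \<Rightarrow> complex mat) \<Rightarrow> bool" where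
  "regular_mat_on U m n G \<longleftrightarrow> (\<forall>P\<in>U. G P \<in> carrier_mat m n) \<and>
     (\<forall>i<m. \<forall>j<n. regular_on U (\<lambda>P. G P $$ (i, j)))"

definition partial_deriv :: "3 \<Rightarrow> (complex ^ 3 \<Rightarrow> complex) \<Rightarrow> complex ^ 3 \<Rightarrow> complex" where
  "partial_deriv i p v = deriv (\<lambda>t. p (v + t *s axis i 1)) 0"

definition smooth_conic :: "P2 set \<Rightarrow> bool" where
  "smooth_conic C \<longleftrightarrow> (\<exists>q. form 2 q \<and> C = {P. q (coords P) = 0} \<and>
     (\<forall>P\<in>C. \<exists>i. partial_deriv i q (coords P) \<noteq> 0))"

section \<open>Algebraic vector bundles\<close>

(* A bundle of rank r is given by its local trivialisations: the fibre over every point is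
   identified, as a mere vector space, with C^r, and a pair (U, \<phi>) in the atlas is
   the trivialisation over U that is the linear isomorphism \<phi> P : C^r -> C^r on the fibre over P.
   The maps \<phi> themselves need not be regular. The geometry is in the transition functions
   \<psi> \<phi>^(-1), which are the usual cocycle of the bundle; every cocycle g arises in this way, by
   \<phi>_j P = g_{j,i(P)} P for any choice of an index i(P) with P in U_{i(P)}. *)
record vb =
  rk :: nat
  atlas :: "(P2 set \<times> (P2 \<Rightarrow> complex mat)) set"

definition vector_bundle :: "P2 set \<Rightarrow> vb \<Rightarrow> bool" where
  "vector_bundle X E \<longleftrightarrow>
     (\<forall>(U, \<phi>) \<in> atlas E. zariski_open X U \<and>
        (\<forall>P\<in>U. \<phi> P \<in> carrier_mat (rk E) (rk E) \<and> invertible_mat (\<phi> P))) \<and>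
     (\<Union>(U, \<phi>) \<in> atlas E. U) = X \<and>
     (\<forall>(U, \<phi>) \<in> atlas E. \<forall>(V, \<psi>) \<in> atlas E. \<exists>G.
        regular_mat_on (U \<inter> V) (rk E) (rk E) G \<and> (\<forall>P \<in> U \<inter> V. \<psi> P = G P * \<phi> P))"

(* T P is the linear map on the fibre over P; in charts it is H = \<psi> T \<phi>^(-1). *)
definition bundle_map :: "P2 set \<Rightarrow> vb \<Rightarrow> vb \<Rightarrow> (P2 \<Rightarrow> complex mat) \<Rightarrow> bool" where
  "bundle_map X E F T \<longleftrightarrow>
     (\<forall>P\<in>X. T P \<in> carrier_mat (rk F) (rk E)) \<and>
     (\<forall>(U, \<phi>) \<in> atlas E. \<forall>(V, \<psi>) \<in> atlas F. \<exists>H.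
        regular_mat_on (U \<inter> V) (rk F) (rk E) H \<and> (\<forall>P \<in> U \<inter> V. \<psi> P * T P = H P * \<phi> P))"

definition isomorphic_vb :: "P2 set \<Rightarrow> vb \<Rightarrow> vb \<Rightarrow> bool" where
  "isomorphic_vb X E F \<longleftrightarrow> (\<exists>S T. bundle_map X E F S \<and> bundle_map X F E T \<and>
     (\<forall>P\<in>X. T P * S P = 1\<^sub>m (rk E) \<and> S P * T P = 1\<^sub>m (rk F)))"

definition restrict_vb :: "vb \<Rightarrow> P2 set \<Rightarrow> vb" where
  "restrict_vb E C = \<lparr>rk = rk E, atlas = (\<lambda>(U, \<phi>). (U \<inter> C, \<phi>)) ` atlas E\<rparr>"

definition direct_sum_vb :: "vb \<Rightarrow> vb \<Rightarrow> vb" where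
  "direct_sum_vb E F = \<lparr>rk = rk E + rk F,
     atlas = {(U \<inter> V, \<lambda>P. four_block_mat (\<phi> P) (0\<^sub>m (rk E) (rk F)) (0\<^sub>m (rk F) (rk E)) (\<psi> P))
       | U \<phi> V \<psi>. (U, \<phi>) \<in> atlas E \<and> (V, \<psi>) \<in> atlas F}\<rparr>"

(* The bundle O(d) on P2. Where the i-th homogeneous coordinate x_i is nonzero, a section s is
   trivialised as s / x_i^d, so that the forms of degree d are global sections; the transition
   functions are (x_i / x_j)^d. *)
definition line_O :: "int \<Rightarrow> vb" where
  "line_O d = \<lparr>rk = 1,
     atlas = range (\<lambda>i. ({P. coords P $ i \<noteq> 0}, \<lambda>P. mat 1 1 (\<lambda>_. (coords P $ i) powi (- d))))\<rparr>"

section \<open>Chern numbers on the projective plane\<close>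

definition short_exact :: "P2 set \<Rightarrow> vb \<Rightarrow> vb \<Rightarrow> vb \<Rightarrow> bool" where
  "short_exact X E' E E'' \<longleftrightarrow> vector_bundle X E' \<and> vector_bundle X E \<and> vector_bundle X E'' \<and>
     (\<exists>S T. bundle_map X E' E S \<and> bundle_map X E E'' T \<and> (\<forall>P\<in>X.
        inj_on (\<lambda>x. S P *\<^sub>v x) (carrier_vec (rk E')) \<and>
        (\<lambda>x. S P *\<^sub>v x) ` carrier_vec (rk E') =
          {y \<in> carrier_vec (rk E). T P *\<^sub>v y = 0\<^sub>v (rk E'')} \<and>
        (\<lambda>y. T P *\<^sub>v y) ` carrier_vec (rk E) = carrier_vec (rk E'')))"

(* chern_numbers E a b: the total Chern class of the bundle E on P2 is 1 + a h + b h^2, where h is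
   the class of a line and h^3 = 0. Chern classes are determined by invariance under
   isomorphism, the normalisation c(O(d)) = 1 + d h, and the Whitney formula c(E) = c(E') c(E'')
   for short exact sequences, since every bundle on P2 has a finite resolution by direct sums of
   line bundles O(d). The Whitney formula is used to find any one of the three classes from
   the other two. *)
inductive chern_numbers :: "vb \<Rightarrow> int \<Rightarrow> int \<Rightarrow> bool" where
  normalisation: "chern_numbers (line_O d) d 0"
| isomorphism: "\<lbrakk>chern_numbers E a b; vector_bundle UNIV F; isomorphic_vb UNIV E F\<rbrakk>
    \<Longrightarrow> chern_numbers F a b"
| whitney_mid: "\<lbrakk>short_exact UNIV E' E E''; chern_numbers E' a' b'; chern_numbers E'' a'' b''\<rbrakk>
    \<Longrightarrow> chern_numbers E (a' + a'') (b' + a' * a'' + b'')"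
| whitney_sub: "\<lbrakk>short_exact UNIV E' E E''; chern_numbers E'' a'' b'';
     chern_numbers E (a' + a'') (b' + a' * a'' + b'')\<rbrakk> \<Longrightarrow> chern_numbers E' a' b'"
| whitney_quot: "\<lbrakk>short_exact UNIV E' E E''; chern_numbers E' a' b';
     chern_numbers E (a' + a'') (b' + a' * a'' + b'')\<rbrakk> \<Longrightarrow> chern_numbers E'' a'' b''"

section \<open>Line bundles of given degree on a smooth plane curve\<close>

(* The function t is regular near P, and its germ generates the maximal ideal of the local ring of
   C at P. *)
definition local_parameter :: "P2 set \<Rightarrow> P2 \<Rightarrow> (P2 \<Rightarrow> complex) \<Rightarrow> bool" where
  "local_parameter C P t \<longleftrightarrow> (\<exists>V. zariski_open C V \<and> P \<in> V \<and> regular_on V t \<and> t P = 0 \<and>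
     (\<forall>W g. zariski_open C W \<and> P \<in> W \<and> regular_on W g \<and> g P = 0 \<longrightarrow>
        (\<exists>W' h. zariski_open C W' \<and> P \<in> W' \<and> W' \<subseteq> V \<inter> W \<and> regular_on W' h \<and>
           (\<forall>R\<in>W'. g R = h R * t R))))"

(* The rational function represented by the regular function f on the dense open set W has order n
   at P: it is t^n u with a local parameter t and a unit u of the local ring at P. The point P
   need not lie in W. *)
definition has_order :: "P2 set \<Rightarrow> P2 \<Rightarrow> P2 set \<Rightarrow> (P2 \<Rightarrow> complex) \<Rightarrow> int \<Rightarrow> bool" where
  "has_order C P W f n \<longleftrightarrow> (\<exists>t V u. local_parameter C P t \<and>
     zariski_open C V \<and> P \<in> V \<and> regular_on V u \<and> u P \<noteq> 0 \<and>
     (\<forall>R \<in> V \<inter> W. t R \<noteq> 0 \<longrightarrow> f R = t R powi n * u R))"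

(* The degree of the line bundle L on C is the degree of the divisor of a nonzero rational
   section s, where s is regular on the nonempty open subset W of C. *)
definition has_degree :: "P2 set \<Rightarrow> vb \<Rightarrow> int \<Rightarrow> bool" where
  "has_degree C L d \<longleftrightarrow> (\<exists>W s n. zariski_open C W \<and> (\<exists>P\<in>W. s P \<noteq> 0) \<and>
     (\<forall>(U, \<phi>) \<in> atlas L. regular_on (U \<inter> W) (\<lambda>R. \<phi> R $$ (0, 0) * s R)) \<and>
     (\<forall>(U, \<phi>) \<in> atlas L. \<forall>P\<in>U. has_order C P (U \<inter> W) (\<lambda>R. \<phi> R $$ (0, 0) * s R) (n P)) \<and>
     finite {P \<in> C. n P \<noteq> 0} \<and> d = (\<Sum>P | P \<in> C \<and> n P \<noteq> 0. n P))"

(* O_C(d/2): the line bundle of degree d on the smooth conic C, which is unique up to isomorphism *)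
definition conic_O :: "P2 set \<Rightarrow> int \<Rightarrow> vb" where
  "conic_O C d = (SOME L. vector_bundle C L \<and> rk L = 1 \<and> has_degree C L d)"

end

(* A section of a twist of a bundle on X is described by its coordinates in the fibres; in every
  chart these are locally fractions of forms. All dimension counts are done with forms and
  sections, without cohomology.

  On the plane the graded module M of sections of all twists is finite dimensional in every
  degree, its Hilbert function is eventually a polynomial, and Hilbert functions are eventually
  additive on exact sequences. So the Chern numbers determine the Hilbert polynomial of M.
  Let s be a nonzero section of E(k) with k least. It has finitely many zeros, because an
  equation of a curve of zeros could be divided out. Wedging with s maps M onto an ideal J of
  the ring S of forms. As M is free of torsion and reflexive, J is saturated, and so the
  dimension of S/J grows to its final value, which is k (k + c) since c_2 = 0. In degree
  2 k + c - 1 the ideal J vanishes, which excludes k > 0. If k = 0, then S = J, and a section t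
  with s wedge t = 1 splits E. If k < 0, then s restricts to a nonzero section on the conic C.

  The conic is parametrised by binary forms. On C a section of least degree e1 and a section of
  least degree among those that are not multiples of e1 form a basis of every fibre (this is
  Grothendieck's theorem for rank two); in the case k < 0 the degree of e1 is at most 2 k <= -2,
  and -r is that degree. *)
theory Submission
 imports Defs "HOL-Library.Function_Algebras" "HOL-Computational_Algebra.Computational_Algebra"
  "HOL-Computational_Algebra.Field_as_Ring"
begin

no_notation vec_index (infixl \<open>$\<close> 100)
no_notation fps_nth (infixl \<open>$\<close> 75)

section \<open>Finite-dimensional spaces of functions\<close>

text \<open>Chern numbers are given only by axioms, so c_2 can be reached only through the Whitney
  formula for arbitrary short exact sequences. The obstacle is exactness on sections in large
  degrees, usually a consequence of vanishing cohomology. It is replaced by a criterion for graded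
  modules of finite dimension in each degree: V/W vanishes in large degrees if, for any two
  independent linear forms a and b, large degrees of V lie in a V + b V + W. This is a dimension
  count, as binary forms over the complex numbers split into linear factors. For bundles the
  criterion is checked at the point a = b = 0, where sections of large degree take every value. The
  number k (k + c) is c_2(E(k)), the number of zeros of s with multiplicity. The twist e with det E
  = O(e) is not known beforehand; e = c comes out because the dimension of S/J stabilises. Degree 2
  k + c - 1 is special because wedging with s raises degrees by k + c, so J there is the image of M
  in degree k - 1, which is zero. A twist by 1 on the plane has degree 2 on the conic, so k <= -1
  gives r >= 2.\<close>

declare plus_fun_apply [simp del] minus_apply [simp del] uminus_apply [simp del]
 times_fun_apply [simp del] zero_fun_apply [simp del] one_fun_apply [simp del]

lemmas fun_ops = plus_fun_apply minus_apply uminus_apply times_fun_apply zero_fun_apply one_fun_apply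

text \<open>Constants live inside the ring of functions, so that scaling is a ring product and the
  vector space laws are ring laws. The pointwise rules are removed from the simplifier above and
  collected in \<open>fun_ops\<close>: identities between forms and sections are handled in the ring
  and evaluated only on demand.\<close>

definition kk :: "complex => 'i => complex" where
 "kk c = (\<lambda>_. c)"

lemma kk_simps: "kk (a + b) = kk a + kk b" "kk (a - b) = kk a - kk b" "kk (a * b) = kk a * kk b"
  "kk 0 = 0" "kk 1 = 1" "kk (- a) = - kk a"
 by (auto simp: kk_def fun_eq_iff fun_ops)

lemma kk_apply: "kk c i = c"
 by (simp add: kk_def)

definition cscale :: "complex => ('i => complex) => 'i => complex" where
 "cscale c f = kk c * f"

lemma cscale_apply: "cscale c f i = c * f i"
 by (simp add: cscale_def kk_apply fun_ops)

global_interpretation fs: vector_space "cscale :: complex => ('i => complex) => 'i => complex"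
 by standard (simp_all only: cscale_def kk_simps distrib_left distrib_right mult.assoc mult_1_left)

global_interpretation fp: vector_space_pair
 "cscale :: complex => ('i => complex) => 'i => complex"
 "cscale :: complex => ('j => complex) => 'j => complex"
 by unfold_locales

abbreviation lin_map :: "(('i => complex) => ('j => complex)) => bool" where
 "lin_map \<equiv> Vector_Spaces.linear cscale cscale"

lemma lin_mapI:
 assumes "\<And>u v. f (u + v) = f u + f v" "\<And>c u. f (cscale c u) = cscale c (f u)"
 shows "lin_map f"
 using assms by (auto intro!: Vector_Spaces.linear.intro simp: module_hom_axioms_def
   fs.vector_space_axioms fs.module_axioms module_hom_def)

lemma lin_map_mult: "lin_map (\<lambda>u. x * u)"
 by (rule lin_mapI) (auto simp: cscale_def algebra_simps)

lemma lin_mapD: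
 assumes "lin_map f"
 shows "f (u + v) = f u + f v" "f (cscale c u) = cscale c (f u)" "f 0 = 0" "f (u - v) = f u - f v"
proof -
 interpret Vector_Spaces.linear cscale cscale f by (rule assms)
 show "f (u + v) = f u + f v" "f (cscale c u) = cscale c (f u)" "f 0 = 0" "f (u - v) = f u - f v"
  by (rule add scale zero diff)+
qed

lemma lin_map_comp: "lin_map f ==> lin_map g ==> lin_map (\<lambda>u. g (f u))"
 by (rule lin_mapI) (auto simp: lin_mapD)

lemma subspace_kk: "fs.subspace V ==> v \<in> V ==> kk c * v \<in> V"
 using fs.subspace_scale[of V v c] by (simp add: cscale_def)

lemma subspace_image: "lin_map f ==> fs.subspace V ==> fs.subspace (f ` V)"
 using fp.linear_subspace_image by blast

lemma subspace_ker: "lin_map f ==> fs.subspace V ==> fs.subspace {v \<in> V. f v = 0}"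
 by (rule fs.subspaceI) (auto simp: lin_mapD fs.subspace_0 fs.subspace_add fs.subspace_scale)

lemma subspace_sum: "fs.subspace V ==> fs.subspace W ==> fs.subspace {v + w | v w. v \<in> V \<and> w \<in> W}"
 using fs.subspace_sums by blast

text \<open>\<open>fs.dim\<close> is the cardinality of a basis and hence 0 for spaces of infinite
  dimension; comparisons of dimensions therefore carry \<open>fd\<close>.\<close>

definition fd :: "('i => complex) set => bool" where
 "fd V \<longleftrightarrow> (\<exists>B. finite B \<and> V \<subseteq> fs.span B)"

lemma fd_subset: "fd W ==> V \<subseteq> W ==> fd V"
 unfolding fd_def by blast

lemma independent_fd:
 assumes "fd V" "A \<subseteq> V" "fs.independent A"
 shows "finite A \<and> card A \<le> fs.dim V"
proof -
 obtain B where B: "finite B" "V \<subseteq> fs.span B" using assms(1) unfolding fd_def by blast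
 have fin: "finite C" if "C \<subseteq> V" "fs.independent C" for C
  using fs.independent_span_bound[OF B(1) that(2)] that(1) B(2) by blast
 obtain C where C: "C \<subseteq> V" "fs.independent C" "V \<subseteq> fs.span C" "card C = fs.dim V"
  using fs.basis_exists by blast
 have "card A \<le> card C"
  using fs.independent_span_bound[OF fin[OF C(1,2)] assms(3)] assms(2) C(3) by blast
 with fin[OF assms(2,3)] C(4) show ?thesis by simp
qed

lemma fd_basis:
 assumes "fd V"
 obtains B where "B \<subseteq> V" "finite B" "fs.independent B" "V \<subseteq> fs.span B" "card B = fs.dim V"
 using fs.basis_exists[of V] independent_fd[OF assms] by metis

lemma dim_mono_fd: "fd W ==> V \<subseteq> W ==> fs.dim V \<le> fs.dim W"
 by (metis fd_basis fd_subset independent_fd subset_trans)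

lemma dim_eq_fd:
 assumes "fd W" "fs.subspace V" "V \<subseteq> W" "fs.dim W \<le> fs.dim V"
 shows "V = W"
proof (rule ccontr)
 assume "V \<noteq> W"
 then obtain w where w: "w \<in> W" "w \<notin> V" using assms(3) by blast
 obtain B where B: "B \<subseteq> V" "finite B" "fs.independent B" "V \<subseteq> fs.span B" "card B = fs.dim V"
  using fd_basis[OF fd_subset[OF assms(1,3)]] .
 have "fs.span B \<subseteq> V" using B(1) assms(2) by (simp add: fs.span_minimal)
 with w have "w \<notin> fs.span B" by blast
 then have "fs.independent (insert w B)" using B(3) fs.independent_insertI by blast
 moreover have "insert w B \<subseteq> W" using w B(1) assms(3) by blast
 ultimately have "card (insert w B) \<le> fs.dim W" using independent_fd[OF assms(1)] by blast
 moreover have "w \<notin> B" using w B by blast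
 ultimately show False using B assms(4) by simp
qed

lemma dim_0_fd: "fs.subspace V ==> fd V ==> fs.dim V = 0 \<longleftrightarrow> V = {0}"
proof
 assume V: "fs.subspace V" "fd V" "fs.dim V = 0"
 have "{0} = V"
  by (rule dim_eq_fd[OF V(2)]) (use V fs.subspace_0 in \<open>auto simp: fs.subspace_single_0\<close>)
 then show "V = {0}" by simp
next
 assume "V = {0}"
 then show "fs.dim V = 0" using fs.dim_le_card[of V "{}"] by auto
qed

lemma projection_along:
 assumes "fs.independent C" "B \<subseteq> C"
 obtains p where "lin_map p" "\<And>v. v \<in> fs.span B ==> p v = 0" "\<And>v. v \<in> fs.span (C - B) ==> p v = v"
  "\<And>v. v \<in> fs.span C ==> v - p v \<in> fs.span B"
proof -
 define p where "p = fp.construct C (\<lambda>b. if b \<in> B then 0 else b)"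
 have p: "lin_map p" unfolding p_def by (rule fp.linear_construct[OF assms(1)])
 have pb: "p b = (if b \<in> B then 0 else b)" if "b \<in> C" for b
  unfolding p_def by (rule fp.construct_basis[OF assms(1) that])
 have 1: "p v = 0" if "v \<in> fs.span B" for v
  by (rule fp.linear_eq_on[OF p _ that, of "\<lambda>_. 0"])
    (use pb assms(2) in \<open>auto intro!: lin_mapI\<close>)
 have 2: "p v = v" if "v \<in> fs.span (C - B)" for v
  by (rule fp.linear_eq_on[OF p _ that, of "\<lambda>v. v"])
    (use pb assms(2) in \<open>auto intro!: lin_mapI\<close>)
 have "v - p v \<in> fs.span B" if "v \<in> fs.span C" for v
  using that
 proof (induction rule: fs.span_induct_alt)
  case base
  then show ?case using lin_mapD(3)[OF p] fs.span_zero by simp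
 next
  case (step c x y)
  have "x - p x \<in> fs.span B"
   using step(1) pb[of x] fs.span_base[of x B] fs.span_zero by auto
  then have "cscale c (x - p x) + (y - p y) \<in> fs.span B"
   using step by (intro fs.span_add fs.span_scale) auto
  moreover have "cscale c (x - p x) + (y - p y) = cscale c x + y - p (cscale c x + y)"
   using lin_mapD[OF p] by (simp add: fs.scale_right_diff_distrib)
  ultimately show ?case by simp
 qed
 with that p 1 2 show ?thesis by blast
qed

text \<open>This replaces the quotient by V: a subspace is the kernel of a linear map of the ambient
  function space to itself, the projection along V to a complement. Quotients thus stay in the same
  type.\<close>

lemma quotient_map:
 fixes V :: "('i => complex) set"
 assumes "fs.subspace V"
 obtains p :: "('i => complex) => 'i => complex" where "lin_map p" "\<And>v. p v = 0 \<longleftrightarrow> v \<in> V"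
proof -
 obtain B where B: "B \<subseteq> V" "fs.independent B" "V \<subseteq> fs.span B" "card B = fs.dim V"
  by (rule fs.basis_exists)
 obtain C where C: "B \<subseteq> C" "fs.independent C" "UNIV \<subseteq> fs.span C"
  by (rule fs.maximal_independent_subset_extend[OF subset_UNIV B(2)])
 have V: "V = fs.span B" using B(3) fs.span_minimal[OF B(1) assms] by blast
 obtain p :: "('i => complex) => 'i => complex" where p: "lin_map p" "\<And>v. v \<in> fs.span B ==> p v = 0"
  "\<And>v. v \<in> fs.span (C - B) ==> p v = v" "\<And>v. v \<in> fs.span C ==> v - p v \<in> fs.span B"
  using projection_along[OF C(2,1)] by metis
 have "p v = 0 \<longleftrightarrow> v \<in> V" for v
 proof
  assume "p v = 0"
  then show "v \<in> V" using p(4)[of v] C(3) V by (metis UNIV_I diff_zero subsetD)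
 next
  assume "v \<in> V"
  then show "p v = 0" using p(2) V by blast
 qed
 from that[OF p(1) this] show ?thesis .
qed

lemma rank_nullity:
 assumes f: "lin_map f" and V: "fs.subspace V" "fd V"
 shows "fd (f ` V)" "fs.dim V = fs.dim {v \<in> V. f v = 0} + fs.dim (f ` V)"
proof -
 let ?K = "{v \<in> V. f v = 0}"
 obtain B where B: "B \<subseteq> ?K" "finite B" "fs.independent B" "?K \<subseteq> fs.span B" "card B = fs.dim ?K"
  using fd_basis[OF fd_subset[OF V(2)], of ?K] by (metis (no_types, lifting) mem_Collect_eq subsetI)
 obtain C where C: "B \<subseteq> C" "C \<subseteq> V" "fs.independent C" "V \<subseteq> fs.span C"
  using fs.maximal_independent_subset_extend[of B V] B(1,3) by (metis (no_types, lifting) mem_Collect_eq subset_iff)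
 have finC: "finite C" and cardC: "card C = fs.dim V"
  using independent_fd[OF V(2) C(2,3)] fs.basis_card_eq_dim[OF C(2,4,3)] by auto
 let ?D = "C - B"
 obtain p where p: "lin_map p" "\<And>v. v \<in> fs.span B ==> p v = 0" "\<And>v. v \<in> fs.span ?D ==> p v = v"
  "\<And>v. v \<in> fs.span C ==> v - p v \<in> fs.span B"
  using projection_along[OF C(3,1)] by metis
 have spV: "fs.span C \<subseteq> V" using C(2) V(1) by (simp add: fs.span_minimal)
 have spD: "fs.span ?D \<subseteq> V" using spV fs.span_mono[of ?D C] by blast
 have z: "v = 0" if v: "v \<in> fs.span ?D" "f v = 0" for v
 proof -
  have "v \<in> ?K" using v spD by auto
  then show ?thesis using B(4) p(2,3) v(1) by fastforce
 qed
 have inj: "inj_on f (fs.span ?D)"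
 proof (rule inj_onI)
  fix a b assume ab: "a \<in> fs.span ?D" "b \<in> fs.span ?D" "f a = f b"
  then have "a - b = 0" using z[of "a - b"] fs.span_diff lin_mapD(4)[OF f] by auto
  then show "a = b" by simp
 qed
 have ind: "fs.independent (f ` ?D)"
  by (rule fp.linear_independent_injective_image[OF f fs.independent_mono[OF C(3)] inj]) blast
 have fB: "f b = 0" if "b \<in> B" for b using B(1) that by auto
 have sp0: "f ` V \<subseteq> fs.span (f ` C)"
  using C(4) fp.linear_span_image[OF f, of C] by (metis image_mono)
 have "f ` C \<subseteq> insert 0 (f ` ?D)" using fB by auto
 then have "fs.span (f ` C) \<subseteq> fs.span (f ` ?D)"
  using fs.span_mono[of "f ` C" "insert 0 (f ` ?D)"] by (simp only: fs.span_insert_0)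
 with sp0 have sp: "f ` V \<subseteq> fs.span (f ` ?D)" by blast
 then show "fd (f ` V)" using finC unfolding fd_def by (intro exI[of _ "f ` ?D"]) simp
 have "fs.dim (f ` V) = card (f ` ?D)"
 proof -
  have "f ` ?D \<subseteq> f ` V" using C(2) by blast
  from fs.basis_card_eq_dim[OF this sp ind] show ?thesis by simp
 qed
 also have "\<dots> = card ?D"
  by (rule card_image[OF inj_on_subset[OF inj fs.span_superset]])
 also have "\<dots> = fs.dim V - fs.dim ?K"
  using card_Diff_subset[OF B(2) C(1)] cardC B(5) by simp
 finally show "fs.dim V = fs.dim ?K + fs.dim (f ` V)"
  using card_mono[OF finC C(1)] cardC B(5) by simp
qed

lemma dim_inj_image:
 assumes "lin_map f" "fs.subspace V" "fd V" "\<And>v. v \<in> V ==> f v = 0 ==> v = 0"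
 shows "fs.dim (f ` V) = fs.dim V"
proof -
 have "{v \<in> V. f v = 0} = {0}"
  using assms(4) fs.subspace_0[OF assms(2)] lin_mapD(3)[OF assms(1)] by auto
 then have "fs.dim {v \<in> V. f v = 0} = 0" using fs.dim_le_card[of "{v \<in> V. f v = 0}" "{}"] by auto
 then show ?thesis using rank_nullity(2)[OF assms(1-3)] by simp
qed

lemma dim_image_le_fd: "lin_map f ==> fs.subspace V ==> fd V ==> fs.dim (f ` V) \<le> fs.dim V"
 using rank_nullity(2) by fastforce

lemma fd_sum: "fd V ==> fd W ==> fd {v + w | v w. v \<in> V \<and> w \<in> W}"
proof -
 assume "fd V" "fd W"
 then obtain A B where AB: "finite A" "finite B" "V \<subseteq> fs.span A" "W \<subseteq> fs.span B" unfolding fd_def by blast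
 have "{v + w | v w. v \<in> V \<and> w \<in> W} \<subseteq> fs.span (A \<union> B)"
  using AB(3,4) fs.span_mono[of A "A \<union> B"] fs.span_mono[of B "A \<union> B"] by (auto intro!: fs.span_add)
 with AB(1,2) show ?thesis unfolding fd_def by (intro exI[of _ "A \<union> B"]) simp
qed

lemma dim_quotient:
 fixes p :: "('i => complex) => 'i => complex"
 assumes "lin_map p" "\<And>v. p v = 0 \<longleftrightarrow> v \<in> W" "fs.subspace V" "fd V" "W \<subseteq> V"
 shows "fs.dim (p ` V) = fs.dim V - fs.dim W"
proof -
 have "{v \<in> V. p v = 0} = W" using assms(2,5) by auto
 then show ?thesis using rank_nullity(2)[OF assms(1,3,4)] by simp
qed

text \<open>Rank-nullity for the quotient map by V, once on V + W, where the kernel is V, and once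
  on W, where it is the intersection; the two images agree.\<close>

lemma dim_sums_Int_fd:
 assumes V: "fs.subspace V" "fd V" and W: "fs.subspace W" "fd W"
 shows "fs.dim {v + w | v w. v \<in> V \<and> w \<in> W} + fs.dim (V \<inter> W) = fs.dim V + fs.dim W"
proof -
 let ?S = "{v + w | v w. v \<in> V \<and> w \<in> W}"
 obtain p :: "('a => complex) => 'a => complex" where p: "lin_map p" "\<And>v. p v = 0 \<longleftrightarrow> v \<in> V"
  using quotient_map[OF V(1)] by metis
 have "v \<in> ?S" if "v \<in> V" for v
  using that fs.subspace_0[OF W(1)] add.right_neutral[of v] by (metis (mono_tags, lifting) mem_Collect_eq)
 then have 1: "{v \<in> ?S. p v = 0} = V" using p(2) by auto
 have 2: "p ` ?S = p ` W"
 proof (intro equalityI subsetI)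
  fix y assume "y \<in> p ` ?S"
  then obtain v w where "v \<in> V" "w \<in> W" "y = p (v + w)" by blast
  then show "y \<in> p ` W" using p(2)[of v] lin_mapD(1)[OF p(1)] by auto
 next
  fix y assume "y \<in> p ` W"
  then obtain w where w: "w \<in> W" "y = p w" by blast
  have "w \<in> ?S" using w(1) fs.subspace_0[OF V(1)] add.left_neutral[of w]
   by (metis (mono_tags, lifting) mem_Collect_eq)
  with w(2) show "y \<in> p ` ?S" by blast
 qed
 have 3: "{v \<in> W. p v = 0} = V \<inter> W" using p(2) by auto
 show ?thesis
  using rank_nullity(2)[OF p(1) subspace_sum[OF V(1) W(1)] fd_sum[OF V(2) W(2)], unfolded 1 2]
   rank_nullity(2)[OF p(1) W, unfolded 3] by linarith
qed

text \<open>This is how conditions imposed by points are counted: W consists of the forms or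
  sections that satisfy them, and the family violates them one at a time.\<close>

lemma independent_mod:
 assumes V: "fs.subspace V" "fd V" and W: "fs.subspace W" "W \<subseteq> V" and I: "finite I"
  and f: "\<And>i. i \<in> I ==> f i \<in> V"
  and triv: "\<And>a. (\<Sum>i\<in>I. cscale (a i) (f i)) \<in> W ==> \<forall>i\<in>I. a i = 0"
 shows "fs.dim W + card I \<le> fs.dim V"
proof -
 obtain p :: "('a => complex) => 'a => complex" where p: "lin_map p" "\<And>v. p v = 0 \<longleftrightarrow> v \<in> W"
  using quotient_map[OF W(1)] by metis
 have psum: "p (\<Sum>i\<in>A. cscale (a i) (f i)) = (\<Sum>i\<in>A. cscale (a i) (p (f i)))" for a A
  by (induction A rule: infinite_finite_induct) (auto simp: lin_mapD[OF p(1)])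
 have trivial: "\<forall>i\<in>I. a i = 0" if "(\<Sum>i\<in>I. cscale (a i) (p (f i))) = 0" for a
  by (rule triv) (use that p(2) psum[of a I] in simp)
 have inj: "inj_on (\<lambda>i. p (f i)) I"
 proof (rule inj_onI)
  fix i j assume ij: "i \<in> I" "j \<in> I" "p (f i) = p (f j)"
  show "i = j"
  proof (rule ccontr)
   assume "i \<noteq> j"
   \<comment> \<open>If two members had the same image, their difference would be a nontrivial
     relation; so \<open>triv\<close> also gives injectivity of the family.\<close>
   let ?a = "\<lambda>k. if k = i then 1 else if k = j then - 1 else (0 :: complex)"
   have eq: "cscale (?a k) (p (f k)) = (if k = i then p (f i) else 0) - (if k = j then p (f i) else 0)" for k
    using ij \<open>i \<noteq> j\<close> by (auto simp: cscale_def kk_simps)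
   have "(\<Sum>k\<in>I. cscale (?a k) (p (f k))) = 0"
    unfolding eq sum_subtractf using ij I by simp
   from trivial[OF this] ij show False by force
  qed
 qed
 have ind: "fs.independent ((\<lambda>i. p (f i)) ` I)"
 proof (rule fs.independent_if_scalars_zero)
  fix g x
  assume g: "(\<Sum>x\<in>(\<lambda>i. p (f i)) ` I. cscale (g x) x) = 0" and x: "x \<in> (\<lambda>i. p (f i)) ` I"
  then have "(\<Sum>i\<in>I. cscale (g (p (f i))) (p (f i))) = 0"
   by (simp add: sum.reindex[OF inj])
  from trivial[OF this] x show "g x = 0" by auto
 qed (use I in simp)
 have "card ((\<lambda>i. p (f i)) ` I) \<le> fs.dim (p ` V)"
  by (rule conjunct2, rule independent_fd[OF rank_nullity(1)[OF p(1) V] _ ind]) (use f in auto)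
 also have "\<dots> = fs.dim V - fs.dim W" by (rule dim_quotient[OF p V W(2)])
 finally show ?thesis using dim_mono_fd[OF V(2) W(2)] by (simp add: card_image[OF inj])
qed

lemma linear_dependence:
 assumes V: "fs.subspace V" "fd V" and W: "fs.subspace W" "W \<subseteq> V"
  and f: "\<And>i. i \<le> n ==> f i \<in> V" and n: "fs.dim V \<le> fs.dim W + n"
 shows "\<exists>a. (\<exists>i\<le>n. a i \<noteq> 0) \<and> (\<Sum>i\<le>n. cscale (a i) (f i)) \<in> W"
proof (rule ccontr)
 assume neg: "\<not> ?thesis"
 have "fs.dim W + card {..n} \<le> fs.dim V"
  by (rule independent_mod[OF V W, of _ f]) (use f neg in auto)
 with n show False by simp
qed

lemma dim_span_family:
 assumes I: "finite I" and triv: "\<And>a. (\<Sum>i\<in>I. cscale (a i) (f i)) = 0 ==> \<forall>i\<in>I. a i = 0"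
 shows "fs.dim (fs.span (f ` I)) = card I"
proof (rule antisym)
 have "fs.dim (fs.span (f ` I)) \<le> card (f ` I)" by (rule fs.dim_le_card) (use I in auto)
 then show "fs.dim (fs.span (f ` I)) \<le> card I" using card_image_le[OF I, of f] by linarith
 have "fd (fs.span (f ` I))" unfolding fd_def by (intro exI[of _ "f ` I"]) (simp add: I)
 then show "card I \<le> fs.dim (fs.span (f ` I))"
  using independent_mod[OF fs.subspace_span _ fs.subspace_single_0 _ I, of "f ` I" f] triv
  by (simp add: fs.span_zero fs.span_base)
qed

section \<open>Graded modules that vanish in large degrees\<close>

text \<open>Multiplication by \<open>l\<close> induces a surjection of V/W onto V'/W'. Dimensions
  can only drop, and a surjection between spaces of equal finite dimension is injective; the second
  claim is this injectivity, read in V.\<close>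

lemma mult_surj_quotient:
 fixes V W V' W' :: "('i => complex) set" and l :: "'i => complex"
 assumes V: "fs.subspace V" "fd V" and W: "fs.subspace W" "W \<subseteq> V"
  and V': "fs.subspace V'" "fd V'" and W': "fs.subspace W'" "W' \<subseteq> V'"
  and l: "\<And>v. v \<in> V ==> l * v \<in> V'" "\<And>w. w \<in> W ==> l * w \<in> W'"
  and surj: "\<And>v. v \<in> V' ==> \<exists>u\<in>V. \<exists>w\<in>W'. v = l * u + w"
 shows "fs.dim V' - fs.dim W' \<le> fs.dim V - fs.dim W"
  and "fs.dim V' - fs.dim W' = fs.dim V - fs.dim W ==> u \<in> V ==> l * u \<in> W' ==> u \<in> W"
proof -
 obtain p :: "('i => complex) => 'i => complex" where p: "lin_map p" "\<And>v. p v = 0 \<longleftrightarrow> v \<in> W'"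
  using quotient_map[OF W'(1)] by metis
 have g: "lin_map (\<lambda>u. p (l * u))" by (rule lin_map_comp[OF lin_map_mult p(1)])
 let ?K = "{u \<in> V. l * u \<in> W'}"
 have im: "(\<lambda>u. p (l * u)) ` V = p ` V'"
 proof (intro equalityI subsetI)
  fix y assume "y \<in> p ` V'"
  then obtain v where v: "v \<in> V'" "y = p v" by (rule imageE)
  then obtain u w where uw: "u \<in> V" "w \<in> W'" "v = l * u + w" using surj by blast
  have "p w = 0" using p(2) uw(2) by blast
  then have "y = p (l * u)" using lin_mapD(1)[OF p(1)] v(2) uw(3) by simp
  then show "y \<in> (\<lambda>u. p (l * u)) ` V" using uw(1) by (rule image_eqI)
 next
  fix y assume "y \<in> (\<lambda>u. p (l * u)) ` V"
  then obtain u where "u \<in> V" "y = p (l * u)" by (rule imageE)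
  then show "y \<in> p ` V'" using l(1) by simp
 qed
 have K: "{u \<in> V. p (l * u) = 0} = ?K" using p(2) by blast
 have dim: "fs.dim V = fs.dim ?K + (fs.dim V' - fs.dim W')"
  using rank_nullity(2)[OF g V] dim_quotient[OF p V' W'(2)] unfolding im K by linarith
 have sub: "W \<subseteq> ?K" using W(2) l(2) by blast
 have subK: "fs.subspace ?K" using subspace_ker[OF g V(1)] unfolding K .
 have fdK: "fd ?K" by (rule fd_subset[OF V(2)]) blast
 have le: "fs.dim W \<le> fs.dim ?K" by (rule dim_mono_fd[OF fdK sub])
 with dim show "fs.dim V' - fs.dim W' \<le> fs.dim V - fs.dim W" by linarith
 assume eq: "fs.dim V' - fs.dim W' = fs.dim V - fs.dim W" and u: "u \<in> V" "l * u \<in> W'"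
 have "fs.dim W \<le> fs.dim V" by (rule dim_mono_fd[OF V(2) W(2)])
 with eq dim have "fs.dim ?K \<le> fs.dim W" by linarith
 from dim_eq_fd[OF fdK W(1) sub this] u show "u \<in> W" by blast
qed

text \<open>The fundamental theorem of algebra for a binary form with coefficients \<open>a\<close>,
  dehomogenised by t = y/x. The conclusion is for all functions x and y at once, because the
  factorisation is an identity of coefficients.\<close>

lemma binary_form_linear_factor:
 fixes a :: "nat => complex"
 assumes "\<exists>i\<le>Suc n. a i \<noteq> 0"
 obtains \<alpha> \<beta> b where "(\<alpha>, \<beta>) \<noteq> (0, 0)" "\<exists>i\<le>n. b i \<noteq> 0"
  "\<And>x y :: 'i => complex. (\<Sum>i\<le>Suc n. kk (a i) * x ^ (Suc n - i) * y ^ i) =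
    (kk \<alpha> * x + kk \<beta> * y) * (\<Sum>i\<le>n. kk (b i) * x ^ (n - i) * y ^ i)"
proof (cases "a (Suc n) = 0")
 \<comment> \<open>Without the pure power of y the form is divisible by x: the root lies at
   infinity.\<close>
 case True
 have "(\<Sum>i\<le>Suc n. kk (a i) * x ^ (Suc n - i) * y ^ i) =
    (kk 1 * x + kk 0 * y) * (\<Sum>i\<le>n. kk (a i) * x ^ (n - i) * y ^ i)" for x y :: "'i => complex"
  using True by (simp add: kk_simps sum_distrib_left Suc_diff_le mult_ac)
 moreover have "\<exists>i\<le>n. a i \<noteq> 0" using assms True le_Suc_eq by metis
 ultimately show ?thesis by (intro that[of 1 0 a]) simp_all
next
 case False
 define p where "p = (\<Sum>i\<le>Suc n. monom (a i) i)"
 have cp: "coeff p i = (if i \<le> Suc n then a i else 0)" for i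
  by (simp add: p_def coeff_sum if_distrib cong: if_cong)
 have deg: "degree p = Suc n"
  using False by (intro antisym degree_le le_degree) (auto simp: cp)
 then have "\<not> constant (poly p)" by (simp add: constant_degree)
 then obtain r where r: "poly p r = 0" using fundamental_theorem_of_algebra by blast
 then obtain q where q: "p = [:- r, 1:] * q" by (metis dvdE poly_eq_0_iff_dvd)
 have "q \<noteq> 0" using q deg by auto
 then have "degree p = degree [:- r, 1:] + degree q" unfolding q by (intro degree_mult_eq) auto
 then have degq: "degree q = n" using deg by simp
 have a: "a i = (if i = 0 then 0 else coeff q (i - 1)) - r * coeff q i" if "i \<le> Suc n" for i
  using cp[of i] that unfolding q by (cases i) auto
 let ?b = "coeff q"
 have "(\<Sum>i\<le>Suc n. kk (a i) * x ^ (Suc n - i) * y ^ i) =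
    (kk (- r) * x + kk 1 * y) * (\<Sum>i\<le>n. kk (?b i) * x ^ (n - i) * y ^ i)" for x y :: "'i => complex"
 proof -
  have "(\<Sum>i\<le>Suc n. kk (a i) * x ^ (Suc n - i) * y ^ i) =
    (\<Sum>i\<le>Suc n. kk (if i = 0 then 0 else ?b (i - 1)) * x ^ (Suc n - i) * y ^ i)
    - (\<Sum>i\<le>Suc n. kk r * (kk (?b i) * x ^ (Suc n - i) * y ^ i))"
   unfolding sum_subtractf[symmetric]
   by (rule sum.cong) (simp_all add: a kk_simps algebra_simps)
  also have "(\<Sum>i\<le>Suc n. kk (if i = 0 then 0 else ?b (i - 1)) * x ^ (Suc n - i) * y ^ i) =
    y * (\<Sum>i\<le>n. kk (?b i) * x ^ (n - i) * y ^ i)"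
   by (subst sum.atMost_Suc_shift) (simp add: kk_simps sum_distrib_left mult_ac)
  also have "(\<Sum>i\<le>Suc n. kk r * (kk (?b i) * x ^ (Suc n - i) * y ^ i)) =
    kk r * x * (\<Sum>i\<le>n. kk (?b i) * x ^ (n - i) * y ^ i)"
   using degq by (simp add: coeff_eq_0 kk_simps sum_distrib_left Suc_diff_le mult_ac)
  finally show ?thesis by (simp add: kk_simps algebra_simps)
 qed
 moreover have "\<exists>i\<le>n. ?b i \<noteq> 0" using \<open>q \<noteq> 0\<close> degq leading_coeff_neq_0 by blast
 ultimately show ?thesis by (intro that[of "- r" 1 ?b]) simp_all
qed

lemma sum_mult_subspace:
 assumes "fs.subspace V" "\<And>i. i \<in> A ==> f i \<in> V"
 shows "(\<Sum>i\<in>A. kk (a i) * f i) \<in> V"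
 using assms by (intro fs.subspace_sum) (auto intro: subspace_kk)

text \<open>The graded module with pieces V k / W k. Pairs are used in place of quotients, so that
  passing to a further quotient only enlarges W.\<close>

locale graded_pair =
 fixes V W :: "nat => ('a => complex) set"
 assumes subV: "fs.subspace (V k)" and fdV: "fd (V k)"
  and subW: "fs.subspace (W k)" and WV: "W k \<subseteq> V k"
begin

definition acts :: "('a => complex) => bool" where
 "acts l \<longleftrightarrow> (\<forall>k. (\<forall>v\<in>V k. l * v \<in> V (Suc k)) \<and> (\<forall>w\<in>W k. l * w \<in> W (Suc k)))"

lemma actsD: "acts l ==> v \<in> V k ==> l * v \<in> V (Suc k)" "acts l ==> v \<in> W k ==> l * v \<in> W (Suc k)"
 by (auto simp: acts_def)

lemma acts_lin: "acts x ==> acts y ==> acts (kk a * x + kk b * y)"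
 by (auto simp: acts_def distrib_right mult.assoc intro!: fs.subspace_add subV subW subspace_kk)

lemma acts_pow: "acts l ==> v \<in> V k ==> l ^ n * v \<in> V (k + n)" "acts l ==> v \<in> W k ==> l ^ n * v \<in> W (k + n)"
 by (induction n) (auto simp: mult.assoc dest: actsD)

definition surj_from :: "nat => ('a => complex) => bool" where
 "surj_from K l \<longleftrightarrow> (\<forall>k\<ge>K. \<forall>v\<in>V (Suc k). \<exists>u\<in>V k. \<exists>w\<in>W (Suc k). v = l * u + w)"

abbreviation d where "d k \<equiv> fs.dim (V k) - fs.dim (W k)"

lemma surj_step:
 assumes "acts l" "surj_from K l" "k \<ge> K"
 shows "d (Suc k) \<le> d k"
  and "d (Suc k) = d k ==> u \<in> V k ==> l * u \<in> W (Suc k) ==> u \<in> W k"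
 using mult_surj_quotient[OF subV fdV subW WV subV fdV subW WV, of k l "Suc k"]
  assms unfolding acts_def surj_from_def by metis+

text \<open>Apply the linear factors of the binary form one at a time: either the factor kills the
  current class, or the image is a nonzero class one degree higher that is killed by the shorter
  product.\<close>

lemma linear_factor_kills:
 assumes x: "acts x" and y: "acts y"
 shows "u \<in> V k ==> u \<notin> W k ==> \<exists>i\<le>n. a i \<noteq> 0 ==>
  (\<Sum>i\<le>n. kk (a i) * x ^ (n - i) * y ^ i) * u \<in> W (k + n) ==>
  \<exists>\<alpha> \<beta> j v. (\<alpha>, \<beta>) \<noteq> (0, 0) \<and> j \<ge> k \<and> v \<in> V j \<and> v \<notin> W j \<and> (kk \<alpha> * x + kk \<beta> * y) * v \<in> W (Suc j)"
proof (induction n arbitrary: u k a)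
 case 0
 have "kk (a 0) * u \<in> W k" using 0(4) by simp
 then have "kk (inverse (a 0)) * (kk (a 0) * u) \<in> W k" by (rule subspace_kk[OF subW])
 also have "kk (inverse (a 0)) * (kk (a 0) * u) = kk (inverse (a 0) * a 0) * u"
  by (simp only: kk_simps mult.assoc)
 also have "inverse (a 0) * a 0 = 1" using 0(3) by simp
 finally have "u \<in> W k" by (simp add: kk_simps)
 with 0 show ?case by blast
next
 case (Suc n)
 obtain \<alpha> \<beta> b where ab: "(\<alpha>, \<beta>) \<noteq> (0, 0)" "\<exists>i\<le>n. b i \<noteq> 0"
  "(\<Sum>i\<le>Suc n. kk (a i) * x ^ (Suc n - i) * y ^ i) =
    (kk \<alpha> * x + kk \<beta> * y) * (\<Sum>i\<le>n. kk (b i) * x ^ (n - i) * y ^ i)"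
  by (rule binary_form_linear_factor[OF Suc.prems(3)]) (rule that)
 let ?l = "kk \<alpha> * x + kk \<beta> * y"
 have acts: "acts ?l" by (rule acts_lin[OF x y])
 show ?case
 proof (cases "?l * u \<in> W (Suc k)")
  case True
  then show ?thesis using ab(1) Suc.prems(1,2) by blast
 next
  case False
  have "(\<Sum>i\<le>n. kk (b i) * x ^ (n - i) * y ^ i) * (?l * u) \<in> W (Suc k + n)"
   using Suc.prems(4) unfolding ab(3) by (simp add: mult_ac)
  from Suc.IH[OF actsD(1)[OF acts Suc.prems(1)] False ab(2) this]
  obtain \<alpha>' \<beta>' j v where "(\<alpha>', \<beta>') \<noteq> (0, 0) \<and> j \<ge> Suc k \<and> v \<in> V j \<and> v \<notin> W j \<and>
   (kk \<alpha>' * x + kk \<beta>' * y) * v \<in> W (Suc j)" by blast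
  then show ?thesis by (intro exI[of _ \<alpha>'] exI[of _ \<beta>'] exI[of _ j] exI[of _ v]) auto
 qed
qed

text \<open>Over \<open>\<complex>\<close>, some linear combination of \<open>x\<close> and \<open>y\<close> has a kernel on \<open>V / W\<close>
 in every large degree, unless \<open>V / W\<close> vanishes there.\<close>

lemma eventually_eq_2:
 assumes x: "acts x" and y: "acts y"
  and surj: "\<And>\<alpha> \<beta>. (\<alpha>, \<beta>) \<noteq> (0, 0) ==> \<exists>K. surj_from K (kk \<alpha> * x + kk \<beta> * y)"
 shows "\<exists>K. \<forall>k\<ge>K. V k = W k"
proof -
 obtain K0 where K0: "surj_from K0 x" using surj[of 1 0] by (auto simp: kk_simps)
 \<comment> \<open>From \<open>K0\<close> on the dimensions decrease, so they become constant at
   their minimum m; from there on multiplication by x is injective as well as surjective.\<close>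
 define m where "m = (LEAST m. \<exists>k\<ge>K0. d k = m)"
 have "\<exists>k\<ge>K0. d k = m" unfolding m_def by (rule LeastI[of _ "d K0"]) auto
 then obtain K where K: "K \<ge> K0" "d K = m" by blast
 have least: "m \<le> d k" if "k \<ge> K0" for k unfolding m_def using that by (intro Least_le) auto
 have dm: "d k = m" if "k \<ge> K" for k
  using that
 proof (induction rule: dec_induct)
  case (step k)
  then show ?case using surj_step(1)[OF x K0, of k] least[of "Suc k"] K(1) by linarith
 qed (rule K(2))
 have xinj: "u \<in> W k" if "k \<ge> K" "u \<in> V k" "x * u \<in> W (Suc k)" for k u
  using surj_step(2)[OF x K0, of k u] that dm[of k] dm[of "Suc k"] K(1) by simp
 have False if k: "k \<ge> K" and u: "u \<in> V k" "u \<notin> W k" for k u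
 proof -
  \<comment> \<open>The m + 1 products x^(m-i) y^i u lie in a quotient of dimension m.\<close>
  have "\<exists>a. (\<exists>i\<le>m. a i \<noteq> 0) \<and> (\<Sum>i\<le>m. cscale (a i) (x ^ (m - i) * y ^ i * u)) \<in> W (k + m)"
  proof (rule linear_dependence[OF subV[of "k + m"] fdV subW WV])
   fix i assume "i \<le> m"
   have "x ^ (m - i) * (y ^ i * u) \<in> V (k + i + (m - i))" by (intro acts_pow x y u)
   then show "x ^ (m - i) * y ^ i * u \<in> V (k + m)" using \<open>i \<le> m\<close> by (simp add: mult.assoc)
  next
   show "fs.dim (V (k + m)) \<le> fs.dim (W (k + m)) + m" using dm[of "k + m"] k by linarith
  qed
  then obtain a where a: "\<exists>i\<le>m. a i \<noteq> 0" "(\<Sum>i\<le>m. cscale (a i) (x ^ (m - i) * y ^ i * u)) \<in> W (k + m)"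
   by blast
  have "(\<Sum>i\<le>m. kk (a i) * x ^ (m - i) * y ^ i) * u \<in> W (k + m)"
   using a(2) by (simp add: cscale_def sum_distrib_right mult.assoc)
  from linear_factor_kills[OF x y u a(1) this] obtain \<alpha> \<beta> j v where
   l: "(\<alpha>, \<beta>) \<noteq> (0, 0)" "j \<ge> k" "v \<in> V j" "v \<notin> W j" "(kk \<alpha> * x + kk \<beta> * y) * v \<in> W (Suc j)"
   by blast
  let ?l = "kk \<alpha> * x + kk \<beta> * y"
  obtain L where L: "surj_from L ?l" using surj[OF l(1)] by blast
  \<comment> \<open>Powers of x keep the class nonzero and carry it to a degree where the linear
    form \<open>?l\<close> is injective, although \<open>?l\<close> kills it.\<close>
  have xn: "x ^ n * v \<notin> W (j + n)" for n
  proof (induction n)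
   case (Suc n)
   then show ?case using xinj[of "j + n" "x ^ n * v"] acts_pow(1)[OF x l(3), of n] l(2) k
    by (auto simp: mult.assoc)
  qed (use l(4) in simp)
  let ?j = "j + L"
  have "x ^ L * (?l * v) \<in> W (Suc j + L)" by (rule acts_pow(2)[OF x l(5)])
  then have "?l * (x ^ L * v) \<in> W (Suc ?j)" by (simp add: mult_ac)
  then have "x ^ L * v \<in> W ?j"
   using surj_step(2)[OF acts_lin[OF x y] L, of ?j "x ^ L * v"] acts_pow(1)[OF x l(3), of L]
    dm[of ?j] dm[of "Suc ?j"] l(2) k by simp
  with xn show False by blast
 qed
 then have "V k = W k" if "k \<ge> K" for k using that WV[of k] by blast
 then show ?thesis by blast
qed

end

definition indep :: "complex ^ 3 => complex ^ 3 => bool" where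
 "indep a b \<longleftrightarrow> (\<forall>s t. s *s a + t *s b = 0 --> s = 0 \<and> t = 0)"

locale graded_pair3 = graded_pair +
 fixes lin :: "complex ^ 3 => 'a => complex"
 assumes lin_add: "lin (a + b) = lin a + lin b" and lin_scale: "lin (c *s a) = kk c * lin a"
  and lin_V: "v \<in> V k ==> lin a * v \<in> V (Suc k)" and lin_W: "w \<in> W k ==> lin a * w \<in> W (Suc k)"
begin

lemma acts: "acts (lin a)"
 by (simp add: acts_def lin_V lin_W)

lemma lin_comb: "kk s * lin a + kk t * lin b = lin (s *s a + t *s b)"
 by (simp add: lin_add lin_scale)

text \<open>The hypothesis says that the module vanishes in large degrees modulo any two independent
  linear forms. Modulo one form a, two further variables remain and \<open>eventually_eq_2\<close>
  applies to the quotient; hence a acts surjectively in large degrees. As this holds for every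
  nonzero a in the span of the first two coordinates, \<open>eventually_eq_2\<close> applies once
  more.\<close>

lemma eventually_eq_3:
 assumes surj: "\<And>a b. indep a b ==>
  \<exists>K. \<forall>k\<ge>K. \<forall>v\<in>V (Suc k). \<exists>u\<in>V k. \<exists>u'\<in>V k. \<exists>w\<in>W (Suc k). v = lin a * u + lin b * u' + w"
 shows "\<exists>K. \<forall>k\<ge>K. V k = W k"
proof (rule eventually_eq_2[OF acts[of "axis 1 1"] acts[of "axis 2 1"]])
 fix \<alpha> \<beta> :: complex assume ab: "(\<alpha>, \<beta>) \<noteq> (0, 0)"
 define a :: "complex ^ 3" where "a = \<alpha> *s axis 1 1 + \<beta> *s axis 2 1"
 \<comment> \<open>Here b and c are such that each of their nonzero combinations is independent of
   a; which coordinate vectors serve depends on whether the first coordinate of a is zero.\<close>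
 have "\<exists>b c. \<forall>s t. (s, t) \<noteq> (0, 0) --> indep a (s *s b + t *s c)"
 proof (cases "\<alpha> = 0")
  case True
  have "indep a (s *s axis 1 1 + t *s axis 3 1)" if st: "(s, t) \<noteq> (0, 0)" for s t
   unfolding indep_def
  proof (intro allI impI)
   fix p q assume eq: "p *s a + q *s (s *s axis 1 1 + t *s axis 3 1) = 0"
   have "p * \<beta> = 0" "q * s = 0" "q * t = 0"
    using True using arg_cong[OF eq, of "\<lambda>v. v $ 1"] arg_cong[OF eq, of "\<lambda>v. v $ 2"]
     arg_cong[OF eq, of "\<lambda>v. v $ 3"] by (simp_all add: a_def axis_def)
   with st ab \<open>\<alpha> = 0\<close> show "p = 0 \<and> q = 0" by auto
  qed
  then show ?thesis by blast
 next
  case False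
  have "indep a (s *s axis 2 1 + t *s axis 3 1)" if st: "(s, t) \<noteq> (0, 0)" for s t
   unfolding indep_def
  proof (intro allI impI)
   fix p q assume eq: "p *s a + q *s (s *s axis 2 1 + t *s axis 3 1) = 0"
   have "p * \<alpha> = 0" "p * \<beta> + q * s = 0" "q * t = 0"
    using arg_cong[OF eq, of "\<lambda>v. v $ 1"] arg_cong[OF eq, of "\<lambda>v. v $ 2"]
     arg_cong[OF eq, of "\<lambda>v. v $ 3"] by (simp_all add: a_def axis_def)
   with st ab \<open>\<alpha> \<noteq> 0\<close> show "p = 0 \<and> q = 0" by auto
  qed
  then show ?thesis by blast
 qed
 then obtain b where "\<exists>c. \<forall>s t. (s, t) \<noteq> (0, 0) --> indep a (s *s b + t *s c)" ..
 then obtain c where bc: "\<forall>s t. (s, t) \<noteq> (0, 0) --> indep a (s *s b + t *s c)" ..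
 \<comment> \<open>The quotient by a, shifted by one degree so that a V k lies in W' k.\<close>
 define V' where "V' k = V (Suc k)" for k
 define W' where "W' k = {v + w | v w. v \<in> (\<lambda>u. lin a * u) ` V k \<and> w \<in> W (Suc k)}" for k
 have W'I: "lin a * u + w \<in> W' k" if "u \<in> V k" "w \<in> W (Suc k)" for u w k
  unfolding W'_def using that by (intro CollectI exI[of _ "lin a * u"] exI[of _ w] conjI imageI) simp_all
 have W'E: "\<exists>u w. v = lin a * u + w \<and> u \<in> V k \<and> w \<in> W (Suc k)" if "v \<in> W' k" for v k
  using that unfolding W'_def by (elim CollectE exE conjE imageE) auto
 have gp: "graded_pair V' W'"
 proof
  show "fs.subspace (V' k)" "fd (V' k)" for k unfolding V'_def by (rule subV fdV)+
  show "fs.subspace (W' k)" for k unfolding W'_def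
   by (rule subspace_sum[OF subspace_image[OF lin_map_mult subV] subW])
  show "W' k \<subseteq> V' k" for k
  proof
   fix v assume "v \<in> W' k"
   then obtain u w where v: "v = lin a * u + w" "u \<in> V k" "w \<in> W (Suc k)" using W'E by blast
   have "lin a * u + w \<in> V (Suc k)"
    by (rule fs.subspace_add[OF subV actsD(1)[OF acts v(2)] subsetD[OF WV v(3)]])
   then show "v \<in> V' k" by (simp add: V'_def v(1))
  qed
 qed
 have Qacts: "graded_pair.acts V' W' (lin e)" for e
  unfolding graded_pair.acts_def[OF gp]
 proof (intro allI conjI ballI)
  fix k v assume "v \<in> V' k" then show "lin e * v \<in> V' (Suc k)"
   unfolding V'_def by (rule actsD(1)[OF acts])
 next
  fix k v assume "v \<in> W' k"
  then obtain u w where "v = lin a * u + w" "u \<in> V k" "w \<in> W (Suc k)" using W'E by blast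
  moreover from this have "lin e * v = lin a * (lin e * u) + lin e * w" by (simp add: algebra_simps)
  moreover have "lin e * u \<in> V (Suc k)" "lin e * w \<in> W (Suc (Suc k))"
   using calculation actsD[OF acts] by blast+
  ultimately show "lin e * v \<in> W' (Suc k)" using W'I by metis
 qed
 have "\<exists>K. \<forall>k\<ge>K. V' k = W' k"
 proof (rule graded_pair.eventually_eq_2[OF gp Qacts[of b] Qacts[of c]])
  fix s t :: complex assume st: "(s, t) \<noteq> (0, 0)"
  let ?e = "s *s b + t *s c"
  have ind: "indep a ?e" by (rule bc[THEN spec, THEN spec, THEN mp, OF st])
  from surj[OF ind] obtain K where K: "\<forall>k\<ge>K. \<forall>v\<in>V (Suc k).
    \<exists>u\<in>V k. \<exists>u'\<in>V k. \<exists>w\<in>W (Suc k). v = lin a * u + lin ?e * u' + w" ..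
  have "graded_pair.surj_from V' W' K (lin ?e)"
   unfolding graded_pair.surj_from_def[OF gp]
  proof (intro allI impI ballI)
   fix k v assume k: "k \<ge> K" and v: "v \<in> V' (Suc k)"
   obtain u u' w where *: "u \<in> V (Suc k)" "u' \<in> V (Suc k)" "w \<in> W (Suc (Suc k))"
    "v = lin a * u + lin ?e * u' + w"
    using K[rule_format, of "Suc k" v] k v unfolding V'_def by (metis le_Suc_eq)
   then have "v = lin ?e * u' + (lin a * u + w)" by (simp add: algebra_simps)
   moreover have "lin a * u + w \<in> W' (Suc k)" by (rule W'I[OF *(1,3)])
   ultimately show "\<exists>u\<in>V' k. \<exists>w\<in>W' (Suc k). v = lin ?e * u + w"
    using *(2) unfolding V'_def by (intro bexI)
  qed
  then show "\<exists>K. graded_pair.surj_from V' W' K (kk s * lin b + kk t * lin c)" unfolding lin_comb by blast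
 qed
 then obtain K where K: "\<forall>k\<ge>K. V' k = W' k" ..
 have "surj_from K (lin a)"
  unfolding surj_from_def
 proof (intro allI impI ballI)
  fix k v assume "k \<ge> K" "v \<in> V (Suc k)"
  then have "v \<in> W' k" using K unfolding V'_def by blast
  then show "\<exists>u\<in>V k. \<exists>w\<in>W (Suc k). v = lin a * u + w" using W'E by blast
 qed
 then show "\<exists>K. surj_from K (kk \<alpha> * lin (axis 1 1) + kk \<beta> * lin (axis 2 1))"
  unfolding lin_comb a_def[symmetric] by blast
qed

end

section \<open>Polynomial functions and forms\<close>

text \<open>Polynomials in three variables are nested univariate ones, the outermost variable being
  the third coordinate. The nesting makes unique factorisation available, from which prime divisors
  of forms are taken.\<close>

definition ev3 :: "complex poly poly poly => complex ^ 3 => complex" where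
 "ev3 F v = poly (poly (poly F [:[:v $ 3:]:]) [:v $ 2:]) (v $ 1)"

lemma ev3_hom [simp]: "ev3 (F + G) = ev3 F + ev3 G" "ev3 (F * G) = ev3 F * ev3 G"
  "ev3 0 = 0" "ev3 1 = 1" "ev3 (F - G) = ev3 F - ev3 G"
 by (auto simp: ev3_def fun_eq_iff fun_ops)

lemma poly_zero_on_infinite:
 fixes p :: "'a :: idom poly"
 assumes "infinite A" "\<And>x. x \<in> A ==> poly p x = 0"
 shows "p = 0"
proof (rule ccontr)
 assume "p \<noteq> 0"
 then have "finite {x. poly p x = 0}" by (rule poly_roots_finite)
 moreover have "A \<subseteq> {x. poly p x = 0}" using assms(2) by auto
 ultimately show False using assms(1) by (metis finite_subset)
qed

lemma infinite_range_const: "infinite (UNIV :: 'a set) ==> infinite (range (\<lambda>x :: 'a :: zero. [:x:]))"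
 by (subst finite_image_iff) (auto simp: inj_on_def)

lemma ev3_eq_0:
 assumes "ev3 F = 0"
 shows "F = 0"
proof -
 have inf: "infinite (UNIV :: complex set)" by (rule infinite_UNIV_char_0)
 have 0: "poly (poly (poly F [:[:z:]:]) [:y:]) x = 0" for x y z
  using fun_cong[OF assms, of "vector [x, y, z]"] by (simp add: ev3_def fun_ops)
 have 1: "poly (poly F [:[:z:]:]) [:y:] = 0" for y z
  by (rule poly_zero_on_infinite[OF inf]) (rule 0)
 have 2: "poly F [:[:z:]:] = 0" for z
  by (rule poly_zero_on_infinite[OF infinite_range_const[OF inf]]) (use 1 in blast)
 have "inj (\<lambda>z :: complex. [:[:z:]:])" by (auto simp: inj_on_def)
 then have "infinite (range (\<lambda>z :: complex. [:[:z:]:]))" using inf by (simp add: finite_image_iff)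
 then show "F = 0"
  by (rule poly_zero_on_infinite) (use 2 in blast)
qed

lemma ev3_inject: "ev3 F = ev3 G \<longleftrightarrow> F = G"
 using ev3_eq_0[of "F - G"] by auto

definition polyfun :: "(complex ^ 3 => complex) => bool" where
 "polyfun p \<longleftrightarrow> (\<exists>F. p = ev3 F)"

lemma polyfun_add: "polyfun p ==> polyfun q ==> polyfun (p + q)"
 unfolding polyfun_def using ev3_hom(1) by metis

lemma polyfun_mult: "polyfun p ==> polyfun q ==> polyfun (p * q)"
 unfolding polyfun_def using ev3_hom(2) by metis

lemma polyfun_kk: "polyfun (kk c)"
 unfolding polyfun_def by (rule exI[of _ "[:[:[:c:]:]:]"]) (simp add: ev3_def fun_eq_iff kk_apply)

lemma polyfun_const: "polyfun (\<lambda>_. c)"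
 using polyfun_kk[of c] by (simp add: kk_def)

lemma polyfun_coord: "polyfun (\<lambda>v. v $ i)"
proof -
 have "(\<lambda>v. v $ 1) = ev3 [:[:[:0, 1:]:]:]" "(\<lambda>v. v $ 2) = ev3 [:[:0, 1:]:]" "(\<lambda>v. v $ 3) = ev3 [:0, 1:]"
  by (simp_all add: ev3_def fun_eq_iff)
 then show ?thesis unfolding polyfun_def using exhaust_3[of i] by metis
qed

lemma polyfun_intros:
 "polyfun f ==> polyfun g ==> polyfun (\<lambda>v. f v + g v)"
 "polyfun f ==> polyfun g ==> polyfun (\<lambda>v. f v * g v)"
 using polyfun_add[of f g] polyfun_mult[of f g] by (simp_all add: plus_fun_def times_fun_def)

lemma polyfun_power: "polyfun f ==> polyfun (\<lambda>v. f v ^ n)"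
 by (induction n) (auto intro: polyfun_intros polyfun_const)

lemma polyfun_sum: "(\<And>i. i \<in> A ==> polyfun (f i)) ==> polyfun (\<lambda>v. \<Sum>i\<in>A. f i v)"
 by (induction A rule: infinite_finite_induct) (auto intro: polyfun_intros polyfun_const)

lemma polyfun_domain: "polyfun p ==> polyfun q ==> p * q = 0 ==> p = 0 \<or> q = 0"
 unfolding polyfun_def by (metis ev3_eq_0 ev3_hom(2,3) mult_eq_0_iff)

lemma form_polyfun: "form d p ==> polyfun p"
proof -
 assume "form d p"
 then obtain a where "p = (\<lambda>v. \<Sum>i\<le>d. \<Sum>j\<le>d - i. a i j * (v $ 1) ^ i * (v $ 2) ^ j * (v $ 3) ^ (d - i - j))"
  unfolding form_def by blast
 then show ?thesis
  by (simp only:) (intro polyfun_sum polyfun_intros polyfun_power polyfun_coord polyfun_const)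
qed

lemma form_homogeneous: "form d p ==> p (t *s v) = t ^ d * p v"
proof -
 assume "form d p"
 then obtain a where p: "p v = (\<Sum>i\<le>d. \<Sum>j\<le>d - i. a i j * (v $ 1) ^ i * (v $ 2) ^ j * (v $ 3) ^ (d - i - j))" for v
  unfolding form_def by blast
 have "t ^ d = t ^ i * t ^ j * t ^ (d - i - j)" if "i \<le> d" "j \<le> d - i" for i j
  using that by (simp add: power_add[symmetric])
 then show ?thesis
  unfolding p sum_distrib_left by (intro sum.cong) (auto simp: power_mult_distrib algebra_simps)
qed

lemma poly_eq_sum: "degree (p :: 'a :: comm_ring_1 poly) \<le> N ==> poly p x = (\<Sum>i\<le>N. coeff p i * x ^ i)"
 unfolding poly_altdef by (rule sum.mono_neutral_left) (auto simp: coeff_eq_0)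

lemma degree_coeff_bounded:
 fixes F :: "'a :: zero poly poly"
 shows "\<exists>N. \<forall>k. degree (coeff F k) \<le> N"
proof -
 have "degree (coeff F k) \<le> (\<Sum>k\<le>degree F. degree (coeff F k))" for k
 proof (cases "k \<le> degree F")
  case True
  then show ?thesis by (intro member_le_sum) auto
 qed (simp add: coeff_eq_0)
 then show ?thesis by blast
qed

lemma polyfun_expansion:
 assumes "polyfun p"
 shows "\<exists>N c. \<forall>v. p v = (\<Sum>(i, j, k)\<in>{..N} \<times> {..N} \<times> {..N}. c i j k * (v $ 1) ^ i * (v $ 2) ^ j * (v $ 3) ^ k)"
proof -
 obtain F where F: "p = ev3 F" using assms unfolding polyfun_def by blast
 obtain N1 where N1: "\<forall>k. degree (coeff F k) \<le> N1" using degree_coeff_bounded by blast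
 have "\<exists>M. \<forall>k\<le>degree F. \<forall>j. degree (coeff (coeff F k) j) \<le> M"
 proof -
  have "\<forall>k. \<exists>N. \<forall>j. degree (coeff (coeff F k) j) \<le> N" using degree_coeff_bounded by blast
  then obtain f where f: "\<forall>k j. degree (coeff (coeff F k) j) \<le> f k" by metis
  have "f k \<le> (\<Sum>k\<le>degree F. f k)" if "k \<le> degree F" for k
   using that by (intro member_le_sum) auto
  then show ?thesis using f le_trans by meson
 qed
 then obtain N2 where N2: "\<forall>k\<le>degree F. \<forall>j. degree (coeff (coeff F k) j) \<le> N2" by blast
 define N where "N = max (degree F) (max N1 N2)"
 have N2': "degree (coeff (coeff F k) j) \<le> N" for k j
  using N2[rule_format, of k j] by (cases "k \<le> degree F") (auto simp: N_def coeff_eq_0)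
 have N1': "degree (coeff F k) \<le> N" for k using N1 by (auto simp: N_def intro: le_trans)
 let ?c = "\<lambda>i j k. coeff (coeff (coeff F k) j) i"
 have "p v = (\<Sum>(i, j, k)\<in>{..N} \<times> {..N} \<times> {..N}. ?c i j k * (v $ 1) ^ i * (v $ 2) ^ j * (v $ 3) ^ k)" for v
 proof -
  have e: "poly (poly (coeff F k) [:y:]) x = (\<Sum>j\<le>N. (\<Sum>i\<le>N. ?c i j k * x ^ i) * y ^ j)" for k x y
   unfolding poly_eq_sum[OF N1'[of k]] by (simp add: poly_sum poly_power poly_eq_sum[OF N2'])
  have dF: "degree F \<le> N" by (simp add: N_def)
  have "p v = (\<Sum>k\<le>N. (\<Sum>j\<le>N. (\<Sum>i\<le>N. ?c i j k * (v $ 1) ^ i) * (v $ 2) ^ j) * (v $ 3) ^ k)"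
   unfolding F ev3_def poly_eq_sum[OF dF] by (simp add: poly_sum poly_power e)
  also have "\<dots> = (\<Sum>k\<le>N. \<Sum>j\<le>N. \<Sum>i\<le>N. ?c i j k * (v $ 1) ^ i * (v $ 2) ^ j * (v $ 3) ^ k)"
   by (simp add: sum_distrib_right)
  also have "\<dots> = (\<Sum>j\<le>N. \<Sum>k\<le>N. \<Sum>i\<le>N. ?c i j k * (v $ 1) ^ i * (v $ 2) ^ j * (v $ 3) ^ k)"
   by (rule sum.swap)
  also have "\<dots> = (\<Sum>j\<le>N. \<Sum>i\<le>N. \<Sum>k\<le>N. ?c i j k * (v $ 1) ^ i * (v $ 2) ^ j * (v $ 3) ^ k)"
   by (rule sum.cong[OF refl]) (rule sum.swap)
  also have "\<dots> = (\<Sum>i\<le>N. \<Sum>j\<le>N. \<Sum>k\<le>N. ?c i j k * (v $ 1) ^ i * (v $ 2) ^ j * (v $ 3) ^ k)"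
   by (rule sum.swap)
  finally show ?thesis by (simp add: sum.cartesian_product)
 qed
 then show ?thesis by (intro exI[of _ N] exI[of _ ?c] allI)
qed

lemma polyfun_homogeneous_parts:
 assumes "polyfun p"
 shows "\<exists>n g. (\<forall>i. form i (g i)) \<and> (\<forall>t v. p (t *s v) = (\<Sum>i\<le>n. t ^ i * g i v))"
proof -
 obtain N c where p: "\<And>v. p v = (\<Sum>(i, j, k)\<in>{..N} \<times> {..N} \<times> {..N}. c i j k * (v $ 1) ^ i * (v $ 2) ^ j * (v $ 3) ^ k)"
  using polyfun_expansion[OF assms] by blast
 define g where "g d v = (\<Sum>(i, j, k)\<in>{s \<in> {..N} \<times> {..N} \<times> {..N}. fst s + fst (snd s) + snd (snd s) = d}.
   c i j k * (v $ 1) ^ i * (v $ 2) ^ j * (v $ 3) ^ k)" for d and v :: "complex ^ 3"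
 have "form d (g d)" for d
 proof -
  define a where "a i j = (if i \<le> N \<and> j \<le> N \<and> d - i - j \<le> N then c i j (d - i - j) else 0)" for i j
  have "g d v = (\<Sum>i\<le>d. \<Sum>j\<le>d - i. a i j * (v $ 1) ^ i * (v $ 2) ^ j * (v $ 3) ^ (d - i - j))" for v
  proof -
   have "(\<Sum>i\<le>d. \<Sum>j\<le>d - i. a i j * (v $ 1) ^ i * (v $ 2) ^ j * (v $ 3) ^ (d - i - j)) =
    (\<Sum>(i, j)\<in>(SIGMA i:{..d}. {..d - i}). a i j * (v $ 1) ^ i * (v $ 2) ^ j * (v $ 3) ^ (d - i - j))"
    by (simp add: sum.Sigma)
   also have "\<dots> = (\<Sum>(i, j)\<in>{(i, j) \<in> (SIGMA i:{..d}. {..d - i}). i \<le> N \<and> j \<le> N \<and> d - i - j \<le> N}.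
     a i j * (v $ 1) ^ i * (v $ 2) ^ j * (v $ 3) ^ (d - i - j))"
    by (rule sum.mono_neutral_right) (auto simp: a_def split: if_splits)
   also have "\<dots> = g d v"
    unfolding g_def
    by (rule sum.reindex_bij_witness[of _ "\<lambda>(i, j, k). (i, j)" "\<lambda>(i, j). (i, j, d - i - j)"])
      (auto simp: a_def)
   finally show ?thesis by simp
  qed
  then show ?thesis unfolding form_def by blast
 qed
 moreover have "p (t *s v) = (\<Sum>d\<le>3 * N. t ^ d * g d v)" for t v
 proof -
  have "(\<Sum>d\<le>3 * N. t ^ d * g d v) = (\<Sum>d\<le>3 * N. \<Sum>(i, j, k)\<in>{s \<in> {..N} \<times> {..N} \<times> {..N}. fst s + fst (snd s) + snd (snd s) = d}.
   c i j k * (t * v $ 1) ^ i * (t * v $ 2) ^ j * (t * v $ 3) ^ k)"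
   unfolding g_def sum_distrib_left
   by (intro sum.cong refl) (auto simp: power_add power_mult_distrib algebra_simps)
  also have "\<dots> = (\<Sum>(i, j, k)\<in>{..N} \<times> {..N} \<times> {..N}. c i j k * (t * v $ 1) ^ i * (t * v $ 2) ^ j * (t * v $ 3) ^ k)"
   by (rule sum.group) auto
  also have "\<dots> = p (t *s v)" by (simp add: p)
  finally show ?thesis by simp
 qed
 ultimately show ?thesis by (intro exI[of _ "3 * N"] exI[of _ g]) blast
qed

lemma poly_coeff_unique:
 fixes a b :: "nat => complex"
 assumes "\<And>t. (\<Sum>i\<le>n. t ^ i * a i) = (\<Sum>i\<le>n. t ^ i * b i)" "i \<le> n"
 shows "a i = b i"
proof -
 let ?p = "\<Sum>i\<le>n. monom (a i - b i) i"
 have "poly ?p t = 0" for t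
  using assms(1)[of t] by (simp add: poly_sum poly_monom algebra_simps sum_subtractf)
 then have "?p = 0" using poly_all_0_iff_0 by blast
 then have "coeff ?p i = 0" by simp
 then show ?thesis using assms(2) by (simp add: coeff_sum)
qed

text \<open>For fixed v, both t^d p(v) and the expansion of p(t v) into homogeneous parts are
  polynomials in t; comparing coefficients leaves only the part of degree d. The characterisation
  makes closure under sums and products immediate.\<close>

lemma form_iff: "form d p \<longleftrightarrow> polyfun p \<and> (\<forall>t v. p (t *s v) = t ^ d * p v)"
proof
 assume "form d p" then show "polyfun p \<and> (\<forall>t v. p (t *s v) = t ^ d * p v)"
  using form_polyfun form_homogeneous by blast
next
 assume p: "polyfun p \<and> (\<forall>t v. p (t *s v) = t ^ d * p v)"
 then obtain n g where g: "\<And>i. form i (g i)" "\<And>t v. p (t *s v) = (\<Sum>i\<le>n. t ^ i * g i v)"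
  using polyfun_homogeneous_parts by metis
 let ?n = "max n d"
 let ?g = "\<lambda>i v. if i \<le> n then g i v else 0"
 have "p v = ?g d v" for v
 proof -
  have "(\<Sum>i\<le>?n. t ^ i * ?g i v) = (\<Sum>i\<le>?n. t ^ i * (if i = d then p v else 0))" for t
  proof -
   have "(\<Sum>i\<le>?n. t ^ i * ?g i v) = (\<Sum>i\<le>n. t ^ i * g i v)"
    by (rule sum.mono_neutral_cong_right) auto
   also have "\<dots> = t ^ d * p v" using g(2)[of t v] p by simp
   also have "\<dots> = (\<Sum>i\<le>?n. t ^ i * (if i = d then p v else 0))"
    by (simp add: if_distrib cong: if_cong)
   finally show ?thesis .
  qed
  from poly_coeff_unique[OF this, of d] show ?thesis by simp
 qed
 then have "p = ?g d" by blast
 moreover have "form d (?g d)"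
  using g(1)[of d] by (cases "d \<le> n") (auto simp: form_def intro!: exI[of _ "\<lambda>_ _. 0"])
 ultimately show "form d p" by simp
qed

lemma form_add: "form d p ==> form d q ==> form d (p + q)"
 unfolding form_iff by (auto simp: polyfun_add fun_ops algebra_simps)

lemma form_mult: "form d p ==> form e q ==> form (d + e) (p * q)"
 unfolding form_iff by (auto simp: polyfun_mult fun_ops power_add)

lemma form_kk: "form 0 (kk c)"
 unfolding form_iff by (auto simp: polyfun_kk kk_apply)

lemma form_0: "form d 0"
 unfolding form_iff using polyfun_kk[of 0] by (auto simp: fun_ops kk_simps)

lemma form_coord: "form 1 (\<lambda>v. v $ i)"
 unfolding form_iff by (auto simp: polyfun_coord)

lemma form_domain: "form d p ==> form e q ==> p * q = 0 ==> p = 0 \<or> q = 0"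
 using polyfun_domain form_polyfun by blast

lemma form_degree_unique: "form d p ==> form e p ==> p \<noteq> 0 ==> d = e"
proof -
 assume p: "form d p" "form e p" "p \<noteq> 0"
 then obtain v where v: "p v \<noteq> 0" by (auto simp: fun_eq_iff fun_ops)
 have "2 ^ d * p v = 2 ^ e * p v" by (metis form_homogeneous p(1,2))
 then have "(2 :: complex) ^ d = 2 ^ e" using v by (metis mult_right_cancel)
 then have "(2 :: real) ^ d = 2 ^ e" by (metis norm_numeral norm_power)
 then show ?thesis by simp
qed

text \<open>Induction on the exponent: if it is positive, one of the factors vanishes at 0 and the
  variable can be divided out of it.\<close>

lemma monom_factor:
 fixes A B :: "'a :: idom poly"
 shows "A * B = monom c d ==> c \<noteq> 0 ==> \<exists>e\<le>d. \<exists>a. A = monom a e"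
proof (induction d arbitrary: A B)
 case 0
 then have "A \<noteq> 0" "B \<noteq> 0" by auto
 then have "degree A = 0" using degree_mult_eq[of A B] 0 by (simp add: degree_monom_eq)
 then show ?case by (metis degree_0_id le_refl monom_0)
next
 case (Suc d)
 have "poly A 0 * poly B 0 = 0" using Suc.prems(1) by (metis poly_mult poly_monom power_Suc mult_zero_left mult_zero_right)
 then consider "coeff A 0 = 0" | "coeff B 0 = 0" by (auto simp: poly_0_coeff_0)
 then show ?case
 proof cases
  case 1
  then obtain A' where A': "A = pCons 0 A'" by (metis pCons_cases coeff_pCons_0)
  then have "pCons 0 (A' * B) = pCons 0 (monom c d)" using Suc.prems(1) by (simp add: monom_Suc)
  then have "A' * B = monom c d" by simp
  then obtain e a where "e \<le> d" "A' = monom a e" using Suc.IH Suc.prems(2) by blast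
  then show ?thesis using A' by (intro exI[of _ "Suc e"]) (auto simp: monom_Suc)
 next
  case 2
  then obtain B' where B': "B = pCons 0 B'" by (metis pCons_cases coeff_pCons_0)
  then have "pCons 0 (A * B') = pCons 0 (monom c d)" using Suc.prems(1) by (simp add: monom_Suc)
  then have "A * B' = monom c d" by simp
  then show ?thesis using Suc.IH Suc.prems(2) le_SucI by blast
 qed
qed

text \<open>On the line through a point v with (a b)(v) nonzero, a becomes a factor of a monomial in
  t, hence a monomial. What remains is that the exponent does not depend on v.\<close>

lemma form_factor1:
 assumes ab: "polyfun a" "polyfun b" "form d (a * b)" "a * b \<noteq> 0"
 shows "\<exists>e\<le>d. form e a"
proof -
 have nz: "a \<noteq> 0" "b \<noteq> 0" using ab(4) by auto
 obtain n g where g: "\<And>i. form i (g i)" "\<And>t v. a (t *s v) = (\<Sum>i\<le>n. t ^ i * g i v)"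
  using polyfun_homogeneous_parts[OF ab(1)] by metis
 obtain m h where h: "\<And>i. form i (h i)" "\<And>t v. b (t *s v) = (\<Sum>i\<le>m. t ^ i * h i v)"
  using polyfun_homogeneous_parts[OF ab(2)] by metis
 have mono: "\<exists>e\<le>d. (\<forall>i\<le>n. i \<noteq> e --> g i v = 0)" if v: "(a * b) v \<noteq> 0" for v
 proof -
  define A where "A = (\<Sum>i\<le>n. monom (g i v) i)"
  define B where "B = (\<Sum>i\<le>m. monom (h i v) i)"
  have "poly (A * B) t = poly (monom ((a * b) v) d) t" for t
   using g(2)[of t v] h(2)[of t v] form_homogeneous[OF ab(3), of t v]
   by (simp add: A_def B_def poly_sum poly_monom fun_ops mult_ac)
  then have AB: "A * B = monom ((a * b) v) d" by (simp add: poly_eq_poly_eq_iff[symmetric] fun_eq_iff)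
  then obtain e c where u: "e \<le> d" "A = monom c e" using monom_factor v by blast
  then have c0: "coeff A i = 0" if "i \<noteq> e" for i using that by simp
  have "g i v = 0" if "i \<le> n" "i \<noteq> e" for i
   using that(1) c0[OF that(2)] by (simp add: A_def coeff_sum)
  with u(1) show ?thesis by blast
 qed
 have "\<exists>e\<le>d. \<forall>i\<le>n. i \<noteq> e --> g i = 0"
 proof (rule ccontr)
  assume "\<not> ?thesis"
  then have neg: "\<And>e. e \<le> d ==> \<exists>i\<le>n. i \<noteq> e \<and> g i \<noteq> 0" by blast
  obtain v where v: "(a * b) v \<noteq> 0" using ab(4) by (auto simp: fun_eq_iff fun_ops)
  obtain e0 where e0: "e0 \<le> d" "\<forall>i\<le>n. i \<noteq> e0 --> g i v = 0" using mono[OF v] by blast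
  obtain i where i: "i \<le> n" "i \<noteq> e0" "g i \<noteq> 0" using neg[OF e0(1)] by blast
  have "g e0 v \<noteq> 0 \<and> e0 \<le> n"
  proof -
   have "a v = (\<Sum>i\<le>n. g i v)" using g(2)[of 1 v] by simp
   also have "\<dots> = (\<Sum>i\<le>n. if i = e0 then g e0 v else 0)"
    using e0(2) by (intro sum.cong) auto
   finally show ?thesis using v by (auto simp: fun_ops split: if_splits)
  qed
  then have ge: "g e0 \<noteq> 0" "e0 \<le> n" by (auto simp: fun_ops)
  \<comment> \<open>If two homogeneous parts of a were nonzero, they and a b would be nonzero at a
    common point, and a would not be a monomial along the line through it.\<close>
  have "g i * (g e0 * (a * b)) \<noteq> 0"
   using i(3) ge(1) ab form_domain[OF g(1) form_mult[OF g(1) ab(3)]] form_domain[OF g(1) ab(3)] by metis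
  then obtain w where w: "g i w \<noteq> 0" "g e0 w \<noteq> 0" "(a * b) w \<noteq> 0"
   by (auto simp: fun_eq_iff fun_ops)
  obtain e where "e \<le> d" "\<forall>i\<le>n. i \<noteq> e --> g i w = 0" using mono[OF w(3)] by blast
  then show False using w i(1,2) ge(2) by metis
 qed
 then obtain e where e: "e \<le> d" "\<And>i. i \<le> n ==> i \<noteq> e ==> g i = 0" by blast
 have at: "a (t *s v) = (if e \<le> n then t ^ e * g e v else 0)" for t v
 proof -
  have "a (t *s v) = (\<Sum>i\<le>n. if i = e then t ^ e * g e v else 0)"
   unfolding g(2) using e(2) by (intro sum.cong) (auto simp: fun_ops)
  then show ?thesis by simp
 qed
 have fa: "form e a"
  unfolding form_iff using ab(1) at at[of 1] by (auto simp: fun_ops)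
 with e(1) show ?thesis by blast
qed

lemma form_factor:
 assumes ab: "polyfun a" "polyfun b" "form d (a * b)" "a * b \<noteq> 0"
 shows "\<exists>e\<le>d. form e a \<and> form (d - e) b"
proof -
 obtain e where e: "form e a" using form_factor1[OF ab] by blast
 obtain e' where e': "form e' b"
  using form_factor1[OF ab(2,1)] ab(3,4) by (metis mult.commute)
 have "e + e' = d" by (rule form_degree_unique[OF form_mult[OF e e'] ab(3,4)])
 with e e' show ?thesis by (intro exI[of _ e]) auto
qed

definition fdvd :: "(complex ^ 3 => complex) => (complex ^ 3 => complex) => bool" where
 "fdvd f g \<longleftrightarrow> (\<exists>c. polyfun c \<and> g = f * c)"

lemma fdvd_ev3: "fdvd (ev3 F) (ev3 G) \<longleftrightarrow> F dvd G"
 unfolding fdvd_def polyfun_def dvd_def by (metis ev3_hom(2) ev3_inject)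

text \<open>A prime factor in the factorial polynomial ring is a form by
  \<open>form_factor1\<close>, and if it had degree 0 it would be a unit.\<close>

lemma form_prime_divisor:
 assumes f: "form d f" "f \<noteq> 0" "d \<ge> 1"
 shows "\<exists>e g. e \<ge> 1 \<and> form e g \<and> fdvd g f \<and>
  (\<forall>a b. polyfun a --> polyfun b --> fdvd g (a * b) --> fdvd g a \<or> fdvd g b)"
proof -
 obtain F where F: "f = ev3 F" using form_polyfun[OF f(1)] unfolding polyfun_def by blast
 have unit: "e = 0" if "F * G = 1" "form e (ev3 F)" for F G e
 proof -
  have 1: "ev3 F * ev3 G = kk 1" using that(1) by (metis ev3_hom(2,4) kk_simps(5))
  have "form 0 (ev3 F * ev3 G)" unfolding 1 by (rule form_kk)
  moreover have "ev3 F * ev3 G \<noteq> 0" unfolding 1 by (simp add: kk_simps(5))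
  ultimately obtain e' where "e' \<le> 0" "form e' (ev3 F)"
   using form_factor1[of "ev3 F" "ev3 G" 0] polyfun_def by blast
  then show "e = 0" using form_degree_unique[OF that(2)] that(1) by (metis bot_nat_0.extremum_uniqueI ev3_eq_0 mult_zero_left zero_neq_one)
 qed
 have "\<not> is_unit F"
 proof
  assume "is_unit F"
  then obtain G where "F * G = 1" by (metis dvdE)
  from unit[OF this f(1)[unfolded F]] f(3) show False by simp
 qed
 moreover have "F \<noteq> 0" using f(2) F by auto
 ultimately obtain G where G: "G dvd F" "prime G" using prime_divisor_exists by blast
 from G(1) obtain C where C: "F = G * C" by (rule dvdE)
 have fGC: "f = ev3 G * ev3 C" unfolding F C by simp
 then obtain e where e: "form e (ev3 G)"
  using form_factor1[of "ev3 G" "ev3 C" d] f polyfun_def by metis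
 have "e \<noteq> 0"
 proof
  assume "e = 0"
  define k where "k = ev3 G 0"
  have G0: "ev3 G v = k" for v
   using form_homogeneous[OF e, of 0 v] \<open>e = 0\<close> by (simp add: k_def)
  then have "ev3 G = ev3 [:[:[:k:]:]:]" by (simp add: ev3_def fun_eq_iff)
  then have G1: "G = [:[:[:k:]:]:]" using ev3_inject by blast
  have "k \<noteq> 0" using G1 G(2) by (metis not_prime_0 pCons_0_0)
  then have "is_unit G" unfolding G1 by (simp add: is_unit_const_poly_iff dvd_field_iff)
  then show False using G(2) not_prime_unit by blast
 qed
 moreover have "fdvd (ev3 G) f" using G(1) F fdvd_ev3 by simp
 moreover have "fdvd (ev3 G) a \<or> fdvd (ev3 G) b" if pab: "polyfun a" "polyfun b" "fdvd (ev3 G) (a * b)" for a b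
 proof -
  obtain A B where AB: "a = ev3 A" "b = ev3 B" using pab(1,2) unfolding polyfun_def by blast
  then have "G dvd A * B" using pab(3) fdvd_ev3 ev3_hom(2) by metis
  then show ?thesis using G(2) fdvd_ev3 AB prime_dvd_multD by blast
 qed
 ultimately show ?thesis using e by (intro exI[of _ e] exI[of _ "ev3 G"]) auto
qed

section \<open>Forms as functions on the projective plane\<close>

text \<open>Forms are evaluated at the chosen representatives, so they are honest functions on the
  plane that can be added and multiplied there. Degrees are integers, with only 0 in negative
  degrees, so that they may be subtracted freely.\<close>

definition pform :: "int => (P2 => complex) => bool" where
 "pform k f \<longleftrightarrow> (if k < 0 then f = 0 else \<exists>p. form (nat k) p \<and> f = (\<lambda>P. p (coords P)))"

lemma pform_of_form: "form d p ==> pform (int d) (\<lambda>P. p (coords P))"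
 unfolding pform_def by auto

lemma pformE:
 assumes "pform k f" "f \<noteq> 0"
 obtains d p where "k = int d" "form d p" "f = (\<lambda>P. p (coords P))"
 using assms unfolding pform_def by (metis nat_0_le not_le)

lemma pform_neg: "pform k f ==> k < 0 ==> f = 0"
 unfolding pform_def by simp

lemma pform_0: "pform k 0"
 unfolding pform_def using form_0[of "nat k"] by (auto simp: fun_eq_iff fun_ops intro!: exI[of _ 0])

lemma pform_kk: "pform 0 (kk c)"
 unfolding pform_def using form_kk[of c] by (auto simp: fun_eq_iff kk_apply intro!: exI[of _ "kk c"])

lemma pform_add: "pform k f ==> pform k g ==> pform k (f + g)"
 unfolding pform_def using form_add
 by (auto simp: fun_eq_iff fun_ops split: if_splits) (metis plus_fun_apply)

lemma pform_mult: "pform k f ==> pform l g ==> pform (k + l) (f * g)"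
proof (cases "f = 0 \<or> g = 0")
 case True
 then show ?thesis using pform_0 by auto
next
 case False
 assume fg: "pform k f" "pform l g"
 have nz: "f \<noteq> 0" "g \<noteq> 0" using False by auto
 obtain d p where p: "k = int d" "form d p" "f = (\<lambda>P. p (coords P))"
  by (rule pformE[OF fg(1) nz(1)])
 obtain e q where q: "l = int e" "form e q" "g = (\<lambda>P. q (coords P))"
  by (rule pformE[OF fg(2) nz(2)])
 note p q
 moreover from this have "form (d + e) (p * q)" using form_mult by blast
 ultimately show ?thesis using pform_of_form[of "d + e" "p * q"] by (simp add: times_fun_def)
qed

lemma pform_kk_mult: "pform k f ==> pform k (kk c * f)"
 using pform_mult[OF pform_kk] by simp

lemma pform_one: "pform 0 1"
 using pform_kk[of 1] by (simp add: kk_simps)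

lemma pform_power: "pform k f ==> pform (int n * k) (f ^ n)"
proof (induction n)
 case (Suc n)
 then show ?case using pform_mult[of k f "int n * k" "f ^ n"] by (simp add: algebra_simps)
qed (simp add: pform_one)

text \<open>Every nonzero vector is a multiple of a chosen representative. At the zero vector
  homogeneity gives 0^d times a value already known to vanish, which covers d = 0 as well.\<close>

lemma form_ext_coords:
 assumes "form d p" "\<And>P. p (coords P) = 0"
 shows "p = 0"
proof -
 have nz: "p v = 0" if v: "v \<noteq> 0" for v
 proof -
  obtain c where c: "c \<noteq> 0" "coords (abs_P2 v) = c *s v" using coords_abs[OF v] by blast
  then have "c ^ d * p v = 0" using assms(2)[of "abs_P2 v"] form_homogeneous[OF assms(1)] by simp
  with c show ?thesis by simp
 qed
 have "p 0 = 0 ^ d * p (axis 1 1)" using form_homogeneous[OF assms(1), of 0 "axis 1 1"] by simp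
 moreover have "p (axis 1 1) = 0" by (rule nz) (simp add: axis_eq_0_iff)
 ultimately have "p v = 0" for v using nz by (cases "v = 0") auto
 then show "p = 0" by (simp add: fun_eq_iff fun_ops)
qed

lemma pform_domain:
 assumes "pform k f" "pform l g" "f * g = 0"
 shows "f = 0 \<or> g = 0"
proof (rule ccontr)
 assume "\<not> ?thesis"
 then have nz: "f \<noteq> 0" "g \<noteq> 0" by auto
 obtain d p where p: "k = int d" "form d p" "f = (\<lambda>P. p (coords P))"
  by (rule pformE[OF assms(1) nz(1)])
 obtain e q where q: "l = int e" "form e q" "g = (\<lambda>P. q (coords P))"
  by (rule pformE[OF assms(2) nz(2)])
 note * = p q
 have "(p * q) (coords P) = 0" for P using fun_cong[OF assms(3), of P] * by (simp add: fun_ops)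
 then have "p * q = 0" by (rule form_ext_coords[OF form_mult[OF *(2,5)]])
 then have "p = 0 \<or> q = 0" using form_domain[OF *(2,5)] by simp
 then show False
 proof
  assume "p = 0"
  then have "f = 0" using p(3) by (simp add: fun_eq_iff fun_ops)
  with nz show False by simp
 next
  assume "q = 0"
  then have "g = 0" using q(3) by (simp add: fun_eq_iff fun_ops)
  with nz show False by simp
 qed
qed

lemma pform_cancel:
 assumes "pform k f" "f \<noteq> 0" "pform l g" "pform l h" "f * g = f * h"
 shows "g = h"
proof -
 have "pform l (g + kk (- 1) * h)" by (intro pform_add pform_kk_mult assms)
 moreover have "f * (g + kk (- 1) * h) = 0" using assms(5) by (simp add: kk_simps algebra_simps)
 ultimately have "g + kk (- 1) * h = 0" using pform_domain assms(1,2) by blast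
 then show ?thesis by (simp add: kk_simps)
qed

text \<open>The degrees of divisor and dividend are part of the relation because the function 0 has
  every degree; they fix the degree of the quotient.\<close>

definition pdvd :: "int => (P2 => complex) => int => (P2 => complex) => bool" where
 "pdvd e f i a \<longleftrightarrow> (\<exists>c. pform (i - e) c \<and> a = f * c)"

definition pprime :: "int => (P2 => complex) => bool" where
 "pprime e f \<longleftrightarrow> pform e f \<and> e \<ge> 1 \<and> f \<noteq> 0 \<and>
  (\<forall>i j a b. pform i a --> pform j b --> pdvd e f (i + j) (a * b) --> pdvd e f i a \<or> pdvd e f j b)"

lemma pdvd_0: "pdvd e f i 0"
 unfolding pdvd_def by (auto intro!: exI[of _ 0] pform_0)

lemma fdvd_pdvd:
 assumes g: "form e g" and a: "form i a" "fdvd g a"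
 shows "pdvd (int e) (\<lambda>P. g (coords P)) (int i) (\<lambda>P. a (coords P))"
proof (cases "a = 0")
 case True
 then have "(\<lambda>P. a (coords P)) = 0" by (simp add: fun_eq_iff fun_ops)
 then show ?thesis using pdvd_0 by metis
next
 case False
 obtain c where c: "polyfun c" "a = g * c" using a(2) unfolding fdvd_def by blast
 obtain e' where e': "e' \<le> i" "form e' g" "form (i - e') c"
  using form_factor[OF form_polyfun[OF g] c(1)] a(1) False c(2) by metis
 have "g \<noteq> 0" using c(2) False by auto
 then have "e' = e" using form_degree_unique[OF e'(2) g] by blast
 then show ?thesis
  unfolding pdvd_def using pform_of_form[OF e'(3)] e'(1) c(2)
  by (intro exI[of _ "\<lambda>P. c (coords P)"]) (auto simp: of_nat_diff fun_eq_iff fun_ops)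
qed

lemma pprime_divisor:
 assumes f: "pform d f" "f \<noteq> 0" "d \<ge> 1"
 obtains e g c where "pprime e g" "pform (d - e) c" "f = g * c"
proof -
 obtain d' p where p: "d = int d'" "form d' p" "f = (\<lambda>P. p (coords P))" using pformE[OF f(1,2)] .
 have "p \<noteq> 0" using f(2) p(3) by (auto simp: fun_eq_iff fun_ops)
 then obtain e g where g: "e \<ge> 1" "form e g" "fdvd g p"
  "\<And>a b. polyfun a ==> polyfun b ==> fdvd g (a * b) ==> fdvd g a \<or> fdvd g b"
  using form_prime_divisor[OF p(2)] f(3) p(1) by auto
 let ?g = "\<lambda>P. g (coords P)"
 have gnz: "g \<noteq> 0" using g(3) \<open>p \<noteq> 0\<close> unfolding fdvd_def by auto
 then have nz: "?g \<noteq> 0" using form_ext_coords[OF g(2)] by (auto simp: fun_eq_iff fun_ops)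
 have prime: "pdvd (int e) ?g i a \<or> pdvd (int e) ?g j b"
  if a: "pform i a" and b: "pform j b" and ab: "pdvd (int e) ?g (i + j) (a * b)" for i j a b
 proof (cases "a = 0 \<or> b = 0")
  case True
  then show ?thesis using pdvd_0 by blast
 next
  case False
  have nzab: "a \<noteq> 0" "b \<noteq> 0" using False by auto
  obtain i' a' where a': "i = int i'" "form i' a'" "a = (\<lambda>P. a' (coords P))"
   by (rule pformE[OF a nzab(1)])
  obtain j' b' where b': "j = int j'" "form j' b'" "b = (\<lambda>P. b' (coords P))"
   by (rule pformE[OF b nzab(2)])
  note ab' = a' b'
  obtain c where c: "pform (i + j - int e) c" "a * b = ?g * c" using ab unfolding pdvd_def by blast
  have "c \<noteq> 0" using c(2) False pform_domain[OF a b] by auto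
  then obtain k c' where c': "i + j - int e = int k" "form k c'" "c = (\<lambda>P. c' (coords P))"
   by (rule pformE[OF c(1)])
  have deg: "i' + j' = e + k" using c'(1) ab'(1,4) by linarith
  have "form (i' + j') (kk (- 1) * (g * c'))"
   using form_mult[OF form_kk[of "- 1"] form_mult[OF g(2) c'(2)]] deg by simp
  then have "form (i' + j') (a' * b' + kk (- 1) * (g * c'))" by (rule form_add[OF form_mult[OF ab'(2,5)]])
  moreover have "(a' * b' + kk (- 1) * (g * c')) (coords P) = 0" for P
   using fun_cong[OF c(2), of P] ab' c' by (simp add: fun_ops kk_apply)
  ultimately have "a' * b' + kk (- 1) * (g * c') = 0" by (rule form_ext_coords)
  then have "fdvd g (a' * b')" unfolding fdvd_def
   using form_polyfun[OF c'(2)] by (intro exI[of _ c']) (simp add: kk_simps)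
  then have "fdvd g a' \<or> fdvd g b'" using g(4) form_polyfun ab' by blast
  then show ?thesis using fdvd_pdvd[OF g(2)] ab' by blast
 qed
 have "pprime (int e) ?g"
  unfolding pprime_def using pform_of_form[OF g(2)] g(1) nz prime by auto
 moreover obtain c where "pform (d - int e) c" "f = ?g * c"
  using fdvd_pdvd[OF g(2) p(2) g(3)] p unfolding pdvd_def by blast
 ultimately show ?thesis by (rule that)
qed

lemma pform_const:
 assumes "pform 0 f"
 shows "\<exists>c. f = kk c"
proof -
 obtain p where p: "form 0 p" "f = (\<lambda>P. p (coords P))" using assms unfolding pform_def by auto
 then have "p v = p 0" for v using form_homogeneous[OF p(1), of 0 v] by simp
 with p(2) show ?thesis by (intro exI[of _ "p 0"]) (simp add: fun_eq_iff kk_apply)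
qed

definition lin :: "complex ^ 3 => P2 => complex" where
 "lin a P = a $ 1 * coords P $ 1 + a $ 2 * coords P $ 2 + a $ 3 * coords P $ 3"

lemma pform_lin: "pform 1 (lin a)"
proof -
 have "form 1 (kk (a $ 1) * (\<lambda>v. v $ 1) + kk (a $ 2) * (\<lambda>v. v $ 2) + kk (a $ 3) * (\<lambda>v. v $ 3))"
  using form_mult[OF form_kk form_coord] by (intro form_add) simp_all
 from pform_of_form[OF this] show ?thesis by (simp add: lin_def[abs_def] fun_ops kk_apply)
qed

lemma lin_add: "lin (a + b) = lin a + lin b"
 by (simp add: fun_eq_iff lin_def fun_ops algebra_simps)

lemma lin_scale: "lin (c *s a) = kk c * lin a"
 by (simp add: fun_eq_iff lin_def fun_ops kk_apply algebra_simps)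

lemma lin_axis: "lin (axis i 1) P = coords P $ i"
 using exhaust_3[of i] by (auto simp: lin_def axis_def)

lemma lin_nonvanishing: "\<exists>a. lin a P \<noteq> 0"
proof -
 obtain i where "coords P $ i \<noteq> 0" using coords_nonzero[of P] by (auto simp: Finite_Cartesian_Product.vec_eq_iff)
 then show ?thesis using lin_axis by metis
qed

lemma three_distinct: "(1 :: 3) \<noteq> 2" "(2 :: 3) \<noteq> 1" "(1 :: 3) \<noteq> 3" "(3 :: 3) \<noteq> 1" "(2 :: 3) \<noteq> 3" "(3 :: 3) \<noteq> 2"
 by simp_all

lemma lin_eq_0_iff: "lin a = 0 \<longleftrightarrow> a = 0"
proof
 assume 0: "lin a = 0"
 let ?p = "kk (a $ 1) * (\<lambda>v :: complex ^ 3. v $ 1) + kk (a $ 2) * (\<lambda>v. v $ 2) + kk (a $ 3) * (\<lambda>v. v $ 3)"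
 have "form 1 ?p" using form_mult[OF form_kk form_coord] by (intro form_add) simp_all
 moreover have "?p (coords P) = 0" for P using fun_cong[OF 0, of P] by (simp add: fun_ops kk_apply lin_def)
 ultimately have p0: "?p = 0" by (rule form_ext_coords)
 have "a $ 1 * v $ 1 + a $ 2 * v $ 2 + a $ 3 * v $ 3 = 0" for v :: "complex ^ 3"
  using fun_cong[OF p0, of v] by (simp only: fun_ops kk_apply)
 from this[of "axis 1 1"] this[of "axis 2 1"] this[of "axis 3 1"] have "a $ i = 0" for i
  using exhaust_3[of i] by (auto simp: axis_def three_distinct)
 then show "a = 0" by (simp add: Finite_Cartesian_Product.vec_eq_iff)
qed (auto simp: lin_def fun_eq_iff fun_ops)

text \<open>A prime divisor of a linear form has degree 1, so it is the linear form up to a nonzero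
  constant, and divisibility by the two is the same.\<close>

lemma pprime_lin:
 assumes "a \<noteq> 0"
 shows "pprime 1 (lin a)"
proof -
 have nz: "lin a \<noteq> 0" using assms lin_eq_0_iff by simp
 obtain e g c where g: "pprime e g" "pform (1 - e) c" "lin a = g * c"
  using pprime_divisor[OF pform_lin nz] by auto
 have "c \<noteq> 0" using g(3) nz by auto
 then have "e \<le> 1" using pform_neg[OF g(2)] by fastforce
 with g(1) have e: "e = 1" by (simp add: pprime_def)
 then obtain k where k: "c = kk k" using pform_const g(2) by auto
 have "k \<noteq> 0" using k \<open>c \<noteq> 0\<close> by (auto simp: kk_simps)
 then have inv: "kk (inverse k) * kk k = (1 :: P2 => complex)" by (simp add: kk_simps(3,5)[symmetric])
 have eq: "lin a = kk k * g" using g(3) k by (simp add: mult.commute)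
 have "pdvd 1 (lin a) i x \<longleftrightarrow> pdvd 1 g i x" for i x
 proof
  assume "pdvd 1 (lin a) i x"
  then obtain y where y: "pform (i - 1) y" "x = kk k * g * y" unfolding pdvd_def eq by blast
  then have "x = g * (kk k * y)" by (simp add: mult_ac)
  with y(1) show "pdvd 1 g i x" unfolding pdvd_def using pform_kk_mult by blast
 next
  assume "pdvd 1 g i x"
  then obtain y where y: "pform (i - 1) y" "x = g * y" unfolding pdvd_def by blast
  have "x = lin a * (kk (inverse k) * y)" unfolding eq y(2)
   using inv by (metis (no_types, lifting) mult.assoc mult.commute mult.left_neutral)
  then show "pdvd 1 (lin a) i x" unfolding pdvd_def using pform_kk_mult[OF y(1)] by blast
 qed
 with g(1) e nz pform_lin show ?thesis unfolding pprime_def by simp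
qed

lemma lin_separates:
 assumes "P \<noteq> R"
 shows "\<exists>a. lin a R = 0 \<and> lin a P \<noteq> 0"
proof (rule ccontr)
 assume neg: "\<not> ?thesis"
 let ?r = "coords R" and ?p = "coords P"
 have neg': "lin a P = 0" if "lin a R = 0" for a using neg that by blast
 \<comment> \<open>The linear form with coefficients (0, r_3, -r_2) and its two analogues vanish at
   R; if they also vanish at P, all minors of size two of the two coordinate vectors are 0.\<close>
 have "?p $ 2 * ?r $ 3 = ?p $ 3 * ?r $ 2"
  using neg'[of "vector [0, ?r $ 3, - (?r $ 2)]"] by (simp add: lin_def vector_3 algebra_simps)
 moreover have "?p $ 1 * ?r $ 3 = ?p $ 3 * ?r $ 1"
  using neg'[of "vector [- (?r $ 3), 0, ?r $ 1]"] by (simp add: lin_def vector_3 algebra_simps)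
 moreover have "?p $ 1 * ?r $ 2 = ?p $ 2 * ?r $ 1"
  using neg'[of "vector [?r $ 2, - (?r $ 1), 0]"] by (simp add: lin_def vector_3 algebra_simps)
 ultimately have eq: "?p $ 2 * ?r $ 3 = ?p $ 3 * ?r $ 2" "?p $ 1 * ?r $ 3 = ?p $ 3 * ?r $ 1" "?p $ 1 * ?r $ 2 = ?p $ 2 * ?r $ 1"
  by blast+
 obtain i where i: "?r $ i \<noteq> 0" using coords_nonzero[of R] by (auto simp: Finite_Cartesian_Product.vec_eq_iff)
 have "?p $ j * ?r $ i = ?p $ i * ?r $ j" for j
  using eq exhaust_3[of i] exhaust_3[of j] by (auto simp: mult.commute)
 then have "?p = (?p $ i / ?r $ i) *s ?r" using i by (auto simp: Finite_Cartesian_Product.vec_eq_iff field_simps)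
 with coords_eqI assms show False by blast
qed

definition pforms :: "int => (P2 => complex) set" where
 "pforms k = {f. pform k f}"

lemma mem_pforms: "f \<in> pforms k \<longleftrightarrow> pform k f"
 by (simp add: pforms_def)

lemma subspace_pforms: "fs.subspace (pforms k)"
 by (rule fs.subspaceI) (auto simp: mem_pforms cscale_def pform_0 pform_add pform_kk_mult)

definition pmono :: "nat => nat \<times> nat => P2 => complex" where
 "pmono d ij P = (coords P $ 1) ^ fst ij * (coords P $ 2) ^ snd ij * (coords P $ 3) ^ (d - fst ij - snd ij)"

lemma sum_fun_apply: "(\<Sum>i\<in>A. f i) x = (\<Sum>i\<in>A. f i x :: 'b :: comm_monoid_add)"
 by (induction A rule: infinite_finite_induct) (auto simp: fun_ops)

lemma card_triangle: "2 * card (SIGMA i:{..d}. {..d - i}) = (d + 1) * (d + 2)"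
proof -
 have "card (SIGMA i:{..d}. {..d - i}) = (\<Sum>i\<le>d. d - i + 1)" by simp
 also have "\<dots> = (\<Sum>i\<le>d. i + 1)" by (rule sum.reindex_bij_witness[of _ "\<lambda>i. d - i" "\<lambda>i. d - i"]) auto
 also have "2 * \<dots> = (d + 1) * (d + 2)" by (induction d) auto
 finally show ?thesis .
qed

lemma triple_sum_zero:
 fixes a :: "nat => nat => complex"
 assumes "\<And>x y. (\<Sum>i\<le>d. \<Sum>j\<le>d - i. a i j * x ^ i * y ^ j) = 0" "i \<le> d" "j \<le> d - i"
 shows "a i j = 0"
proof -
 have "(\<Sum>j\<le>d - i. a i j * y ^ j) = 0" for y
 proof (rule poly_coeff_unique[where n = d and a = "\<lambda>i. \<Sum>j\<le>d - i. a i j * y ^ j" and b = "\<lambda>_. 0", OF _ assms(2)])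
  fix t :: complex
  show "(\<Sum>i\<le>d. t ^ i * (\<Sum>j\<le>d - i. a i j * y ^ j)) = (\<Sum>i\<le>d. t ^ i * 0)"
   using assms(1)[of t y] by (simp add: sum_distrib_left mult_ac)
 qed
 then have "(\<Sum>j\<le>d - i. y ^ j * a i j) = (\<Sum>j\<le>d - i. y ^ j * 0)" for y by (simp add: mult_ac)
 then show ?thesis by (rule poly_coeff_unique[OF _ assms(3)])
qed

lemma pforms_span: "pforms (int d) = fs.span (pmono d ` (SIGMA i:{..d}. {..d - i}))"
proof (intro equalityI subsetI)
 fix f assume "f \<in> pforms (int d)"
 then obtain p where p: "form d p" "f = (\<lambda>P. p (coords P))" by (auto simp: mem_pforms pform_def)
 then obtain a where a: "\<And>v. p v = (\<Sum>i\<le>d. \<Sum>j\<le>d - i. a i j * (v $ 1) ^ i * (v $ 2) ^ j * (v $ 3) ^ (d - i - j))"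
  unfolding form_def by blast
 have "f = (\<Sum>ij\<in>(SIGMA i:{..d}. {..d - i}). cscale (a (fst ij) (snd ij)) (pmono d ij))"
  unfolding p(2) a by (simp add: fun_eq_iff sum_fun_apply cscale_apply pmono_def sum.Sigma case_prod_unfold mult.assoc)
 also have "\<dots> \<in> fs.span (pmono d ` (SIGMA i:{..d}. {..d - i}))"
  by (intro fs.span_sum fs.span_scale fs.span_base) auto
 finally show "f \<in> fs.span (pmono d ` (SIGMA i:{..d}. {..d - i}))" .
next
 fix f assume "f \<in> fs.span (pmono d ` (SIGMA i:{..d}. {..d - i}))"
 moreover have "pmono d ij \<in> pforms (int d)" if mem: "ij \<in> (SIGMA i:{..d}. {..d - i})" for ij
 proof -
  obtain i j where ij: "ij = (i, j)" "i \<le> d" "j \<le> d - i" using mem by auto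
  let ?x = "\<lambda>k v. (v :: complex ^ 3) $ k"
  have pow: "form n (?x k ^ n)" for n k
  proof (induction n)
   case 0
   show ?case using form_kk[of 1] by (simp add: kk_simps)
  next
   case (Suc n)
   show ?case using form_mult[OF form_coord Suc] by simp
  qed
  have "form (i + (j + (d - i - j))) (?x 1 ^ i * (?x 2 ^ j * ?x 3 ^ (d - i - j)))"
   by (rule form_mult[OF pow form_mult[OF pow pow]])
  moreover have "i + (j + (d - i - j)) = d" using ij(2,3) by simp
  ultimately have "form d (?x 1 ^ i * (?x 2 ^ j * ?x 3 ^ (d - i - j)))" by metis
  from pform_of_form[OF this]
  have "pform (int d) (\<lambda>P. (?x 1 ^ i * (?x 2 ^ j * ?x 3 ^ (d - i - j))) (coords P))" .
  moreover have "(?x k ^ n) v = (v $ k) ^ n" for n k and v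
   by (induction n) (auto simp: fun_ops)
  ultimately show ?thesis by (simp add: mem_pforms pmono_def[abs_def] fun_ops ij(1) mult.assoc)
 qed
 ultimately show "f \<in> pforms (int d)"
  using fs.span_minimal[OF _ subspace_pforms, of "pmono d ` (SIGMA i:{..d}. {..d - i})" "int d"] by blast
qed

lemma fd_pforms: "fd (pforms k)"
proof (cases "k < 0")
 case True
 then have "pforms k \<subseteq> fs.span {}" by (auto simp: mem_pforms pform_def)
 then show ?thesis unfolding fd_def by blast
next
 case False
 then have "pforms k = pforms (int (nat k))" by simp
 then show ?thesis unfolding pforms_span fd_def
  by (metis finite_SigmaI finite_atMost finite_imageI order_refl)
qed

text \<open>Stated for twice the dimension to stay within the integers. As (k + 1) (k + 2) also
  vanishes at -1 and -2, the polynomial is valid from -2 on.\<close>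

lemma dim_pforms: "2 * int (fs.dim (pforms k)) = (if k < 0 then 0 else (k + 1) * (k + 2))"
proof (cases "k < 0")
 case True
 then have "pforms k = {0}" by (auto simp: mem_pforms pform_def)
 then show ?thesis using True dim_0_fd[OF subspace_pforms fd_pforms, of k] by simp
next
 case False
 define d where "d = nat k"
 have k: "k = int d" using False by (simp add: d_def)
 let ?I = "SIGMA i:{..d}. {..d - i}"
 have "fs.dim (fs.span (pmono d ` ?I)) = card ?I"
 proof (rule dim_span_family)
  fix a assume 0: "(\<Sum>i\<in>?I. cscale (a i) (pmono d i)) = 0"
  let ?p = "\<lambda>v :: complex ^ 3. \<Sum>i\<le>d. \<Sum>j\<le>d - i. a (i, j) * (v $ 1) ^ i * (v $ 2) ^ j * (v $ 3) ^ (d - i - j)"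
  have "?p (coords P) = 0" for P
   using fun_cong[OF 0, of P] by (simp add: sum_fun_apply cscale_apply pmono_def sum.Sigma case_prod_unfold mult.assoc fun_ops)
  then have p0: "?p = 0" by (intro form_ext_coords[of d]) (auto simp: form_def intro!: exI[of _ "\<lambda>i j. a (i, j)"])
  have xy: "(\<Sum>i\<le>d. \<Sum>j\<le>d - i. a (i, j) * x ^ i * y ^ j) = 0" for x y
   using fun_cong[OF p0, of "vector [x, y, 1]"] by (simp add: fun_ops vector_3)
  show "\<forall>i\<in>?I. a i = 0"
   using triple_sum_zero[where d = d and a = "\<lambda>i j. a (i, j)", OF xy] by auto
 qed simp
 moreover have "2 * int (card ?I) = (int d + 1) * (int d + 2)"
  using arg_cong[OF card_triangle[of d], of int] by (simp del: card_SigmaI add: algebra_simps)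
 ultimately show ?thesis using False unfolding k pforms_span by simp
qed

section \<open>Zeros of forms\<close>

lemma separating_form:
 assumes "finite Z" "P \<notin> Z"
 shows "\<exists>f. pform (int (card Z)) f \<and> f P \<noteq> 0 \<and> (\<forall>R\<in>Z. f R = 0)"
 using assms
proof (induction Z rule: finite_induct)
 case empty
 have "(1 :: P2 => complex) P \<noteq> 0" by (simp add: fun_ops)
 with pform_one show ?case by auto
next
 case (insert R Z)
 then obtain f where f: "pform (int (card Z)) f" "f P \<noteq> 0" "\<forall>R\<in>Z. f R = 0" by auto
 obtain a where a: "lin a R = 0" "lin a P \<noteq> 0" using lin_separates[of P R] insert by auto
 have "pform (int (card (insert R Z))) (lin a * f)"
  using pform_mult[OF pform_lin f(1), of a] insert by (simp add: add.commute)
 moreover have "(lin a * f) P \<noteq> 0" "\<forall>S\<in>insert R Z. (lin a * f) S = 0" using f a by (auto simp: fun_ops)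
 ultimately show ?case by blast
qed

lemma nonvanishing_form: "\<exists>f. pform (int n) f \<and> f P \<noteq> 0"
proof -
 obtain a where "lin a P \<noteq> 0" using lin_nonvanishing by blast
 then have "(lin a ^ n) P \<noteq> 0" by (induction n) (auto simp: fun_ops)
 then show ?thesis using pform_power[OF pform_lin, of n a] by auto
qed

text \<open>For each point of Z there is a form of degree k that is nonzero there and zero at the
  other points: card Z - 1 lines and a factor that fills up the degree. These forms are independent
  modulo W.\<close>

lemma points_impose_conditions:
 assumes Z: "finite Z" "int (card Z) \<le> k" and W: "fs.subspace W" "W \<subseteq> pforms k" "\<And>f P. f \<in> W ==> P \<in> Z ==> f P = 0"
 shows "fs.dim W + card Z \<le> fs.dim (pforms k)"
proof -
 have "\<forall>P\<in>Z. \<exists>f. pform k f \<and> f P \<noteq> 0 \<and> (\<forall>R\<in>Z - {P}. f R = 0)"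
 proof
  fix P assume "P \<in> Z"
  obtain f where f: "pform (int (card (Z - {P}))) f" "f P \<noteq> 0" "\<forall>R\<in>Z - {P}. f R = 0"
   using separating_form[of "Z - {P}" P] Z(1) by auto
  define n where "n = nat (k - int (card (Z - {P})))"
  obtain g where g: "pform (int n) g" "g P \<noteq> 0" using nonvanishing_form by blast
  have "card (Z - {P}) \<le> card Z" using Z(1) by (simp add: card_mono)
  then have "int (card (Z - {P})) + int n = k" using Z(2) by (simp add: n_def)
  then have "pform k (f * g)" using pform_mult[OF f(1) g(1)] by simp
  then have "pform k (f * g)" using pform_mult[OF f(1) g(1)] by simp
  moreover have "(f * g) P \<noteq> 0" "\<forall>R\<in>Z - {P}. (f * g) R = 0" using f g by (auto simp: fun_ops)
  ultimately show "\<exists>f. pform k f \<and> f P \<noteq> 0 \<and> (\<forall>R\<in>Z - {P}. f R = 0)" by blast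
 qed
 then obtain f where f: "\<forall>P\<in>Z. pform k (f P) \<and> f P P \<noteq> 0 \<and> (\<forall>R\<in>Z - {P}. f P R = 0)"
  by (rule bchoice[THEN exE])
 show ?thesis
 proof (rule independent_mod[OF subspace_pforms fd_pforms W(1,2) Z(1), of f])
  show "f P \<in> pforms k" if "P \<in> Z" for P using f that by (simp add: mem_pforms)
  fix a assume a: "(\<Sum>P\<in>Z. cscale (a P) (f P)) \<in> W"
  show "\<forall>P\<in>Z. a P = 0"
  proof
   fix R assume R: "R \<in> Z"
   have "0 = (\<Sum>P\<in>Z. cscale (a P) (f P)) R" using W(3)[OF a R] by simp
   also have "\<dots> = (\<Sum>P\<in>Z. if P = R then a R * f R R else 0)"
    unfolding sum_fun_apply cscale_apply using f R by (intro sum.cong) auto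
   finally show "a R = 0" using R f Z(1) by simp
  qed
 qed
qed

lemma subspace_mult_pforms: "fs.subspace ((\<lambda>u. f * u) ` pforms k)"
 by (rule subspace_image[OF lin_map_mult subspace_pforms])

lemma dim_mult_pforms:
 assumes "pform e f" "f \<noteq> 0"
 shows "fs.dim ((\<lambda>u. f * u) ` pforms k) = fs.dim (pforms k)"
 by (rule dim_inj_image[OF lin_map_mult subspace_pforms fd_pforms])
   (use pform_domain[OF assms(1)] assms(2) in \<open>auto simp: mem_pforms\<close>)

text \<open>A weak form of Bezout: there are at most e j common zeros. In degree n the multiples of
  f and of b meet in the multiples of f b, because f is prime and does not divide b, so their sum
  has codimension e j; and n is large enough for finitely many common zeros to impose independent
  conditions.\<close>

lemma prime_common_zeros_finite:
 assumes f: "pprime e f" and b: "pform j b" "\<not> pdvd e f j b"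
 shows "finite {P. f P = 0 \<and> b P = 0}"
proof -
 have f': "pform e f" "f \<noteq> 0" "e \<ge> 1" using f by (auto simp: pprime_def)
 have bnz: "b \<noteq> 0" using b(2) pdvd_0 by blast
 have j: "j \<ge> 0" using pform_neg[OF b(1)] bnz by force
 have bound: "int (card Z) \<le> e * j" if Z: "finite Z" "Z \<subseteq> {P. f P = 0 \<and> b P = 0}" for Z
 proof -
  \<comment> \<open>Large enough for the points of Z to impose independent conditions and for all
    four dimensions below to be given by the polynomial.\<close>
  define n where "n = int (card Z) + e + j"
  let ?V = "(\<lambda>u. f * u) ` pforms (n - e)" and ?U = "(\<lambda>u. b * u) ` pforms (n - j)"
  let ?W = "{v + w | v w. v \<in> ?V \<and> w \<in> ?U}"
  have fdV: "fd ?V" "fd ?U" by (rule rank_nullity(1)[OF lin_map_mult subspace_pforms fd_pforms])+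
  have VU: "?V \<inter> ?U \<subseteq> (\<lambda>u. f * b * u) ` pforms (n - e - j)"
  proof
   fix x assume "x \<in> ?V \<inter> ?U"
   then have "x \<in> ?V" "x \<in> ?U" by auto
   then obtain u v where uv: "pform (n - e) u" "x = f * u" "pform (n - j) v" "x = b * v"
    by (metis (no_types, lifting) image_iff mem_pforms)
   have "pdvd e f (j + (n - j)) (b * v)" unfolding pdvd_def using uv by (intro exI[of _ u]) simp
   then have "pdvd e f (n - j) v" using f b uv(3) unfolding pprime_def by blast
   then obtain w where "pform (n - j - e) w" "v = f * w" unfolding pdvd_def by blast
   then show "x \<in> (\<lambda>u. f * b * u) ` pforms (n - e - j)"
    using uv(4) by (intro image_eqI[of _ _ w]) (auto simp: mem_pforms mult_ac diff_diff_eq add.commute)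
  qed
  have "fs.dim (?V \<inter> ?U) \<le> fs.dim ((\<lambda>u. f * b * u) ` pforms (n - e - j))"
   by (rule dim_mono_fd[OF rank_nullity(1)[OF lin_map_mult subspace_pforms fd_pforms] VU])
  also have "\<dots> = fs.dim (pforms (n - e - j))"
   by (rule dim_mult_pforms[OF pform_mult[OF f'(1) b(1)]]) (use pform_domain[OF f'(1) b(1)] f'(2) bnz in auto)
  finally have int: "fs.dim (?V \<inter> ?U) \<le> fs.dim (pforms (n - e - j))" .
  have dW: "fs.dim ?W + fs.dim (?V \<inter> ?U) = fs.dim (pforms (n - e)) + fs.dim (pforms (n - j))"
   using dim_sums_Int_fd[OF subspace_mult_pforms fdV(1) subspace_mult_pforms fdV(2)]
   unfolding dim_mult_pforms[OF f'(1,2)] dim_mult_pforms[OF b(1) bnz] .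
  have "fs.dim ?W + card Z \<le> fs.dim (pforms n)"
  proof (rule points_impose_conditions[OF Z(1)])
   show "int (card Z) \<le> n" using j f'(3) by (simp add: n_def)
   show "fs.subspace ?W" by (rule subspace_sum[OF subspace_mult_pforms subspace_mult_pforms])
   show "?W \<subseteq> pforms n"
   proof
    fix x assume "x \<in> ?W"
    then obtain u v where uv: "u \<in> pforms (n - e)" "v \<in> pforms (n - j)" "x = f * u + b * v" by blast
    have "pform (e + (n - e)) (f * u)" "pform (j + (n - j)) (b * v)"
     using pform_mult[OF f'(1), of "n - e" u] pform_mult[OF b(1), of "n - j" v] uv(1,2) by (simp_all add: mem_pforms)
    then show "x \<in> pforms n" unfolding uv(3) mem_pforms by (intro pform_add) simp_all
   qed
   show "x P = 0" if "x \<in> ?W" "P \<in> Z" for x P using that Z(2) by (auto simp: fun_ops)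
  qed
  then have "int (card Z) + int (fs.dim (pforms (n - e))) + int (fs.dim (pforms (n - j)))
    \<le> int (fs.dim (pforms n)) + int (fs.dim (pforms (n - e - j)))"
   using dW int by linarith
  then have "2 * int (card Z) + (n - e + 1) * (n - e + 2) + (n - j + 1) * (n - j + 2)
    \<le> (n + 1) * (n + 2) + (n - e - j + 1) * (n - e - j + 2)"
   using dim_pforms[of n] dim_pforms[of "n - e"] dim_pforms[of "n - j"] dim_pforms[of "n - e - j"] j f'(3)
   by (simp add: n_def)
  \<comment> \<open>The mixed second difference of (n + 1) (n + 2) with steps e and j is 2 e
    j.\<close>
  then show ?thesis by (simp add: algebra_simps)
 qed
 show ?thesis
 proof (rule ccontr)
  assume "infinite {P. f P = 0 \<and> b P = 0}"
  then obtain Z where "Z \<subseteq> {P. f P = 0 \<and> b P = 0}" "finite Z" "card Z = nat (e * j) + 1"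
   using infinite_arbitrarily_large by blast
  moreover have "e * j \<ge> 0" using j f'(3) by simp
  ultimately show False using bound[of Z] by simp
 qed
qed

lemma form_on_line:
 assumes "polyfun p"
 obtains q where "\<And>t. p (t *s a + b) = poly q t"
proof -
 obtain N c where p: "\<And>v. p v = (\<Sum>(i, j, k)\<in>{..N} \<times> {..N} \<times> {..N}. c i j k * (v $ 1) ^ i * (v $ 2) ^ j * (v $ 3) ^ k)"
  using polyfun_expansion[OF assms] by blast
 let ?l = "\<lambda>i. [:b $ i, a $ i:]"
 show ?thesis
  by (rule that[of "\<Sum>(i, j, k)\<in>{..N} \<times> {..N} \<times> {..N}. [:c i j k:] * ?l 1 ^ i * ?l 2 ^ j * ?l 3 ^ k"])
    (simp add: p poly_sum case_prod_unfold add.commute mult.assoc)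
qed

lemma basis_extension:
 fixes a :: "complex ^ 3"
 assumes "a \<noteq> 0"
 shows "\<exists>b c. \<forall>x y z. x *s a + y *s b + z *s c = 0 --> x = 0 \<and> y = 0 \<and> z = 0"
proof -
 have comps: "x * a $ i + y * (if i = j then 1 else 0) + z * (if i = k then 1 else 0) = 0"
  if eq: "x *s a + y *s axis j 1 + z *s axis k 1 = 0" for x y z i j k
  using arg_cong[OF eq, of "\<lambda>v. v $ i"] by (simp add: axis_def)
 obtain i where i: "a $ i \<noteq> 0" using assms by (auto simp: Finite_Cartesian_Product.vec_eq_iff)
 obtain j k where jk: "j \<noteq> i" "k \<noteq> i" "j \<noteq> k" using exhaust_3[of i] three_distinct by metis
 have "x = 0 \<and> y = 0 \<and> z = 0" if eq: "x *s a + y *s axis j 1 + z *s axis k 1 = 0" for x y z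
  using comps[OF eq, of i] comps[OF eq, of j] comps[OF eq, of k] i jk by auto
 then show ?thesis by blast
qed

text \<open>Projection from a point a off the curve: each line through a meets the curve by the
  fundamental theorem of algebra, and the lines joining a to the points b + s c are pairwise
  different. For f = 0 any a serves.\<close>

lemma zeros_infinite:
 assumes "pform e f" "e \<ge> 1"
 shows "infinite {P. f P = 0}"
proof -
 have inf: "infinite (UNIV :: complex set)" by (rule infinite_UNIV_char_0)
 obtain p where p: "form (nat e) p" "f = (\<lambda>P. p (coords P))" using assms by (auto simp: pform_def)
 have e: "nat e \<ge> 1" using assms(2) by simp
 have zero: "f (abs_P2 v) = 0" if v: "v \<noteq> 0" "p v = 0" for v
 proof -
  obtain c where "c \<noteq> 0" "coords (abs_P2 v) = c *s v" using coords_abs[OF v(1)] by blast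
  then show ?thesis using p(2) form_homogeneous[OF p(1)] v(2) by simp
 qed
 obtain a where a: "a \<noteq> 0" "p a \<noteq> 0 \<or> p = 0"
 proof (cases "p = 0")
  case True
  then show ?thesis using that[of "axis 1 1"] by (simp add: axis_eq_0_iff)
 next
  case False
  then obtain a where a: "p a \<noteq> 0" by (auto simp: fun_eq_iff fun_ops)
  moreover have "p 0 = 0" using form_homogeneous[OF p(1), of 0 a] e by (cases "nat e") auto
  ultimately show ?thesis using that by metis
 qed
 from basis_extension[OF a(1)] obtain b where
  "\<exists>c. \<forall>x y z. x *s a + y *s b + z *s c = 0 --> x = 0 \<and> y = 0 \<and> z = 0" ..
 then obtain c where bc': "\<forall>x y z. x *s a + y *s b + z *s c = 0 --> x = 0 \<and> y = 0 \<and> z = 0" ..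
 note bc = bc'[rule_format]
 have ex: "\<exists>t. p (t *s a + (b + s *s c)) = 0" for s
 proof (rule ccontr)
  assume neg: "\<not> ?thesis"
  then have pa: "p a \<noteq> 0" using a(2) by (auto simp: fun_ops)
  obtain q where q: "\<And>t. p (t *s a + (b + s *s c)) = poly q t"
   by (rule form_on_line[OF form_polyfun[OF p(1)], of a "b + s *s c"]) (rule that)
  have "\<not> (\<exists>z. poly q z = 0)" using neg q by simp
  then have "constant (poly q)" using fundamental_theorem_of_algebra by blast
  then have q0: "p (t *s a + (b + s *s c)) = poly q 0" for t unfolding q constant_def by blast
  \<comment> \<open>The same line parametrised with a at t = 0. Were p constant along the first
    parametrisation, it would be that constant times t^e here by homogeneity, and p would vanish at
    a since e is positive.\<close>
  obtain q2 where q2: "\<And>t. p (t *s (b + s *s c) + a) = poly q2 t"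
   by (rule form_on_line[OF form_polyfun[OF p(1)], of "b + s *s c" a]) (rule that)
  have root: "poly (q2 - monom (poly q 0) (nat e)) t = 0" if t: "t \<in> - {0}" for t
  proof -
   have "t *s (b + s *s c) + a = t *s (inverse t *s a + (b + s *s c))"
    using t by (simp add: Finite_Cartesian_Product.vec_eq_iff algebra_simps)
   then have "poly q2 t = t ^ nat e * p (inverse t *s a + (b + s *s c))"
    unfolding q2[symmetric] using form_homogeneous[OF p(1)] by metis
   then show ?thesis unfolding q0 by (simp add: poly_monom)
  qed
  have "infinite (- {0 :: complex})" using inf by (simp add: Compl_eq_Diff_UNIV)
  then have "q2 - monom (poly q 0) (nat e) = 0" by (rule poly_zero_on_infinite) (rule root)
  then have "poly q2 0 = poly q 0 * 0 ^ nat e" by (simp add: poly_monom)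
  then have "poly q2 0 = 0" using e by (cases "nat e") auto
  then show False using q2[of 0] pa by simp
 qed
 then have "\<forall>s. \<exists>t. p (t *s a + (b + s *s c)) = 0" ..
 then obtain t where t': "\<forall>s. p (t s *s a + (b + s *s c)) = 0" by (rule choice[THEN exE])
 note t = t'[rule_format]
 let ?v = "\<lambda>s. t s *s a + (b + s *s c)"
 have nz: "?v s \<noteq> 0" for s
  using bc[of "t s" 1 s] by (auto simp: add.assoc)
 have "inj (\<lambda>s. abs_P2 (?v s))"
 proof (rule injI)
  fix r s assume rs: "abs_P2 (?v r) = abs_P2 (?v s)"
  obtain x where x: "x \<noteq> 0" "coords (abs_P2 (?v r)) = x *s ?v r" using coords_abs[OF nz[of r]] by blast
  obtain y where y: "y \<noteq> 0" "coords (abs_P2 (?v s)) = y *s ?v s" using coords_abs[OF nz[of s]] by blast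
  have eq: "x *s ?v r = y *s ?v s" using x y rs by simp
  have "(x * t r - y * t s) *s a + (x - y) *s b + (x * r - y * s) *s c = x *s ?v r - y *s ?v s"
   by (simp add: Finite_Cartesian_Product.vec_eq_iff algebra_simps)
  then have "(x * t r - y * t s) *s a + (x - y) *s b + (x * r - y * s) *s c = 0"
   unfolding eq by simp
  from bc[OF this] have "x - y = 0" "x * r - y * s = 0" by blast+
  then show "r = s" using x(1) by simp
 qed
 then have "infinite (range (\<lambda>s. abs_P2 (?v s)))" using inf by (simp add: finite_image_iff)
 moreover have "range (\<lambda>s. abs_P2 (?v s)) \<subseteq> {P. f P = 0}" using zero[OF nz t] by auto
 ultimately show ?thesis using infinite_super by blast
qed

section \<open>Lowest terms\<close>

lemma kk_inverse: "c \<noteq> 0 ==> kk c * kk (inverse c) = 1" "c \<noteq> 0 ==> kk (inverse c) * kk c = 1"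
 by (simp_all add: kk_simps(3)[symmetric]) (simp_all add: kk_simps)

text \<open>Induction over a prime factorisation without naming it: strip one prime factor at a
  time, down to a nonzero constant.\<close>

lemma pform_prime_induct [consumes 2, case_names const prime]:
 assumes "pform d f" "f \<noteq> 0"
  and const: "\<And>c. c \<noteq> 0 ==> Q 0 (kk c)"
  and prime: "\<And>e g k h. pprime e g ==> pform k h ==> h \<noteq> 0 ==> Q k h ==> Q (e + k) (g * h)"
 shows "Q d f"
proof -
 have "d \<ge> 0" using assms(1,2) pform_neg by force
 with assms(1,2) show ?thesis
 proof (induction "nat d" arbitrary: d f rule: less_induct)
  case less
  show ?case
  proof (cases "d = 0")
   case True
   then have "pform 0 f" using less.prems(1) by simp
   from pform_const[OF this] obtain c where "f = kk c" ..
   moreover from this have "c \<noteq> 0" using less.prems(2) kk_simps(4) by metis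
   ultimately show ?thesis using True const[of c] by simp
  next
   case False
   then have "d \<ge> 1" using less.prems(3) by simp
   from pprime_divisor[OF less.prems(1,2) this] obtain e g c
    where g: "pprime e g" "pform (d - e) c" "f = g * c" .
   then have c: "c \<noteq> 0" using less.prems(2) by auto
   then have "d - e \<ge> 0" using pform_neg[OF g(2)] by force
   moreover have "e \<ge> 1" using g(1) by (simp add: pprime_def)
   ultimately have "Q (d - e) c" using less.hyps[OF _ g(2) c] by simp
   from prime[OF g(1,2) c this] g(3) show ?thesis by simp
  qed
 qed
qed

text \<open>Euclid's lemma with q in place of a prime. In a q = p b each prime factor g of q divides
  p b but not p, hence b; cancel g and continue. The equation of degrees keeps both sides in one
  degree, as cancellation requires.\<close>

lemma no_common_prime_coprime:
 assumes "pform j q" "q \<noteq> 0" "pform i p"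
  and "\<And>e g. pprime e g ==> pdvd e g j q ==> \<not> pdvd e g i p"
  and "pform l b" "pform k a" "k + j = i + l" "a * q = p * b"
 shows "pdvd j q l b"
 using assms(1,2,4-)
proof (induction arbitrary: b a k l rule: pform_prime_induct)
 case (const c)
 then have "b = kk c * (kk (inverse c) * b)" by (simp add: mult.assoc[symmetric] kk_inverse)
 then show ?case unfolding pdvd_def using pform_kk_mult[OF const(3), of "inverse c"] by auto
next
 case (prime e g m h)
 have g: "pform e g" "g \<noteq> 0" using prime(1) by (auto simp: pprime_def)
 have "pform m h" by (rule prime(2))
 have "pdvd e g (e + m) (g * h)" unfolding pdvd_def using prime(2) by auto
 then have np: "\<not> pdvd e g i p" using prime(5)[OF prime(1)] by blast
 have "pform (i + l - e) (a * h)"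
 proof -
  have "i + l - e = k + m" using prime(8) by simp
  then show ?thesis using pform_mult[OF prime(7,2)] by simp
 qed
 moreover have "p * b = g * (a * h)" using prime(9) by (simp add: mult_ac)
 ultimately have "pdvd e g (i + l) (p * b)" unfolding pdvd_def by blast
 then have "pdvd e g l b" using prime(1) assms(3) prime(6) np unfolding pprime_def by blast
 then obtain b' where b': "pform (l - e) b'" "b = g * b'" unfolding pdvd_def by blast
 have "g * (a * h) = g * (p * b')" using prime(9) b'(2) by (simp add: mult_ac)
 moreover have "pform (k + m) (a * h)" by (rule pform_mult[OF prime(7,2)])
 moreover have "pform (k + m) (p * b')" 
 proof -
  have "i + (l - e) = k + m" using prime(8) by simp
  then show ?thesis using pform_mult[OF assms(3) b'(1)] by simp
 qed
 ultimately have eq: "a * h = p * b'" using pform_cancel[OF g] by blast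
 have "pdvd m h (l - e) b'"
 proof (rule prime(4)[OF _ b'(1) prime(7) _ eq])
  fix e' g' assume g': "pprime e' g'" "pdvd e' g' m h"
  then obtain x where x: "pform (m - e') x" "h = g' * x" unfolding pdvd_def by blast
  have "pdvd e' g' (e + m) (g * h)" unfolding pdvd_def
   using pform_mult[OF g(1) x(1)] x(2) by (intro exI[of _ "g * x"]) (simp add: algebra_simps)
  then show "\<not> pdvd e' g' i p" using prime(5)[OF g'(1)] by blast
 qed (use prime(8) in simp)
 then obtain x where "pform (l - e - m) x" "b' = h * x" unfolding pdvd_def by blast
 then show ?case unfolding pdvd_def using b'(2) by (intro exI[of _ x]) (simp add: algebra_simps)
qed

text \<open>Common primes are cancelled until none is left; the degree of q bounds their number.
  Coprimality is delivered in the form in which it is used: whenever a / b is the same fraction as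
  p' / q', the denominator b is divisible by q'.\<close>

lemma lowest_terms:
 assumes "pform j q" "q \<noteq> 0" "pform i p"
 obtains m h q' p' where "pform m h" "h \<noteq> 0" "pform (j - m) q'" "q' \<noteq> 0" "pform (i - m) p'" "q = h * q'" "p = h * p'"
  "\<And>l b k a. pform l b ==> pform k a ==> k + (j - m) = (i - m) + l ==> a * q' = p' * b ==> pdvd (j - m) q' l b"
proof -
 have "\<exists>m h q' p'. pform m h \<and> h \<noteq> 0 \<and> pform (j - m) q' \<and> q' \<noteq> 0 \<and> pform (i - m) p' \<and> q = h * q' \<and> p = h * p' \<and>
  (\<forall>e g. pprime e g --> pdvd e g (j - m) q' --> \<not> pdvd e g (i - m) p')"
  using assms
 proof (induction "nat j" arbitrary: i j p q rule: less_induct)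
  case less
  show ?case
  proof (cases "\<exists>e g. pprime e g \<and> pdvd e g j q \<and> pdvd e g i p")
   case False
   then show ?thesis using less.prems
    by (intro exI[of _ 0] exI[of _ 1] exI[of _ q] exI[of _ p]) (simp add: pform_one)
  next
   case True
   then obtain e g where g: "pprime e g" "pdvd e g j q" "pdvd e g i p" by blast
   then obtain q1 p1 where q1: "pform (j - e) q1" "q = g * q1" "pform (i - e) p1" "p = g * p1"
    unfolding pdvd_def by blast
   have g': "pform e g" "e \<ge> 1" "g \<noteq> 0" using g(1) by (auto simp: pprime_def)
   have nz: "q1 \<noteq> 0" using q1(2) less.prems(2) by auto
   then have "nat (j - e) < nat j" using g'(2) pform_neg[OF q1(1)] by force
   from less.hyps[OF this q1(1) nz q1(3)] obtain m h q' p' where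
    *: "pform m h" "h \<noteq> 0" "pform (j - e - m) q'" "q' \<noteq> 0" "pform (i - e - m) p'" "q1 = h * q'" "p1 = h * p'"
     "\<forall>e' g. pprime e' g --> pdvd e' g (j - e - m) q' --> \<not> pdvd e' g (i - e - m) p'" by blast
   have "g * h \<noteq> 0" using pform_domain[OF g'(1) *(1)] g'(3) *(2) by blast
   with * show ?thesis using pform_mult[OF g'(1) *(1)] q1
    by (intro exI[of _ "e + m"] exI[of _ "g * h"] exI[of _ q'] exI[of _ p']) (simp add: diff_diff_eq mult.assoc)
  qed
 qed
 then obtain m h q' p' where *: "pform m h" "h \<noteq> 0" "pform (j - m) q'" "q' \<noteq> 0" "pform (i - m) p'" "q = h * q'" "p = h * p'"
  "\<And>e g. pprime e g ==> pdvd e g (j - m) q' ==> \<not> pdvd e g (i - m) p'" by blast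
 show ?thesis
  by (rule that[OF *(1-7)], rule no_common_prime_coprime[OF *(3,4,5) *(8)]) auto
qed

text \<open>Each prime factor g of q divides F: otherwise g and F would have only finitely many
  common zeros, while F vanishes on the infinite zero set of g. One power of F per prime factor,
  counted with multiplicity, then suffices.\<close>

lemma hypersurface_nullstellensatz:
 assumes "pform j q" "q \<noteq> 0" and F: "pform d F" and "\<And>P. q P = 0 ==> F P = 0"
 shows "\<exists>N. pdvd j q (int N * d) (F ^ N)"
 using assms(1,2,4)
proof (induction rule: pform_prime_induct)
 case (const c)
 have "F ^ 0 = kk c * kk (inverse c)" using const(1) by (simp add: kk_inverse)
 moreover have "pform (int 0 * d - 0) (kk (inverse c))" using pform_kk by simp
 ultimately show ?case unfolding pdvd_def by blast
next
 case (prime e g k h)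
 obtain N where "pdvd k h (int N * d) (F ^ N)" using prime(4) prime(5) by (auto simp: fun_ops)
 then obtain x where x: "pform (int N * d - k) x" "F ^ N = h * x" unfolding pdvd_def by blast
 have g: "pform e g" "e \<ge> 1" using prime(1) by (auto simp: pprime_def)
 have "pdvd e g d F"
 proof (rule ccontr)
  assume "\<not> pdvd e g d F"
  then have "finite {P. g P = 0 \<and> F P = 0}" by (rule prime_common_zeros_finite[OF prime(1) F])
  moreover have "{P. g P = 0 \<and> F P = 0} = {P. g P = 0}" using prime(5) by (auto simp: fun_ops)
  ultimately show False using zeros_infinite[OF g] by simp
 qed
 then obtain y where y: "pform (d - e) y" "F = g * y" unfolding pdvd_def by blast
 have "F ^ Suc N = g * h * (y * x)" using x(2) y(2) by (simp add: mult_ac)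
 moreover have "pform (int (Suc N) * d - (e + k)) (y * x)"
  using pform_mult[OF y(1) x(1)] by (simp add: algebra_simps)
 ultimately show ?case unfolding pdvd_def by blast
qed

section \<open>Sections of twisted vector bundles\<close>

lemma mat_mult_entry:
 "A \<in> carrier_mat m n ==> B \<in> carrier_mat n p ==> i < m ==> j < p ==>
  (A * B) $$ (i, j) = (\<Sum>k<n. A $$ (i, k) * B $$ (k, j))"
 by (simp add: scalar_prod_def lessThan_atLeast0)

lemma invertible_matE:
 assumes "invertible_mat M" "M \<in> carrier_mat r r"
 obtains B where "B \<in> carrier_mat r r" "M * B = 1\<^sub>m r" "B * M = 1\<^sub>m r"
proof -
 obtain B where B: "M * B = 1\<^sub>m (dim_row M)" "B * M = 1\<^sub>m (dim_row B)"
  using assms(1) unfolding invertible_mat_def inverts_mat_def by blast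
 have "dim_col (M * B) = r" using B(1) assms(2) by simp
 then have "dim_col B = r" by simp
 moreover have "dim_col (B * M) = dim_row B" using B(2) by simp
 then have "dim_row B = r" using assms(2) by simp
 ultimately have "B \<in> carrier_mat r r" by auto
 with B assms(2) show ?thesis by (intro that) auto
qed

lemma invertible_mat_solve:
 assumes "invertible_mat M" "M \<in> carrier_mat r r"
 shows "\<exists>\<tau>. \<forall>i<r. (\<Sum>j<r. M $$ (i, j) * \<tau> j) = (y i :: complex)"
proof -
 obtain B where B: "B \<in> carrier_mat r r" "M * B = 1\<^sub>m r" by (rule invertible_matE[OF assms])
 have "(\<Sum>j<r. M $$ (i, j) * (\<Sum>k<r. B $$ (j, k) * y k)) = y i" if i: "i < r" for i
 proof -
  have "(\<Sum>j<r. M $$ (i, j) * (\<Sum>k<r. B $$ (j, k) * y k)) = (\<Sum>j<r. \<Sum>k<r. M $$ (i, j) * B $$ (j, k) * y k)"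
   by (simp add: sum_distrib_left mult.assoc)
  also have "\<dots> = (\<Sum>k<r. (\<Sum>j<r. M $$ (i, j) * B $$ (j, k)) * y k)"
   by (subst sum.swap) (simp add: sum_distrib_right)
  also have "\<dots> = (\<Sum>k<r. (M * B) $$ (i, k) * y k)"
   using i by (intro sum.cong) (auto simp: mat_mult_entry[OF assms(2) B(1)])
  also have "\<dots> = (\<Sum>k<r. if k = i then y k else 0)"
   unfolding B(2) using i by (intro sum.cong) auto
  finally show ?thesis using i by simp
 qed
 then show ?thesis by (intro exI[of _ "\<lambda>j. \<Sum>k<r. B $$ (j, k) * y k"]) blast
qed

lemma invertible_mat_kernel:
 assumes "invertible_mat M" "M \<in> carrier_mat r r" "\<forall>i<r. (\<Sum>j<r. M $$ (i, j) * \<tau> j) = (0 :: complex)" "j < r"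
 shows "\<tau> j = 0"
proof -
 obtain B where B: "B \<in> carrier_mat r r" "B * M = 1\<^sub>m r" by (rule invertible_matE[OF assms(1,2)])
 have "0 = (\<Sum>k<r. B $$ (j, k) * (\<Sum>l<r. M $$ (k, l) * \<tau> l))" using assms(3) by simp
 also have "\<dots> = (\<Sum>k<r. \<Sum>l<r. B $$ (j, k) * M $$ (k, l) * \<tau> l)"
  by (simp add: sum_distrib_left mult.assoc)
 also have "\<dots> = (\<Sum>l<r. (\<Sum>k<r. B $$ (j, k) * M $$ (k, l)) * \<tau> l)"
  by (subst sum.swap) (simp add: sum_distrib_right)
 also have "\<dots> = (\<Sum>l<r. (B * M) $$ (j, l) * \<tau> l)"
  using assms(4) by (intro sum.cong) (auto simp: mat_mult_entry[OF B(1) assms(2)])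
 also have "\<dots> = (\<Sum>l<r. if l = j then \<tau> l else 0)"
  unfolding B(2) using assms(4) by (intro sum.cong) auto
 finally show ?thesis using assms(4) by simp
qed

text \<open>The chart coordinates of a section. Regularity is a property of these functions; the
  numbers \<open>\<sigma> (P, j)\<close> depend on the arbitrary identification of the fibres and
  need not vary regularly.\<close>

definition app :: "(P2 => complex mat) => nat => (P2 \<times> nat => complex) => nat => P2 => complex" where
 "app \<phi> r \<sigma> i P = (\<Sum>j<r. \<phi> P $$ (i, j) * \<sigma> (P, j))"

lemma app_trans:
 assumes "\<psi> P = G P * \<phi> P" "G P \<in> carrier_mat m n" "\<phi> P \<in> carrier_mat n r" "i < m"
 shows "app \<psi> r \<sigma> i P = (\<Sum>k<n. G P $$ (i, k) * app \<phi> r \<sigma> k P)"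
proof -
 have "app \<psi> r \<sigma> i P = (\<Sum>j<r. (\<Sum>k<n. G P $$ (i, k) * \<phi> P $$ (k, j)) * \<sigma> (P, j))"
  unfolding app_def assms(1) using assms(4) by (intro sum.cong) (auto simp: mat_mult_entry[OF assms(2,3)])
 also have "\<dots> = (\<Sum>j<r. \<Sum>k<n. G P $$ (i, k) * (\<phi> P $$ (k, j) * \<sigma> (P, j)))"
  by (simp add: sum_distrib_right mult.assoc)
 also have "\<dots> = (\<Sum>k<n. G P $$ (i, k) * app \<phi> r \<sigma> k P)"
  unfolding app_def by (subst sum.swap) (simp add: sum_distrib_left)
 finally show ?thesis .
qed

definition lift :: "(P2 => complex) => P2 \<times> nat => complex" where
 "lift f = (\<lambda>(P, i). f P)"

lemma lift_simps: "lift f (P, i) = f P" "lift (f + g) = lift f + lift g" "lift (f * g) = lift f * lift g"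
  "lift (kk c) = kk c" "lift 0 = 0" "lift 1 = 1"
 by (auto simp: lift_def fun_eq_iff fun_ops kk_apply)

lemma app_add: "app \<phi> r (\<sigma> + \<tau>) i = app \<phi> r \<sigma> i + app \<phi> r \<tau> i"
 by (simp add: fun_eq_iff app_def fun_ops algebra_simps sum.distrib)

lemma app_mult: "app \<phi> r (lift f * \<sigma>) i = f * app \<phi> r \<sigma> i"
 by (simp add: fun_eq_iff app_def fun_ops lift_simps sum_distrib_left mult_ac)

lemma app_0: "app \<phi> r 0 i = (\<lambda>_. 0)"
 by (simp add: fun_eq_iff app_def fun_ops)

lemma app_cong: "(\<And>j. j < r ==> \<sigma> (P, j) = \<tau> (P, j)) ==> app \<phi> r \<sigma> i P = app \<phi> r \<tau> i P"
 unfolding app_def by (rule sum.cong) auto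

text \<open>The homogeneous coordinate ring of X, with \<open>H k\<close> its part of degree k. It
  has two instances: forms on the plane, and on a conic the binary forms in its parameters, where
  one degree of the plane counts twice. \<open>H_dom\<close> expresses that X is
  irreducible.\<close>

locale coord_ring =
 fixes X :: "P2 set" and H :: "int => (P2 => complex) => bool"
 assumes H_0: "H k 0" and H_add: "H k f ==> H k g ==> H k (f + g)"
  and H_mult: "H k f ==> H l g ==> H (k + l) (f * g)" and H_kk: "H 0 (kk c)"
  and H_neg: "H k f ==> k < 0 ==> P \<in> X ==> f P = 0"
  and H_nonvan: "P \<in> X ==> \<exists>f. H 1 f \<and> f P \<noteq> 0"
  and H_dom: "H k f ==> H l g ==> P \<in> X ==> f P \<noteq> 0 ==> Q \<in> X ==> g Q \<noteq> 0 ==> \<exists>R\<in>X. f R \<noteq> 0 \<and> g R \<noteq> 0"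
begin

text \<open>On A, near R, the function g is a fraction of degree k. The point R need not belong to
  A: with A dense, the definition then says that g extends to R as such a fraction.\<close>

definition lreg :: "int => P2 set => (P2 => complex) => P2 => bool" where
 "lreg k A g R \<longleftrightarrow> (\<exists>d p q. H (d + k) p \<and> H d q \<and> q R \<noteq> 0 \<and> (\<forall>Q\<in>A. q Q \<noteq> 0 --> g Q = p Q / q Q))"

definition zopen :: "P2 set => bool" where
 "zopen U \<longleftrightarrow> U \<subseteq> X \<and> (\<forall>R\<in>U. \<exists>d h. H d h \<and> h R \<noteq> 0 \<and> (\<forall>Q\<in>X. h Q \<noteq> 0 --> Q \<in> U))"

lemma H_one: "H 0 1"
 using H_kk[of 1] by (simp add: kk_simps)

lemma H_kk_mult: "H k f ==> H k (kk c * f)"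
 using H_mult[OF H_kk] by simp

lemma H_power: "H k f ==> H (int n * k) (f ^ n)"
proof (induction n)
 case (Suc n)
 then show ?case using H_mult[of k f "int n * k" "f ^ n"] by (simp add: algebra_simps)
qed (simp add: H_one)

lemma H_nonvan_nat: "P \<in> X ==> \<exists>f. H (int n) f \<and> f P \<noteq> 0"
proof -
 assume "P \<in> X"
 then obtain f where f: "H 1 f" "f P \<noteq> 0" using H_nonvan by blast
 have "(f ^ n) P \<noteq> 0" using f(2) by (induction n) (auto simp: fun_ops)
 then show ?thesis using H_power[OF f(1), of n] by auto
qed

lemma lreg_H: "H k f ==> lreg k A f R"
 unfolding lreg_def by (rule exI[of _ 0], rule exI[of _ f], rule exI[of _ 1]) (simp add: H_one fun_ops)

lemma lreg_frac: "H (d + k) p ==> H d q ==> q R \<noteq> 0 ==> lreg k A (\<lambda>Q. p Q / q Q) R"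
 unfolding lreg_def by blast

lemma lreg_mono: "lreg k A g R ==> B \<subseteq> A ==> lreg k B g R"
 unfolding lreg_def by blast

lemma lreg_cong: "lreg k A g R ==> (\<And>Q. Q \<in> A ==> g Q = g' Q) ==> lreg k A g' R"
 unfolding lreg_def by metis

text \<open>Multiplying numerator and denominator by h removes the zeros of h from the region where
  the fraction has to represent the function.\<close>

lemma lreg_local:
 assumes "lreg k A g R" "H e h" "h R \<noteq> 0" "\<And>Q. Q \<in> B ==> h Q \<noteq> 0 ==> Q \<in> A \<and> g Q = g' Q"
 shows "lreg k B g' R"
proof -
 obtain d p q where *: "H (d + k) p" "H d q" "q R \<noteq> 0" "\<forall>Q\<in>A. q Q \<noteq> 0 --> g Q = p Q / q Q"
  using assms(1) unfolding lreg_def by blast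
 have "H (d + e + k) (p * h)" using H_mult[OF *(1) assms(2)] by (simp add: ac_simps)
 moreover have "H (d + e) (q * h)" by (rule H_mult[OF *(2) assms(2)])
 moreover have "(q * h) R \<noteq> 0" using *(3) assms(3) by (simp add: fun_ops)
 moreover have "\<forall>Q\<in>B. (q * h) Q \<noteq> 0 --> g' Q = (p * h) Q / (q * h) Q"
  using *(4) assms(4) by (auto simp: fun_ops)
 ultimately show ?thesis unfolding lreg_def by blast
qed

lemma lreg_near: "lreg k A g R ==> \<exists>d h. H d h \<and> h R \<noteq> 0 \<and> (\<forall>R'. h R' \<noteq> 0 --> lreg k A g R')"
 unfolding lreg_def by blast

lemma finite_near:
 assumes "finite J" "\<And>x. x \<in> J ==> \<exists>d h. H d h \<and> h R \<noteq> 0 \<and> (\<forall>S. h S \<noteq> 0 --> P x S)"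
 shows "\<exists>d h. H d h \<and> h R \<noteq> 0 \<and> (\<forall>S. h S \<noteq> 0 --> (\<forall>x\<in>J. P x S))"
 using assms
proof (induction J rule: finite_induct)
 case empty
 have "(1 :: P2 => complex) R \<noteq> 0" by (simp add: fun_ops)
 then show ?case using H_one by (intro exI[of _ 0] exI[of _ "1 :: P2 => complex"]) simp
next
 case (insert x J)
 then obtain d h where 1: "H d h" "h R \<noteq> 0" "\<forall>S. h S \<noteq> 0 --> (\<forall>x\<in>J. P x S)" by auto
 obtain d' h' where 2: "H d' h'" "h' R \<noteq> 0" "\<forall>S. h' S \<noteq> 0 --> P x S" using insert.prems by blast
 have "(h * h') R \<noteq> 0" "\<forall>S. (h * h') S \<noteq> 0 --> (\<forall>x\<in>insert x J. P x S)" using 1 2 by (auto simp: fun_ops)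
 with H_mult[OF 1(1) 2(1)] show ?case by blast
qed

lemma lreg_mult:
 assumes "lreg k A g R" "lreg l A g' R"
 shows "lreg (k + l) A (g * g') R"
proof -
 obtain d p q where 1: "H (d + k) p" "H d q" "q R \<noteq> 0" "\<forall>Q\<in>A. q Q \<noteq> 0 --> g Q = p Q / q Q"
  using assms(1) unfolding lreg_def by blast
 obtain d' p' q' where 2: "H (d' + l) p'" "H d' q'" "q' R \<noteq> 0" "\<forall>Q\<in>A. q' Q \<noteq> 0 --> g' Q = p' Q / q' Q"
  using assms(2) unfolding lreg_def by blast
 have "H (d + d' + (k + l)) (p * p')" using H_mult[OF 1(1) 2(1)] by (simp add: ac_simps)
 moreover have "H (d + d') (q * q')" by (rule H_mult[OF 1(2) 2(2)])
 moreover have "(q * q') R \<noteq> 0" "\<forall>Q\<in>A. (q * q') Q \<noteq> 0 --> (g * g') Q = (p * p') Q / (q * q') Q"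
  using 1 2 by (auto simp: fun_ops)
 ultimately show ?thesis unfolding lreg_def by blast
qed

lemma lreg_add:
 assumes "lreg k A g R" "lreg k A g' R"
 shows "lreg k A (g + g') R"
proof -
 obtain d p q where 1: "H (d + k) p" "H d q" "q R \<noteq> 0" "\<forall>Q\<in>A. q Q \<noteq> 0 --> g Q = p Q / q Q"
  using assms(1) unfolding lreg_def by blast
 obtain d' p' q' where 2: "H (d' + k) p'" "H d' q'" "q' R \<noteq> 0" "\<forall>Q\<in>A. q' Q \<noteq> 0 --> g' Q = p' Q / q' Q"
  using assms(2) unfolding lreg_def by blast
 have "H (d + d' + k) (p * q' + p' * q)"
  using H_add[of "d + d' + k" "p * q'" "p' * q"] H_mult[OF 1(1) 2(2)] H_mult[OF 2(1) 1(2)] by (simp add: ac_simps)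
 moreover have "H (d + d') (q * q')" by (rule H_mult[OF 1(2) 2(2)])
 moreover have "(q * q') R \<noteq> 0" "\<forall>Q\<in>A. (q * q') Q \<noteq> 0 --> (g + g') Q = (p * q' + p' * q) Q / (q * q') Q"
  using 1 2 by (auto simp: fun_ops field_simps)
 ultimately show ?thesis unfolding lreg_def by blast
qed

lemma lreg_0: "lreg k A (\<lambda>_. 0) R"
 using lreg_H[OF H_0, of k A R] by (rule lreg_cong) (simp add: fun_ops)

lemma lreg_sum:
 assumes "\<And>i. i \<in> I ==> lreg k A (g i) R"
 shows "lreg k A (\<lambda>Q. \<Sum>i\<in>I. g i Q) R"
 using assms
proof (induction I rule: infinite_finite_induct)
 case (insert i I)
 then have "lreg k A (g i + (\<lambda>Q. \<Sum>i\<in>I. g i Q)) R" by (intro lreg_add) auto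
 then show ?case by (rule lreg_cong) (use insert in \<open>simp add: fun_ops\<close>)
qed (auto simp: lreg_0)

lemma lreg_inverse:
 assumes "lreg k A g R" "R \<in> A" "g R \<noteq> 0"
 shows "lreg (- k) A (\<lambda>Q. inverse (g Q)) R"
proof -
 obtain d p q where 1: "H (d + k) p" "H d q" "q R \<noteq> 0" "\<forall>Q\<in>A. q Q \<noteq> 0 --> g Q = p Q / q Q"
  using assms(1) unfolding lreg_def by blast
 have "H (d + (d + k) + - k) (q * q)" using H_mult[OF 1(2,2)] by simp
 moreover have "H (d + (d + k)) (q * p)" by (rule H_mult[OF 1(2,1)])
 moreover have "(q * p) R \<noteq> 0" using 1(3,4) assms(2,3) by (auto simp: fun_ops)
 moreover have "\<forall>Q\<in>A. (q * p) Q \<noteq> 0 --> inverse (g Q) = (q * q) Q / (q * p) Q"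
 proof (intro ballI impI)
  fix Q assume "Q \<in> A" "(q * p) Q \<noteq> 0"
  then have "g Q = p Q / q Q" "q Q \<noteq> 0" using 1(4) by (auto simp: fun_ops)
  then show "inverse (g Q) = (q * q) Q / (q * p) Q" by (simp add: fun_ops)
 qed
 ultimately show ?thesis unfolding lreg_def by blast
qed

text \<open>The difference is a fraction. If its numerator were nonzero at R, then by
  \<open>H_dom\<close> it would be nonzero at a point of U where f is nonzero too; but there the
  functions agree.\<close>

lemma lreg_identity:
 assumes g: "lreg k U g R" "lreg k U g' R" and R: "R \<in> U" and U: "zopen U"
  and f: "H e f" "P \<in> X" "f P \<noteq> 0" and eq: "\<And>Q. Q \<in> U ==> f Q \<noteq> 0 ==> g Q = g' Q"
 shows "g R = g' R"
proof (rule ccontr)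
 assume neq: "g R \<noteq> g' R"
 obtain d1 h where h: "H d1 h" "h R \<noteq> 0" "\<forall>Q\<in>X. h Q \<noteq> 0 --> Q \<in> U" and RX: "R \<in> X"
  using U R unfolding zopen_def by blast
 have "lreg k U (kk (- 1) * g') R" using lreg_mult[OF lreg_H[OF H_kk] g(2)] by simp
 then have "lreg k U (g + kk (- 1) * g') R" by (rule lreg_add[OF g(1)])
 then obtain d p q where 1: "H (d + k) p" "H d q" "q R \<noteq> 0"
  "\<forall>Q\<in>U. q Q \<noteq> 0 --> (g + kk (- 1) * g') Q = p Q / q Q" unfolding lreg_def by blast
 have "p R \<noteq> 0" using 1(3,4) R neq by (force simp: fun_ops kk_apply)
 then have "(p * (q * h)) R \<noteq> 0" using 1(3) h(2) by (simp add: fun_ops)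
 then obtain Q where Q: "Q \<in> X" "(p * (q * h)) Q \<noteq> 0" "f Q \<noteq> 0"
  using H_dom[OF H_mult[OF 1(1) H_mult[OF 1(2) h(1)]] f(1) RX _ f(2,3)] by blast
 then have "Q \<in> U" "p Q \<noteq> 0" "q Q \<noteq> 0" using h(3) by (auto simp: fun_ops)
 with 1(4) eq[OF \<open>Q \<in> U\<close> Q(3)] show False by (auto simp: fun_ops kk_apply)
qed

lemma zopen_inter: "zopen U ==> zopen V ==> zopen (U \<inter> V)"
 unfolding zopen_def
proof (intro conjI ballI)
 assume U: "U \<subseteq> X \<and> (\<forall>R\<in>U. \<exists>d h. H d h \<and> h R \<noteq> 0 \<and> (\<forall>Q\<in>X. h Q \<noteq> 0 --> Q \<in> U))"
  and V: "V \<subseteq> X \<and> (\<forall>R\<in>V. \<exists>d h. H d h \<and> h R \<noteq> 0 \<and> (\<forall>Q\<in>X. h Q \<noteq> 0 --> Q \<in> V))"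
 show "U \<inter> V \<subseteq> X" using U by blast
 fix R assume R: "R \<in> U \<inter> V"
 obtain d h where h: "H d h" "h R \<noteq> 0" "\<forall>Q\<in>X. h Q \<noteq> 0 --> Q \<in> U" using U R by blast
 obtain d' h' where h': "H d' h'" "h' R \<noteq> 0" "\<forall>Q\<in>X. h' Q \<noteq> 0 --> Q \<in> V" using V R by blast
 have "H (d + d') (h * h')" by (rule H_mult[OF h(1) h'(1)])
 moreover have "(h * h') R \<noteq> 0" "\<forall>Q\<in>X. (h * h') Q \<noteq> 0 --> Q \<in> U \<inter> V"
  using h h' by (auto simp: fun_ops)
 ultimately show "\<exists>d h. H d h \<and> h R \<noteq> 0 \<and> (\<forall>Q\<in>X. h Q \<noteq> 0 --> Q \<in> U \<inter> V)" by blast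
qed

lemma zopenD:
 assumes "zopen U" "R \<in> U"
 obtains d h where "H d h" "h R \<noteq> 0" "\<And>Q. Q \<in> X ==> h Q \<noteq> 0 ==> Q \<in> U"
 using assms unfolding zopen_def by blast

end

locale coord_space = coord_ring +
 assumes zariski: "zariski_open X U \<longleftrightarrow> zopen U"
  and regular: "U \<subseteq> X ==> regular_on U g \<longleftrightarrow> (\<forall>P\<in>U. lreg 0 U g P)"
begin

text \<open>The global sections of the twist E(k), by their coordinates in the fibres. They are 0
  outside X and beyond the rank, so that sections are equal exactly when they are equal as
  functions.\<close>

definition secs :: "vb => int => (P2 \<times> nat => complex) set" where
 "secs E k = {\<sigma>. (\<forall>P j. rk E \<le> j \<or> P \<notin> X --> \<sigma> (P, j) = 0) \<and>
   (\<forall>(U, \<phi>) \<in> atlas E. \<forall>R\<in>U. \<forall>i<rk E. lreg k U (app \<phi> (rk E) \<sigma> i) R)}"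

lemma regular_matD:
 assumes "U \<subseteq> X" "regular_mat_on U m n G"
 shows "P \<in> U ==> G P \<in> carrier_mat m n"
  and "P \<in> U ==> i < m ==> j < n ==> lreg 0 U (\<lambda>Q. G Q $$ (i, j)) P"
 using assms regular unfolding regular_mat_on_def by auto

lemma regular_matI:
 assumes "U \<subseteq> X" "\<And>P. P \<in> U ==> G P \<in> carrier_mat m n"
  "\<And>P i j. P \<in> U ==> i < m ==> j < n ==> lreg 0 U (\<lambda>Q. G Q $$ (i, j)) P"
 shows "regular_mat_on U m n G"
 using assms regular unfolding regular_mat_on_def by auto

context
 fixes E :: vb
 assumes E: "vector_bundle X E"
begin

lemma chart: "(U, \<phi>) \<in> atlas E ==> zopen U" "(U, \<phi>) \<in> atlas E ==> U \<subseteq> X"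
 "(U, \<phi>) \<in> atlas E ==> P \<in> U ==> \<phi> P \<in> carrier_mat (rk E) (rk E)"
 "(U, \<phi>) \<in> atlas E ==> P \<in> U ==> invertible_mat (\<phi> P)"
 using E zariski unfolding vector_bundle_def by (auto simp: zopen_def)

lemma chart_ex:
 assumes "P \<in> X"
 obtains U \<phi> where "(U, \<phi>) \<in> atlas E" "P \<in> U"
 using E assms unfolding vector_bundle_def by blast

lemma transition:
 assumes "(U, \<phi>) \<in> atlas E" "(V, \<psi>) \<in> atlas E"
 obtains G where "\<And>P. P \<in> U \<inter> V ==> G P \<in> carrier_mat (rk E) (rk E)" "\<And>P. P \<in> U \<inter> V ==> \<psi> P = G P * \<phi> P"
  "\<And>P i j. P \<in> U \<inter> V ==> i < rk E ==> j < rk E ==> lreg 0 (U \<inter> V) (\<lambda>Q. G Q $$ (i, j)) P"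
proof -
 obtain G where G: "regular_mat_on (U \<inter> V) (rk E) (rk E) G" "\<forall>P \<in> U \<inter> V. \<psi> P = G P * \<phi> P"
  using E assms unfolding vector_bundle_def by blast
 have "U \<inter> V \<subseteq> X" using chart(2)[OF assms(1)] by blast
 from regular_matD[OF this G(1)] G(2) show ?thesis by (intro that[of G]) auto
qed

lemma lreg_change_chart:
 assumes U: "(U, \<phi>) \<in> atlas E" and V: "(V, \<psi>) \<in> atlas E" and R: "R \<in> U" "R \<in> V"
  and \<sigma>: "\<And>i. i < rk E ==> lreg k (U \<inter> B) (app \<phi> (rk E) \<sigma> i) R" and i: "i < rk E" and B: "B \<subseteq> X"
 shows "lreg k (V \<inter> B) (app \<psi> (rk E) \<sigma> i) R"
proof -
 obtain G where G: "\<And>P. P \<in> U \<inter> V ==> G P \<in> carrier_mat (rk E) (rk E)" "\<And>P. P \<in> U \<inter> V ==> \<psi> P = G P * \<phi> P"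
  "\<And>P i j. P \<in> U \<inter> V ==> i < rk E ==> j < rk E ==> lreg 0 (U \<inter> V) (\<lambda>Q. G Q $$ (i, j)) P"
  by (rule transition[OF U V]) (rule that)
 have "lreg k (U \<inter> V \<inter> B) (\<lambda>Q. \<Sum>j<rk E. ((\<lambda>Q. G Q $$ (i, j)) * app \<phi> (rk E) \<sigma> j) Q) R"
 proof (rule lreg_sum)
  fix j assume "j \<in> {..<rk E}"
  then have j: "j < rk E" by simp
  have "lreg 0 (U \<inter> V \<inter> B) (\<lambda>Q. G Q $$ (i, j)) R"
   by (rule lreg_mono[OF G(3)[OF _ i j]]) (use R in auto)
  moreover have "lreg k (U \<inter> V \<inter> B) (app \<phi> (rk E) \<sigma> j) R" by (rule lreg_mono[OF \<sigma>[OF j]]) auto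
  ultimately show "lreg k (U \<inter> V \<inter> B) ((\<lambda>Q. G Q $$ (i, j)) * app \<phi> (rk E) \<sigma> j) R"
   using lreg_mult by fastforce
 qed
 then have 1: "lreg k (U \<inter> V \<inter> B) (app \<psi> (rk E) \<sigma> i) R"
 proof (rule lreg_cong)
  fix Q assume Q: "Q \<in> U \<inter> V \<inter> B"
  then show "(\<Sum>j<rk E. ((\<lambda>Q. G Q $$ (i, j)) * app \<phi> (rk E) \<sigma> j) Q) = app \<psi> (rk E) \<sigma> i Q"
   using app_trans[of \<psi> Q G \<phi> "rk E" "rk E" "rk E" i \<sigma>] G(1,2)[of Q] chart(3)[OF U, of Q] i by (simp add: fun_ops)
 qed
 obtain d h where h: "H d h" "h R \<noteq> 0" "\<And>Q. Q \<in> X ==> h Q \<noteq> 0 ==> Q \<in> U"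
  by (rule zopenD[OF chart(1)[OF U] R(1)]) (rule that)
 show ?thesis by (rule lreg_local[OF 1 h(1,2)]) (use h(3) chart(2)[OF V] in auto)
qed

lemma secsI:
 assumes "\<And>P j. rk E \<le> j \<or> P \<notin> X ==> \<sigma> (P, j) = 0"
  and "\<And>R. R \<in> X ==> \<exists>(U, \<phi>) \<in> atlas E. R \<in> U \<and> (\<forall>i<rk E. lreg k U (app \<phi> (rk E) \<sigma> i) R)"
 shows "\<sigma> \<in> secs E k"
 unfolding secs_def
proof (safe)
 fix V \<psi> R i assume V: "(V, \<psi>) \<in> atlas E" and R: "R \<in> V" and i: "i < rk E"
 have "R \<in> X" using chart(2)[OF V] R by blast
 then obtain U \<phi> where U: "(U, \<phi>) \<in> atlas E" "R \<in> U" "\<And>i. i < rk E ==> lreg k U (app \<phi> (rk E) \<sigma> i) R"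
  using assms(2)[of R] by blast
 have "lreg k (V \<inter> X) (app \<psi> (rk E) \<sigma> i) R"
  by (rule lreg_change_chart[OF U(1) V U(2) R _ i subset_refl]) (rule lreg_mono[OF U(3)], auto)
 then show "lreg k V (app \<psi> (rk E) \<sigma> i) R"
  by (rule lreg_mono) (use chart(2)[OF V] in blast)
qed (use assms(1) in auto)

lemma secsD:
 assumes "\<sigma> \<in> secs E k"
 shows "rk E \<le> j \<or> P \<notin> X ==> \<sigma> (P, j) = 0"
  and "(U, \<phi>) \<in> atlas E ==> R \<in> U ==> i < rk E ==> lreg k U (app \<phi> (rk E) \<sigma> i) R"
 using assms unfolding secs_def by auto

lemma secs_mult:
 assumes "\<sigma> \<in> secs E k" "H l f"
 shows "lift f * \<sigma> \<in> secs E (l + k)"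
 unfolding secs_def
proof (safe)
 fix U \<phi> R i assume "(U, \<phi>) \<in> atlas E" "R \<in> U" "i < rk E"
 then show "lreg (l + k) U (app \<phi> (rk E) (lift f * \<sigma>) i) R"
  unfolding app_mult using lreg_mult[OF lreg_H[OF assms(2)] secsD(2)[OF assms(1)]] by blast
qed (use secsD(1)[OF assms(1)] in \<open>auto simp: fun_ops\<close>)

lemma secs_add:
 assumes "\<sigma> \<in> secs E k" "\<tau> \<in> secs E k"
 shows "\<sigma> + \<tau> \<in> secs E k"
 unfolding secs_def
proof (safe)
 fix U \<phi> R i assume "(U, \<phi>) \<in> atlas E" "R \<in> U" "i < rk E"
 then show "lreg k U (app \<phi> (rk E) (\<sigma> + \<tau>) i) R"
  unfolding app_add by (intro lreg_add secsD(2)[OF assms(1)] secsD(2)[OF assms(2)])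
qed (use secsD(1)[OF assms(1)] secsD(1)[OF assms(2)] in \<open>auto simp: fun_ops\<close>)

lemma secs_0: "0 \<in> secs E k"
 unfolding secs_def by (auto simp: zero_fun_apply app_0 lreg_0)

lemma subspace_secs: "fs.subspace (secs E k)"
proof (rule fs.subspaceI)
 fix c \<sigma> assume "\<sigma> \<in> secs E k"
 from secs_mult[OF this H_kk[of c]] show "cscale c \<sigma> \<in> secs E k" by (simp add: lift_simps cscale_def)
qed (auto intro: secs_0 secs_add)

lemma fibre_eq_0:
 assumes "(U, \<phi>) \<in> atlas E" "P \<in> U" "\<And>i. i < rk E ==> app \<phi> (rk E) \<sigma> i P = 0" "j < rk E"
 shows "\<sigma> (P, j) = 0"
 by (rule invertible_mat_kernel[OF chart(4)[OF assms(1,2)] chart(3)[OF assms(1,2)] _ assms(4), of "\<lambda>j. \<sigma> (P, j)"])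
   (use assms(3) in \<open>auto simp: app_def\<close>)

lemma secs_identity:
 assumes \<sigma>: "\<sigma> \<in> secs E k" "\<tau> \<in> secs E k" and f: "H e f" "P \<in> X" "f P \<noteq> 0"
  and eq: "\<And>Q j. Q \<in> X ==> f Q \<noteq> 0 ==> j < rk E ==> \<sigma> (Q, j) = \<tau> (Q, j)"
 shows "\<sigma> = \<tau>"
proof
 fix x :: "P2 \<times> nat"
 obtain R j where x: "x = (R, j)" by (cases x)
 show "\<sigma> x = \<tau> x"
 proof (cases "rk E \<le> j \<or> R \<notin> X")
  case True
  then show ?thesis using secsD(1)[OF \<sigma>(1)] secsD(1)[OF \<sigma>(2)] x by simp
 next
  case False
  then obtain U \<phi> where U: "(U, \<phi>) \<in> atlas E" "R \<in> U" using chart_ex by blast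
  have "app \<phi> (rk E) \<sigma> i R = app \<phi> (rk E) \<tau> i R" if i: "i < rk E" for i
  proof (rule lreg_identity[OF secsD(2)[OF \<sigma>(1) U i] secsD(2)[OF \<sigma>(2) U i] U(2) chart(1)[OF U(1)] f])
   fix Q assume "Q \<in> U" "f Q \<noteq> 0"
   then show "app \<phi> (rk E) \<sigma> i Q = app \<phi> (rk E) \<tau> i Q"
    using eq chart(2)[OF U(1)] by (intro app_cong) blast
  qed
  then have "app \<phi> (rk E) (\<sigma> - \<tau>) i R = 0" if "i < rk E" for i
   using that by (simp add: app_def fun_ops algebra_simps sum_subtractf)
  from fibre_eq_0[OF U this, of j] False show ?thesis by (simp add: x fun_ops)
 qed
qed

lemma secs_torsion_free:
 assumes "\<sigma> \<in> secs E k" "H e f" "P \<in> X" "f P \<noteq> 0" "lift f * \<sigma> = 0"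
 shows "\<sigma> = 0"
proof (rule secs_identity[OF assms(1) secs_0 assms(2-4)])
 fix Q j assume "f Q \<noteq> 0"
 then show "\<sigma> (Q, j) = 0 (Q, j)" using fun_cong[OF assms(5), of "(Q, j)"] by (simp add: fun_ops lift_simps)
qed

text \<open>At a zero R of f the value is found by solving the chart equations for the values at R
  of the local fractions. The identity principle shows that charts chosen at different points lead
  to compatible values.\<close>

lemma secs_extend:
 assumes f: "H e f" "P0 \<in> X" "f P0 \<noteq> 0"
  and ext: "\<And>R. R \<in> X ==> \<exists>(U, \<phi>) \<in> atlas E. R \<in> U \<and>
   (\<forall>i<rk E. lreg k (U \<inter> {Q \<in> X. f Q \<noteq> 0}) (app \<phi> (rk E) \<sigma>0 i) R)"
 obtains \<sigma> where "\<sigma> \<in> secs E k" "\<And>Q j. Q \<in> X ==> f Q \<noteq> 0 ==> j < rk E ==> \<sigma> (Q, j) = \<sigma>0 (Q, j)"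
proof -
 let ?r = "rk E" and ?D = "{Q \<in> X. f Q \<noteq> 0}"
 \<comment> \<open>For every R one chart is fixed, together with fractions g that are regular at R
   and agree near R with the chart coordinates wherever f is nonzero.\<close>
 define loc where "loc R U \<phi> g \<longleftrightarrow> (U, \<phi>) \<in> atlas E \<and> R \<in> U \<and> (\<forall>i<?r. lreg k UNIV (g i) R \<and>
   (\<exists>d h. H d h \<and> h R \<noteq> 0 \<and> (\<forall>Q\<in>U \<inter> ?D. h Q \<noteq> 0 --> app \<phi> ?r \<sigma>0 i Q = g i Q)))" for R U \<phi> g
 have "\<forall>R\<in>X. \<exists>U \<phi> g. loc R U \<phi> g"
 proof
  fix R assume "R \<in> X"
  then obtain U \<phi> where U: "(U, \<phi>) \<in> atlas E" "R \<in> U" "\<forall>i<?r. lreg k (U \<inter> ?D) (app \<phi> ?r \<sigma>0 i) R"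
   using ext by blast
  have "\<forall>i\<in>{..<?r}. \<exists>g. lreg k UNIV g R \<and>
   (\<exists>d h. H d h \<and> h R \<noteq> 0 \<and> (\<forall>Q\<in>U \<inter> ?D. h Q \<noteq> 0 --> app \<phi> ?r \<sigma>0 i Q = g Q))"
  proof
   fix i assume "i \<in> {..<?r}"
   then obtain d p q where *: "H (d + k) p" "H d q" "q R \<noteq> 0" "\<forall>Q\<in>U \<inter> ?D. q Q \<noteq> 0 --> app \<phi> ?r \<sigma>0 i Q = p Q / q Q"
    using U(3) unfolding lreg_def by blast
   show "\<exists>g. lreg k UNIV g R \<and> (\<exists>d h. H d h \<and> h R \<noteq> 0 \<and> (\<forall>Q\<in>U \<inter> ?D. h Q \<noteq> 0 --> app \<phi> ?r \<sigma>0 i Q = g Q))"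
    using lreg_frac[OF *(1-3)] *(2-4) by (intro exI[of _ "\<lambda>Q. p Q / q Q"]) blast
  qed
  from bchoice[OF this] show "\<exists>U \<phi> g. loc R U \<phi> g"
   unfolding loc_def Ball_def lessThan_iff by (elim exE) (intro exI[of _ U] exI[of _ \<phi>] exI conjI U(1,2))
 qed
 from bchoice[OF this] obtain U where "\<forall>R\<in>X. \<exists>\<phi> g. loc R (U R) \<phi> g" ..
 from bchoice[OF this] obtain \<phi> where "\<forall>R\<in>X. \<exists>g. loc R (U R) (\<phi> R) g" ..
 from bchoice[OF this] obtain g where "\<forall>R\<in>X. loc R (U R) (\<phi> R) (g R)" ..
 then have U: "R \<in> X ==> (U R, \<phi> R) \<in> atlas E" "R \<in> X ==> R \<in> U R"
  and g: "R \<in> X ==> i < ?r ==> lreg k UNIV (g R i) R"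
  and ge: "R \<in> X ==> i < ?r ==> \<exists>d h. H d h \<and> h R \<noteq> 0 \<and> (\<forall>Q\<in>U R \<inter> ?D. h Q \<noteq> 0 --> app (\<phi> R) ?r \<sigma>0 i Q = g R i Q)"
  for R i unfolding loc_def by blast+
 have "\<forall>R\<in>X. \<exists>\<tau>. \<forall>i<?r. (\<Sum>j<?r. \<phi> R R $$ (i, j) * \<tau> j) = g R i R"
 proof
  fix R assume R: "R \<in> X"
  show "\<exists>\<tau>. \<forall>i<?r. (\<Sum>j<?r. \<phi> R R $$ (i, j) * \<tau> j) = g R i R"
   by (rule invertible_mat_solve[OF chart(4)[OF U(1)[OF R] U(2)[OF R]] chart(3)[OF U(1)[OF R] U(2)[OF R]]])
 qed
 from bchoice[OF this] obtain \<tau> where \<tau>: "\<forall>R\<in>X. \<forall>i<?r. (\<Sum>j<?r. \<phi> R R $$ (i, j) * \<tau> R j) = g R i R" ..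
 define \<sigma> where "\<sigma> = (\<lambda>(R, j). if R \<in> X \<and> j < ?r then if f R \<noteq> 0 then \<sigma>0 (R, j) else \<tau> R j else 0)"
 have \<sigma>D: "\<sigma> (Q, j) = \<sigma>0 (Q, j)" if "Q \<in> X" "f Q \<noteq> 0" "j < ?r" for Q j
  using that by (simp add: \<sigma>_def)
 \<comment> \<open>The point is the case of a zero Q of f, where \<open>\<sigma>\<close> was defined
   by the chart of Q and not by that of R: the two expressions are regular at Q and agree where f is
   nonzero, hence also at Q.\<close>
 have near: "app (\<phi> R) ?r \<sigma> i Q = g R i Q"
  if R: "R \<in> X" and i: "i < ?r" and Q: "Q \<in> U R" and h: "H d h" "h Q \<noteq> 0"
   and hge: "\<forall>Q\<in>U R \<inter> ?D. h Q \<noteq> 0 --> app (\<phi> R) ?r \<sigma>0 i Q = g R i Q" and gQ: "lreg k UNIV (g R i) Q"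
  for R i Q d h
 proof (cases "f Q = 0")
  case False
  then have "app (\<phi> R) ?r \<sigma> i Q = app (\<phi> R) ?r \<sigma>0 i Q"
   using chart(2)[OF U(1)[OF R]] Q by (intro app_cong \<sigma>D) auto
  then show ?thesis using hge h(2) Q False chart(2)[OF U(1)[OF R]] by auto
 next
  case f0: True
  have QX: "Q \<in> X" using Q chart(2)[OF U(1)[OF R]] by blast
  let ?W = "U Q \<inter> U R"
  have W: "zopen ?W" by (rule zopen_inter[OF chart(1)[OF U(1)[OF QX]] chart(1)[OF U(1)[OF R]]])
  have QW: "Q \<in> ?W" using Q U(2)[OF QX] by blast
  obtain G where G: "\<And>P. P \<in> ?W ==> G P \<in> carrier_mat ?r ?r" "\<And>P. P \<in> ?W ==> \<phi> R P = G P * \<phi> Q P"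
   "\<And>P i j. P \<in> ?W ==> i < ?r ==> j < ?r ==> lreg 0 ?W (\<lambda>S. G S $$ (i, j)) P"
   by (rule transition[OF U(1)[OF QX] U(1)[OF R]]) (rule that)
  have tr: "app (\<phi> R) ?r \<rho> i P = (\<Sum>j<?r. G P $$ (i, j) * app (\<phi> Q) ?r \<rho> j P)" if P: "P \<in> ?W" for \<rho> P
   by (rule app_trans[where G = G and \<psi> = "\<phi> R" and \<phi> = "\<phi> Q", OF G(2)[OF P] G(1)[OF P] chart(3)[OF U(1)[OF QX]] i]) (use P in blast)
  have appQ: "app (\<phi> Q) ?r \<sigma> j Q = g Q j Q" if "j < ?r" for j
   using \<tau> QX that f0 by (simp add: app_def \<sigma>_def)
  let ?g = "\<lambda>S. \<Sum>j<?r. ((\<lambda>S. G S $$ (i, j)) * g Q j) S"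
  have l1: "lreg k ?W ?g Q"
  proof (rule lreg_sum)
   fix j assume j: "j \<in> {..<?r}"
   then have "lreg (0 + k) ?W ((\<lambda>S. G S $$ (i, j)) * g Q j) Q"
    by (intro lreg_mult G(3)[OF QW i] lreg_mono[OF g[OF QX]]) auto
   then show "lreg k ?W ((\<lambda>S. G S $$ (i, j)) * g Q j) Q" by simp
  qed
  have "\<exists>d h. H d h \<and> h Q \<noteq> 0 \<and> (\<forall>S. h S \<noteq> 0 --> (\<forall>j\<in>{..<?r}. S \<in> U Q \<inter> ?D --> app (\<phi> Q) ?r \<sigma>0 j S = g Q j S))"
   by (rule finite_near) (use ge[OF QX] in \<open>simp, blast\<close>)
  then obtain d2 h2 where h2: "H d2 h2" "h2 Q \<noteq> 0"
   "\<forall>S\<in>U Q \<inter> ?D. h2 S \<noteq> 0 --> (\<forall>j\<in>{..<?r}. app (\<phi> Q) ?r \<sigma>0 j S = g Q j S)" by blast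
  obtain P1 where P1: "P1 \<in> X" "(f * (h * h2)) P1 \<noteq> 0"
  proof -
   have "(h * h2) Q \<noteq> 0" using h h2 by (simp add: fun_ops)
   from H_dom[OF f(1) H_mult[OF h(1) h2(1)] f(2,3) QX this] show ?thesis
    using that by (auto simp: fun_ops)
  qed
  have "g R i Q = ?g Q"
  proof (rule lreg_identity[OF lreg_mono[OF gQ subset_UNIV] l1 QW W H_mult[OF f(1) H_mult[OF h(1) h2(1)]] P1])
   fix S assume S: "S \<in> ?W" "(f * (h * h2)) S \<noteq> 0"
   then have SX: "S \<in> X" using chart(2)[OF U(1)[OF R]] by blast
   then have "g R i S = app (\<phi> R) ?r \<sigma>0 i S" using hge S by (auto simp: fun_ops)
   also have "\<dots> = ?g S"
    unfolding tr[OF S(1)] using h2(3) S SX by (auto simp: fun_ops intro!: sum.cong)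
   finally show "g R i S = ?g S" .
  qed
  then show ?thesis unfolding tr[OF QW] using appQ by (auto simp: fun_ops intro!: sum.cong)
 qed
 have "\<sigma> \<in> secs E k"
 proof (rule secsI)
  show "\<sigma> (P, j) = 0" if "?r \<le> j \<or> P \<notin> X" for P j using that by (auto simp: \<sigma>_def)
  fix R assume R: "R \<in> X"
  have "lreg k (U R) (app (\<phi> R) ?r \<sigma> i) R" if i: "i < ?r" for i
  proof -
   obtain d h where h: "H d h" "h R \<noteq> 0" "\<forall>Q\<in>U R \<inter> ?D. h Q \<noteq> 0 --> app (\<phi> R) ?r \<sigma>0 i Q = g R i Q"
    using ge[OF R i] by blast
   obtain d' h' where h': "H d' h'" "h' R \<noteq> 0" "\<And>Q. h' Q \<noteq> 0 ==> lreg k UNIV (g R i) Q"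
    using lreg_near[OF g[OF R i]] by blast
   show ?thesis
   proof (rule lreg_local[OF g[OF R i] H_mult[OF h(1) h'(1)]])
    show "(h * h') R \<noteq> 0" using h h' by (simp add: fun_ops)
    fix Q assume Q: "Q \<in> U R" "(h * h') Q \<noteq> 0"
    then show "Q \<in> UNIV \<and> g R i Q = app (\<phi> R) ?r \<sigma> i Q"
     using near[OF R i Q(1) h(1) _ h(3) h'(3)] by (auto simp: fun_ops)
   qed
  qed
  then show "\<exists>(U, \<phi>) \<in> atlas E. R \<in> U \<and> (\<forall>i<?r. lreg k U (app \<phi> ?r \<sigma> i) R)"
   using U[OF R] by blast
 qed
 then show ?thesis using \<sigma>D by (rule that)
qed

end

end

section \<open>Matrices of size two and direct sums of line bundles\<close>

definition mat2 :: "complex => complex => complex => complex => complex mat" where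
 "mat2 a b c d = mat 2 2 (\<lambda>(i, j). if i = 0 then if j = 0 then a else b else if j = 0 then c else d)"

lemma mat2_carrier [simp]: "mat2 a b c d \<in> carrier_mat 2 2"
 by (simp add: mat2_def)

lemma mat2_entry [simp]: "mat2 a b c d $$ (0, 0) = a" "mat2 a b c d $$ (0, Suc 0) = b"
  "mat2 a b c d $$ (Suc 0, 0) = c" "mat2 a b c d $$ (Suc 0, Suc 0) = d"
 by (simp_all add: mat2_def)

lemma mat2_eqI:
 assumes "A \<in> carrier_mat 2 2" "A $$ (0, 0) = a" "A $$ (0, Suc 0) = b" "A $$ (Suc 0, 0) = c" "A $$ (Suc 0, Suc 0) = d"
 shows "A = mat2 a b c d"
 using assms by (intro eq_matI) (auto simp: mat2_def less_2_cases_iff)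

lemma mat2_eta: "A \<in> carrier_mat 2 2 ==> A = mat2 (A $$ (0, 0)) (A $$ (0, Suc 0)) (A $$ (Suc 0, 0)) (A $$ (Suc 0, Suc 0))"
 by (rule mat2_eqI) auto

lemma sum_2: "(\<Sum>j<(2 :: nat). f j) = f 0 + (f (Suc 0) :: complex)"
 by (simp add: numeral_2_eq_2)

lemma mat2_mult: "mat2 a b c d * mat2 a' b' c' d' = mat2 (a * a' + b * c') (a * b' + b * d') (c * a' + d * c') (c * b' + d * d')"
 by (rule mat2_eqI) (auto simp: mat_mult_entry[of _ 2 2 _ 2] sum_2 mult_carrier_mat[of _ 2 2 _ 2])

lemma mat2_one: "1\<^sub>m 2 = mat2 1 0 0 1"
 by (rule mat2_eqI) auto

lemma mat2_inverse:
 assumes "a * d - b * c = e" "e \<noteq> 0"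
 shows "mat2 (d / e) (- b / e) (- c / e) (a / e) * mat2 a b c d = 1\<^sub>m 2"
proof -
 have "d / e * a + - b / e * c = 1" "d / e * b + - b / e * d = 0" "- c / e * a + a / e * c = 0" "- c / e * b + a / e * d = 1"
  using assms by (simp_all add: field_simps)
 then show ?thesis unfolding mat2_mult mat2_one by (simp only:)
qed

lemma four_block_1_1:
 "A \<in> carrier_mat 1 1 ==> B \<in> carrier_mat 1 1 ==>
  four_block_mat A (0\<^sub>m 1 1) (0\<^sub>m 1 1) B = mat2 (A $$ (0, 0)) 0 0 (B $$ (0, 0))"
 by (rule mat2_eqI) (auto simp: numeral_2_eq_2)

lemma app_2: "app \<phi> 2 \<sigma> i P = \<phi> P $$ (i, 0) * \<sigma> (P, 0) + \<phi> P $$ (i, Suc 0) * \<sigma> (P, Suc 0)"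
 by (simp add: app_def sum_2)

lemma app_1: "app \<phi> 1 \<sigma> i P = \<phi> P $$ (i, 0) * \<sigma> (P, 0)"
 by (simp add: app_def)

lemma invertible_1x1: "invertible_mat (M :: complex mat) ==> M \<in> carrier_mat 1 1 ==> M $$ (0, 0) \<noteq> 0"
 using invertible_mat_kernel[of M 1 "\<lambda>_. 1" 0] by auto

lemma invertible_2x2:
 assumes "invertible_mat (M :: complex mat)" "M \<in> carrier_mat 2 2"
 shows "M $$ (0, 0) * M $$ (Suc 0, Suc 0) - M $$ (0, Suc 0) * M $$ (Suc 0, 0) \<noteq> 0"
proof
 assume det: "M $$ (0, 0) * M $$ (Suc 0, Suc 0) - M $$ (0, Suc 0) * M $$ (Suc 0, 0) = 0"
 have ker: "x = 0 \<and> y = 0"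
  if eq: "M $$ (0, 0) * x + M $$ (0, Suc 0) * y = 0" "M $$ (Suc 0, 0) * x + M $$ (Suc 0, Suc 0) * y = 0" for x y
 proof -
  let ?t = "\<lambda>j :: nat. if j = 0 then x else y"
  have "\<forall>i<2. (\<Sum>j<2. M $$ (i, j) * ?t j) = 0"
   using eq by (auto simp: sum_2 less_2_cases_iff)
  note k = invertible_mat_kernel[OF assms this]
  from k[of 0] k[of 1] show ?thesis by simp
 qed
 have 1: "M $$ (Suc 0, Suc 0) = 0" "M $$ (Suc 0, 0) = 0"
  using ker[of "M $$ (Suc 0, Suc 0)" "- M $$ (Suc 0, 0)"] det by (simp_all add: mult.commute)
 have 2: "M $$ (0, Suc 0) = 0" "M $$ (0, 0) = 0"
  using ker[of "M $$ (0, Suc 0)" "- M $$ (0, 0)"] det by (simp_all add: mult.commute algebra_simps)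
 show False using ker[of 1 0] 1 2 by simp
qed

context coord_ring
begin

lemma lreg_diff: "lreg k A g R ==> lreg k A g' R ==> lreg k A (\<lambda>Q. g Q - g' Q) R"
proof -
 assume "lreg k A g R" "lreg k A g' R"
 then have "lreg k A (g + kk (- 1) * g') R" using lreg_mult[OF lreg_H[OF H_kk]] by (intro lreg_add) fastforce+
 then show ?thesis by (rule lreg_cong) (simp add: fun_ops kk_apply)
qed

lemma lreg_times: "lreg k A g R ==> lreg l A g' R ==> m = k + l ==> lreg m A (\<lambda>Q. g Q * g' Q) R"
 using lreg_mult[of k A g R l g'] by (simp add: times_fun_def)

lemma lreg_divide: "lreg k A g R ==> lreg l A g' R ==> R \<in> A ==> g' R \<noteq> 0 ==> m = k - l ==>
  lreg m A (\<lambda>Q. g Q / g' Q) R"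
 using lreg_times[OF _ lreg_inverse, of k A g R l g' m] by (simp add: divide_inverse)

lemma lreg_uminus: "lreg k A g R ==> lreg k A (\<lambda>Q. - g Q) R"
proof -
 assume "lreg k A g R"
 then have "lreg k A (\<lambda>Q. 0 - g Q) R" by (rule lreg_diff[OF lreg_0])
 then show ?thesis by simp
qed

lemma lreg_const: "lreg 0 A (\<lambda>_. c) R"
 using lreg_H[OF H_kk[of c], of A R] by (simp add: kk_def)

lemma lreg_powi:
 assumes "lreg k A g R" "R \<in> A" "g R \<noteq> 0"
 shows "lreg (n * k) A (\<lambda>Q. g Q powi n) R"
proof -
 have pos: "lreg (int m * k) A (\<lambda>Q. g Q ^ m) R" for m
 proof (induction m)
  case (Suc m)
  then show ?case using lreg_times[OF assms(1) Suc] by (simp add: algebra_simps)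
 qed (simp add: lreg_const)
 show ?thesis
 proof (cases "n \<ge> 0")
  case True
  then show ?thesis using pos[of "nat n"] by (simp add: power_int_def)
 next
  case False
  then have "lreg (- (int (nat (- n)) * k)) A (\<lambda>Q. inverse (g Q ^ nat (- n))) R"
   by (intro lreg_inverse[OF pos assms(2)]) (simp add: assms(3))
  then show ?thesis using False by (simp add: power_int_def power_inverse)
 qed
qed

text \<open>Forms of degree d on the plane become elements of degree m d, and all of these arise so.
  Denominators of other degrees are no obstacle: multiplication by an element that is nonzero at the
  point in question raises the degree to a multiple of m.\<close>

lemma coord_spaceI:
 assumes m: "m \<ge> 1"
  and a: "\<And>d p. form d p ==> \<exists>f. H (m * int d) f \<and> (\<forall>P\<in>X. f P = p (coords P))"
  and b: "\<And>d f. H (m * int d) f ==> \<exists>p. form d p \<and> (\<forall>P\<in>X. f P = p (coords P))"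
 shows "coord_space X H"
proof
 have homog: "\<exists>d' f. H (m * int d') (f * h) \<and> H (m * int d' - d) f \<and> f R \<noteq> 0"
  if h: "H d h" "h R \<noteq> 0" and R: "R \<in> X" for d h R
 proof -
  have d: "d \<ge> 0" using H_neg[OF h(1) _ R] h(2) by force
  then have "m * d - d \<ge> 0" using m mult_right_mono[of 1 m d] by simp
  then have md: "int (nat (m * d - d)) = m * d - d" by simp
  obtain f where f: "H (int (nat (m * d - d))) f" "f R \<noteq> 0" using H_nonvan_nat[OF R] by blast
  have f': "H (m * int (nat d) - d) f" using f(1) md d by simp
  have "H (m * int (nat d)) (f * h)" using H_mult[OF f' h(1)] by simp
  with f' f(2) show ?thesis by blast
 qed
 show "zariski_open X U \<longleftrightarrow> zopen U" for U
 proof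
  assume "zariski_open X U"
  then obtain S where S: "\<forall>p\<in>S. \<exists>d. form d p" "U = {P \<in> X. \<exists>p\<in>S. p (coords P) \<noteq> 0}"
   unfolding zariski_open_def by blast
  show "zopen U"
   unfolding zopen_def
  proof (intro conjI ballI)
   show "U \<subseteq> X" using S(2) by blast
   fix R assume R: "R \<in> U"
   then obtain p where p: "p \<in> S" "p (coords R) \<noteq> 0" using S(2) by blast
   obtain d where d: "form d p" using S(1) p(1) by blast
   obtain f where f: "H (m * int d) f" "\<forall>P\<in>X. f P = p (coords P)" using a[OF d] by blast
   have "f R \<noteq> 0" "\<forall>Q\<in>X. f Q \<noteq> 0 --> Q \<in> U" using f(2) p R S(2) by auto
   with f(1) show "\<exists>d h. H d h \<and> h R \<noteq> 0 \<and> (\<forall>Q\<in>X. h Q \<noteq> 0 --> Q \<in> U)" by blast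
  qed
 next
  assume U: "zopen U"
  let ?S = "{p. (\<exists>d. form d p) \<and> (\<forall>Q\<in>X. p (coords Q) \<noteq> 0 --> Q \<in> U)}"
  have "U = {P \<in> X. \<exists>p\<in>?S. p (coords P) \<noteq> 0}"
  proof (intro equalityI subsetI)
   fix R assume R: "R \<in> U"
   then have RX: "R \<in> X" using U unfolding zopen_def by blast
   obtain d h where h: "H d h" "h R \<noteq> 0" "\<forall>Q\<in>X. h Q \<noteq> 0 --> Q \<in> U"
    using U R unfolding zopen_def by blast
   obtain d' f where f: "H (m * int d') (f * h)" "f R \<noteq> 0" using homog[OF h(1,2) RX] by blast
   obtain p where p: "form d' p" "\<forall>P\<in>X. (f * h) P = p (coords P)" using b[OF f(1)] by blast
   have "p (coords R) \<noteq> 0" using p(2) RX f(2) h(2) by (metis mult_eq_0_iff times_fun_apply)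
   moreover have "Q \<in> U" if Q: "Q \<in> X" "p (coords Q) \<noteq> 0" for Q
   proof -
    have "(f * h) Q \<noteq> 0" using p(2) Q by simp
    then show ?thesis using h(3) Q(1) by (auto simp: fun_ops)
   qed
   ultimately show "R \<in> {P \<in> X. \<exists>p\<in>?S. p (coords P) \<noteq> 0}" using p(1) RX by blast
  qed blast
  then show "zariski_open X U" unfolding zariski_open_def by (intro exI[of _ ?S]) blast
 qed
 show "regular_on U g \<longleftrightarrow> (\<forall>P\<in>U. lreg 0 U g P)" if UX: "U \<subseteq> X" for U g
 proof
  assume reg: "regular_on U g"
  show "\<forall>P\<in>U. lreg 0 U g P"
  proof
   fix R assume R: "R \<in> U"
   then obtain V d p q where V: "zariski_open U V" "R \<in> V" "form d p" "form d q"
    "\<forall>R\<in>V. q (coords R) \<noteq> 0 \<and> g R = p (coords R) / q (coords R)"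
    using reg unfolding regular_on_def by blast
   obtain S where S: "\<forall>p\<in>S. \<exists>d. form d p" "V = {P \<in> U. \<exists>p\<in>S. p (coords P) \<noteq> 0}"
    using V(1) unfolding zariski_open_def by blast
   obtain s e where s: "s \<in> S" "s (coords R) \<noteq> 0" "form e s" using S V(2) by blast
   obtain fp where fp: "H (m * int d) fp" "\<forall>P\<in>X. fp P = p (coords P)" using a[OF V(3)] by blast
   obtain fq where fq: "H (m * int d) fq" "\<forall>P\<in>X. fq P = q (coords P)" using a[OF V(4)] by blast
   obtain fs where fs: "H (m * int e) fs" "\<forall>P\<in>X. fs P = s (coords P)" using a[OF s(3)] by blast
   have "H (m * int d + m * int e + 0) (fp * fs)" using H_mult[OF fp(1) fs(1)] by simp
   moreover have "H (m * int d + m * int e) (fq * fs)" by (rule H_mult[OF fq(1) fs(1)])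
   moreover have "(fq * fs) R \<noteq> 0" using fq(2) fs(2) V(2,5) s(2) R UX by (auto simp: fun_ops)
   moreover have "\<forall>Q\<in>U. (fq * fs) Q \<noteq> 0 --> g Q = (fp * fs) Q / (fq * fs) Q"
   proof (intro ballI impI)
    fix Q assume Q: "Q \<in> U" "(fq * fs) Q \<noteq> 0"
    then have QX: "Q \<in> X" using UX by blast
    then have "s (coords Q) \<noteq> 0" using Q(2) fs(2) by (auto simp: fun_ops)
    then have "Q \<in> V" using S(2) s(1) Q(1) by blast
    then show "g Q = (fp * fs) Q / (fq * fs) Q"
     using V(5) fp(2) fq(2) QX Q(2) by (auto simp: fun_ops)
   qed
   ultimately show "lreg 0 U g R" unfolding lreg_def by blast
  qed
 next
  assume reg: "\<forall>P\<in>U. lreg 0 U g P"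
  show "regular_on U g"
   unfolding regular_on_def
  proof
   fix R assume R: "R \<in> U"
   then have RX: "R \<in> X" using UX by blast
   obtain d p q where *: "H (d + 0) p" "H d q" "q R \<noteq> 0" "\<forall>Q\<in>U. q Q \<noteq> 0 --> g Q = p Q / q Q"
    using reg R unfolding lreg_def by blast
   obtain d' f where f: "H (m * int d') (f * q)" "H (m * int d' - d) f" "f R \<noteq> 0"
    using homog[OF *(2,3) RX] by blast
   have "H (m * int d') (f * p)" using H_mult[OF f(2) *(1)] by simp
   from b[OF this] obtain p' where p': "form d' p'" "\<forall>P\<in>X. (f * p) P = p' (coords P)" by blast
   from b[OF f(1)] obtain q' where q': "form d' q'" "\<forall>P\<in>X. (f * q) P = q' (coords P)" by blast
   let ?V = "{Q \<in> U. q' (coords Q) \<noteq> 0}"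
   have "zariski_open U ?V" unfolding zariski_open_def
    using q'(1) by (intro exI[of _ "{q'}"]) auto
   moreover have "q' (coords R) \<noteq> 0" using q'(2) RX f(3) *(3) by (metis mult_eq_0_iff times_fun_apply)
   moreover have "\<forall>Q\<in>?V. q' (coords Q) \<noteq> 0 \<and> g Q = p' (coords Q) / q' (coords Q)"
   proof
    fix Q assume Q: "Q \<in> ?V"
    then have QX: "Q \<in> X" using UX by blast
    have nz: "(f * q) Q \<noteq> 0" using q'(2) QX Q by simp
    then have "g Q = p Q / q Q" using *(4) Q by (auto simp: fun_ops)
    also have "\<dots> = (f * p) Q / (f * q) Q" using nz by (auto simp: fun_ops)
    finally show "q' (coords Q) \<noteq> 0 \<and> g Q = p' (coords Q) / q' (coords Q)"
     using p'(2) q'(2) QX Q by auto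
   qed
   ultimately show "\<exists>V d p q. zariski_open U V \<and> R \<in> V \<and> form d p \<and> form d q \<and>
     (\<forall>R\<in>V. q (coords R) \<noteq> 0 \<and> g R = p (coords R) / q (coords R))"
    using R p'(1) q'(1) by blast
  qed
 qed
qed

end

context coord_space
begin

lemma vector_bundle_rank1:
 assumes L: "rk L = 1" "atlas L = (\<lambda>i. (U i, \<lambda>P. mat 1 1 (\<lambda>_. g i P))) ` I"
  and U: "\<And>i. i \<in> I ==> zopen (U i)" "(\<Union>i\<in>I. U i) = X"
  and g: "\<And>i P. i \<in> I ==> P \<in> U i ==> g i P \<noteq> 0"
  and tr: "\<And>i j P. i \<in> I ==> j \<in> I ==> P \<in> U i \<inter> U j ==> lreg 0 (U i \<inter> U j) (\<lambda>Q. g j Q / g i Q) P"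
 shows "vector_bundle X L"
proof -
 let ?M = "\<lambda>g P. mat 1 1 (\<lambda>_. g P :: complex)"
 have inv: "invertible_mat (mat 1 1 (\<lambda>_. c))" if "c \<noteq> 0" for c :: complex
  unfolding invertible_mat_def inverts_mat_def using that
  by (auto intro!: exI[of _ "mat 1 1 (\<lambda>_. 1 / c)"] simp: scalar_prod_def)
 have all: "(\<forall>(V, \<phi>)\<in>atlas L. p V \<phi>) \<longleftrightarrow> (\<forall>i\<in>I. p (U i) (?M (g i)))" for p
  by (simp add: L(2))
 show ?thesis unfolding vector_bundle_def all L(1)
 proof (intro conjI ballI)
  show "(\<Union>(V, \<phi>)\<in>atlas L. V) = X" using U(2) by (simp add: L(2))
  fix i assume i: "i \<in> I"
  show "zariski_open X (U i)" using U(1)[OF i] by (simp add: zariski)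
  show "invertible_mat (?M (g i) P)" if "P \<in> U i" for P using inv[OF g[OF i that]] by simp
  fix j assume j: "j \<in> I"
  show "\<exists>G. regular_mat_on (U i \<inter> U j) 1 1 G \<and> (\<forall>P\<in>U i \<inter> U j. ?M (g j) P = G P * ?M (g i) P)"
  proof (intro exI conjI ballI)
   show "regular_mat_on (U i \<inter> U j) 1 1 (?M (\<lambda>Q. g j Q / g i Q))"
   proof (rule regular_matI)
    show "U i \<inter> U j \<subseteq> X" using U(2) i by blast
    fix P and k l :: nat assume "P \<in> U i \<inter> U j" "k < 1" "l < 1"
    then show "lreg 0 (U i \<inter> U j) (\<lambda>Q. ?M (\<lambda>Q. g j Q / g i Q) Q $$ (k, l)) P" using tr[OF i j] by simp
   qed auto
   fix P assume "P \<in> U i \<inter> U j"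
   then show "?M (g j) P = ?M (\<lambda>Q. g j Q / g i Q) P * ?M (g i) P"
    using g[OF i, of P] by (intro eq_matI) (auto simp: scalar_prod_def)
  qed
 qed auto
qed

lemma bundle_mapI:
 assumes "\<And>P. P \<in> X ==> T P \<in> carrier_mat (rk F) (rk E)"
  and "\<And>U \<phi> V \<psi>. (U, \<phi>) \<in> atlas E ==> (V, \<psi>) \<in> atlas F ==>
   \<exists>H. regular_mat_on (U \<inter> V) (rk F) (rk E) H \<and> (\<forall>P\<in>U \<inter> V. \<psi> P * T P = H P * \<phi> P)"
 shows "bundle_map X E F T"
 using assms unfolding bundle_map_def by blast

text \<open>The map from the sum sends t1 to e1 and t2 to e2. Since t1 and e1 have the same degree,
  and likewise t2 and e2, its matrices in charts consist of quotients of degree 0 and are regular;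
  so are the inverses, because the determinant vanishes nowhere.\<close>

lemma isomorphic_direct_sum:
 assumes E: "vector_bundle X E" "rk E = 2" and L1: "vector_bundle X L1" "rk L1 = 1"
  and L2: "vector_bundle X L2" "rk L2 = 1"
  and e1: "e1 \<in> secs E k1" and e2: "e2 \<in> secs E k2"
  and nz: "\<And>P. P \<in> X ==> e1 (P, 0) * e2 (P, Suc 0) - e1 (P, Suc 0) * e2 (P, 0) \<noteq> 0"
  and t1: "t1 \<in> secs L1 k1" "\<And>P. P \<in> X ==> t1 (P, 0) \<noteq> 0"
  and t2: "t2 \<in> secs L2 k2" "\<And>P. P \<in> X ==> t2 (P, 0) \<noteq> 0"
 shows "isomorphic_vb X E (direct_sum_vb L1 L2)"
proof -
 let ?F = "direct_sum_vb L1 L2"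
 define D where "D P = e1 (P, 0) * e2 (P, Suc 0) - e1 (P, Suc 0) * e2 (P, 0)" for P
 define x where "x P = t1 (P, 0)" for P
 define y where "y P = t2 (P, 0)" for P
 \<comment> \<open>The columns are e1 / t1 and e2 / t2; \<open>S\<close> is the inverse by Cramer's
   rule.\<close>
 define T where "T P = mat2 (e1 (P, 0) / x P) (e2 (P, 0) / y P) (e1 (P, Suc 0) / x P) (e2 (P, Suc 0) / y P)" for P
 define S where "S P = mat2 (x P * e2 (P, Suc 0) / D P) (- (x P * e2 (P, 0)) / D P)
  (- (y P * e1 (P, Suc 0)) / D P) (y P * e1 (P, 0) / D P)" for P
 have rkF: "rk ?F = 2" using L1 L2 by (simp add: direct_sum_vb_def)
 have nonzero: "D P \<noteq> 0" "x P \<noteq> 0" "y P \<noteq> 0" if P: "P \<in> X" for P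
  using nz[OF P] t1(2)[OF P] t2(2)[OF P] by (simp_all add: D_def x_def y_def)
 have inv: "T P * S P = 1\<^sub>m 2" "S P * T P = 1\<^sub>m 2" if P: "P \<in> X" for P
 proof -
  have one: "e1 (P, 0) * e2 (P, Suc 0) / D P - e1 (P, Suc 0) * e2 (P, 0) / D P = 1"
   using nonzero(1)[OF P] by (simp add: diff_divide_distrib[symmetric] D_def)
  show "T P * S P = 1\<^sub>m 2" "S P * T P = 1\<^sub>m 2"
   unfolding T_def S_def mat2_mult mat2_one using nonzero[OF P] one
   by (simp_all add: mult.commute mult.left_commute)
 qed
 have charts: "\<exists>HT HS. regular_mat_on (W \<inter> V) 2 2 HT \<and> (\<forall>P\<in>W \<inter> V. \<psi> P * T P = HT P * \<kappa> P) \<and>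
   regular_mat_on (V \<inter> W) 2 2 HS \<and> (\<forall>P\<in>V \<inter> W. \<kappa> P * S P = HS P * \<psi> P)"
  if V: "(V, \<psi>) \<in> atlas E" and W: "(W, \<kappa>) \<in> atlas ?F" for V \<psi> W \<kappa>
 proof -
  obtain U1 \<phi>1 U2 \<phi>2 where U: "(U1, \<phi>1) \<in> atlas L1" "(U2, \<phi>2) \<in> atlas L2" "W = U1 \<inter> U2"
   "\<kappa> = (\<lambda>P. four_block_mat (\<phi>1 P) (0\<^sub>m 1 1) (0\<^sub>m 1 1) (\<phi>2 P))"
   using W L1(2) L2(2) by (auto simp: direct_sum_vb_def)
  let ?A = "V \<inter> W"
  have AX: "?A \<subseteq> X" using chart(2)[OF E(1) V] by blast
  define a where "a = app \<psi> 2 e1"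
  define b where "b = app \<psi> 2 e2"
  define u where "u P = \<phi>1 P $$ (0, 0)" for P
  define v where "v P = \<phi>2 P $$ (0, 0)" for P
  have \<psi>c: "\<psi> P \<in> carrier_mat 2 2" if P: "P \<in> ?A" for P using chart(3)[OF E(1) V] P E(2) by auto
  have \<phi>c: "\<phi>1 P \<in> carrier_mat 1 1" "\<phi>2 P \<in> carrier_mat 1 1" if P: "P \<in> ?A" for P
   using chart(3)[OF L1(1) U(1)] chart(3)[OF L2(1) U(2)] P U(3) L1(2) L2(2) by auto
  have uv: "u P \<noteq> 0" "v P \<noteq> 0" if P: "P \<in> ?A" for P
   using invertible_1x1[OF chart(4)[OF L1(1) U(1)] \<phi>c(1)[OF P]] invertible_1x1[OF chart(4)[OF L2(1) U(2)] \<phi>c(2)[OF P]]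
    P U(3) by (auto simp: u_def v_def)
  define w where "w i j P = \<psi> P $$ (i, j)" for i j P
  have \<psi>2: "\<psi> P = mat2 (w 0 0 P) (w 0 (Suc 0) P) (w (Suc 0) 0 P) (w (Suc 0) (Suc 0) P)" if P: "P \<in> ?A" for P
   unfolding w_def by (rule mat2_eta[OF \<psi>c[OF P]])
  have \<kappa>2: "\<kappa> P = mat2 (u P) 0 0 (v P)" if P: "P \<in> ?A" for P
   unfolding U(4) u_def v_def by (rule four_block_1_1[OF \<phi>c[OF P]])
  have ab: "a i P = w i 0 P * e1 (P, 0) + w i (Suc 0) P * e1 (P, Suc 0)"
   "b i P = w i 0 P * e2 (P, 0) + w i (Suc 0) P * e2 (P, Suc 0)" for i P
   by (simp_all add: a_def b_def app_2 w_def)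
  define \<delta> where "\<delta> P = w 0 0 P * w (Suc 0) (Suc 0) P - w 0 (Suc 0) P * w (Suc 0) 0 P" for P
  have \<delta>: "\<delta> P \<noteq> 0" if P: "P \<in> ?A" for P
   using invertible_2x2[OF chart(4)[OF E(1) V] \<psi>c[OF P]] P unfolding \<delta>_def w_def by auto
  define \<Delta> where "\<Delta> P = a 0 P * b (Suc 0) P - b 0 P * a (Suc 0) P" for P
  have \<Delta>e: "\<Delta> P = \<delta> P * D P" for P
   unfolding \<Delta>_def ab \<delta>_def D_def by (simp add: algebra_simps)
  have \<Delta>nz: "\<Delta> P \<noteq> 0" if P: "P \<in> ?A" for P using \<Delta>e \<delta>[OF P] nonzero(1)[of P] P AX by auto
  define c1 where "c1 P = u P * x P" for P
  define c2 where "c2 P = v P * y P" for P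
  have cnz: "c1 P \<noteq> 0" "c2 P \<noteq> 0" if P: "P \<in> ?A" for P
   using uv[OF P] nonzero(2,3)[of P] P AX unfolding c1_def c2_def by auto
  have la: "lreg k1 ?A (a i) P" "lreg k2 ?A (b i) P" if P: "P \<in> ?A" and i: "i < 2" for P i
   using secsD(2)[OF E(1) e1 V, of P i] secsD(2)[OF E(1) e2 V, of P i] P i E(2)
   unfolding a_def b_def by (auto intro: lreg_mono)
  have lc: "lreg k1 ?A c1 P" "lreg k2 ?A c2 P" if P: "P \<in> ?A" for P
  proof -
   have "lreg k1 U1 (app \<phi>1 1 t1 0) P" "lreg k2 U2 (app \<phi>2 1 t2 0) P"
    using secsD(2)[OF L1(1) t1(1) U(1), of P 0] secsD(2)[OF L2(1) t2(1) U(2), of P 0] P L1(2) L2(2) U(3) by auto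
   moreover have "app \<phi>1 1 t1 0 = c1" "app \<phi>2 1 t2 0 = c2"
    by (simp_all add: fun_eq_iff app_1[unfolded One_nat_def] c1_def c2_def u_def v_def x_def y_def)
   ultimately show "lreg k1 ?A c1 P" "lreg k2 ?A c2 P" using U(3) by (auto intro: lreg_mono)
  qed
  define HT where "HT P = mat2 (a 0 P / c1 P) (b 0 P / c2 P) (a (Suc 0) P / c1 P) (b (Suc 0) P / c2 P)" for P
  \<comment> \<open>The determinant of \<open>HT\<close>. It has degree 0 and no zeros, so dividing
    by it keeps the entries of \<open>HS\<close> regular.\<close>
  define \<epsilon> where "\<epsilon> P = \<Delta> P / (c1 P * c2 P)" for P
  have \<epsilon>nz: "\<epsilon> P \<noteq> 0" if "P \<in> ?A" for P using \<Delta>nz[OF that] cnz[OF that] by (simp add: \<epsilon>_def)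
  define HS where "HS P = mat2 (b (Suc 0) P / c2 P / \<epsilon> P) (- (b 0 P / c2 P) / \<epsilon> P)
   (- (a (Suc 0) P / c1 P) / \<epsilon> P) (a 0 P / c1 P / \<epsilon> P)" for P
  have quot: "lreg 0 ?A (\<lambda>Q. a i Q / c1 Q) P" "lreg 0 ?A (\<lambda>Q. b i Q / c2 Q) P" if P: "P \<in> ?A" and i: "i < 2" for P i
   using lreg_divide[OF la(1)[OF P i] lc(1)[OF P] P cnz(1)[OF P]]
    lreg_divide[OF la(2)[OF P i] lc(2)[OF P] P cnz(2)[OF P]] by auto
  have l\<epsilon>: "lreg 0 ?A \<epsilon> P" if P: "P \<in> ?A" for P
  proof -
   have "lreg (k1 + k2) ?A \<Delta> P"
    unfolding \<Delta>_def[abs_def] by (intro lreg_diff lreg_times[OF la(1) la(2)] lreg_times[OF la(2) la(1)] P) auto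
   then show ?thesis unfolding \<epsilon>_def[abs_def]
    by (rule lreg_divide[OF _ lreg_times[OF lc[OF P] refl] P]) (use cnz[OF P] in auto)
  qed
  have \<psi>T: "\<psi> P * T P = HT P * \<kappa> P" if P: "P \<in> ?A" for P
  proof -
   have c: "c * u P / c1 P = c / x P" "c * v P / c2 P = c / y P" for c
    using uv[OF P] by (simp_all add: c1_def c2_def)
   show ?thesis unfolding \<psi>2[OF P] \<kappa>2[OF P] T_def HT_def mat2_mult
    by (simp add: c) (simp add: ab add_divide_distrib)
  qed
  have "regular_mat_on ?A 2 2 HT"
  proof (rule regular_matI[OF AX])
   show "HT P \<in> carrier_mat 2 2" for P by (simp add: HT_def)
   fix P i j assume P: "P \<in> ?A" and ij: "i < (2 :: nat)" "j < (2 :: nat)"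
   from quot[OF P, of 0] quot[OF P, of "Suc 0"] show "lreg 0 ?A (\<lambda>Q. HT Q $$ (i, j)) P"
    using ij unfolding less_2_cases_iff by (elim disjE) (simp_all add: HT_def)
  qed
  moreover have "regular_mat_on ?A 2 2 HS"
  proof (rule regular_matI[OF AX])
   show "HS P \<in> carrier_mat 2 2" for P by (simp add: HS_def)
   fix P i j assume P: "P \<in> ?A" and ij: "i < (2 :: nat)" "j < (2 :: nat)"
   note l = lreg_divide[OF _ l\<epsilon>[OF P] P \<epsilon>nz[OF P], of 0 _ 0, simplified]
   from l[OF quot(2)[OF P, of "Suc 0"]] l[OF lreg_uminus[OF quot(2)[OF P, of 0]]]
    l[OF lreg_uminus[OF quot(1)[OF P, of "Suc 0"]]] l[OF quot(1)[OF P, of 0]]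
   show "lreg 0 ?A (\<lambda>Q. HS Q $$ (i, j)) P"
    using ij unfolding less_2_cases_iff by (elim disjE) (simp_all add: HS_def)
  qed
  moreover have "\<kappa> P * S P = HS P * \<psi> P" if P: "P \<in> ?A" for P
  proof -
   have PX: "P \<in> X" using P AX by blast
   have \<kappa>c: "\<kappa> P \<in> carrier_mat 2 2" by (simp add: \<kappa>2[OF P])
   have c: "HS P \<in> carrier_mat 2 2" "HT P \<in> carrier_mat 2 2" "T P \<in> carrier_mat 2 2" "S P \<in> carrier_mat 2 2"
    by (simp_all add: HS_def HT_def T_def S_def)
   have "a 0 P / c1 P * (b (Suc 0) P / c2 P) - b 0 P / c2 P * (a (Suc 0) P / c1 P) = \<epsilon> P"
    by (simp add: \<epsilon>_def \<Delta>_def diff_divide_distrib mult.commute)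
   then have "HS P * HT P = 1\<^sub>m 2"
    unfolding HS_def HT_def by (rule mat2_inverse) (rule \<epsilon>nz[OF P])
   then have "\<kappa> P = HS P * (HT P * \<kappa> P)" using assoc_mult_mat[OF c(1,2) \<kappa>c] \<kappa>c by simp
   then have "\<kappa> P * S P = HS P * (\<psi> P * T P) * S P" by (simp add: \<psi>T[OF P])
   also have "\<dots> = HS P * (\<psi> P * (T P * S P))"
    using assoc_mult_mat[OF c(1) mult_carrier_mat[OF \<psi>c[OF P] c(3)] c(4)] assoc_mult_mat[OF \<psi>c[OF P] c(3,4)] by simp
   finally show ?thesis using \<psi>c[OF P] by (simp add: inv(1)[OF PX])
  qed
  ultimately show ?thesis using \<psi>T by (intro exI[of _ HT] exI[of _ HS]) (simp add: Int_commute)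
 qed
 have carrier: "T P \<in> carrier_mat 2 2" "S P \<in> carrier_mat 2 2" for P by (simp_all add: T_def S_def)
 have "bundle_map X E ?F S"
  by (rule bundle_mapI) (use carrier charts rkF E(2) in \<open>simp, metis\<close>)
 moreover have "bundle_map X ?F E T"
  by (rule bundle_mapI) (use carrier charts rkF E(2) in \<open>simp, metis\<close>)
 ultimately show ?thesis unfolding isomorphic_vb_def rkF E(2) using inv by blast
qed

end

global_interpretation p2: coord_ring UNIV pform
proof
 show "pform k f ==> k < 0 ==> f P = 0" for k f P
  using pform_neg[of k f] by (auto simp: fun_ops)
 show "\<exists>f. pform 1 f \<and> f P \<noteq> 0" for P using lin_nonvanishing pform_lin by blast
 show "\<exists>R\<in>UNIV. f R \<noteq> 0 \<and> g R \<noteq> 0" if fg: "pform k f" "pform l g" "f P \<noteq> 0" "g Q \<noteq> 0" for k f l g P Q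
 proof -
  have "f \<noteq> 0" "g \<noteq> 0" using fg by (auto simp: fun_ops)
  then have "f * g \<noteq> 0" using pform_domain[OF fg(1,2)] by blast
  then show ?thesis by (auto simp: fun_eq_iff fun_ops)
 qed
qed (auto intro: pform_0 pform_add pform_mult pform_kk)

global_interpretation p2: coord_space UNIV pform
proof (rule p2.coord_spaceI[of 1])
 show "\<exists>f. pform (1 * int d) f \<and> (\<forall>P\<in>UNIV. f P = p (coords P))" if "form d p" for d p
  using pform_of_form[OF that] by auto
 show "\<exists>p. form d p \<and> (\<forall>P\<in>UNIV. f P = p (coords P))" if "pform (1 * int d) f" for d f
  using that by (auto simp: pform_def)
qed simp

section \<open>Sections on the projective plane\<close>

lemma pform_eq_on_open:
 assumes "pform k a" "pform k b" "pform l h" "h \<noteq> 0" "\<And>Q. h Q \<noteq> 0 ==> a Q = b Q"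
 shows "a = b"
proof -
 have "h * a = h * b" using assms(5) by (auto simp: fun_eq_iff fun_ops)
 then show ?thesis using pform_cancel[OF assms(3,4,1,2)] by blast
qed

lemma pform_nonzero: "f P \<noteq> 0 ==> f \<noteq> (0 :: P2 => complex)"
 by (auto simp: fun_ops)

lemma pform_mult_nonzero: "pform k f ==> pform l g ==> f \<noteq> 0 ==> g \<noteq> 0 ==> f * g \<noteq> 0"
 using pform_domain by blast

text \<open>The denominator in lowest terms of a function that is regular on a dense open set does not
 vanish at any point of that set.\<close>

lemma regular_lowest_terms:
 assumes F: "pform l F" "F \<noteq> 0"
  and g: "p2.lreg k {Q. F Q \<noteq> 0} g R0"
 obtains d p q where "pform (d + k) p" "pform d q" "q \<noteq> 0"
  "\<And>R. p2.lreg k {Q. F Q \<noteq> 0} g R ==> q R \<noteq> 0"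
  "\<And>R. p2.lreg k {Q. F Q \<noteq> 0} g R ==> F R \<noteq> 0 ==> g R = p R / q R"
proof -
 let ?D = "{Q. F Q \<noteq> 0}"
 obtain d p q where 0: "pform (d + k) p" "pform d q" "q R0 \<noteq> 0" "\<forall>Q\<in>?D. q Q \<noteq> 0 --> g Q = p Q / q Q"
  using g unfolding p2.lreg_def by blast
 have qnz: "q \<noteq> 0" using 0(3) by (rule pform_nonzero)
 obtain m h q' p' where lt: "pform m h" "h \<noteq> 0" "pform (d - m) q'" "q' \<noteq> 0" "pform (d + k - m) p'" "q = h * q'" "p = h * p'"
  "\<And>l b k' a. pform l b ==> pform k' a ==> k' + (d - m) = (d + k - m) + l ==> a * q' = p' * b ==> pdvd (d - m) q' l b"
  by (rule lowest_terms[OF 0(2) qnz 0(1)]) (rule that)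
 have main: "q' R \<noteq> 0 \<and> (F R \<noteq> 0 --> g R = p' R / q' R)" if R: "p2.lreg k ?D g R" for R
 proof -
  obtain d1 p1 q1 where 1: "pform (d1 + k) p1" "pform d1 q1" "q1 R \<noteq> 0" "\<forall>Q\<in>?D. q1 Q \<noteq> 0 --> g Q = p1 Q / q1 Q"
   using R unfolding p2.lreg_def by blast
  have q1nz: "q1 \<noteq> 0" using 1(3) by (rule pform_nonzero)
  have "pform (d + k + d1) (p * q1)" by (rule pform_mult[OF 0(1) 1(2)])
  moreover have "pform (d + k + d1) (p1 * q)" using pform_mult[OF 1(1) 0(2)] by (simp add: ac_simps)
  moreover have "pform (l + (d + d1)) (F * (q * q1))" by (intro pform_mult F 0 1)
  moreover have "F * (q * q1) \<noteq> 0"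
   by (intro pform_mult_nonzero[OF F(1) pform_mult[OF 0(2) 1(2)]] F pform_mult_nonzero[OF 0(2) 1(2)] qnz q1nz)
  moreover have "(p * q1) Q = (p1 * q) Q" if "(F * (q * q1)) Q \<noteq> 0" for Q
  proof -
   have nz: "F Q \<noteq> 0" "q Q \<noteq> 0" "q1 Q \<noteq> 0" using that by (auto simp: fun_ops)
   then have "p Q / q Q = p1 Q / q1 Q" using 0(4) 1(4) by force
   then show ?thesis using nz by (simp add: fun_ops field_simps)
  qed
  \<comment> \<open>Two fractions for g agree on a nonempty open set, hence as forms. Coprimality
    then makes q' divide the denominator q1, which is nonzero at R.\<close>
  ultimately have "p * q1 = p1 * q" by (rule pform_eq_on_open)
  then have "h * (p' * q1) = h * (p1 * q')" using lt(6,7) by (simp add: mult_ac)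
  moreover have "pform (d + k - m + d1) (p' * q1)" by (rule pform_mult[OF lt(5) 1(2)])
  moreover have "pform (d + k - m + d1) (p1 * q')" using pform_mult[OF 1(1) lt(3)] by (simp add: algebra_simps)
  ultimately have eq: "p' * q1 = p1 * q'" using pform_cancel[OF lt(1,2)] by blast
  have "pdvd (d - m) q' d1 q1" by (rule lt(8)[OF 1(2,1)]) (simp_all add: eq)
  then obtain x where "q1 = q' * x" unfolding pdvd_def by blast
  then have q'R: "q' R \<noteq> 0" using 1(3) by (auto simp: fun_ops)
  moreover have "g R = p' R / q' R" if "F R \<noteq> 0"
  proof -
   have "g R = p1 R / q1 R" using 1(3,4) that by blast
   also have "\<dots> = p' R / q' R" using fun_cong[OF eq, of R] q'R 1(3) by (simp add: fun_ops field_simps)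
   finally show ?thesis .
  qed
  ultimately show ?thesis by blast
 qed
 show ?thesis
 proof (rule that[of "d - m" p' q'])
  show "pform (d - m + k) p'" using lt(5) by (simp add: algebra_simps)
 qed (use lt(3,4) main in blast)+
qed

text \<open>The denominator in lowest terms has no zeros, whereas a form of positive degree has
  infinitely many; so the denominator is a constant.\<close>

lemma global_form:
 assumes F: "pform l F" "F \<noteq> 0" and g: "\<And>R. p2.lreg k {Q. F Q \<noteq> 0} g R"
 obtains p where "pform k p" "\<And>Q. F Q \<noteq> 0 ==> g Q = p Q"
proof -
 obtain d p q where q: "pform (d + k) p" "pform d q" "q \<noteq> 0"
  "\<And>R. p2.lreg k {Q. F Q \<noteq> 0} g R ==> q R \<noteq> 0"
  "\<And>R. p2.lreg k {Q. F Q \<noteq> 0} g R ==> F R \<noteq> 0 ==> g R = p R / q R"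
  by (rule regular_lowest_terms[OF F g]) (rule that)
 have nz: "q R \<noteq> 0" for R using q(4) g by blast
 then have "finite {R. q R = 0}" by simp
 then have "d < 1" using zeros_infinite[OF q(2)] by fastforce
 moreover have "d \<ge> 0" using pform_neg[OF q(2)] q(3) by force
 ultimately have d: "d = 0" by simp
 then obtain c where c: "q = kk c" using pform_const q(2) by blast
 then have "c \<noteq> 0" using nz by (simp add: kk_apply)
 have "pform k (kk (inverse c) * p)" using pform_kk_mult[OF q(1)] d by simp
 moreover have "g Q = (kk (inverse c) * p) Q" if "F Q \<noteq> 0" for Q
  using q(5)[OF g that] c by (simp add: fun_ops kk_apply divide_inverse)
 ultimately show ?thesis by (rule that)
qed

text \<open>A function that is regular where f h is nonzero has, in lowest terms, a denominator
  whose zeros lie on f h = 0; by the Nullstellensatz it divides a power of f h. The power of f is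
  moved to the left, and the power of h is nonzero at R.\<close>

lemma clear_denominators:
 assumes f: "pform e f" "f \<noteq> 0" and V: "p2.zopen V" "R \<in> V"
  and g: "\<And>Q. Q \<in> V ==> f Q \<noteq> 0 ==> p2.lreg 0 (V \<inter> {Q. f Q \<noteq> 0}) g Q"
 shows "\<exists>N. p2.lreg (int N * e) (V \<inter> {Q. f Q \<noteq> 0}) (f ^ N * g) R"
proof -
 obtain l h where h: "pform l h" "h R \<noteq> 0" "\<And>Q. Q \<in> UNIV ==> h Q \<noteq> 0 ==> Q \<in> V"
  by (rule p2.zopenD[OF V]) (rule that)
 have hnz: "h \<noteq> 0" using h(2) by (rule pform_nonzero)
 define F where "F = f * h"
 have F: "pform (e + l) F" "F \<noteq> 0"
  unfolding F_def by (rule pform_mult[OF f(1) h(1)], rule pform_mult_nonzero[OF f(1) h(1) f(2) hnz])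
 have reg: "p2.lreg 0 {Q. F Q \<noteq> 0} g Q" if "F Q \<noteq> 0" for Q
 proof (rule p2.lreg_mono[OF g])
  show "Q \<in> V" "f Q \<noteq> 0" using that h(3)[of Q] by (auto simp: F_def fun_ops)
  show "{Q. F Q \<noteq> 0} \<subseteq> V \<inter> {Q. f Q \<noteq> 0}" using h(3) by (auto simp: F_def fun_ops)
 qed
 obtain Q0 where "F Q0 \<noteq> 0" using F(2) by (auto simp: fun_eq_iff fun_ops)
 then obtain d p q where q: "pform (d + 0) p" "pform d q" "q \<noteq> 0"
  "\<And>R. p2.lreg 0 {Q. F Q \<noteq> 0} g R ==> q R \<noteq> 0"
  "\<And>R. p2.lreg 0 {Q. F Q \<noteq> 0} g R ==> F R \<noteq> 0 ==> g R = p R / q R"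
  by (rule regular_lowest_terms[OF F reg]) (rule that)
 have "\<exists>N. pdvd d q (int N * (e + l)) (F ^ N)"
  by (rule hypersurface_nullstellensatz[OF q(2,3) F(1)]) (use q(4) reg in blast)
 then obtain N x where x: "pform (int N * (e + l) - d) x" "F ^ N = q * x" unfolding pdvd_def by blast
 have pow: "(a ^ n) Q = a Q ^ n" for a :: "P2 => complex" and n Q by (induction n) (auto simp: fun_ops)
 have "pform (d + (int N * (e + l) - d) + l) (p * x * h)"
  using pform_mult[OF pform_mult[OF q(1)[simplified] x(1)] h(1)] .
 moreover have "d + (int N * (e + l) - d) + l = (int N * l + l) + int N * e" by (simp add: algebra_simps)
 ultimately have 1: "pform ((int N * l + l) + int N * e) (p * x * h)" by metis
 \<comment> \<open>The extra factor h makes the denominator vanish wherever h does, even if N =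
   0.\<close>
 have 2: "pform (int N * l + l) (h ^ N * h)" by (rule pform_mult[OF pform_power[OF h(1)] h(1)])
 have 3: "(h ^ N * h) R \<noteq> 0" using h(2) by (simp add: fun_ops pow)
 have 4: "\<forall>Q\<in>V \<inter> {Q. f Q \<noteq> 0}. (h ^ N * h) Q \<noteq> 0 --> (f ^ N * g) Q = (p * x * h) Q / (h ^ N * h) Q"
 proof (intro ballI impI)
  fix Q assume Q: "Q \<in> V \<inter> {Q. f Q \<noteq> 0}" "(h ^ N * h) Q \<noteq> 0"
  then have nz: "h Q \<noteq> 0" "f Q \<noteq> 0" by (auto simp: fun_ops)
  then have FQ: "F Q \<noteq> 0" by (simp add: F_def fun_ops)
  have "f Q ^ N * h Q ^ N = q Q * x Q"
   using fun_cong[OF x(2), of Q] by (simp add: pow fun_ops F_def power_mult_distrib)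
  moreover have "g Q = p Q / q Q" "q Q \<noteq> 0" using q(4,5)[OF reg[OF FQ]] FQ by auto
  ultimately show "(f ^ N * g) Q = (p * x * h) Q / (h ^ N * h) Q"
   using nz by (simp add: fun_ops pow field_simps)
 qed
 show ?thesis unfolding p2.lreg_def using 1 2 3 4 by blast
qed

lemma form_continuous: "form d p ==> continuous_on UNIV p"
proof -
 assume "form d p"
 then obtain a where p: "p = (\<lambda>v. \<Sum>i\<le>d. \<Sum>j\<le>d - i. a i j * (v $ 1) ^ i * (v $ 2) ^ j * (v $ 3) ^ (d - i - j))"
  unfolding form_def by blast
 show ?thesis unfolding p by (intro continuous_intros)
qed

text \<open>Euclidean compactness in place of the Noetherian property: the sets where the forms are
  nonzero are open in C^3 and cover the unit sphere, and every point of the plane has a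
  representative on the sphere.\<close>

lemma quasi_compact:
 assumes "\<And>R. pform (d R) (h R)" "\<And>R. h R R \<noteq> 0"
 shows "\<exists>F. finite F \<and> (\<forall>Q. \<exists>R\<in>F. h R Q \<noteq> 0)"
proof -
 have "\<exists>p. form (nat (d R)) p \<and> h R = (\<lambda>P. p (coords P))" for R
  using pformE[OF assms(1) pform_nonzero[of "h R" R, OF assms(2)]] by (metis nat_int)
 then obtain p where p: "\<And>R. form (nat (d R)) (p R)" "\<And>R Q. h R Q = p R (coords Q)" by metis
 let ?U = "\<lambda>R. {v. p R v \<noteq> 0}"
 have op: "open (?U R)" for R
 proof -
  have "?U R = p R -` (- {0})" by auto
  then show ?thesis using continuous_open_vimage[of "- {0}" "p R"] form_continuous[OF p(1)]
   by (metis closed_singleton continuous_on_eq_continuous_at open_Compl open_UNIV UNIV_I)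
 qed
 have cov: "sphere 0 1 \<subseteq> (\<Union>R\<in>UNIV. ?U R)"
 proof
  fix v :: "complex ^ 3" assume "v \<in> sphere 0 1"
  then have v: "v \<noteq> 0" by auto
  obtain c where c: "c \<noteq> 0" "coords (abs_P2 v) = c *s v" using coords_abs[OF v] by blast
  have "p (abs_P2 v) (coords (abs_P2 v)) \<noteq> 0" using assms(2) p(2) by metis
  then have "p (abs_P2 v) v \<noteq> 0" using form_homogeneous[OF p(1)] c by auto
  then show "v \<in> (\<Union>R\<in>UNIV. ?U R)" by blast
 qed
 obtain F where F: "finite F" "sphere 0 1 \<subseteq> (\<Union>R\<in>F. ?U R)"
  by (rule compactE_image[OF compact_sphere op cov]) (rule that)
 have "\<exists>R\<in>F. h R Q \<noteq> 0" for Q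
 proof -
  define c where "c = complex_of_real (1 / norm (coords Q))"
  have n: "norm (coords Q) \<noteq> 0" using coords_nonzero[of Q] by simp
  have "c *s coords Q = (1 / norm (coords Q)) *\<^sub>R coords Q"
   by (simp add: Finite_Cartesian_Product.vec_eq_iff c_def) (simp add: scaleR_conv_of_real)
  then have "norm (c *s coords Q) = 1" using n by simp
  then obtain R where "R \<in> F" "p R (c *s coords Q) \<noteq> 0" using F(2) by auto
  then show ?thesis using form_homogeneous[OF p(1)] p(2) by (metis mult_zero_right)
 qed
 with F(1) show ?thesis by blast
qed

context
 fixes E :: vb
 assumes E: "vector_bundle UNIV E"
begin

text \<open>One exponent n clears the denominators of the transition matrices, in both directions,
  between the fixed chart and suitable charts around all points. It exists near each point by
  \<open>clear_denominators\<close>, and globally by quasi-compactness.\<close>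

lemma uniform_denominators:
 assumes U: "(U, \<phi>) \<in> atlas E" and f: "pform e f" "f \<noteq> 0" "\<And>Q. f Q \<noteq> 0 ==> Q \<in> U"
 obtains n where "n \<ge> 1" "\<And>R. \<exists>V \<psi> G G'. (V, \<psi>) \<in> atlas E \<and> R \<in> V \<and>
  (\<forall>Q\<in>U \<inter> V. G Q \<in> carrier_mat (rk E) (rk E) \<and> \<psi> Q = G Q * \<phi> Q) \<and>
  (\<forall>Q\<in>V \<inter> U. G' Q \<in> carrier_mat (rk E) (rk E) \<and> \<phi> Q = G' Q * \<psi> Q) \<and>
  (\<forall>i<rk E. \<forall>j<rk E. p2.lreg (int n * e) (V \<inter> {Q. f Q \<noteq> 0}) (f ^ n * (\<lambda>Q. G Q $$ (i, j))) R \<and>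
   p2.lreg (int n * e) (V \<inter> {Q. f Q \<noteq> 0}) (f ^ n * (\<lambda>Q. G' Q $$ (i, j))) R)"
proof -
 let ?r = "rk E" and ?D = "{Q. f Q \<noteq> 0}"
 define entries where "entries G = (\<lambda>(i, j) Q. G Q $$ (i, j)) ` ({..<?r} \<times> {..<?r})" for G :: "P2 => complex mat"
 have entryI: "(\<lambda>Q. G Q $$ (i, j)) \<in> entries G" if "i < ?r" "j < ?r" for G i j
  unfolding entries_def by (rule image_eqI[of _ _ "(i, j)"]) (use that in auto)
 define good where "good n R \<longleftrightarrow> (\<exists>V \<psi> G G'. (V, \<psi>) \<in> atlas E \<and> R \<in> V \<and>
  (\<forall>Q\<in>U \<inter> V. G Q \<in> carrier_mat ?r ?r \<and> \<psi> Q = G Q * \<phi> Q) \<and>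
  (\<forall>Q\<in>V \<inter> U. G' Q \<in> carrier_mat ?r ?r \<and> \<phi> Q = G' Q * \<psi> Q) \<and>
  (\<forall>g\<in>entries G \<union> entries G'. p2.lreg (int n * e) (V \<inter> ?D) (f ^ n * g) R))" for n R
 have raise: "p2.lreg (int n * e) A (f ^ n * g) R" if "p2.lreg (int N * e) A (f ^ N * g) R" "N \<le> n" for N n A g R
 proof -
  have "p2.lreg (int (n - N) * e + int N * e) A (f ^ (n - N) * (f ^ N * g)) R"
   by (rule p2.lreg_mult[OF p2.lreg_H[OF pform_power[OF f(1)]] that(1)])
  moreover have "int (n - N) * e + int N * e = int n * e" using that(2) by (simp add: of_nat_diff algebra_simps)
  moreover have "f ^ (n - N) * (f ^ N * g) = f ^ n * g"
   using that(2) by (simp add: mult.assoc[symmetric] power_add[symmetric])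
  ultimately show ?thesis by simp
 qed
 have mono: "good n R" if good: "good N R" and le: "N \<le> n" for N n R
 proof -
  from good obtain V \<psi> G G' where *: "(V, \<psi>) \<in> atlas E" "R \<in> V"
   "\<forall>Q\<in>U \<inter> V. G Q \<in> carrier_mat ?r ?r \<and> \<psi> Q = G Q * \<phi> Q"
   "\<forall>Q\<in>V \<inter> U. G' Q \<in> carrier_mat ?r ?r \<and> \<phi> Q = G' Q * \<psi> Q"
   "\<forall>g\<in>entries G \<union> entries G'. p2.lreg (int N * e) (V \<inter> ?D) (f ^ N * g) R"
   unfolding good_def by (elim exE conjE) (rule that)
  show ?thesis
   unfolding good_def by (intro exI[of _ V] exI[of _ \<psi>] exI[of _ G] exI[of _ G'] conjI * ballI raise[OF _ le]) (rule *(5)[rule_format])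
 qed
 have "\<forall>R. \<exists>N d h. pform d h \<and> h R \<noteq> 0 \<and> (\<forall>S. h S \<noteq> 0 --> good N S)"
 proof
  fix R
  obtain V \<psi> where V: "(V, \<psi>) \<in> atlas E" "R \<in> V" using p2.chart_ex[OF E, of R] by blast
  obtain G where G: "\<And>P. P \<in> U \<inter> V ==> G P \<in> carrier_mat ?r ?r" "\<And>P. P \<in> U \<inter> V ==> \<psi> P = G P * \<phi> P"
   "\<And>P i j. P \<in> U \<inter> V ==> i < ?r ==> j < ?r ==> p2.lreg 0 (U \<inter> V) (\<lambda>Q. G Q $$ (i, j)) P"
   by (rule p2.transition[OF E U V(1)]) (rule that)
  obtain G' where G': "\<And>P. P \<in> V \<inter> U ==> G' P \<in> carrier_mat ?r ?r" "\<And>P. P \<in> V \<inter> U ==> \<phi> P = G' P * \<psi> P"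
   "\<And>P i j. P \<in> V \<inter> U ==> i < ?r ==> j < ?r ==> p2.lreg 0 (V \<inter> U) (\<lambda>Q. G' Q $$ (i, j)) P"
   by (rule p2.transition[OF E V(1) U]) (rule that)
  let ?I = "entries G \<union> entries G'"
  note zV = p2.chart(1)[OF E V(1)]
  have "V \<inter> ?D \<subseteq> U \<inter> V" "V \<inter> ?D \<subseteq> V \<inter> U" using f(3) by auto
  note VU = p2.lreg_mono[OF _ this(1)] p2.lreg_mono[OF _ this(2)]
  have fin: "finite ?I" by (simp add: entries_def)
  have "\<forall>g\<in>?I. \<exists>N. p2.lreg (int N * e) (V \<inter> ?D) (f ^ N * g) R"
  proof
   fix g assume g: "g \<in> ?I"
   show "\<exists>N. p2.lreg (int N * e) (V \<inter> ?D) (f ^ N * g) R"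
   proof (rule clear_denominators[OF f(1,2) zV V(2)])
    fix Q assume "Q \<in> V" "f Q \<noteq> 0"
    then have Q: "Q \<in> U \<inter> V" "Q \<in> V \<inter> U" using f(3) by auto
    show "p2.lreg 0 (V \<inter> ?D) g Q"
     using g VU(1)[OF G(3)[OF Q(1)]] VU(2)[OF G'(3)[OF Q(2)]] by (auto simp: entries_def)
   qed
  qed
  from bchoice[OF this] obtain N where N: "\<forall>g\<in>?I. p2.lreg (int (N g) * e) (V \<inter> ?D) (f ^ N g * g) R" ..
  define M where "M = Max (insert 0 (N ` ?I))"
  have "N g \<le> M" if "g \<in> ?I" for g unfolding M_def using that fin by (intro Max_ge) auto
  then have M: "p2.lreg (int M * e) (V \<inter> ?D) (f ^ M * g) R" if "g \<in> ?I" for g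
   using raise N that by blast
  obtain d h where h: "pform d h" "h R \<noteq> 0" "\<And>Q. Q \<in> UNIV ==> h Q \<noteq> 0 ==> Q \<in> V"
   by (rule p2.zopenD[OF zV V(2)]) (rule that)
  have "\<exists>d h. pform d h \<and> h R \<noteq> 0 \<and> (\<forall>S. h S \<noteq> 0 --> (\<forall>g\<in>?I. p2.lreg (int M * e) (V \<inter> ?D) (f ^ M * g) S))"
   by (rule p2.finite_near[OF fin p2.lreg_near[OF M]])
  then obtain d' h' where h': "pform d' h'" "h' R \<noteq> 0"
   "\<And>S g. h' S \<noteq> 0 ==> g \<in> ?I ==> p2.lreg (int M * e) (V \<inter> ?D) (f ^ M * g) S" by blast
  have "good M S" if "(h * h') S \<noteq> 0" for S
  proof -
   have S: "h S \<noteq> 0" "h' S \<noteq> 0" using that by (auto simp: fun_ops)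
   show ?thesis unfolding good_def
    by (intro exI[of _ V] exI[of _ \<psi>] exI[of _ G] exI[of _ G'] conjI ballI V(1) h(3) UNIV_I S(1) G(1,2) G'(1,2) h'(3)[OF S(2)])
  qed
  moreover have "(h * h') R \<noteq> 0" using h(2) h'(2) by (simp add: fun_ops)
  ultimately show "\<exists>N d h. pform d h \<and> h R \<noteq> 0 \<and> (\<forall>S. h S \<noteq> 0 --> good N S)"
   using pform_mult[OF h(1) h'(1)] by blast
 qed
 from choice[OF this] obtain N where "\<forall>R. \<exists>d h. pform d h \<and> h R \<noteq> 0 \<and> (\<forall>S. h S \<noteq> 0 --> good (N R) S)" ..
 from choice[OF this] obtain d where "\<forall>R. \<exists>h. pform (d R) h \<and> h R \<noteq> 0 \<and> (\<forall>S. h S \<noteq> 0 --> good (N R) S)" ..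
 from choice[OF this] obtain h where h: "pform (d R) (h R)" "h R R \<noteq> 0" "h R S \<noteq> 0 ==> good (N R) S" for R S by blast
 obtain F where F: "finite F" "\<forall>Q. \<exists>R\<in>F. h R Q \<noteq> 0" using quasi_compact[of d h] h(1,2) by blast
 define n where "n = Max (insert 1 (N ` F))"
 have n1: "n \<ge> 1" and nN: "R \<in> F ==> N R \<le> n" for R
  unfolding n_def using F(1) by (auto intro: Max_ge)
 show ?thesis
 proof (rule that[OF n1])
  fix S
  obtain R where R: "R \<in> F" "h R S \<noteq> 0" using F(2) by blast
  obtain V \<psi> G G' where *: "(V, \<psi>) \<in> atlas E" "S \<in> V"
   "\<forall>Q\<in>U \<inter> V. G Q \<in> carrier_mat ?r ?r \<and> \<psi> Q = G Q * \<phi> Q"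
   "\<forall>Q\<in>V \<inter> U. G' Q \<in> carrier_mat ?r ?r \<and> \<phi> Q = G' Q * \<psi> Q"
   "\<forall>g\<in>entries G \<union> entries G'. p2.lreg (int n * e) (V \<inter> ?D) (f ^ n * g) S"
   using mono[OF h(3)[OF R(2)] nN[OF R(1)]] unfolding good_def by (elim exE conjE) (rule that)
  show "\<exists>V \<psi> G G'. (V, \<psi>) \<in> atlas E \<and> S \<in> V \<and>
  (\<forall>Q\<in>U \<inter> V. G Q \<in> carrier_mat ?r ?r \<and> \<psi> Q = G Q * \<phi> Q) \<and>
  (\<forall>Q\<in>V \<inter> U. G' Q \<in> carrier_mat ?r ?r \<and> \<phi> Q = G' Q * \<psi> Q) \<and>
  (\<forall>i<?r. \<forall>j<?r. p2.lreg (int n * e) (V \<inter> ?D) (f ^ n * (\<lambda>Q. G Q $$ (i, j))) S \<and>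
   p2.lreg (int n * e) (V \<inter> ?D) (f ^ n * (\<lambda>Q. G' Q $$ (i, j))) S)"
   using *(5) by (intro exI[of _ V] exI[of _ \<psi>] exI[of _ G] exI[of _ G'] conjI * allI impI) (simp_all add: entryI)
 qed
qed

end

section \<open>Finite dimension and growth of spaces of sections\<close>

lemma inj_fd:
 assumes f: "lin_map f" and V: "fs.subspace V" and W: "fd W" "\<And>v. v \<in> V ==> f v \<in> W"
  and inj: "\<And>v. v \<in> V ==> f v = 0 ==> v = 0"
 shows "fd V" "fs.dim V \<le> fs.dim W"
proof -
 obtain B where B: "B \<subseteq> V" "fs.independent B" "V \<subseteq> fs.span B"
  using fs.basis_exists[of V] by metis
 have spV: "fs.span B \<subseteq> V" by (rule fs.span_minimal[OF B(1) V])
 have injB: "inj_on f (fs.span B)"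
 proof (rule inj_onI)
  fix u v assume uv: "u \<in> fs.span B" "v \<in> fs.span B" "f u = f v"
  then have "u - v \<in> V" using fs.subspace_diff[OF V] spV by blast
  then show "u = v" using inj[of "u - v"] uv(3) lin_mapD(4)[OF f] by simp
 qed
 have ind: "fs.independent (f ` B)"
  by (rule fp.linear_independent_injective_image[OF f B(2) injB])
 have "f ` B \<subseteq> W" using B(1) W(2) by blast
 from independent_fd[OF W(1) this ind] have "finite (f ` B)" ..
 then have "finite B"
  by (rule finite_imageD) (rule inj_on_subset[OF injB fs.span_superset])
 then show fd: "fd V" unfolding fd_def using B(3) by blast
 have "fs.dim V = fs.dim (f ` V)" by (rule dim_inj_image[OF f V fd inj, symmetric])
 also have "\<dots> \<le> fs.dim W" by (rule dim_mono_fd[OF W(1)]) (use W(2) in blast)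
 finally show "fs.dim V \<le> fs.dim W" .
qed

definition form_vecs :: "nat => int => (P2 \<times> nat => complex) set" where
 "form_vecs r m = {\<tau>. (\<forall>i<r. pform m (\<lambda>Q. \<tau> (Q, i))) \<and> (\<forall>Q. \<forall>i\<ge>r. \<tau> (Q, i) = 0)}"

lemma subspace_form_vecs: "fs.subspace (form_vecs r m)"
proof (rule fs.subspaceI)
 show "0 \<in> form_vecs r m"
  using pform_0[of m] by (simp add: form_vecs_def zero_fun_apply) (simp add: zero_fun_def)
 show "\<sigma> + \<tau> \<in> form_vecs r m" if "\<sigma> \<in> form_vecs r m" "\<tau> \<in> form_vecs r m" for \<sigma> \<tau>
  using that pform_add[of m "\<lambda>Q. \<sigma> (Q, i)" "\<lambda>Q. \<tau> (Q, i)" for i]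
  by (simp add: form_vecs_def plus_fun_apply) (simp add: plus_fun_def)
 show "cscale c \<sigma> \<in> form_vecs r m" if "\<sigma> \<in> form_vecs r m" for c \<sigma>
  using that pform_kk_mult[of m "\<lambda>Q. \<sigma> (Q, i)" c for i]
  by (simp add: form_vecs_def cscale_apply) (simp add: times_fun_def kk_def)
qed

lemma dim_form_vecs: "fd (form_vecs r m) \<and> fs.dim (form_vecs r m) \<le> r * fs.dim (pforms m)"
proof (induction r)
 case 0
 have "form_vecs 0 m = {0}"
  using fs.subspace_0[OF subspace_form_vecs[of 0 m]] by (auto simp: form_vecs_def fun_eq_iff fun_ops)
 moreover have "fd {0 :: P2 \<times> nat => complex}" unfolding fd_def by (rule exI[of _ "{}"]) auto
 ultimately show ?case using dim_0_fd[OF subspace_form_vecs[of 0 m]] by simp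
next
 case (Suc r)
 let ?e = "\<lambda>p (Q, i). if i = r then p Q else (0 :: complex)"
 have e: "lin_map ?e" by (rule lin_mapI) (auto simp: fun_eq_iff fun_ops cscale_apply)
 let ?I = "?e ` pforms m"
 note I = subspace_image[OF e subspace_pforms] rank_nullity(1)[OF e subspace_pforms fd_pforms]
 let ?S = "{v + w | v w. v \<in> form_vecs r m \<and> w \<in> ?I}"
 have "form_vecs (Suc r) m \<subseteq> ?S"
 proof
  fix \<tau> assume \<tau>: "\<tau> \<in> form_vecs (Suc r) m"
  define w where "w = ?e (\<lambda>Q. \<tau> (Q, r))"
  define v where "v = \<tau> - w"
  have "w \<in> ?I" unfolding w_def using \<tau> by (intro imageI) (simp add: mem_pforms form_vecs_def)
  moreover have "v \<in> form_vecs r m" unfolding form_vecs_def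
  proof (intro CollectI conjI allI impI)
   fix i assume i: "i < r"
   then have "(\<lambda>Q. v (Q, i)) = (\<lambda>Q. \<tau> (Q, i))" by (simp add: v_def w_def fun_ops)
   then show "pform m (\<lambda>Q. v (Q, i))" using \<tau> i by (simp add: form_vecs_def)
  next
   fix Q i assume "r \<le> i"
   then show "v (Q, i) = 0" using \<tau> by (cases "i = r") (simp_all add: v_def w_def fun_ops form_vecs_def)
  qed
  moreover have "\<tau> = v + w" by (simp add: v_def)
  ultimately show "\<tau> \<in> ?S" by (intro CollectI exI[of _ v] exI[of _ w] conjI)
 qed
 note sub = this
 note IH = Suc[THEN conjunct1]
 have fdS: "fd ?S" by (rule fd_sum[OF IH I(2)])
 have 1: "fd (form_vecs (Suc r) m)" "fs.dim (form_vecs (Suc r) m) \<le> fs.dim ?S"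
  by (rule fd_subset[OF fdS sub]) (rule dim_mono_fd[OF fdS sub])
 have "fs.dim ?S \<le> fs.dim (form_vecs r m) + fs.dim ?I"
  using dim_sums_Int_fd[OF subspace_form_vecs IH I, where ?k2 = m] by linarith
 moreover have "fs.dim ?I \<le> fs.dim (pforms m)" by (rule dim_image_le_fd[OF e subspace_pforms fd_pforms])
 ultimately have "fs.dim ?S \<le> Suc r * fs.dim (pforms m)" using Suc[THEN conjunct2] by simp
 with 1 show ?case by (simp add: conjI)
qed

text \<open>By \<open>conv\<close> the corrected first difference \<open>D\<close> is eventually
  nondecreasing; \<open>bound\<close> keeps it bounded, and a bounded monotone sequence of integers
  is eventually constant. So h is eventually a quadratic polynomial.\<close>

lemma quadratic_growth:
 fixes h :: "nat => int" and r m :: nat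
 assumes conv: "\<And>k. k \<ge> K ==> h (k + 2) - 2 * h (k + 1) + h k \<ge> int r"
  and bound: "\<And>k. 2 * h k \<le> int r * (int k + int m + 1) * (int k + int m + 2)"
 shows "\<exists>a b. \<exists>K. \<forall>k\<ge>K. 2 * h k = int r * (int k + 1) * (int k + 2) + 2 * a * int k + b"
proof -
 define D where "D k = h (k + 1) - h k - int r * int k" for k
 have mono: "D k \<le> D (Suc k)" if "k \<ge> K" for k
  using conv[OF that] by (simp add: D_def algebra_simps)
 have monoD: "D k \<le> D l" if "K \<le> k" "k \<le> l" for k l
  using that(2)
 proof (induction l rule: dec_induct)
  case (step n)
  then show ?case using mono[of n] that(1) by linarith
 qed simp
 \<comment> \<open>If \<open>D\<close> exceeded this value, then from that point on 2 h would grow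
   with the same quadratic coefficient as the upper bound but a larger linear one; \<open>n\<close>
   below is a number of steps after which this is a contradiction.\<close>
 define B where "B = int r * (int m + 3)"
 have bounded: "D l \<le> B" if l: "l \<ge> K" for l
 proof (rule ccontr)
  assume "\<not> D l \<le> B"
  then have D: "D k \<ge> B + 1" if "k \<ge> l" for k using monoD[of l k] l that by linarith
  have low: "2 * h (l + n) \<ge> 2 * h l + int n * (2 * B + 2) + int r * (2 * int l * int n + int n * (int n - 1))" for n
  proof (induction n)
   case (Suc n)
   have "h (l + Suc n) \<ge> h (l + n) + int r * int (l + n) + B + 1" using D[of "l + n"] by (simp add: D_def)
   then have "2 * h (l + Suc n) \<ge> 2 * h (l + n) + 2 * int r * int (l + n) + 2 * B + 2" by linarith
   then show ?case using Suc by (simp add: algebra_simps)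
  qed simp
  define n where "n = nat \<bar>int r * (int l + int m + 1) * (int l + int m + 2) - 2 * h l\<bar> + 1"
  have up: "2 * h (l + n) \<le> int r * (int (l + n) + int m + 1) * (int (l + n) + int m + 2)" by (rule bound)
  have "int n * (2 * B + 2) + int r * (2 * int l * int n + int n * (int n - 1)) \<le>
    int r * (int l + int m + 1) * (int l + int m + 2) - 2 * h l + int r * (2 * int l * int n + 2 * int m * int n + 3 * int n + int n * int n)"
   using low[of n] up by (simp add: algebra_simps)
  then have "int n * 2 + int r * int n * 2 \<le> int r * (int l + int m + 1) * (int l + int m + 2) - 2 * h l"
   unfolding B_def by (simp add: algebra_simps)
  moreover have "int r * int n \<ge> 0" by simp
  moreover have "int n \<ge> int r * (int l + int m + 1) * (int l + int m + 2) - 2 * h l + 1" unfolding n_def by linarith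
  moreover have "int n \<ge> 1" by (simp add: n_def)
  ultimately show False by linarith
 qed
 have "\<exists>L\<ge>K. \<forall>k\<ge>L. D k = D L"
 proof -
  define S where "S = D ` {K..}"
  have fin: "finite S"
   by (rule finite_subset[of _ "{D K..B}"]) (use bounded monoD in \<open>auto simp: S_def\<close>)
  have "Max S \<in> S" by (rule Max_in[OF fin]) (auto simp: S_def)
  then obtain L where L: "L \<ge> K" "D L = Max S" by (auto simp: S_def)
  have "D k = D L" if "k \<ge> L" for k
  proof (rule antisym)
   show "D k \<le> D L" unfolding L(2) by (rule Max_ge[OF fin]) (use that L(1) in \<open>auto simp: S_def\<close>)
  qed (rule monoD[OF L(1) that])
  with L(1) show ?thesis by blast
 qed
 then obtain L where L: "L \<ge> K" "\<And>k. k \<ge> L ==> D k = D L" by blast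
 \<comment> \<open>As (k + 1) (k + 2) increases by 2 k + 4, the quadratic part accounts for 2 r of
   the constant difference, and a is the remainder.\<close>
 define a where "a = D L - 2 * int r"
 define b where "b = 2 * h L - int r * (int L + 1) * (int L + 2) - 2 * a * int L"
 have "2 * h k = int r * (int k + 1) * (int k + 2) + 2 * a * int k + b" if "k \<ge> L" for k
  using that
 proof (induction k rule: dec_induct)
  case (step n)
  have "h (n + 1) = h n + int r * int n + D L" using L(2)[of n] step by (simp add: D_def)
  then show ?case using step.IH by (simp add: a_def algebra_simps)
 qed (simp add: b_def)
 then show ?thesis by blast
qed

text \<open>The point is the cross product of a and b, which is nonzero because they are
  independent.\<close>

lemma common_zero:
 assumes "indep a b"
 obtains P where "lin a P = 0" "lin b P = 0"
proof -
 define v :: "complex ^ 3" where "v = vector [a $ 2 * b $ 3 - a $ 3 * b $ 2, a $ 3 * b $ 1 - a $ 1 * b $ 3, a $ 1 * b $ 2 - a $ 2 * b $ 1]"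
 have v: "v $ 1 = a $ 2 * b $ 3 - a $ 3 * b $ 2" "v $ 2 = a $ 3 * b $ 1 - a $ 1 * b $ 3" "v $ 3 = a $ 1 * b $ 2 - a $ 2 * b $ 1"
  by (simp_all add: v_def vector_3)
 have "v \<noteq> 0"
 proof
  assume v0: "v = 0"
  have "b $ i *s a + (- (a $ i)) *s b = 0" for i
   using exhaust_3[of i] v unfolding v0
   by (auto simp: Finite_Cartesian_Product.vec_eq_iff forall_3 algebra_simps)
  then have "a $ i = 0" for i using assms unfolding indep_def by (metis neg_equal_0_iff_equal)
  then have "1 *s a + 0 *s b = 0" by (simp add: Finite_Cartesian_Product.vec_eq_iff)
  then show False using assms unfolding indep_def by (metis zero_neq_one)
 qed
 then obtain c where c: "coords (abs_P2 v) = c *s v" using coords_abs by blast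
 show ?thesis by (rule that[of "abs_P2 v"]) (simp_all add: lin_def c v algebra_simps)
qed

section \<open>Division of sections by forms, and the Hilbert polynomial\<close>

context coord_space
begin

text \<open>Where f is nonzero the quotient is a section; at the zeros of f, \<open>div\<close>
  provides the fractions that \<open>secs_extend\<close> asks for.\<close>

lemma secs_divisible:
 assumes E: "vector_bundle X E" and \<sigma>: "\<sigma> \<in> secs E k" and f: "H e f" "P0 \<in> X" "f P0 \<noteq> 0"
  and div: "\<And>U \<phi> R i d p q. (U, \<phi>) \<in> atlas E ==> R \<in> U ==> i < rk E ==> f R = 0 ==> H (d + k) p ==> H d q ==>
   q R \<noteq> 0 ==> \<forall>Q\<in>U. q Q \<noteq> 0 --> app \<phi> (rk E) \<sigma> i Q = p Q / q Q ==> \<exists>x. H (d + k - e) x \<and> (\<forall>Q\<in>X. p Q = f Q * x Q)"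
 obtains \<tau> where "\<tau> \<in> secs E (k - e)" "\<sigma> = lift f * \<tau>"
proof -
 let ?\<sigma>0 = "\<lambda>(Q, j). \<sigma> (Q, j) / f Q"
 have app: "app \<phi> (rk E) ?\<sigma>0 i = (\<lambda>Q. app \<phi> (rk E) \<sigma> i Q / f Q)" for \<phi> i
  by (simp add: app_def sum_divide_distrib fun_eq_iff)
 have "\<exists>(U, \<phi>) \<in> atlas E. R \<in> U \<and> (\<forall>i<rk E. lreg (k - e) (U \<inter> {Q \<in> X. f Q \<noteq> 0}) (app \<phi> (rk E) ?\<sigma>0 i) R)" if R: "R \<in> X" for R
 proof -
  obtain U \<phi> where U: "(U, \<phi>) \<in> atlas E" "R \<in> U" by (rule chart_ex[OF E R])
  have "lreg (k - e) (U \<inter> {Q \<in> X. f Q \<noteq> 0}) (\<lambda>Q. app \<phi> (rk E) \<sigma> i Q / f Q) R" if i: "i < rk E" for i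
  proof -
   obtain d p q where 1: "H (d + k) p" "H d q" "q R \<noteq> 0" "\<forall>Q\<in>U. q Q \<noteq> 0 --> app \<phi> (rk E) \<sigma> i Q = p Q / q Q"
    using secsD(2)[OF E \<sigma> U i] unfolding lreg_def by blast
   show ?thesis
   proof (cases "f R = 0")
    case False
    have "H (d + e + (k - e)) p" "H (d + e) (q * f)" using 1(1) H_mult[OF 1(2) f(1)] by simp_all
    moreover have "(q * f) R \<noteq> 0" using 1(3) False by (simp add: fun_ops)
    ultimately show ?thesis unfolding lreg_def using 1(4)
     by (intro exI[of _ "d + e"] exI[of _ p] exI[of _ "q * f"]) (simp add: fun_ops)
   next
    case True
    from div[OF U i True 1] obtain x where x: "H (d + k - e) x" "\<forall>Q\<in>X. p Q = f Q * x Q" by blast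
    then have "H (d + (k - e)) x" by (simp add: algebra_simps)
    then show ?thesis unfolding lreg_def using 1(2,3,4) x(2)
     by (intro exI[of _ d] exI[of _ x] exI[of _ q]) simp
   qed
  qed
  with U show ?thesis unfolding app by blast
 qed
 from secs_extend[OF E f this] obtain \<tau> where \<tau>: "\<tau> \<in> secs E (k - e)"
  "\<And>Q j. Q \<in> X ==> f Q \<noteq> 0 ==> j < rk E ==> \<tau> (Q, j) = ?\<sigma>0 (Q, j)" by blast
 have "lift f * \<tau> \<in> secs E k" using secs_mult[OF E \<tau>(1) f(1)] by simp
 then have "\<sigma> = lift f * \<tau>"
  by (rule secs_identity[OF E \<sigma> _ f]) (auto simp: \<tau>(2) fun_ops lift_simps)
 with \<tau>(1) show ?thesis by (rule that)
qed

end

lemma prime_vanishing_divides: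
 assumes f: "pprime e f" and p: "pform d p" and A: "infinite A" "\<And>Q. Q \<in> A ==> f Q = 0 \<and> p Q = 0"
 shows "pdvd e f d p"
proof (rule ccontr)
 assume "\<not> pdvd e f d p"
 then have "finite {P. f P = 0 \<and> p P = 0}" by (rule prime_common_zeros_finite[OF f p])
 then have "finite A" by (rule rev_finite_subset) (use A(2) in blast)
 with A(1) show False by blast
qed

lemma pdvd_vanishes: "pdvd e f d p ==> f R = 0 ==> p R = 0"
 by (auto simp: pdvd_def fun_ops)

lemma not_pdvdI: "f R = 0 ==> p R \<noteq> 0 ==> \<not> pdvd e f d p"
 by (auto simp: pdvd_def fun_ops)

lemma pprimeD:
 assumes "pprime e f"
 shows "pform e f" "e \<ge> 1" "f \<noteq> 0" "pform i a ==> pform j b ==> pdvd e f (i + j) (a * b) ==> pdvd e f i a \<or> pdvd e f j b"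
 using assms unfolding pprime_def by blast+

lemma prime_zeros_infinite:
 assumes f: "pprime e f" and h: "pform d h" "\<not> pdvd e f d h"
 shows "infinite {P. f P = 0 \<and> h P \<noteq> 0}"
proof
 assume "finite {P. f P = 0 \<and> h P \<noteq> 0}"
 moreover have "finite {P. f P = 0 \<and> h P = 0}" by (rule prime_common_zeros_finite[OF f h])
 ultimately have "finite ({P. f P = 0 \<and> h P \<noteq> 0} \<union> {P. f P = 0 \<and> h P = 0})" by simp
 moreover have "{P. f P = 0 \<and> h P \<noteq> 0} \<union> {P. f P = 0 \<and> h P = 0} = {P. f P = 0}" by blast
 ultimately show False using zeros_infinite[OF pprimeD(1,2)[OF f]] by simp
qed

context
 fixes E :: vb
 assumes E: "vector_bundle UNIV E"
begin

text \<open>Near any point E is compared with a trivial bundle, up to a power of f: the frame of the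
  chart times f^n extends to global sections, and f^n times a chart coordinate of a section is a
  form. The first fact gives enough sections, the second bounds their dimension.\<close>

lemma local_frame:
 obtains U \<phi> f e n m where "(U, \<phi>) \<in> atlas E" "P0 \<in> U" "pform e f" "f P0 \<noteq> 0" "e \<ge> 0" "\<And>Q. f Q \<noteq> 0 ==> Q \<in> U"
  "m \<ge> 0" "\<And>i. \<exists>s\<in>p2.secs E m. \<forall>Q. f Q \<noteq> 0 --> (\<forall>l<rk E. app \<phi> (rk E) s l Q = f Q ^ n * (if l = i then 1 else 0))"
  "\<And>k \<sigma> i. \<sigma> \<in> p2.secs E k ==> i < rk E ==> \<exists>p. pform (k + m) p \<and> (\<forall>Q. f Q \<noteq> 0 --> p Q = f Q ^ n * app \<phi> (rk E) \<sigma> i Q)"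
proof -
 let ?r = "rk E"
 have pow: "(a ^ n) Q = a Q ^ n" for a :: "P2 => complex" and n Q by (induction n) (auto simp: fun_ops)
 obtain U \<phi> where U: "(U, \<phi>) \<in> atlas E" "P0 \<in> U" using p2.chart_ex[OF E, of P0] by blast
 obtain e f where f: "pform e f" "f P0 \<noteq> 0" "\<And>Q. Q \<in> UNIV ==> f Q \<noteq> 0 ==> Q \<in> U"
  by (rule p2.zopenD[OF p2.chart(1)[OF E U(1)] U(2)]) (rule that)
 have fnz: "f \<noteq> 0" using f(2) by (rule pform_nonzero)
 have e: "e \<ge> 0" using pform_neg[OF f(1)] fnz by force
 let ?D = "{Q. f Q \<noteq> 0}"
 obtain n where n: "n \<ge> 1" "\<And>R. \<exists>V \<psi> G G'. (V, \<psi>) \<in> atlas E \<and> R \<in> V \<and>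
  (\<forall>Q\<in>U \<inter> V. G Q \<in> carrier_mat ?r ?r \<and> \<psi> Q = G Q * \<phi> Q) \<and>
  (\<forall>Q\<in>V \<inter> U. G' Q \<in> carrier_mat ?r ?r \<and> \<phi> Q = G' Q * \<psi> Q) \<and>
  (\<forall>i<?r. \<forall>j<?r. p2.lreg (int n * e) (V \<inter> ?D) (f ^ n * (\<lambda>Q. G Q $$ (i, j))) R \<and>
   p2.lreg (int n * e) (V \<inter> ?D) (f ^ n * (\<lambda>Q. G' Q $$ (i, j))) R)"
  by (rule uniform_denominators[OF E U(1) f(1) fnz f(3)[OF UNIV_I]]) (assumption, rule that)
 let ?m = "int n * e"
 show ?thesis
 proof (rule that[OF U f(1,2) e f(3)[OF UNIV_I], where m = ?m and n = n])
  show "?m \<ge> 0" using e by simp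
  fix i
  have "\<exists>\<tau>. \<forall>l<?r. (\<Sum>j<?r. \<phi> Q $$ (l, j) * \<tau> j) = f Q ^ n * (if l = i then 1 else 0)" if "Q \<in> U" for Q
   by (rule invertible_mat_solve[OF p2.chart(4)[OF E U(1) that] p2.chart(3)[OF E U(1) that]])
  then have "\<forall>Q\<in>U. \<exists>\<tau>. \<forall>l<?r. (\<Sum>j<?r. \<phi> Q $$ (l, j) * \<tau> j) = f Q ^ n * (if l = i then 1 else 0)" by blast
  from bchoice[OF this] obtain \<tau> where \<tau>: "\<forall>Q\<in>U. \<forall>l<?r. (\<Sum>j<?r. \<phi> Q $$ (l, j) * \<tau> Q j) = f Q ^ n * (if l = i then 1 else 0)" ..
  define \<sigma>0 where "\<sigma>0 = (\<lambda>(Q, j). \<tau> Q j)"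
  have app0: "app \<phi> ?r \<sigma>0 l Q = f Q ^ n * (if l = i then 1 else 0)" if "Q \<in> U" "l < ?r" for Q l
   using \<tau> that by (simp add: app_def \<sigma>0_def)
  have "\<exists>(V, \<psi>) \<in> atlas E. R \<in> V \<and> (\<forall>l<?r. p2.lreg ?m (V \<inter> {Q \<in> UNIV. f Q \<noteq> 0}) (app \<psi> ?r \<sigma>0 l) R)" for R
  proof -
   obtain V \<psi> G G' where V: "(V, \<psi>) \<in> atlas E" "R \<in> V" and G: "\<forall>Q\<in>U \<inter> V. G Q \<in> carrier_mat ?r ?r \<and> \<psi> Q = G Q * \<phi> Q"
    and reg: "\<forall>i<?r. \<forall>j<?r. p2.lreg ?m (V \<inter> ?D) (f ^ n * (\<lambda>Q. G Q $$ (i, j))) R \<and>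
     p2.lreg ?m (V \<inter> ?D) (f ^ n * (\<lambda>Q. G' Q $$ (i, j))) R"
    using n(2)[of R] by (elim exE conjE) (rule that)
   have "p2.lreg ?m (V \<inter> ?D) (app \<psi> ?r \<sigma>0 l) R" if l: "l < ?r" for l
   proof -
    have "p2.lreg ?m (V \<inter> ?D) (if i < ?r then f ^ n * (\<lambda>Q. G Q $$ (l, i)) else (\<lambda>_. 0)) R"
     using reg l p2.lreg_0 by simp
    then show ?thesis
    proof (rule p2.lreg_cong)
     fix Q assume Q: "Q \<in> V \<inter> ?D"
     then have QU: "Q \<in> U" using f(3) by blast
     have "app \<psi> ?r \<sigma>0 l Q = (\<Sum>k<?r. G Q $$ (l, k) * app \<phi> ?r \<sigma>0 k Q)"
      by (rule app_trans) (use G Q QU p2.chart(3)[OF E U(1) QU] l in auto)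
     also have "\<dots> = (\<Sum>k<?r. if k = i then G Q $$ (l, k) * f Q ^ n else 0)"
      by (intro sum.cong) (use app0[OF QU] in auto)
     finally show "(if i < ?r then f ^ n * (\<lambda>Q. G Q $$ (l, i)) else (\<lambda>_. 0)) Q = app \<psi> ?r \<sigma>0 l Q"
      by (simp add: fun_ops pow)
    qed
   qed
   with V show ?thesis by auto
  qed
  from p2.secs_extend[OF E f(1) UNIV_I f(2) this] obtain s where s: "s \<in> p2.secs E ?m"
   "\<And>Q j. Q \<in> UNIV ==> f Q \<noteq> 0 ==> j < ?r ==> s (Q, j) = \<sigma>0 (Q, j)" by blast
  have "app \<phi> ?r s l Q = f Q ^ n * (if l = i then 1 else 0)" if "f Q \<noteq> 0" "l < ?r" for Q l
  proof -
   have "app \<phi> ?r s l Q = app \<phi> ?r \<sigma>0 l Q" by (rule app_cong) (rule s(2)[OF UNIV_I that(1)])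
   then show ?thesis using app0[OF f(3)[OF UNIV_I that(1)] that(2)] by simp
  qed
  with s(1) show "\<exists>s\<in>p2.secs E ?m. \<forall>Q. f Q \<noteq> 0 --> (\<forall>l<?r. app \<phi> ?r s l Q = f Q ^ n * (if l = i then 1 else 0))"
   by blast
 next
  fix k \<sigma> i assume \<sigma>: "\<sigma> \<in> p2.secs E k" and i: "i < ?r"
  have "p2.lreg (k + ?m) ?D (f ^ n * app \<phi> ?r \<sigma> i) R" for R
  proof -
   obtain V \<psi> G G' where V: "(V, \<psi>) \<in> atlas E" "R \<in> V" and G': "\<forall>Q\<in>V \<inter> U. G' Q \<in> carrier_mat ?r ?r \<and> \<phi> Q = G' Q * \<psi> Q"
    and reg: "\<forall>i<?r. \<forall>j<?r. p2.lreg ?m (V \<inter> ?D) (f ^ n * (\<lambda>Q. G Q $$ (i, j))) R \<and>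
     p2.lreg ?m (V \<inter> ?D) (f ^ n * (\<lambda>Q. G' Q $$ (i, j))) R"
    using n(2)[of R] by (elim exE conjE) (rule that)
   have "p2.lreg (k + ?m) (V \<inter> ?D) (\<lambda>Q. \<Sum>j<?r. (app \<psi> ?r \<sigma> j * (f ^ n * (\<lambda>Q. G' Q $$ (i, j)))) Q) R"
   proof (rule p2.lreg_sum)
    fix j assume j: "j \<in> {..<?r}"
    have "p2.lreg k (V \<inter> ?D) (app \<psi> ?r \<sigma> j) R"
     by (rule p2.lreg_mono[OF p2.secsD(2)[OF E \<sigma> V]]) (use j in auto)
    moreover have "p2.lreg ?m (V \<inter> ?D) (f ^ n * (\<lambda>Q. G' Q $$ (i, j))) R" using reg i j by blast
    ultimately show "p2.lreg (k + ?m) (V \<inter> ?D) (app \<psi> ?r \<sigma> j * (f ^ n * (\<lambda>Q. G' Q $$ (i, j)))) R"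
     by (rule p2.lreg_mult)
   qed
   then have 1: "p2.lreg (k + ?m) (V \<inter> ?D) (f ^ n * app \<phi> ?r \<sigma> i) R"
   proof (rule p2.lreg_cong)
    fix Q assume Q: "Q \<in> V \<inter> ?D"
    then have QU: "Q \<in> U" using f(3) by blast
    have "app \<phi> ?r \<sigma> i Q = (\<Sum>j<?r. G' Q $$ (i, j) * app \<psi> ?r \<sigma> j Q)"
     by (rule app_trans) (use G' Q QU p2.chart(3)[OF E V(1)] i in auto)
    then show "(\<Sum>j<?r. (app \<psi> ?r \<sigma> j * (f ^ n * (\<lambda>Q. G' Q $$ (i, j)))) Q) = (f ^ n * app \<phi> ?r \<sigma> i) Q"
     by (simp add: fun_ops sum_distrib_left mult_ac)
   qed
   obtain d h where h: "pform d h" "h R \<noteq> 0" "\<And>Q. Q \<in> UNIV ==> h Q \<noteq> 0 ==> Q \<in> V"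
    by (rule p2.zopenD[OF p2.chart(1)[OF E V(1)] V(2)]) (rule that)
   show ?thesis by (rule p2.lreg_local[OF 1 h(1,2)]) (use h(3) in auto)
  qed
  from global_form[OF f(1) fnz this] obtain p where "pform (k + ?m) p" "\<And>Q. f Q \<noteq> 0 ==> (f ^ n * app \<phi> ?r \<sigma> i) Q = p Q"
   by blast
  then show "\<exists>p. pform (k + ?m) p \<and> (\<forall>Q. f Q \<noteq> 0 --> p Q = f Q ^ n * app \<phi> ?r \<sigma> i Q)"
   by (intro exI[of _ p]) (simp add: fun_ops pow)
 qed
qed

text \<open>The sections of \<open>local_frame\<close> form a basis of the fibre at P; a form that
  is nonzero at P fills up the degree.\<close>

lemma generated_at:
 "\<exists>K. \<forall>k\<ge>K. \<forall>y. \<exists>\<sigma>\<in>p2.secs E (int k). \<forall>j<rk E. \<sigma> (P, j) = y j"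
proof -
 let ?r = "rk E"
 obtain U \<phi> f e n m where U: "(U, \<phi>) \<in> atlas E" "P \<in> U" and f: "pform e f" "f P \<noteq> 0" and m: "m \<ge> 0"
  and s: "\<And>i. \<exists>s\<in>p2.secs E m. \<forall>Q. f Q \<noteq> 0 --> (\<forall>l<?r. app \<phi> ?r s l Q = f Q ^ n * (if l = i then 1 else 0))"
  by (rule local_frame[of P]) (rule that)
 show ?thesis
 proof (intro exI[of _ "nat m"] allI impI)
  fix k y assume k: "nat m \<le> k"
  obtain g where g: "pform (int (k - nat m)) g" "g P \<noteq> 0" using nonvanishing_form by blast
  have "\<forall>i\<in>{..<?r}. \<exists>s\<in>p2.secs E m. \<forall>l<?r. app \<phi> ?r s l P = f P ^ n * (if l = i then 1 else 0)"
   using s f(2) by blast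
  then have "\<forall>i\<in>{..<?r}. \<exists>s. s \<in> p2.secs E m \<and> (\<forall>l<?r. app \<phi> ?r s l P = f P ^ n * (if l = i then 1 else 0))" by blast
  from bchoice[OF this] obtain t where t: "\<forall>i\<in>{..<?r}. t i \<in> p2.secs E m \<and> (\<forall>l<?r. app \<phi> ?r (t i) l P = f P ^ n * (if l = i then 1 else 0))" ..
  define z where "z i = (\<Sum>j<?r. \<phi> P $$ (i, j) * y j) / (f P ^ n * g P)" for i
  define \<sigma> where "\<sigma> = (\<Sum>i<?r. kk (z i) * (lift g * t i))"
  have 1: "lift g * t i \<in> p2.secs E (int k)" if "i < ?r" for i
  proof -
   have "lift g * t i \<in> p2.secs E (int (k - nat m) + m)" by (rule p2.secs_mult[OF E _ g(1)]) (use t that in blast)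
   moreover have "int (k - nat m) + m = int k" using k m by (simp add: of_nat_diff)
   ultimately show ?thesis by metis
  qed
  have "\<sigma> \<in> p2.secs E (int k)" unfolding \<sigma>_def
   by (rule sum_mult_subspace[OF p2.subspace_secs[OF E]]) (use 1 in simp)
  moreover have "\<sigma> (P, j) = y j" if j: "j < ?r" for j
  proof -
   have "app \<phi> ?r (\<lambda>x. \<sigma> x - y (snd x)) l P = 0" if l: "l < ?r" for l
   proof -
    have "app \<phi> ?r \<sigma> l P = (\<Sum>j<?r. \<phi> P $$ (l, j) * (\<Sum>i<?r. z i * (g P * t i (P, j))))"
     by (simp add: app_def \<sigma>_def sum_fun_apply fun_ops kk_apply lift_simps)
    also have "\<dots> = (\<Sum>j<?r. \<Sum>i<?r. z i * g P * (\<phi> P $$ (l, j) * t i (P, j)))"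
     by (simp add: sum_distrib_left mult_ac)
    also have "\<dots> = (\<Sum>i<?r. z i * g P * app \<phi> ?r (t i) l P)"
     by (subst sum.swap) (simp add: app_def sum_distrib_left)
    also have "\<dots> = (\<Sum>i<?r. if i = l then z i * g P * f P ^ n else 0)"
     by (intro sum.cong) (use t l in auto)
    also have "\<dots> = (\<Sum>j<?r. \<phi> P $$ (l, j) * y j)"
     using l f(2) g(2) by (simp add: z_def)
    finally show ?thesis by (simp add: app_def algebra_simps sum_subtractf)
   qed
   from p2.fibre_eq_0[OF E U this j] show ?thesis by simp
  qed
  ultimately show "\<exists>\<sigma>\<in>p2.secs E (int k). \<forall>j<?r. \<sigma> (P, j) = y j" by blast
 qed
qed

lemma secs_finite_dim:
 "fd (p2.secs E k)" and secs_dim_bound: "\<exists>m. \<forall>k. fs.dim (p2.secs E k) \<le> rk E * fs.dim (pforms (k + int m))"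
proof -
 let ?r = "rk E"
 obtain U \<phi> f e n m where U: "(U, \<phi>) \<in> atlas E" and f: "pform e f" "f P0 \<noteq> 0" and e: "e \<ge> 0" and fU: "\<And>Q. f Q \<noteq> 0 ==> Q \<in> U" and m: "m \<ge> 0"
  and p: "\<And>k \<sigma> i. \<sigma> \<in> p2.secs E k ==> i < ?r ==> \<exists>p. pform (k + m) p \<and> (\<forall>Q. f Q \<noteq> 0 --> p Q = f Q ^ n * app \<phi> ?r \<sigma> i Q)"
  by (rule local_frame[of P0]) (rule that)
 \<comment> \<open>The exponent is n + 1 rather than n because f^n times a coordinate is known to be
   a form only where f is nonzero; the further factor f makes both sides 0 elsewhere.\<close>
 define \<theta> where "\<theta> \<sigma> = (\<lambda>(Q, i). if i < ?r then f Q ^ Suc n * app \<phi> ?r \<sigma> i Q else 0)" for \<sigma>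
 have \<theta>: "lin_map \<theta>"
  by (rule lin_mapI)
    (auto simp: \<theta>_def fun_eq_iff fun_ops cscale_apply app_def algebra_simps sum.distrib sum_distrib_left)
 have mem: "\<theta> \<sigma> \<in> form_vecs ?r (k + (m + e))" if \<sigma>: "\<sigma> \<in> p2.secs E k" for \<sigma> k
  unfolding form_vecs_def
 proof (intro CollectI conjI allI impI)
  fix i assume i: "i < ?r"
  obtain q where q: "pform (k + m) q" "\<forall>Q. f Q \<noteq> 0 --> q Q = f Q ^ n * app \<phi> ?r \<sigma> i Q" using p[OF \<sigma> i] by blast
  have "(\<lambda>Q. \<theta> \<sigma> (Q, i)) = q * f"
  proof
   fix Q show "\<theta> \<sigma> (Q, i) = (q * f) Q" using q(2) i by (cases "f Q = 0") (auto simp: \<theta>_def fun_ops)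
  qed
  then show "pform (k + (m + e)) (\<lambda>Q. \<theta> \<sigma> (Q, i))" using pform_mult[OF q(1) f(1)] by (simp add: ac_simps)
 qed (simp add: \<theta>_def)
 have inj: "\<sigma> = 0" if \<sigma>: "\<sigma> \<in> p2.secs E k" "\<theta> \<sigma> = 0" for \<sigma> k
 proof (rule p2.secs_identity[OF E \<sigma>(1) p2.secs_0[OF E] f(1) UNIV_I f(2)])
  fix Q j assume Q: "f Q \<noteq> 0" and j: "j < ?r"
  have "app \<phi> ?r \<sigma> i Q = 0" if "i < ?r" for i
   using fun_cong[OF \<sigma>(2), of "(Q, i)"] Q that by (simp add: \<theta>_def fun_ops)
  from p2.fibre_eq_0[OF E U fU[OF Q] this j] show "\<sigma> (Q, j) = 0 (Q, j)" by (simp add: fun_ops)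
 qed
 have d: "fd (p2.secs E k) \<and> fs.dim (p2.secs E k) \<le> fs.dim (form_vecs ?r (k + (m + e)))" for k
  by (rule conjI; rule inj_fd[OF \<theta> p2.subspace_secs[OF E] dim_form_vecs[THEN conjunct1] mem inj]; assumption)
 show "fd (p2.secs E k)" by (rule d[THEN conjunct1])
 have "fs.dim (p2.secs E k) \<le> ?r * fs.dim (pforms (k + int (nat (m + e))))" for k
  using d[THEN conjunct2, of k] dim_form_vecs[THEN conjunct2, of ?r "k + (m + e)"] m e by simp
 then show "\<exists>m. \<forall>k. fs.dim (p2.secs E k) \<le> ?r * fs.dim (pforms (k + int m))" by blast
qed

lemma lin_kills: "\<sigma> \<in> p2.secs E k ==> a \<noteq> 0 ==> lift (lin a) * \<sigma> = 0 ==> \<sigma> = 0"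
proof -
 assume *: "\<sigma> \<in> p2.secs E k" "a \<noteq> 0" "lift (lin a) * \<sigma> = 0"
 obtain P where "lin a P \<noteq> 0" using lin_eq_0_iff[of a] *(2) by (auto simp: fun_eq_iff fun_ops)
 then show ?thesis by (rule p2.secs_torsion_free[OF E *(1) pform_lin UNIV_I _ *(3)])
qed

text \<open>In one chart the coordinates of the section are forms up to a power of f0. They vanish
  at infinitely many points of the prime curve f = 0, hence on all of it within the chart. Therefore
  f divides the local numerators in every chart, and \<open>secs_divisible\<close> applies.\<close>

lemma prime_divides_section:
 assumes \<sigma>: "\<sigma> \<in> p2.secs E k" and f: "pprime e f"
  and inf: "infinite {P. f P = 0 \<and> (\<forall>j<rk E. \<sigma> (P, j) = 0)}"
 obtains \<tau> where "\<tau> \<in> p2.secs E (k - e)" "\<sigma> = lift f * \<tau>"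
proof -
 let ?r = "rk E" and ?Z = "{P. f P = 0 \<and> (\<forall>j<rk E. \<sigma> (P, j) = 0)}"
 note fD = pprimeD[OF f]
 obtain P0 where P0: "P0 \<in> ?Z" using infinite_imp_nonempty[OF inf] unfolding ex_in_conv[symmetric] ..
 obtain U \<phi> f0 e0 n m where U: "(U, \<phi>) \<in> atlas E" and f0: "pform e0 f0" "f0 P0 \<noteq> 0" and f0U: "\<And>Q. f0 Q \<noteq> 0 ==> Q \<in> U"
  and p: "\<And>k \<sigma> i. \<sigma> \<in> p2.secs E k ==> i < ?r ==> \<exists>p. pform (k + m) p \<and> (\<forall>Q. f0 Q \<noteq> 0 --> p Q = f0 Q ^ n * app \<phi> ?r \<sigma> i Q)"
  by (rule local_frame[of P0]) (rule that)
 have nf0: "\<not> pdvd e f e0 f0" by (rule not_pdvdI[of f P0 f0]) (use f0(2) P0 in simp_all)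
 have van: "\<sigma> (Q, j) = 0" if Q: "f Q = 0" "f0 Q \<noteq> 0" and j: "j < ?r" for Q j
 proof (rule p2.fibre_eq_0[OF E U f0U[OF Q(2)] _ j])
  fix i assume i: "i < ?r"
  obtain q where q: "pform (k + m) q" "\<forall>Q. f0 Q \<noteq> 0 --> q Q = f0 Q ^ n * app \<phi> ?r \<sigma> i Q" using p[OF \<sigma> i] by blast
  \<comment> \<open>The factor f0 makes the form vanish at all points of \<open>?Z\<close>, also at
    those outside the chart; f does not divide f0, which is nonzero at the point P0 of the
    curve.\<close>
  have "pdvd e f (e0 + (k + m)) (f0 * q)"
  proof (rule prime_vanishing_divides[OF f pform_mult[OF f0(1) q(1)] inf])
   fix S assume S: "S \<in> ?Z"
   then have "app \<phi> ?r \<sigma> i S = 0" by (simp add: app_def)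
   then show "f S = 0 \<and> (f0 * q) S = 0" using S q(2) by (cases "f0 S = 0") (auto simp: fun_ops)
  qed
  then have "pdvd e f (k + m) q" using fD(4)[OF f0(1) q(1)] nf0 by blast
  then show "app \<phi> ?r \<sigma> i Q = 0" using pdvd_vanishes[where f = f and R = Q and p = q] Q(1) q(2) Q(2) by force
 qed
 obtain P1 where P1: "f P1 \<noteq> 0" using fD(3) by (auto simp: fun_eq_iff fun_ops)
 show ?thesis
 proof (rule p2.secs_divisible[OF E \<sigma> fD(1) UNIV_I P1])
  fix V \<psi> R i d p q
  assume V: "(V, \<psi>) \<in> atlas E" "R \<in> V" and i: "i < ?r" and R: "f R = 0"
   and 1: "pform (d + k) p" "pform d q" "q R \<noteq> 0" "\<forall>Q\<in>V. q Q \<noteq> 0 --> app \<psi> ?r \<sigma> i Q = p Q / q Q"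
  obtain e1 h where h: "pform e1 h" "h R \<noteq> 0" "\<And>Q. Q \<in> UNIV ==> h Q \<noteq> 0 ==> Q \<in> V"
   by (rule p2.zopenD[OF p2.chart(1)[OF E V(1)] V(2)]) (rule that)
  have "\<not> pdvd e f d q" "\<not> pdvd e f e1 h"
   by (rule not_pdvdI[of f R q, OF R 1(3)], rule not_pdvdI[of f R h, OF R h(2)])
  then have "\<not> pdvd e f (e0 + (d + e1)) (f0 * (q * h))"
   using nf0 fD(4)[OF f0(1) pform_mult[OF 1(2) h(1)]] fD(4)[OF 1(2) h(1)] by blast
  then have "infinite {P. f P = 0 \<and> (f0 * (q * h)) P \<noteq> 0}"
   by (rule prime_zeros_infinite[OF f pform_mult[OF f0(1) pform_mult[OF 1(2) h(1)]]])
  then have "pdvd e f (d + k) p"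
  proof (rule prime_vanishing_divides[OF f 1(1)])
   fix Q assume "Q \<in> {P. f P = 0 \<and> (f0 * (q * h)) P \<noteq> 0}"
   then have Q: "f Q = 0" "f0 Q \<noteq> 0" "q Q \<noteq> 0" "Q \<in> V" using h(3) by (auto simp: fun_ops)
   then have "app \<psi> ?r \<sigma> i Q = 0" using van by (simp add: app_def)
   then show "f Q = 0 \<and> p Q = 0" using 1(4) Q by force
  qed
  then show "\<exists>x. pform (d + k - e) x \<and> (\<forall>Q\<in>UNIV. p Q = f Q * x Q)" unfolding pdvd_def by (auto simp: fun_ops)
 qed (rule that)
qed

text \<open>Where b is zero and a is not, the section has to vanish; these are infinitely many
  points of the line b = 0, because b does not divide a.\<close>

lemma koszul:
 assumes ab: "indep a b" and \<sigma>: "\<sigma> \<in> p2.secs E k" and eq: "lift (lin a) * \<sigma> = lift (lin b) * \<tau>"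
 obtains \<rho> where "\<rho> \<in> p2.secs E (k - 1)" "\<sigma> = lift (lin b) * \<rho>"
proof -
 have b0: "b \<noteq> 0" using ab[unfolded indep_def, rule_format, of 0 1] by auto
 have pb: "pprime 1 (lin b)" by (rule pprime_lin[OF b0])
 have nd: "\<not> pdvd 1 (lin b) 1 (lin a)"
 proof
  assume "pdvd 1 (lin b) 1 (lin a)"
  then obtain c where c: "pform 0 c" "lin a = lin b * c" unfolding pdvd_def by auto
  obtain x where "c = kk x" using pform_const[OF c(1)] by blast
  then have "lin (1 *s a + (- x) *s b) = 0"
   unfolding lin_add lin_scale using c(2) by (simp add: kk_simps mult.commute)
  then show False using lin_eq_0_iff ab unfolding indep_def by (metis zero_neq_one)
 qed
 have "{P. lin b P = 0 \<and> lin a P \<noteq> 0} \<subseteq> {P. lin b P = 0 \<and> (\<forall>j<rk E. \<sigma> (P, j) = 0)}"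
 proof safe
  fix P j assume "lin b P = 0" "lin a P \<noteq> 0"
  then show "\<sigma> (P, j) = 0" using fun_cong[OF eq, of "(P, j)"] by (simp add: fun_ops lift_simps)
 qed
 from infinite_super[OF this prime_zeros_infinite[OF pb pform_lin nd]]
 show ?thesis by (rule prime_divides_section[OF \<sigma> pb]) (rule that)
qed

text \<open>By \<open>koszul\<close> the subspaces a M and b M meet exactly in a b M, with M taken
  one degree lower.\<close>

lemma lin_sums:
 fixes k :: int
 assumes ab: "indep a b"
 defines "W \<equiv> {u + v | u v. u \<in> (\<lambda>\<sigma>. lift (lin a) * \<sigma>) ` p2.secs E k \<and> v \<in> (\<lambda>\<sigma>. lift (lin b) * \<sigma>) ` p2.secs E k}"
 shows "fs.subspace W" "fs.dim W + fs.dim (p2.secs E (k - 1)) = 2 * fs.dim (p2.secs E k)"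
proof -
 let ?M = "p2.secs E" and ?a = "lift (lin a)" and ?b = "lift (lin b)"
 let ?S = "(\<lambda>\<sigma>. ?a * \<sigma>) ` ?M k" and ?T = "(\<lambda>\<sigma>. ?b * \<sigma>) ` ?M k"
 have nz: "a \<noteq> 0" "b \<noteq> 0" using ab[unfolded indep_def, rule_format, of 1 0] ab[unfolded indep_def, rule_format, of 0 1] by auto
 note sub = p2.subspace_secs[OF E] and fin = secs_finite_dim
 have dS: "fs.subspace ?S" "fd ?S" "fs.dim ?S = fs.dim (?M k)"
  by (rule subspace_image[OF lin_map_mult sub], rule rank_nullity(1)[OF lin_map_mult sub fin],
    rule dim_inj_image[OF lin_map_mult sub fin], rule lin_kills[OF _ nz(1)])
 have dT: "fs.subspace ?T" "fd ?T" "fs.dim ?T = fs.dim (?M k)"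
  by (rule subspace_image[OF lin_map_mult sub], rule rank_nullity(1)[OF lin_map_mult sub fin],
    rule dim_inj_image[OF lin_map_mult sub fin], rule lin_kills[OF _ nz(2)])
 have "?S \<inter> ?T = (\<lambda>\<rho>. (?a * ?b) * \<rho>) ` ?M (k - 1)"
 proof (rule equalityI; rule subsetI)
  fix x assume "x \<in> ?S \<inter> ?T"
  then obtain \<sigma> \<tau> where x: "\<sigma> \<in> ?M k" "x = ?a * \<sigma>" "\<tau> \<in> ?M k" "x = ?b * \<tau>" by (elim IntE imageE)
  have "?a * \<sigma> = ?b * \<tau>" using x(2,4) by simp
  from koszul[OF ab x(1) this] obtain \<rho> where "\<rho> \<in> ?M (k - 1)" "\<sigma> = ?b * \<rho>" .
  then show "x \<in> (\<lambda>\<rho>. (?a * ?b) * \<rho>) ` ?M (k - 1)" using x(2) by (simp add: mult.assoc)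
 next
  fix x assume "x \<in> (\<lambda>\<rho>. (?a * ?b) * \<rho>) ` ?M (k - 1)"
  then obtain \<rho> where \<rho>: "\<rho> \<in> ?M (k - 1)" "x = (?a * ?b) * \<rho>" by (elim imageE)
  have "?a * \<rho> \<in> ?M k" "?b * \<rho> \<in> ?M k"
   using p2.secs_mult[OF E \<rho>(1) pform_lin[of a]] p2.secs_mult[OF E \<rho>(1) pform_lin[of b]] by simp_all
  then have "?a * (?b * \<rho>) \<in> ?S" "?b * (?a * \<rho>) \<in> ?T" by (simp_all only: imageI)
  moreover have "?a * (?b * \<rho>) = x" "?b * (?a * \<rho>) = x" by (simp_all add: \<rho>(2) mult_ac)
  ultimately show "x \<in> ?S \<inter> ?T" by (simp only: IntI)
 qed
 moreover have "fs.dim ((\<lambda>\<rho>. (?a * ?b) * \<rho>) ` ?M (k - 1)) = fs.dim (?M (k - 1))"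
 proof (rule dim_inj_image[OF lin_map_mult sub fin])
  fix \<rho> assume \<rho>: "\<rho> \<in> ?M (k - 1)" "?a * ?b * \<rho> = 0"
  have "?b * \<rho> \<in> ?M k" using p2.secs_mult[OF E \<rho>(1) pform_lin[of b]] by simp
  then have "?b * \<rho> = 0" by (rule lin_kills[OF _ nz(1)]) (use \<rho>(2) in \<open>simp add: mult.assoc\<close>)
  then show "\<rho> = 0" by (rule lin_kills[OF \<rho>(1) nz(2)])
 qed
 ultimately show "fs.dim W + fs.dim (p2.secs E (k - 1)) = 2 * fs.dim (p2.secs E k)"
  using dim_sums_Int_fd[OF dS(1,2) dT(1,2)] dS(3) dT(3) by (simp add: W_def)
 show "fs.subspace W" unfolding W_def by (rule subspace_sum[OF dS(1) dT(1)])
qed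

abbreviation secs_through :: "P2 => int => (P2 \<times> nat => complex) set" where
 "secs_through P k \<equiv> {\<sigma> \<in> p2.secs E k. \<forall>j<rk E. \<sigma> (P, j) = 0}"

lemma subspace_secs_through: "fs.subspace (secs_through P k)"
 by (rule fs.subspaceI)
   (use p2.subspace_secs[OF E, of k] in \<open>auto simp: fs.subspace_0 fs.subspace_add fs.subspace_scale fun_ops cscale_apply\<close>)

text \<open>In large degrees some section takes each unit vector as its value at P, by
  \<open>generated_at\<close>; these sections are independent modulo the ones that vanish
  there.\<close>

lemma dim_secs_through:
 "\<exists>K. \<forall>k\<ge>K. fs.dim (secs_through P (int k)) + rk E \<le> fs.dim (p2.secs E (int k))"
proof -
 obtain K where K: "\<forall>k\<ge>K. \<forall>y. \<exists>\<sigma>\<in>p2.secs E (int k). \<forall>j<rk E. \<sigma> (P, j) = y j" using generated_at[of P] by blast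
 have "fs.dim (secs_through P (int k)) + card {..<rk E} \<le> fs.dim (p2.secs E (int k))" if k: "k \<ge> K" for k
 proof -
  have "\<forall>i. \<exists>\<sigma>. \<sigma> \<in> p2.secs E (int k) \<and> (\<forall>j<rk E. \<sigma> (P, j) = (if j = i then 1 else 0))"
  proof
   fix i show "\<exists>\<sigma>. \<sigma> \<in> p2.secs E (int k) \<and> (\<forall>j<rk E. \<sigma> (P, j) = (if j = i then 1 else 0))"
    using K[rule_format, OF k, of "\<lambda>j. if j = i then 1 else 0"] by blast
  qed
  from choice[OF this] obtain s where s: "\<forall>i. s i \<in> p2.secs E (int k) \<and> (\<forall>j<rk E. s i (P, j) = (if j = i then 1 else 0))" ..
  show ?thesis
  proof (rule independent_mod[OF p2.subspace_secs[OF E] secs_finite_dim subspace_secs_through _ finite_lessThan])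
   show "secs_through P (int k) \<subseteq> p2.secs E (int k)" by (rule Collect_restrict)
   show "s i \<in> p2.secs E (int k)" for i using s by simp
   fix a assume a: "(\<Sum>i<rk E. cscale (a i) (s i)) \<in> secs_through P (int k)"
   show "\<forall>i\<in>{..<rk E}. a i = 0"
   proof
    fix j assume j: "j \<in> {..<rk E}"
    then have "0 = (\<Sum>i<rk E. cscale (a i) (s i)) (P, j)" using a by simp
    also have "\<dots> = (\<Sum>i<rk E. if i = j then a i else 0)"
     unfolding sum_fun_apply cscale_apply using s j by (intro sum.cong) auto
    also have "\<dots> = a j" using j by simp
    finally show "a j = 0" by simp
   qed
  qed
 qed
 then show ?thesis by auto
qed

lemma lin_sums_through:
 assumes "lin a P = 0" "lin b P = 0"
 shows "{u + v | u v. u \<in> (\<lambda>\<sigma>. lift (lin a) * \<sigma>) ` p2.secs E k \<and> v \<in> (\<lambda>\<sigma>. lift (lin b) * \<sigma>) ` p2.secs E k}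
  \<subseteq> secs_through P (k + 1)"
proof
 fix x assume "x \<in> {u + v | u v. u \<in> (\<lambda>\<sigma>. lift (lin a) * \<sigma>) ` p2.secs E k \<and> v \<in> (\<lambda>\<sigma>. lift (lin b) * \<sigma>) ` p2.secs E k}"
 then obtain \<sigma> \<tau> where x: "\<sigma> \<in> p2.secs E k" "\<tau> \<in> p2.secs E k" "x = lift (lin a) * \<sigma> + lift (lin b) * \<tau>"
  by (elim CollectE exE conjE imageE) simp
 have "lift (lin a) * \<sigma> \<in> p2.secs E (k + 1)" "lift (lin b) * \<tau> \<in> p2.secs E (k + 1)"
  using p2.secs_mult[OF E x(1) pform_lin[of a]] p2.secs_mult[OF E x(2) pform_lin[of b]] by (simp_all add: add.commute)
 then have "x \<in> p2.secs E (k + 1)" unfolding x(3) by (rule p2.secs_add[OF E])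
 then show "x \<in> secs_through P (k + 1)" using assms by (simp add: x(3) fun_ops lift_simps)
qed

text \<open>At the common zero P of two linear forms, a M + b M consists of sections vanishing at P,
  which have codimension at least rk E. With \<open>lin_sums\<close> the second difference of the
  dimension is therefore at least rk E, and \<open>secs_dim_bound\<close> is the matching upper
  bound for \<open>quadratic_growth\<close>.\<close>

theorem hilbert_polynomial:
 "\<exists>a b K. \<forall>k\<ge>K. 2 * int (fs.dim (p2.secs E (int k))) = int (rk E) * (int k + 1) * (int k + 2) + 2 * a * int k + b"
proof -
 define a b :: "complex ^ 3" where "a = axis 1 1" and "b = axis 2 1"
 have ab: "indep a b" unfolding indep_def
 proof (intro allI impI)
  fix s t :: complex assume "s *s a + t *s b = 0"
  then have "(s *s a + t *s b) $ 1 = 0" "(s *s a + t *s b) $ 2 = 0" by simp_all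
  then show "s = 0 \<and> t = 0" by (simp add: a_def b_def axis_def)
 qed
 from common_zero[OF this] obtain P where P: "lin a P = 0" "lin b P = 0" .
 obtain K where K: "\<forall>k\<ge>K. fs.dim (secs_through P (int k)) + rk E \<le> fs.dim (p2.secs E (int k))"
  using dim_secs_through by blast
 obtain m where m: "\<forall>k. fs.dim (p2.secs E k) \<le> rk E * fs.dim (pforms (k + int m))" using secs_dim_bound by blast
 define h where "h k = int (fs.dim (p2.secs E (int k)))" for k
 have fdt: "fd (secs_through P k)" for k by (rule fd_subset[OF secs_finite_dim]) (rule Collect_restrict)
 have "\<exists>a b K. \<forall>k\<ge>K. 2 * h k = int (rk E) * (int k + 1) * (int k + 2) + 2 * a * int k + b"
 proof (rule quadratic_growth[of K])
  fix k assume k: "k \<ge> K"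
  have "fs.dim (secs_through P (int (k + 2))) + rk E \<le> fs.dim (p2.secs E (int (k + 2)))"
   by (rule K[rule_format]) (use k in simp)
  moreover note dim_mono_fd[OF fdt lin_sums_through[OF P, of "int k + 1"]] lin_sums(2)[OF ab, of "int k + 1"]
  moreover have e: "int (k + 2) = int k + 1 + 1" "int (k + 1) = int k + 1" "int k + 1 - 1 = int k" by simp_all
  ultimately show "int (rk E) \<le> h (k + 2) - 2 * h (k + 1) + h k" unfolding h_def e by linarith
 next
  fix k
  have "2 * h k \<le> 2 * (int (rk E) * int (fs.dim (pforms (int k + int m))))"
   unfolding h_def using m by (simp flip: of_nat_mult)
  also have "\<dots> = int (rk E) * (2 * int (fs.dim (pforms (int k + int m))))" by simp
  also have "\<dots> = int (rk E) * (int k + int m + 1) * (int k + int m + 2)" unfolding dim_pforms by simp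
  finally show "2 * h k \<le> int (rk E) * (int k + int m + 1) * (int k + int m + 2)" .
 qed
 then show ?thesis by (simp add: h_def)
qed

text \<open>Once the Hilbert function is a polynomial its second difference is exactly rk E, so a M
  + b M, which is contained in the sections through P, has at least their dimension.\<close>

lemma secs_through_eq:
 assumes ab: "indep a b" and P: "lin a P = 0" "lin b P = 0"
 shows "\<exists>K. \<forall>k\<ge>K. \<forall>\<sigma>\<in>p2.secs E (int (Suc k)). (\<forall>j<rk E. \<sigma> (P, j) = 0) -->
  (\<exists>u\<in>p2.secs E (int k). \<exists>v\<in>p2.secs E (int k). \<sigma> = lift (lin a) * u + lift (lin b) * v)"
proof -
 obtain K where K: "\<forall>k\<ge>K. fs.dim (secs_through P (int k)) + rk E \<le> fs.dim (p2.secs E (int k))"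
  using dim_secs_through by blast
 obtain x y L where L: "\<forall>k\<ge>L. 2 * int (fs.dim (p2.secs E (int k))) = int (rk E) * (int k + 1) * (int k + 2) + 2 * x * int k + y"
  using hilbert_polynomial by blast
 have fdt: "fd (secs_through P k)" for k by (rule fd_subset[OF secs_finite_dim]) (rule Collect_restrict)
 show ?thesis
 proof (intro exI[of _ "max K (Suc L)"] allI impI ballI)
  fix k \<sigma> assume k: "k \<ge> max K (Suc L)" and \<sigma>: "\<sigma> \<in> p2.secs E (int (Suc k))" "\<forall>j<rk E. \<sigma> (P, j) = 0"
  let ?W = "{u + v | u v. u \<in> (\<lambda>\<sigma>. lift (lin a) * \<sigma>) ` p2.secs E (int k) \<and> v \<in> (\<lambda>\<sigma>. lift (lin b) * \<sigma>) ` p2.secs E (int k)}"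
  have Wsub: "?W \<subseteq> secs_through P (int (Suc k))" using lin_sums_through[OF P, of "int k"] by (simp add: add.commute)
  obtain l where l: "k = Suc l" "l \<ge> L" using k by (cases k) auto
  have "int (fs.dim (p2.secs E (int (Suc k)))) + int (fs.dim (p2.secs E (int l))) = 2 * int (fs.dim (p2.secs E (int k))) + int (rk E)"
   using L[rule_format, of "Suc k"] L[rule_format, of l] L[rule_format, of k] l by (simp add: algebra_simps)
  moreover have kl: "int k - 1 = int l" using l(1) by simp
  moreover have "fs.dim (secs_through P (int (Suc k))) + rk E \<le> fs.dim (p2.secs E (int (Suc k)))"
   by (rule K[rule_format]) (use k in simp)
  moreover note lin_sums(2)[OF ab, of "int k", unfolded kl]
  ultimately have "fs.dim (secs_through P (int (Suc k))) \<le> fs.dim ?W" by linarith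
  from dim_eq_fd[OF fdt lin_sums(1)[OF ab] Wsub this] have W: "?W = secs_through P (int (Suc k))" .
  have "\<sigma> \<in> ?W" unfolding W using \<sigma> by simp
  then obtain u v where "u \<in> p2.secs E (int k)" "v \<in> p2.secs E (int k)" "\<sigma> = lift (lin a) * u + lift (lin b) * v"
   by (elim CollectE exE conjE imageE) simp
  then show "\<exists>u\<in>p2.secs E (int k). \<exists>v\<in>p2.secs E (int k). \<sigma> = lift (lin a) * u + lift (lin b) * v"
   by (intro bexI)
 qed
qed

end

section \<open>Exact sequences and Chern numbers\<close>

context coord_space
begin

text \<open>The map on sections induced by a bundle map, with the default value 0 that
  \<open>secs\<close> prescribes outside X and beyond the rank.\<close>

definition push :: "nat => nat => (P2 => complex mat) => (P2 \<times> nat => complex) => P2 \<times> nat => complex" where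
 "push m n T \<sigma> = (\<lambda>(P, i). if P \<in> X \<and> i < m then app T n \<sigma> i P else 0)"

lemma push_apply: "P \<in> X ==> i < m ==> push m n T \<sigma> (P, i) = app T n \<sigma> i P"
 by (simp add: push_def)

lemma lin_map_push: "lin_map (push m n T)"
 by (rule lin_mapI) (auto simp: push_def fun_eq_iff fun_ops cscale_apply app_def algebra_simps sum.distrib sum_distrib_left)

lemma push_mult: "push m n T (lift f * \<sigma>) = lift f * push m n T \<sigma>"
 by (auto simp: push_def fun_eq_iff fun_ops app_mult lift_simps)

lemma push_secs:
 assumes E: "vector_bundle X E" and F: "vector_bundle X F" and T: "bundle_map X E F T" and \<sigma>: "\<sigma> \<in> secs E k"
 shows "push (rk F) (rk E) T \<sigma> \<in> secs F k"
proof (rule secsI[OF F])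
 show "push (rk F) (rk E) T \<sigma> (P, j) = 0" if "rk F \<le> j \<or> P \<notin> X" for P j using that by (auto simp: push_def)
 fix R assume R: "R \<in> X"
 obtain V \<psi> where V: "(V, \<psi>) \<in> atlas F" "R \<in> V" using chart_ex[OF F R] by blast
 obtain U \<phi> where U: "(U, \<phi>) \<in> atlas E" "R \<in> U" using chart_ex[OF E R] by blast
 obtain K where K: "regular_mat_on (U \<inter> V) (rk F) (rk E) K" "\<forall>P \<in> U \<inter> V. \<psi> P * T P = K P * \<phi> P"
  using T U(1) V(1) unfolding bundle_map_def by blast
 have UX: "U \<inter> V \<subseteq> X" using chart(2)[OF E U(1)] by blast
 note KD = regular_matD[OF UX K(1)]
 have "lreg k V (app \<psi> (rk F) (push (rk F) (rk E) T \<sigma>) i) R" if i: "i < rk F" for i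
 proof -
  have "lreg k (U \<inter> V) (\<lambda>Q. \<Sum>j<rk E. ((\<lambda>Q. K Q $$ (i, j)) * app \<phi> (rk E) \<sigma> j) Q) R"
  proof (rule lreg_sum)
   fix j assume "j \<in> {..<rk E}"
   then have j: "j < rk E" by simp
   have "lreg 0 (U \<inter> V) (\<lambda>Q. K Q $$ (i, j)) R" by (rule KD(2)[OF _ i j]) (use U V in auto)
   moreover have "lreg k (U \<inter> V) (app \<phi> (rk E) \<sigma> j) R" by (rule lreg_mono[OF secsD(2)[OF E \<sigma> U j]]) auto
   ultimately show "lreg k (U \<inter> V) ((\<lambda>Q. K Q $$ (i, j)) * app \<phi> (rk E) \<sigma> j) R"
    using lreg_mult by fastforce
  qed
  then have 1: "lreg k (U \<inter> V) (app \<psi> (rk F) (push (rk F) (rk E) T \<sigma>) i) R"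
  proof (rule lreg_cong)
   fix Q assume Q: "Q \<in> U \<inter> V"
   have QX: "Q \<in> X" using UX Q by blast
   have T': "T Q \<in> carrier_mat (rk F) (rk E)" using T QX unfolding bundle_map_def by blast
   let ?\<kappa> = "\<lambda>P. \<psi> P * T P"
   have \<psi>: "\<psi> Q \<in> carrier_mat (rk F) (rk F)" using chart(3)[OF F V(1)] Q by blast
   have \<phi>: "\<phi> Q \<in> carrier_mat (rk E) (rk E)" using chart(3)[OF E U(1)] Q by blast
   have "app \<psi> (rk F) (push (rk F) (rk E) T \<sigma>) i Q = (\<Sum>j<rk F. \<psi> Q $$ (i, j) * app T (rk E) \<sigma> j Q)"
    unfolding app_def[of \<psi>] using QX by (intro sum.cong) (auto simp: push_apply)
   also have "\<dots> = app ?\<kappa> (rk E) \<sigma> i Q" by (rule app_trans[where G = \<psi> and \<phi> = T and \<psi> = ?\<kappa>, OF _ \<psi> T' i, symmetric]) simp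
   also have "\<dots> = (\<Sum>j<rk E. K Q $$ (i, j) * app \<phi> (rk E) \<sigma> j Q)"
    by (rule app_trans[where G = K and \<phi> = \<phi> and \<psi> = ?\<kappa>, OF _ KD(1)[OF Q] \<phi> i]) (use K(2) Q in simp)
   finally show "(\<Sum>j<rk E. ((\<lambda>Q. K Q $$ (i, j)) * app \<phi> (rk E) \<sigma> j) Q) = app \<psi> (rk F) (push (rk F) (rk E) T \<sigma>) i Q"
    by (simp add: fun_ops)
  qed
  obtain d h where h: "H d h" "h R \<noteq> 0" "\<And>Q. Q \<in> X ==> h Q \<noteq> 0 ==> Q \<in> U"
   by (rule zopenD[OF chart(1)[OF E U(1)] U(2)]) (rule that)
  show ?thesis by (rule lreg_local[OF 1 h(1,2)]) (use h(3) chart(2)[OF F V(1)] in auto)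
 qed
 with V show "\<exists>(V, \<psi>) \<in> atlas F. R \<in> V \<and> (\<forall>i<rk F. lreg k V (app \<psi> (rk F) (push (rk F) (rk E) T \<sigma>) i) R)" by blast
qed

lemma push_inverse:
 assumes E: "vector_bundle X E" and \<sigma>: "\<sigma> \<in> secs E k"
  and ST: "\<And>P. P \<in> X ==> S P \<in> carrier_mat m (rk E) \<and> T P \<in> carrier_mat (rk E) m \<and> T P * S P = 1\<^sub>m (rk E)"
 shows "push (rk E) m T (push m (rk E) S \<sigma>) = \<sigma>"
proof
 fix x :: "P2 \<times> nat"
 obtain P i where x: "x = (P, i)" by (cases x)
 show "push (rk E) m T (push m (rk E) S \<sigma>) x = \<sigma> x"
 proof (cases "P \<in> X \<and> i < rk E")
  case True
  then have "push (rk E) m T (push m (rk E) S \<sigma>) x = (\<Sum>j<m. T P $$ (i, j) * app S (rk E) \<sigma> j P)"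
   unfolding x by (subst push_apply) (auto simp: app_def[of T] push_apply intro!: sum.cong)
  also have "\<dots> = app (\<lambda>P. T P * S P) (rk E) \<sigma> i P"
   using ST[of P] True by (intro app_trans[symmetric]) auto
  also have "\<dots> = (\<Sum>j<rk E. if j = i then \<sigma> (P, j) else 0)"
   unfolding app_def using ST[of P] True by (intro sum.cong) auto
  also have "\<dots> = \<sigma> x" using True x by simp
  finally show ?thesis .
 next
  case False
  then show ?thesis using secsD(1)[OF E \<sigma>, of i P] x by (auto simp: push_def)
 qed
qed

end

section \<open>Hilbert functions on exact sequences\<close>

abbreviation hsecs :: "vb => nat => int" where
 "hsecs E k \<equiv> int (fs.dim (p2.secs E (int k)))"

lemma hsecs_isomorphic:
 assumes E: "vector_bundle UNIV E" and F: "vector_bundle UNIV F" and iso: "isomorphic_vb UNIV E F"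
 shows "hsecs E k = hsecs F k"
proof -
 obtain S T where ST: "bundle_map UNIV E F S" "bundle_map UNIV F E T"
  "\<And>P. T P * S P = 1\<^sub>m (rk E)" "\<And>P. S P * T P = 1\<^sub>m (rk F)" using iso unfolding isomorphic_vb_def by auto
 have c: "S P \<in> carrier_mat (rk F) (rk E)" "T P \<in> carrier_mat (rk E) (rk F)" for P
  using ST(1,2) unfolding bundle_map_def by auto
 have inj: "\<sigma> = 0" if "\<sigma> \<in> p2.secs E k" "p2.push (rk F) (rk E) S \<sigma> = 0" for \<sigma> k
  using p2.push_inverse[OF E that(1), of S "rk F" T] ST(3) c that(2) lin_mapD(3)[OF p2.lin_map_push] by metis
 have inj': "\<sigma> = 0" if "\<sigma> \<in> p2.secs F k" "p2.push (rk E) (rk F) T \<sigma> = 0" for \<sigma> k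
  using p2.push_inverse[OF F that(1), of T "rk E" S] ST(4) c that(2) lin_mapD(3)[OF p2.lin_map_push] by metis
 have "fs.dim (p2.secs E (int k)) \<le> fs.dim (p2.secs F (int k))"
  by (rule inj_fd(2)[OF p2.lin_map_push p2.subspace_secs[OF E] secs_finite_dim[OF F] p2.push_secs[OF E F ST(1)] inj])
 moreover have "fs.dim (p2.secs F (int k)) \<le> fs.dim (p2.secs E (int k))"
  by (rule inj_fd(2)[OF p2.lin_map_push p2.subspace_secs[OF F] secs_finite_dim[OF E] p2.push_secs[OF F E ST(2)] inj'])
 ultimately show ?thesis by linarith
qed

lemma mult_mat_vec_app:
 fixes A :: "P2 => complex mat"
 assumes "A P \<in> carrier_mat m n" "i < m"
 shows "vec_index (A P *\<^sub>v vec n (\<lambda>j. \<sigma> (P, j))) i = app A n \<sigma> i P"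
 using assms by (simp add: app_def scalar_prod_def lessThan_atLeast0)

context
 fixes E' E E'' :: vb and S T :: "P2 => complex mat"
 assumes E': "vector_bundle UNIV E'" and E: "vector_bundle UNIV E" and E'': "vector_bundle UNIV E''"
  and S: "bundle_map UNIV E' E S" and T: "bundle_map UNIV E E'' T"
  and exact: "\<And>P. inj_on (\<lambda>x. S P *\<^sub>v x) (carrier_vec (rk E'))"
   "\<And>P. (\<lambda>x. S P *\<^sub>v x) ` carrier_vec (rk E') = {y \<in> carrier_vec (rk E). T P *\<^sub>v y = 0\<^sub>v (rk E'')}"
   "\<And>P. (\<lambda>y. T P *\<^sub>v y) ` carrier_vec (rk E) = carrier_vec (rk E'')"
begin

private abbreviation "Sp \<equiv> p2.push (rk E) (rk E') S"
private abbreviation "Tp \<equiv> p2.push (rk E'') (rk E) T"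

private lemma carr: "S P \<in> carrier_mat (rk E) (rk E')" "T P \<in> carrier_mat (rk E'') (rk E)"
 using S T unfolding bundle_map_def by auto

private lemma fibre_inj:
 assumes "\<And>i. i < rk E ==> app S (rk E') \<sigma> i P = 0" "j < rk E'"
 shows "\<sigma> (P, j) = 0"
proof -
 let ?x = "vec (rk E') (\<lambda>j. \<sigma> (P, j))"
 have "S P *\<^sub>v ?x = S P *\<^sub>v 0\<^sub>v (rk E')"
 proof (rule eq_vecI)
  fix i assume "i < dim_vec (S P *\<^sub>v 0\<^sub>v (rk E'))"
  then have i: "i < rk E" using carr(1)[of P] by simp
  show "vec_index (S P *\<^sub>v ?x) i = vec_index (S P *\<^sub>v 0\<^sub>v (rk E')) i"
   using mult_mat_vec_app[where A = S and P = P and \<sigma> = \<sigma>, OF carr(1) i] assms(1)[OF i] carr(1)[of P] i by simp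
 qed (use carr(1)[of P] in simp)
 then have "?x = 0\<^sub>v (rk E')" using exact(1)[of P] by (auto dest: inj_onD)
 then have "vec_index ?x j = 0" using assms(2) by simp
 then show ?thesis using assms(2) by simp
qed

private lemma fibre_comp: "i < rk E'' ==> app T (rk E) (Sp \<sigma>) i P = 0"
proof -
 assume i: "i < rk E''"
 let ?x = "vec (rk E') (\<lambda>j. \<sigma> (P, j))"
 have "S P *\<^sub>v ?x \<in> {y \<in> carrier_vec (rk E). T P *\<^sub>v y = 0\<^sub>v (rk E'')}" using exact(2)[of P] by auto
 then have 1: "T P *\<^sub>v (S P *\<^sub>v ?x) = 0\<^sub>v (rk E'')" by simp
 have "S P *\<^sub>v ?x = vec (rk E) (\<lambda>j. Sp \<sigma> (P, j))"
  by (rule eq_vecI) (use carr(1)[of P] mult_mat_vec_app[where A = S and P = P and \<sigma> = \<sigma>, OF carr(1)] in \<open>auto simp: p2.push_apply\<close>)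
 then show ?thesis using 1 mult_mat_vec_app[where A = T and P = P and \<sigma> = "Sp \<sigma>", OF carr(2) i] i by simp
qed

text \<open>Phrased for all sections with prescribed values at P, because
  \<open>generated_at\<close> then supplies such a section.\<close>

private lemma fibre_exact:
 assumes "\<And>i. i < rk E'' ==> app T (rk E) \<sigma> i P = 0"
 shows "\<exists>x. \<forall>\<tau>. (\<forall>j<rk E'. \<tau> (P, j) = x j) --> (\<forall>i<rk E. app S (rk E') \<tau> i P = \<sigma> (P, i))"
proof -
 let ?y = "vec (rk E) (\<lambda>j. \<sigma> (P, j))"
 have "T P *\<^sub>v ?y = 0\<^sub>v (rk E'')"
  by (rule eq_vecI) (use carr(2)[of P] assms mult_mat_vec_app[where A = T and P = P and \<sigma> = \<sigma>, OF carr(2)] in auto)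
 then have "?y \<in> (\<lambda>x. S P *\<^sub>v x) ` carrier_vec (rk E')" unfolding exact(2) by simp
 then obtain x where x: "x \<in> carrier_vec (rk E')" "?y = S P *\<^sub>v x" by (elim imageE)
 have "app S (rk E') \<tau> i P = \<sigma> (P, i)" if \<tau>: "\<forall>j<rk E'. \<tau> (P, j) = vec_index x j" and i: "i < rk E" for \<tau> i
 proof -
  have "x = vec (rk E') (\<lambda>j. \<tau> (P, j))" by (rule eq_vecI) (use x(1) \<tau> in auto)
  then have "vec_index ?y i = app S (rk E') \<tau> i P" using x(2) mult_mat_vec_app[where A = S and P = P and \<sigma> = \<tau>, OF carr(1) i] by simp
  then show ?thesis using i by simp
 qed
 then show ?thesis by (intro exI[of _ "vec_index x"]) blast
qed

private lemma fibre_surj: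
 "\<exists>y. \<forall>\<sigma>. (\<forall>j<rk E. \<sigma> (P, j) = y j) --> (\<forall>i<rk E''. app T (rk E) \<sigma> i P = z i)"
proof -
 have "vec (rk E'') z \<in> (\<lambda>y. T P *\<^sub>v y) ` carrier_vec (rk E)" unfolding exact(3) by simp
 then obtain y where y: "y \<in> carrier_vec (rk E)" "vec (rk E'') z = T P *\<^sub>v y" by (elim imageE)
 have "app T (rk E) \<sigma> i P = z i" if \<sigma>: "\<forall>j<rk E. \<sigma> (P, j) = vec_index y j" and i: "i < rk E''" for \<sigma> i
 proof -
  have "y = vec (rk E) (\<lambda>j. \<sigma> (P, j))" by (rule eq_vecI) (use y(1) \<sigma> in auto)
  then have "vec_index (vec (rk E'') z) i = app T (rk E) \<sigma> i P" using y(2) mult_mat_vec_app[where A = T and P = P and \<sigma> = \<sigma>, OF carr(2) i] by simp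
  then show ?thesis using i by simp
 qed
 then show ?thesis by (intro exI[of _ "vec_index y"]) blast
qed

private lemma Tp_Sp: "Tp (Sp \<sigma>) = 0"
 by (auto simp: fun_eq_iff fun_ops p2.push_def[of "rk E''"] fibre_comp)

private lemma lin_acts:
 assumes "vector_bundle UNIV F" "v \<in> p2.secs F (int k)"
 shows "lift (lin a) * v \<in> p2.secs F (int (Suc k))"
 using p2.secs_mult[OF assms pform_lin[of a]] by simp

text \<open>The criterion \<open>eventually_eq_3\<close> for the cokernel. At the common zero P of a
  and b the value of a section of E'' lifts to a section of E, by exactness in the fibre and
  \<open>generated_at\<close>; the remaining section vanishes at P and lies in a M'' + b M'' by
  \<open>secs_through_eq\<close>.\<close>

private lemma eventually_surjective: "\<exists>K. \<forall>k\<ge>K. p2.secs E'' (int k) = Tp ` p2.secs E (int k)"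
proof -
 interpret g: graded_pair3 "\<lambda>k. p2.secs E'' (int k)" "\<lambda>k. Tp ` p2.secs E (int k)" "\<lambda>a. lift (lin a)"
 proof unfold_locales
  show "fs.subspace (p2.secs E'' (int k))" for k by (rule p2.subspace_secs[OF E''])
  show "fd (p2.secs E'' (int k))" for k by (rule secs_finite_dim[OF E''])
  show "fs.subspace (Tp ` p2.secs E (int k))" for k by (rule subspace_image[OF p2.lin_map_push p2.subspace_secs[OF E]])
  show "Tp ` p2.secs E (int k) \<subseteq> p2.secs E'' (int k)" for k by (rule image_subsetI) (rule p2.push_secs[OF E E'' T])
  show "lift (lin (a + b)) = lift (lin a) + lift (lin b)" for a b by (simp add: lin_add lift_simps)
  show "lift (lin (c *s a)) = kk c * lift (lin a)" for c a by (simp add: lin_scale lift_simps)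
  show "lift (lin a) * v \<in> p2.secs E'' (int (Suc k))" if "v \<in> p2.secs E'' (int k)" for v k a
   by (rule lin_acts[OF E'' that])
  show "lift (lin a) * w \<in> Tp ` p2.secs E (int (Suc k))" if "w \<in> Tp ` p2.secs E (int k)" for w k a
  proof -
   obtain v where v: "v \<in> p2.secs E (int k)" "w = Tp v" using \<open>w \<in> _\<close> by (elim imageE)
   show ?thesis unfolding v(2) p2.push_mult[symmetric] by (rule imageI) (rule lin_acts[OF E v(1)])
  qed
 qed
 show ?thesis
 proof (rule g.eventually_eq_3)
  fix a b assume ab: "indep a b"
  obtain P where P: "lin a P = 0" "lin b P = 0" by (rule common_zero[OF ab])
  obtain K where K: "\<forall>k\<ge>K. \<forall>y. \<exists>\<sigma>\<in>p2.secs E (int k). \<forall>j<rk E. \<sigma> (P, j) = y j" using generated_at[OF E, of P] by blast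
  obtain L where L: "\<forall>k\<ge>L. \<forall>\<sigma>\<in>p2.secs E'' (int (Suc k)). (\<forall>j<rk E''. \<sigma> (P, j) = 0) -->
    (\<exists>u\<in>p2.secs E'' (int k). \<exists>v\<in>p2.secs E'' (int k). \<sigma> = lift (lin a) * u + lift (lin b) * v)"
   using secs_through_eq[OF E'' ab P] by blast
  show "\<exists>K. \<forall>k\<ge>K. \<forall>v\<in>p2.secs E'' (int (Suc k)). \<exists>u\<in>p2.secs E'' (int k). \<exists>u'\<in>p2.secs E'' (int k).
   \<exists>w\<in>Tp ` p2.secs E (int (Suc k)). v = lift (lin a) * u + lift (lin b) * u' + w"
  proof (intro exI[of _ "max K L"] allI impI ballI)
   fix k v assume k: "max K L \<le> k" and v: "v \<in> p2.secs E'' (int (Suc k))"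
   obtain y where y: "\<forall>\<sigma>. (\<forall>j<rk E. \<sigma> (P, j) = y j) --> (\<forall>i<rk E''. app T (rk E) \<sigma> i P = v (P, i))"
    using fibre_surj[of P "\<lambda>i. v (P, i)"] by (elim exE) (rule that)
   have "Suc k \<ge> K" using k by simp
   then obtain \<sigma> where \<sigma>: "\<sigma> \<in> p2.secs E (int (Suc k))" "\<forall>j<rk E. \<sigma> (P, j) = y j" using K by blast
   have w: "Tp \<sigma> \<in> p2.secs E'' (int (Suc k))" by (rule p2.push_secs[OF E E'' T \<sigma>(1)])
   have "v - Tp \<sigma> \<in> p2.secs E'' (int (Suc k))" by (rule fs.subspace_diff[OF p2.subspace_secs[OF E''] v w])
   moreover have "\<forall>j<rk E''. (v - Tp \<sigma>) (P, j) = 0"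
    using y[rule_format, of \<sigma>] \<sigma>(2) by (simp add: fun_ops p2.push_apply)
   ultimately obtain u u' where u: "u \<in> p2.secs E'' (int k)" "u' \<in> p2.secs E'' (int k)" "v - Tp \<sigma> = lift (lin a) * u + lift (lin b) * u'"
    using L[rule_format, of k "v - Tp \<sigma>"] k by auto
   show "\<exists>u\<in>p2.secs E'' (int k). \<exists>u'\<in>p2.secs E'' (int k). \<exists>w\<in>Tp ` p2.secs E (int (Suc k)). v = lift (lin a) * u + lift (lin b) * u' + w"
    by (rule bexI[OF _ u(1)], rule bexI[OF _ u(2)], rule bexI[OF _ imageI[OF \<sigma>(1)]]) (simp add: u(3)[symmetric])
  qed
 qed
qed

text \<open>The same criterion for the kernel modulo the image. Lifting the value at P leaves a u +
  b u' with u and u' among the sections of E, but not yet in the kernel of T; a Koszul correction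
  moves them there.\<close>

private lemma eventually_exact: "\<exists>K. \<forall>k\<ge>K. {v \<in> p2.secs E (int k). Tp v = 0} = Sp ` p2.secs E' (int k)"
proof -
 let ?V = "\<lambda>k. {v \<in> p2.secs E (int k). Tp v = 0}" and ?W = "\<lambda>k. Sp ` p2.secs E' (int k)"
 have subV: "fs.subspace (?V k)" for k by (rule subspace_ker[OF p2.lin_map_push p2.subspace_secs[OF E]])
 have fdV: "fd (?V k)" for k by (rule fd_subset[OF secs_finite_dim[OF E]]) (rule Collect_restrict)
 have subW: "fs.subspace (?W k)" for k by (rule subspace_image[OF p2.lin_map_push p2.subspace_secs[OF E']])
 have WV: "?W k \<subseteq> ?V k" for k
 proof (rule image_subsetI)
  fix x assume "x \<in> p2.secs E' (int k)"
  then show "Sp x \<in> ?V k" using p2.push_secs[OF E' E S] Tp_Sp by simp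
 qed
 interpret g: graded_pair3 ?V ?W "\<lambda>a. lift (lin a)"
 proof unfold_locales
  show "lift (lin a) * v \<in> ?V (Suc k)" if "v \<in> ?V k" for v k a
   using that lin_acts[OF E] by (simp only: mem_Collect_eq p2.push_mult mult_zero_right)
  show "lift (lin a) * w \<in> ?W (Suc k)" if "w \<in> ?W k" for w k a
  proof -
   obtain v where v: "v \<in> p2.secs E' (int k)" "w = Sp v" using \<open>w \<in> _\<close> by (elim imageE)
   show ?thesis unfolding v(2) p2.push_mult[symmetric] by (rule imageI) (rule lin_acts[OF E' v(1)])
  qed
  show "lift (lin (a + b)) = lift (lin a) + lift (lin b)" for a b by (simp add: lin_add lift_simps)
  show "lift (lin (c *s a)) = kk c * lift (lin a)" for c a by (simp add: lin_scale lift_simps)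
 qed (rule subV fdV subW WV)+
 show ?thesis
 proof (rule g.eventually_eq_3)
  fix a b assume ab: "indep a b"
  obtain P where P: "lin a P = 0" "lin b P = 0" by (rule common_zero[OF ab])
  obtain K where K: "\<forall>k\<ge>K. \<forall>y. \<exists>\<sigma>\<in>p2.secs E' (int k). \<forall>j<rk E'. \<sigma> (P, j) = y j" using generated_at[OF E', of P] by blast
  obtain L where L: "\<forall>k\<ge>L. \<forall>\<sigma>\<in>p2.secs E (int (Suc k)). (\<forall>j<rk E. \<sigma> (P, j) = 0) -->
    (\<exists>u\<in>p2.secs E (int k). \<exists>v\<in>p2.secs E (int k). \<sigma> = lift (lin a) * u + lift (lin b) * v)"
   using secs_through_eq[OF E ab P] by blast
  obtain M where M: "\<forall>k\<ge>M. p2.secs E'' (int k) = Tp ` p2.secs E (int k)" using eventually_surjective by blast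
  show "\<exists>K. \<forall>k\<ge>K. \<forall>v\<in>?V (Suc k). \<exists>u\<in>?V k. \<exists>u'\<in>?V k. \<exists>w\<in>?W (Suc k). v = lift (lin a) * u + lift (lin b) * u' + w"
  proof (intro exI[of _ "max K (max L (Suc M))"] allI impI ballI)
   fix k v assume k: "max K (max L (Suc M)) \<le> k" and v: "v \<in> ?V (Suc k)"
   have vM: "v \<in> p2.secs E (int (Suc k))" and Tv: "Tp v = 0" using v by auto
   have Tv0: "app T (rk E) v i P = 0" if "i < rk E''" for i
    using fun_cong[OF Tv, of "(P, i)"] that by (simp add: p2.push_apply fun_ops)
   have "\<exists>x. \<forall>\<tau>. (\<forall>j<rk E'. \<tau> (P, j) = x j) --> (\<forall>i<rk E. app S (rk E') \<tau> i P = v (P, i))"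
    by (rule fibre_exact) (rule Tv0)
   then obtain x where x: "\<forall>\<tau>. (\<forall>j<rk E'. \<tau> (P, j) = x j) --> (\<forall>i<rk E. app S (rk E') \<tau> i P = v (P, i))"
    by (elim exE) (rule that)
   have "Suc k \<ge> K" using k by simp
   then obtain \<tau> where \<tau>: "\<tau> \<in> p2.secs E' (int (Suc k))" "\<forall>j<rk E'. \<tau> (P, j) = x j" using K by blast
   have w: "Sp \<tau> \<in> p2.secs E (int (Suc k))" by (rule p2.push_secs[OF E' E S \<tau>(1)])
   have "v - Sp \<tau> \<in> p2.secs E (int (Suc k))" by (rule fs.subspace_diff[OF p2.subspace_secs[OF E] vM w])
   moreover have "\<forall>j<rk E. (v - Sp \<tau>) (P, j) = 0"
    using x[rule_format, of \<tau>] \<tau>(2) by (simp add: fun_ops p2.push_apply)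
   ultimately obtain u u' where u: "u \<in> p2.secs E (int k)" "u' \<in> p2.secs E (int k)" "v - Sp \<tau> = lift (lin a) * u + lift (lin b) * u'"
    using L[rule_format, of k "v - Sp \<tau>"] k by auto
   have "Tp (v - Sp \<tau>) = 0" by (simp add: lin_mapD(4)[OF p2.lin_map_push] Tv Tp_Sp)
   then have Tu: "lift (lin a) * Tp u + lift (lin b) * Tp u' = 0"
    unfolding u(3) by (simp add: lin_mapD(1)[OF p2.lin_map_push] p2.push_mult)
   \<comment> \<open>Since a Tu + b Tu' = 0, the Koszul lemma gives Tu = b \<open>\<rho>\<close>,
     and surjectivity one degree lower gives \<open>\<rho>\<close> = T r; this is why
     \<open>Suc M\<close> enters the bound on k.\<close>
   have eq: "lift (lin a) * Tp u = lift (lin b) * (- Tp u')" using Tu by (simp add: eq_neg_iff_add_eq_0)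
   from koszul[OF E'' ab p2.push_secs[OF E E'' T u(1)] eq] obtain \<rho> where \<rho>: "\<rho> \<in> p2.secs E'' (int k - 1)" "Tp u = lift (lin b) * \<rho>" .
   have k1: "int k - 1 = int (k - 1)" using k by simp
   have "k - 1 \<ge> M" using k by linarith
   then have "\<rho> \<in> Tp ` p2.secs E (int (k - 1))" using M \<rho>(1) unfolding k1 by blast
   then obtain r where r: "r \<in> p2.secs E (int (k - 1))" "\<rho> = Tp r" by (elim imageE)
   have "Suc (k - 1) = k" using k by simp
   then have rm: "lift (lin a) * r \<in> p2.secs E (int k)" "lift (lin b) * r \<in> p2.secs E (int k)"
    using lin_acts[OF E r(1)] by metis+
   \<comment> \<open>The correction leaves a u + b u' unchanged, as the terms a b r cancel.\<close>
   define u1 where "u1 = u - lift (lin b) * r"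
   define u2 where "u2 = u' + lift (lin a) * r"
   have u1: "u1 \<in> ?V k"
   proof (rule CollectI, rule conjI)
    show "u1 \<in> p2.secs E (int k)" unfolding u1_def by (rule fs.subspace_diff[OF p2.subspace_secs[OF E] u(1) rm(2)])
    show "Tp u1 = 0" unfolding u1_def by (simp add: lin_mapD(4)[OF p2.lin_map_push] p2.push_mult \<rho>(2) r(2))
   qed
   have "lift (lin b) * (Tp u' + lift (lin a) * \<rho>) = 0"
    using Tu unfolding \<rho>(2) by (simp add: algebra_simps)
   moreover have "Tp u' + lift (lin a) * \<rho> \<in> p2.secs E'' (int k)"
   proof (rule p2.secs_add[OF E'' p2.push_secs[OF E E'' T u(2)]])
    show "lift (lin a) * \<rho> \<in> p2.secs E'' (int k)" using p2.secs_mult[OF E'' \<rho>(1) pform_lin[of a]] by simp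
   qed
   moreover have "b \<noteq> 0" using ab[unfolded indep_def, rule_format, of 0 1] by auto
   ultimately have z: "Tp u' + lift (lin a) * \<rho> = 0" using lin_kills[OF E''] by metis
   have u2: "u2 \<in> ?V k"
   proof (rule CollectI, rule conjI)
    show "u2 \<in> p2.secs E (int k)" unfolding u2_def by (rule p2.secs_add[OF E u(2) rm(1)])
    show "Tp u2 = 0" unfolding u2_def using z by (simp add: lin_mapD(1)[OF p2.lin_map_push] p2.push_mult r(2))
   qed
   have "v = (v - Sp \<tau>) + Sp \<tau>" by simp
   also have "\<dots> = lift (lin a) * u1 + lift (lin b) * u2 + Sp \<tau>"
    unfolding u(3) u1_def u2_def by (simp add: algebra_simps)
   finally have veq: "v = lift (lin a) * u1 + lift (lin b) * u2 + Sp \<tau>" .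
   show "\<exists>u\<in>?V k. \<exists>u'\<in>?V k. \<exists>w\<in>?W (Suc k). v = lift (lin a) * u + lift (lin b) * u' + w"
    by (rule bexI[OF _ u1], rule bexI[OF _ u2], rule bexI[OF _ imageI[OF \<tau>(1)]], rule veq)
  qed
 qed
qed

lemma hsecs_exact: "\<exists>K. \<forall>k\<ge>K. hsecs E k = hsecs E' k + hsecs E'' k"
proof -
 obtain K where K: "\<forall>k\<ge>K. p2.secs E'' (int k) = Tp ` p2.secs E (int k)" using eventually_surjective by blast
 obtain L where L: "\<forall>k\<ge>L. {v \<in> p2.secs E (int k). Tp v = 0} = Sp ` p2.secs E' (int k)" using eventually_exact by blast
 show ?thesis
 proof (intro exI[of _ "max K L"] allI impI)
  fix k assume k: "max K L \<le> k"
  have "fs.dim (p2.secs E (int k)) = fs.dim {v \<in> p2.secs E (int k). Tp v = 0} + fs.dim (Tp ` p2.secs E (int k))"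
   by (rule rank_nullity(2)[OF p2.lin_map_push p2.subspace_secs[OF E] secs_finite_dim[OF E]])
  also have "{v \<in> p2.secs E (int k). Tp v = 0} = Sp ` p2.secs E' (int k)" using L k by simp
  also have "fs.dim (Sp ` p2.secs E' (int k)) = fs.dim (p2.secs E' (int k))"
  proof (rule dim_inj_image[OF p2.lin_map_push p2.subspace_secs[OF E'] secs_finite_dim[OF E']])
   fix \<sigma> assume \<sigma>: "\<sigma> \<in> p2.secs E' (int k)" "Sp \<sigma> = 0"
   show "\<sigma> = 0"
   proof
    fix x :: "P2 \<times> nat"
    obtain P j where x: "x = (P, j)" by (cases x)
    have "app S (rk E') \<sigma> i P = 0" if "i < rk E" for i
     using fun_cong[OF \<sigma>(2), of "(P, i)"] that by (simp add: p2.push_apply fun_ops)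
    from fibre_inj[OF this] p2.secsD(1)[OF E' \<sigma>(1), of j P] show "\<sigma> x = 0 x"
     unfolding x zero_fun_apply by (cases "j < rk E'") auto
   qed
  qed
  also have "Tp ` p2.secs E (int k) = p2.secs E'' (int k)" using K k by simp
  finally show "hsecs E k = hsecs E' k + hsecs E'' k" by simp
 qed
qed

end

section \<open>Hilbert polynomials and Chern numbers\<close>

lemma quadratic_coefficients:
 fixes p q s :: int
 assumes "\<forall>k\<ge>K. p * int k * int k + q * int k + s = 0"
 shows "p = 0" "q = 0" "s = 0"
proof -
 have 0: "p * int K * int K + q * int K + s = 0" using assms by simp
 have 1: "p * int (K + 1) * int (K + 1) + q * int (K + 1) + s = 0" using assms[rule_format, of "K + 1"] by simp
 have 2: "p * int (K + 2) * int (K + 2) + q * int (K + 2) + s = 0" using assms[rule_format, of "K + 2"] by simp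
 have "2 * p = 0" using 0 1 2 by (simp add: algebra_simps)
 then show p: "p = 0" by simp
 then show q: "q = 0" using 0 1 by (simp add: algebra_simps)
 then show "s = 0" using 0 p by simp
qed

text \<open>Doubled, to stay within the integers. The shape is chosen so that for a bundle r is the
  rank, a is c_1, and b is c_1^2 - 2 c_2 + 3 c_1.\<close>

definition hilb :: "(nat => int) => int => int => int => bool" where
 "hilb h r a b \<longleftrightarrow> (\<exists>K. \<forall>k\<ge>K. 2 * h k = r * (int k + 1) * (int k + 2) + 2 * a * int k + b)"

lemma hilb_unique:
 assumes "hilb h r a b" "hilb h r' a' b'"
 shows "r = r'" "a = a'" "b = b'"
proof -
 obtain K where K: "\<forall>k\<ge>K. 2 * h k = r * (int k + 1) * (int k + 2) + 2 * a * int k + b" using assms(1) unfolding hilb_def by blast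
 obtain L where L: "\<forall>k\<ge>L. 2 * h k = r' * (int k + 1) * (int k + 2) + 2 * a' * int k + b'" using assms(2) unfolding hilb_def by blast
 have "\<forall>k\<ge>max K L. (r - r') * int k * int k + (3 * (r - r') + 2 * (a - a')) * int k + (2 * (r - r') + b - b') = 0"
 proof (intro allI impI)
  fix k assume "max K L \<le> k"
  then have "r * (int k + 1) * (int k + 2) + 2 * a * int k + b = r' * (int k + 1) * (int k + 2) + 2 * a' * int k + b'"
   using K[rule_format, of k] L[rule_format, of k] by simp
  then show "(r - r') * int k * int k + (3 * (r - r') + 2 * (a - a')) * int k + (2 * (r - r') + b - b') = 0"
   by (simp add: algebra_simps)
 qed
 note q = quadratic_coefficients[OF this]
 show "r = r'" "a = a'" "b = b'" using q by simp_all
qed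

lemma hilb_exact:
 assumes "\<exists>K. \<forall>k\<ge>K. h k = h' k + h'' k" "hilb h' r' a' b'" "hilb h'' r'' a'' b''"
 shows "hilb h (r' + r'') (a' + a'') (b' + b'')"
proof -
 obtain K where K: "\<forall>k\<ge>K. 2 * h' k = r' * (int k + 1) * (int k + 2) + 2 * a' * int k + b'" using assms(2) unfolding hilb_def by blast
 obtain L where L: "\<forall>k\<ge>L. 2 * h'' k = r'' * (int k + 1) * (int k + 2) + 2 * a'' * int k + b''" using assms(3) unfolding hilb_def by blast
 obtain M where M: "\<forall>k\<ge>M. h k = h' k + h'' k" using assms(1) by blast
 show ?thesis unfolding hilb_def
 proof (intro exI[of _ "max K (max L M)"] allI impI)
  fix k assume "max K (max L M) \<le> k"
  then show "2 * h k = (r' + r'') * (int k + 1) * (int k + 2) + 2 * (a' + a'') * int k + (b' + b'')"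
   using K[rule_format, of k] L[rule_format, of k] M[rule_format, of k] by (simp add: algebra_simps)
 qed
qed

lemma hsecs_hilb: "vector_bundle UNIV E ==> \<exists>a b. hilb (hsecs E) (int (rk E)) a b"
 using hilbert_polynomial unfolding hilb_def by blast

lemma short_exact_hilb:
 assumes "short_exact UNIV E' E E''"
 obtains a' b' a'' b'' where "hilb (hsecs E') (int (rk E')) a' b'" "hilb (hsecs E'') (int (rk E'')) a'' b''"
  "hilb (hsecs E) (int (rk E)) (a' + a'') (b' + b'')"
proof -
 have vb: "vector_bundle UNIV E'" "vector_bundle UNIV E" "vector_bundle UNIV E''"
  using assms unfolding short_exact_def by simp_all
 obtain S T where ST: "bundle_map UNIV E' E S" "bundle_map UNIV E E'' T" "\<forall>P\<in>UNIV.
    inj_on (\<lambda>x. S P *\<^sub>v x) (carrier_vec (rk E')) \<and>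
    (\<lambda>x. S P *\<^sub>v x) ` carrier_vec (rk E') = {y \<in> carrier_vec (rk E). T P *\<^sub>v y = 0\<^sub>v (rk E'')} \<and>
    (\<lambda>y. T P *\<^sub>v y) ` carrier_vec (rk E) = carrier_vec (rk E'')"
  using assms unfolding short_exact_def by (elim conjE exE) (rule that)
 have ex: "\<exists>K. \<forall>k\<ge>K. hsecs E k = hsecs E' k + hsecs E'' k"
  by (rule hsecs_exact[OF vb ST(1,2)]) (use ST(3) in \<open>simp_all\<close>)
 obtain a' b' where 1: "hilb (hsecs E') (int (rk E')) a' b'" using hsecs_hilb[OF vb(1)] by blast
 obtain a'' b'' where 2: "hilb (hsecs E'') (int (rk E'')) a'' b''" using hsecs_hilb[OF vb(3)] by blast
 obtain a b where 3: "hilb (hsecs E) (int (rk E)) a b" using hsecs_hilb[OF vb(2)] by blast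
 from hilb_exact[OF ex 1 2] hilb_unique[OF 3 hilb_exact[OF ex 1 2]] 3 show ?thesis by (intro that[OF 1 2]) simp
qed

lemma lreg_coord_powi: "coords R $ i \<noteq> 0 ==> p2.lreg n A (\<lambda>P. coords P $ i powi n) R"
 using p2.lreg_mono[OF p2.lreg_powi[OF p2.lreg_H[OF pform_lin[of "axis i 1"]] UNIV_I] subset_UNIV, of R n A]
 by (simp add: lin_axis)

lemma coords_neq_0: "\<exists>i. coords P $ i \<noteq> 0"
 using coords_nonzero[of P] by (auto simp: Finite_Cartesian_Product.vec_eq_iff)

lemma zopen_coord: "p2.zopen {P. coords P $ i \<noteq> 0}"
 unfolding p2.zopen_def using pform_lin[of "axis i 1"] lin_axis by (auto intro!: exI[of _ "1 :: int"] exI[of _ "lin (axis i 1)"])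

lemma rk_line_O: "rk (line_O d) = 1"
 by (simp add: line_O_def)

lemma vector_bundle_line_O: "vector_bundle UNIV (line_O d)"
proof (rule p2.vector_bundle_rank1[OF rk_line_O])
 show "atlas (line_O d) = range (\<lambda>i. ({P. coords P $ i \<noteq> 0}, \<lambda>P. mat 1 1 (\<lambda>_. coords P $ i powi (- d))))"
  by (simp add: line_O_def)
 show "(\<Union>i. {P. coords P $ i \<noteq> 0}) = UNIV" using coords_neq_0 by auto
 fix i j P assume P: "P \<in> {P. coords P $ i \<noteq> 0} \<inter> {P. coords P $ j \<noteq> 0}"
 show "p2.lreg 0 ({P. coords P $ i \<noteq> 0} \<inter> {P. coords P $ j \<noteq> 0}) (\<lambda>P. coords P $ j powi (- d) / coords P $ i powi (- d)) P"
  by (rule p2.lreg_divide[OF lreg_coord_powi lreg_coord_powi P]) (use P in auto)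
qed (auto simp: zopen_coord)

lemma app_line_O:
 "app (\<lambda>P. mat 1 1 (\<lambda>_. (coords P $ i) powi (- d))) 1 \<sigma> 0 = (\<lambda>P. (coords P $ i) powi (- d) * \<sigma> (P, 0))"
 by (simp add: fun_eq_iff app_1[unfolded One_nat_def])

definition line_sec :: "(P2 => complex) => P2 \<times> nat => complex" where
 "line_sec f = (\<lambda>(P, j). if j = 0 then f P else 0)"

lemma line_sec_secs:
 assumes "pform (k + d) f"
 shows "line_sec f \<in> p2.secs (line_O d) k"
proof (rule p2.secsI[OF vector_bundle_line_O])
 show "line_sec f (P, j) = 0" if "rk (line_O d) \<le> j \<or> P \<notin> UNIV" for P j using that by (auto simp: line_sec_def rk_line_O)
 fix R
 obtain i where i: "coords R $ i \<noteq> 0" using coords_neq_0 by blast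
 let ?U = "{P. coords P $ i \<noteq> 0}" and ?\<phi> = "\<lambda>P. mat 1 1 (\<lambda>_. (coords P $ i) powi (- d))"
 have "(?U, ?\<phi>) \<in> atlas (line_O d)" by (simp add: line_O_def)
 moreover have "p2.lreg k ?U (app ?\<phi> 1 (line_sec f) 0) R"
  unfolding app_line_O using i by (intro p2.lreg_times[OF lreg_coord_powi p2.lreg_H[OF assms, THEN p2.lreg_cong]]) (auto simp: line_sec_def)
 ultimately show "\<exists>(U, \<phi>)\<in>atlas (line_O d). R \<in> U \<and> (\<forall>j<rk (line_O d). p2.lreg k U (app \<phi> (rk (line_O d)) (line_sec f) j) R)"
  using i unfolding rk_line_O by (intro bexI[of _ "(?U, ?\<phi>)"]) auto
qed

text \<open>Undoing the trivialisation by a power of a coordinate turns the fibre coordinate into a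
  function that is locally a fraction of degree k + d, hence a form by \<open>global_form\<close>
  with F = 1.\<close>

lemma secs_line_O: "p2.secs (line_O d) k = line_sec ` pforms (k + d)"
proof (rule equalityI; rule subsetI)
 fix \<sigma> assume \<sigma>: "\<sigma> \<in> p2.secs (line_O d) k"
 have "p2.lreg (k + d) {Q. (1 :: P2 => complex) Q \<noteq> 0} (\<lambda>P. \<sigma> (P, 0)) R" for R
 proof -
  obtain i where i: "coords R $ i \<noteq> 0" using coords_neq_0 by blast
  let ?U = "{P. coords P $ i \<noteq> 0}" and ?\<phi> = "\<lambda>P. mat 1 1 (\<lambda>_. (coords P $ i) powi (- d))"
  have "(?U, ?\<phi>) \<in> atlas (line_O d)" by (simp add: line_O_def)
  then have "p2.lreg k ?U (app ?\<phi> 1 \<sigma> 0) R"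
   using p2.secsD(2)[OF vector_bundle_line_O \<sigma>, of ?U ?\<phi> R 0] i by (simp add: rk_line_O)
  then have "p2.lreg (k + d) ?U (\<lambda>P. coords P $ i powi d * (app ?\<phi> 1 \<sigma> 0) P) R"
   by (intro p2.lreg_times[OF lreg_coord_powi[OF i]]) (auto simp: add.commute)
  then show ?thesis
  proof (rule p2.lreg_local[OF _ pform_lin[of "axis i 1"]])
   fix Q assume "lin (axis i 1) Q \<noteq> 0"
   then show "Q \<in> ?U \<and> coords Q $ i powi d * app ?\<phi> 1 \<sigma> 0 Q = \<sigma> (Q, 0)"
    unfolding app_line_O by (simp add: lin_axis power_int_minus)
  qed (use i in \<open>simp add: lin_axis\<close>)
 qed
 from global_form[OF pform_one one_neq_zero this] obtain p where
  "pform (k + d) p" "\<And>Q. (1 :: P2 => complex) Q \<noteq> 0 ==> \<sigma> (Q, 0) = p Q" by blast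
 then have p: "pform (k + d) p" "\<And>Q. \<sigma> (Q, 0) = p Q" by (simp_all add: fun_ops)
 have "\<sigma> = line_sec p"
  using p(2) p2.secsD(1)[OF vector_bundle_line_O \<sigma>] by (auto simp: fun_eq_iff line_sec_def rk_line_O)
 then show "\<sigma> \<in> line_sec ` pforms (k + d)" using p(1) by (intro image_eqI) (auto simp: mem_pforms)
next
 fix \<sigma> assume "\<sigma> \<in> line_sec ` pforms (k + d)"
 then show "\<sigma> \<in> p2.secs (line_O d) k" using line_sec_secs by (auto simp: mem_pforms)
qed

lemma hilb_line_O: "hilb (hsecs (line_O d)) 1 d (d * d + 3 * d)"
 unfolding hilb_def
proof (intro exI[of _ "nat (- d)"] allI impI)
 fix k assume k: "nat (- d) \<le> k"
 have lin: "lin_map line_sec" by (rule lin_mapI) (auto simp: line_sec_def fun_eq_iff fun_ops cscale_apply)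
 have "fs.dim (p2.secs (line_O d) (int k)) = fs.dim (pforms (int k + d))"
  unfolding secs_line_O
 proof (rule dim_inj_image[OF lin subspace_pforms fd_pforms])
  fix v assume "line_sec v = 0"
  then have "line_sec v (P, 0) = 0" for P by (simp add: zero_fun_apply)
  then show "v = 0" by (simp add: line_sec_def fun_eq_iff fun_ops)
 qed
 then have "2 * hsecs (line_O d) k = 2 * int (fs.dim (pforms (int k + d)))" by simp
 also have "\<dots> = (int k + d + 1) * (int k + d + 2)" unfolding dim_pforms using k by simp
 finally show "2 * hsecs (line_O d) k = 1 * (int k + 1) * (int k + 2) + 2 * d * int k + (d * d + 3 * d)"
  by (simp add: algebra_simps)
qed

text \<open>Riemann--Roch, for large twists.\<close>

theorem chern_numbers_hilb:
 "chern_numbers E a b ==> vector_bundle UNIV E \<and> hilb (hsecs E) (int (rk E)) a (a * a - 2 * b + 3 * a)"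
proof (induction rule: chern_numbers.induct)
 case (normalisation d)
 then show ?case using vector_bundle_line_O hilb_line_O by (simp add: rk_line_O)
next
 case (isomorphism E a b F)
 have "hsecs E k = hsecs F k" for k using hsecs_isomorphic isomorphism by blast
 then have "hilb (hsecs F) (int (rk E)) a (a * a - 2 * b + 3 * a)" using isomorphism.IH unfolding hilb_def by simp
 moreover obtain x y where xy: "hilb (hsecs F) (int (rk F)) x y" using hsecs_hilb isomorphism by blast
 \<comment> \<open>The leading coefficient of the Hilbert polynomial recovers the rank.\<close>
 ultimately have "int (rk E) = int (rk F)" using hilb_unique by blast
 with \<open>hilb (hsecs F) (int (rk E)) a _\<close> isomorphism show ?case by simp
next
 case (whitney_mid E' E E'' a' b' a'' b'')
 then have vb: "vector_bundle UNIV E" by (simp add: short_exact_def)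
 obtain x' y' x'' y'' where h: "hilb (hsecs E') (int (rk E')) x' y'" "hilb (hsecs E'') (int (rk E'')) x'' y''"
  "hilb (hsecs E) (int (rk E)) (x' + x'') (y' + y'')" by (rule short_exact_hilb[OF whitney_mid(1)])
 have "x' = a'" "y' = a' * a' - 2 * b' + 3 * a'" "x'' = a''" "y'' = a'' * a'' - 2 * b'' + 3 * a''"
  using hilb_unique[OF h(1)] hilb_unique[OF h(2)] whitney_mid by blast+
 \<comment> \<open>Under the Whitney formula c_1 and c_1^2 - 2 c_2 are additive, as Hilbert
   polynomials are.\<close>
 then have "y' + y'' = (a' + a'') * (a' + a'') - 2 * (b' + a' * a'' + b'') + 3 * (a' + a'')" "x' + x'' = a' + a''"
  by (simp_all add: algebra_simps)
 with h(3) vb show ?case by simp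
next
 case (whitney_sub E' E E'' a'' b'' a' b')
 then have vb: "vector_bundle UNIV E'" by (simp add: short_exact_def)
 obtain x' y' x'' y'' where h: "hilb (hsecs E') (int (rk E')) x' y'" "hilb (hsecs E'') (int (rk E'')) x'' y''"
  "hilb (hsecs E) (int (rk E)) (x' + x'') (y' + y'')" by (rule short_exact_hilb[OF whitney_sub(1)])
 \<comment> \<open>The bundle E' has some Hilbert polynomial; uniqueness for the other two bundles
   determines its coefficients.\<close>
 have e: "x'' = a''" "y'' = a'' * a'' - 2 * b'' + 3 * a''" "x' + x'' = a' + a''"
  "y' + y'' = (a' + a'') * (a' + a'') - 2 * (b' + a' * a'' + b'') + 3 * (a' + a'')"
  using hilb_unique[OF h(2)] hilb_unique[OF h(3)] whitney_sub by blast+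
 then have "x' = a'" by simp
 moreover have "y' = a' * a' - 2 * b' + 3 * a'" using e(2,4) by (simp add: algebra_simps)
 ultimately show ?case using h(1) vb by simp
next
 case (whitney_quot E' E E'' a' b' a'' b'')
 then have vb: "vector_bundle UNIV E''" by (simp add: short_exact_def)
 obtain x' y' x'' y'' where h: "hilb (hsecs E') (int (rk E')) x' y'" "hilb (hsecs E'') (int (rk E'')) x'' y''"
  "hilb (hsecs E) (int (rk E)) (x' + x'') (y' + y'')" by (rule short_exact_hilb[OF whitney_quot(1)])
 have e: "x' = a'" "y' = a' * a' - 2 * b' + 3 * a'" "x' + x'' = a' + a''"
  "y' + y'' = (a' + a'') * (a' + a'') - 2 * (b' + a' * a'' + b'') + 3 * (a' + a'')"
  using hilb_unique[OF h(1)] hilb_unique[OF h(3)] whitney_quot by blast+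
 then have "x'' = a''" by simp
 moreover have "y'' = a'' * a'' - 2 * b'' + 3 * a''" using e(2,4) by (simp add: algebra_simps)
 ultimately show ?case using h(2) vb by simp
qed

section \<open>Bundles of rank one and two on the plane\<close>

text \<open>Pigeonhole over the prime factors of g.\<close>

lemma prime_factor_infinite_zeros:
 assumes "pform d g" "g \<noteq> 0" "infinite A" "\<And>P. P \<in> A ==> g P = 0"
 shows "\<exists>e f. pprime e f \<and> infinite {P \<in> A. f P = 0}"
 using assms
proof (induction arbitrary: A rule: pform_prime_induct)
 case (const c)
 then have "A = {}" by (auto simp: kk_apply)
 then show ?case using const by simp
next
 case (prime e f k h)
 show ?case
 proof (cases "infinite {P \<in> A. f P = 0}")
  case True
  then show ?thesis using prime by blast
 next
  case False
  then have "infinite (A - {P \<in> A. f P = 0})" using prime.prems(1) by (simp add: Diff_infinite_finite)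
  moreover have "h P = 0" if "P \<in> A - {P \<in> A. f P = 0}" for P
   using prime.prems(2)[of P] that by (auto simp: fun_ops)
  ultimately obtain e' f' where "pprime e' f'" "infinite {P \<in> A - {P \<in> A. f P = 0}. f' P = 0}"
   using prime.IH[of "A - {P \<in> A. f P = 0}"] by blast
  moreover from this have "infinite {P \<in> A. f' P = 0}" by (elim infinite_super[rotated]) blast
  ultimately show ?thesis by blast
 qed
qed

lemma infinite_P2: "infinite (UNIV :: P2 set)"
 by (rule infinite_super[OF subset_UNIV zeros_infinite[OF pform_lin[of 0]]]) simp

text \<open>Hartogs for the plane: a nonconstant denominator in lowest terms would have infinitely
  many zeros, so it cannot be hidden in a finite set.\<close>

lemma global_form_finite:
 assumes F: "pform l F" "F \<noteq> 0" and g: "finite {R. \<not> p2.lreg k {Q. F Q \<noteq> 0} g R}"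
 obtains p where "pform k p" "\<And>Q. F Q \<noteq> 0 ==> p2.lreg k {Q. F Q \<noteq> 0} g Q ==> g Q = p Q"
proof -
 obtain R0 where R0: "p2.lreg k {Q. F Q \<noteq> 0} g R0" using g infinite_P2 by (metis (mono_tags, lifting) UNIV_eq_I mem_Collect_eq)
 obtain d p q where q: "pform (d + k) p" "pform d q" "q \<noteq> 0"
  "\<And>R. p2.lreg k {Q. F Q \<noteq> 0} g R ==> q R \<noteq> 0"
  "\<And>R. p2.lreg k {Q. F Q \<noteq> 0} g R ==> F R \<noteq> 0 ==> g R = p R / q R"
  by (rule regular_lowest_terms[OF F R0]) (rule that)
 have "finite {R. q R = 0}" by (rule finite_subset[OF _ g]) (use q(4) in blast)
 then have "d < 1" using zeros_infinite[OF q(2)] by fastforce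
 moreover have "d \<ge> 0" using pform_neg[OF q(2)] q(3) by force
 ultimately have d: "d = 0" by simp
 then obtain c where c: "q = kk c" using pform_const q(2) by blast
 then have "c \<noteq> 0" using q(3) by (auto simp: kk_simps)
 have "pform k (kk (inverse c) * p)" using pform_kk_mult[OF q(1)] d by simp
 moreover have "g Q = (kk (inverse c) * p) Q" if "F Q \<noteq> 0" "p2.lreg k {Q. F Q \<noteq> 0} g Q" for Q
  using q(5)[OF that(2,1)] c by (simp add: fun_ops kk_apply divide_inverse)
 ultimately show ?thesis by (rule that)
qed

lemma (in coord_ring) lreg_nonzero_near:
 assumes "lreg k A g R" "R \<in> A" "g R \<noteq> 0"
 shows "\<exists>d h. H d h \<and> h R \<noteq> 0 \<and> (\<forall>Q\<in>A. h Q \<noteq> 0 --> g Q \<noteq> 0)"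
proof -
 obtain d p q where *: "H (d + k) p" "H d q" "q R \<noteq> 0" "\<forall>Q\<in>A. q Q \<noteq> 0 --> g Q = p Q / q Q"
  using assms(1) unfolding lreg_def by blast
 have "(q * p) R \<noteq> 0" "\<forall>Q\<in>A. (q * p) Q \<noteq> 0 --> g Q \<noteq> 0" using * assms(2,3) by (auto simp: fun_ops)
 with H_mult[OF *(2,1)] show ?thesis by blast
qed

definition minimal_section :: "vb => int => (P2 \<times> nat => complex) => bool" where
 "minimal_section E k s \<longleftrightarrow> s \<in> p2.secs E k \<and> s \<noteq> 0 \<and> (\<forall>l<k. p2.secs E l = {0})"

text \<open>Very negative degrees have no sections by \<open>secs_dim_bound\<close>, and large
  degrees have some by \<open>generated_at\<close>.\<close>

lemma minimal_section_exists:
 assumes E: "vector_bundle UNIV E" and r: "rk E \<ge> 1"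
 shows "\<exists>k s. minimal_section E k s"
proof -
 obtain m where m: "\<forall>k. fs.dim (p2.secs E k) \<le> rk E * fs.dim (pforms (k + int m))" using secs_dim_bound[OF E] by blast
 have neg: "p2.secs E l = {0}" if "l < - int m" for l
 proof -
  have "fs.dim (pforms (l + int m)) = 0" using dim_pforms[of "l + int m"] that by simp
  then have "fs.dim (p2.secs E l) = 0" using m[rule_format, of l] by simp
  then show ?thesis using dim_0_fd[OF p2.subspace_secs[OF E] secs_finite_dim[OF E]] by blast
 qed
 obtain K where K: "\<forall>k\<ge>K. \<forall>y. \<exists>\<sigma>\<in>p2.secs E (int k). \<forall>j<rk E. \<sigma> (undefined, j) = y j" using generated_at[OF E, of undefined] by blast
 obtain \<sigma> where \<sigma>: "\<sigma> \<in> p2.secs E (int K)" "\<forall>j<rk E. \<sigma> (undefined, j) = 1"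
  using K[rule_format, of K "\<lambda>_. 1"] by blast
 have "\<sigma> (undefined, 0) \<noteq> 0" using \<sigma>(2) r by simp
 then have \<sigma>0: "\<sigma> \<noteq> 0" by (auto simp: fun_ops)
 define N where "N = (LEAST n. p2.secs E (int n - int m) \<noteq> {0})"
 have "int (K + m) - int m = int K" by simp
 then have "p2.secs E (int (K + m) - int m) \<noteq> {0}" using \<sigma>(1) \<sigma>0 by auto
 then have N: "p2.secs E (int N - int m) \<noteq> {0}" unfolding N_def by (rule LeastI)
 then obtain s where s: "s \<in> p2.secs E (int N - int m)" "s \<noteq> 0" using p2.secs_0[OF E] by blast
 have "p2.secs E l = {0}" if l: "l < int N - int m" for l
 proof (cases "l < - int m")
  case False
  then have "l = int (nat (l + int m)) - int m" "nat (l + int m) < N" using l by auto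
  then show ?thesis using not_less_Least[of "nat (l + int m)" "\<lambda>n. p2.secs E (int n - int m) \<noteq> {0}"] unfolding N_def by simp
 qed (rule neg)
 with s show ?thesis unfolding minimal_section_def by blast
qed

lemma section_nonzero_at:
 assumes E: "vector_bundle UNIV E" and "s \<in> p2.secs E k" "s \<noteq> 0"
 obtains P j where "j < rk E" "s (P, j) \<noteq> 0"
proof -
 obtain P j where "s (P, j) \<noteq> 0" using assms(3) by (auto simp: fun_eq_iff fun_ops)
 moreover from this have "j < rk E" using p2.secsD(1)[OF E assms(2), of j P] by force
 ultimately show ?thesis by (rule that[rotated])
qed

text \<open>All zeros of s are zeros of one nonzero form, f0 times a chart coordinate of s made into
  a form. If they were infinite in number, infinitely many would lie on one prime curve f = 0, and s
  could be divided by f, lowering the degree.\<close>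

lemma minimal_section_zeros:
 assumes E: "vector_bundle UNIV E" and s: "minimal_section E k s"
 shows "finite {P. \<forall>j<rk E. s (P, j) = 0}"
proof (rule ccontr)
 let ?r = "rk E" and ?Z = "{P. \<forall>j<rk E. s (P, j) = 0}"
 assume inf: "infinite ?Z"
 have sE: "s \<in> p2.secs E k" "s \<noteq> 0" and min: "\<And>l. l < k ==> p2.secs E l = {0}" using s unfolding minimal_section_def by auto
 obtain P0 j0 where j0: "j0 < ?r" "s (P0, j0) \<noteq> 0" by (rule section_nonzero_at[OF E sE])
 obtain U \<phi> f0 e0 n m where U: "(U, \<phi>) \<in> atlas E" "P0 \<in> U" and f0: "pform e0 f0" "f0 P0 \<noteq> 0"
  and p: "\<And>k \<sigma> i. \<sigma> \<in> p2.secs E k ==> i < ?r ==> \<exists>p. pform (k + m) p \<and> (\<forall>Q. f0 Q \<noteq> 0 --> p Q = f0 Q ^ n * app \<phi> ?r \<sigma> i Q)"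
  by (rule local_frame[OF E, of P0]) (rule that)
 obtain i where i: "i < ?r" "app \<phi> ?r s i P0 \<noteq> 0" using p2.fibre_eq_0[OF E U _ j0(1), of s] j0(2) by blast
 obtain q where q: "pform (k + m) q" "\<forall>Q. f0 Q \<noteq> 0 --> q Q = f0 Q ^ n * app \<phi> ?r s i Q" using p[OF sE(1) i(1)] by blast
 have "(f0 * q) P0 \<noteq> 0" using q(2) f0(2) i(2) by (simp add: fun_ops)
 then have nz: "f0 * q \<noteq> 0" by (rule pform_nonzero)
 have "(f0 * q) P = 0" if "P \<in> ?Z" for P
 proof -
  have "app \<phi> ?r s i P = 0" using that by (simp add: app_def)
  then show ?thesis using q(2) by (cases "f0 P = 0") (auto simp: fun_ops)
 qed
 then obtain e f where f: "pprime e f" "infinite {P \<in> ?Z. f P = 0}"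
  using prime_factor_infinite_zeros[OF pform_mult[OF f0(1) q(1)] nz inf] by blast
 have "{P \<in> ?Z. f P = 0} = {P. f P = 0 \<and> (\<forall>j<?r. s (P, j) = 0)}" by blast
 then have "infinite {P. f P = 0 \<and> (\<forall>j<?r. s (P, j) = 0)}" using f(2) by simp
 from prime_divides_section[OF E sE(1) f(1) this] obtain \<tau> where \<tau>: "\<tau> \<in> p2.secs E (k - e)" "s = lift f * \<tau>" .
 have "k - e < k" using pprimeD(2)[OF f(1)] by simp
 then have "\<tau> = 0" using min \<tau>(1) by blast
 then show False using \<tau>(2) sE(2) by simp
qed

lemma prime_through:
 assumes "pform d p" "p \<noteq> 0" "p P = 0"
 shows "\<exists>e f. pprime e f \<and> f P = 0 \<and> (\<forall>Q. f Q = 0 --> p Q = 0)"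
 using assms
proof (induction rule: pform_prime_induct)
 case (const c)
 then show ?case by (simp add: kk_apply)
next
 case (prime e g l x)
 show ?case
 proof (cases "g P = 0")
  case True
  with prime(1) show ?thesis by (intro exI[of _ e] exI[of _ g]) (simp add: fun_ops)
 next
  case False
  then have "x P = 0" using prime.prems by (simp add: fun_ops)
  then obtain e' f' where "pprime e' f'" "f' P = 0" "\<forall>Q. f' Q = 0 --> x Q = 0" using prime.IH by blast
  then show ?thesis by (intro exI[of _ e'] exI[of _ f']) (simp add: fun_ops)
 qed
qed

text \<open>Every line bundle on the plane is a twist of the trivial one. In rank one the zeros of a
  section are locally those of one form p, so a zero would lie on a whole curve of zeros; but a
  section of least degree has only finitely many.\<close>

lemma line_bundle_frame:
 assumes L: "vector_bundle UNIV L" and r: "rk L = 1"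
 obtains k t where "t \<in> p2.secs L k" "\<And>P. t (P, 0) \<noteq> 0"
proof -
 obtain k t where t: "minimal_section L k t" using minimal_section_exists[OF L] r by auto
 have fin: "finite {P. t (P, 0) = 0}" using minimal_section_zeros[OF L t] r by simp
 have tL: "t \<in> p2.secs L k" using t unfolding minimal_section_def by auto
 have "t (P, 0) \<noteq> 0" for P
 proof
  assume tP: "t (P, 0) = 0"
  obtain U \<phi> f0 e0 n m where U: "(U, \<phi>) \<in> atlas L" and f0: "pform e0 f0" "f0 P \<noteq> 0" and f0U: "\<And>Q. f0 Q \<noteq> 0 ==> Q \<in> U"
   and fr: "\<And>k \<sigma> i. \<sigma> \<in> p2.secs L k ==> i < rk L ==> \<exists>p. pform (k + m) p \<and> (\<forall>Q. f0 Q \<noteq> 0 --> p Q = f0 Q ^ n * app \<phi> (rk L) \<sigma> i Q)"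
   by (rule local_frame[OF L, of P]) (rule that)
  obtain p where p: "pform (k + m) p" "\<forall>Q. f0 Q \<noteq> 0 --> p Q = f0 Q ^ n * app \<phi> 1 t 0 Q" using fr[OF tL, of 0] r by auto
  have pt: "p Q = 0 \<longleftrightarrow> t (Q, 0) = 0" if "f0 Q \<noteq> 0" for Q
   using that p(2) invertible_1x1 p2.chart(3,4)[OF L U f0U[OF that]] r by (simp add: app_1[unfolded One_nat_def])
  have inf: "infinite {Q. f Q = 0 \<and> f0 Q \<noteq> 0}" if "pprime e f" "f P = 0" for e f
   by (rule prime_zeros_infinite[OF that(1) f0(1) not_pdvdI[of f P f0, OF that(2) f0(2)]])
  have "\<exists>e f. pprime e f \<and> f P = 0 \<and> (\<forall>Q. f Q = 0 --> p Q = 0)"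
  proof (cases "p = 0")
   case True
   obtain R where "R \<noteq> P" using infinite_P2 by (metis (full_types) UNIV_eq_I finite.emptyI finite_insert singletonI)
   then obtain a where "lin a P = 0" "lin a R \<noteq> 0" using lin_separates by blast
   then have "a \<noteq> 0" "lin a P = 0" by (auto simp: lin_def)
   with pprime_lin True show ?thesis by (intro exI[of _ 1] exI[of _ "lin a"]) (simp add: fun_ops)
  qed (rule prime_through[OF p(1)], use pt[OF f0(2)] tP in simp_all)
  then obtain e f where f: "pprime e f" "f P = 0" "\<forall>Q. f Q = 0 --> p Q = 0" by blast
  have "infinite {P. t (P, 0) = 0}" by (rule infinite_super[OF _ inf[OF f(1,2)]]) (use pt f(3) in blast)
  with fin show False by blast
 qed
 with tL show ?thesis by (rule that)
qed

section \<open>The determinant bundle and the ideal of a minimal section\<close>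

definition det2 :: "complex mat => complex" where
 "det2 M = M $$ (0, 0) * M $$ (Suc 0, Suc 0) - M $$ (0, Suc 0) * M $$ (Suc 0, 0)"

definition det_vb :: "vb => vb" where
 "det_vb E = \<lparr>rk = 1, atlas = (\<lambda>(U, \<phi>). (U, \<lambda>P. mat 1 1 (\<lambda>_. det2 (\<phi> P)))) ` atlas E\<rparr>"

lemma det2_mult: "A \<in> carrier_mat 2 2 ==> B \<in> carrier_mat 2 2 ==> det2 (A * B) = det2 A * det2 B"
proof -
 assume A: "A \<in> carrier_mat 2 2" and B: "B \<in> carrier_mat 2 2"
 have "(A * B) $$ (i, j) = A $$ (i, 0) * B $$ (0, j) + A $$ (i, Suc 0) * B $$ (Suc 0, j)" if "i < 2" "j < 2" for i j
  by (simp only: mat_mult_entry[OF A B that] sum_2)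
 then show ?thesis unfolding det2_def by (simp only: pos2 Suc_1[symmetric] lessI) (simp add: algebra_simps)
qed

definition wedge :: "(P2 \<times> nat => complex) => (P2 \<times> nat => complex) => P2 => complex" where
 "wedge \<sigma> \<tau> P = \<sigma> (P, 0) * \<tau> (P, Suc 0) - \<sigma> (P, Suc 0) * \<tau> (P, 0)"

lemma det2_wedge: "det2 (\<phi> P) * wedge \<sigma> \<tau> P = app \<phi> 2 \<sigma> 0 P * app \<phi> 2 \<tau> (Suc 0) P - app \<phi> 2 \<sigma> (Suc 0) P * app \<phi> 2 \<tau> 0 P"
 by (simp add: det2_def wedge_def app_2 algebra_simps)

text \<open>By \<open>line_bundle_frame\<close> the determinant bundle is O(e) for some e, still
  unknown at this point. The function \<open>\<delta>\<close> is its frame in the fibre coordinates;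
  dividing wedges by it removes their dependence on the identification of the fibres.\<close>

lemma determinant_frame:
 assumes E: "vector_bundle UNIV E" and r: "rk E = 2"
 obtains e \<delta> where "\<And>P. \<delta> P \<noteq> 0" "\<And>U \<phi> R. (U, \<phi>) \<in> atlas E ==> R \<in> U ==> p2.lreg (- e) U (\<lambda>P. det2 (\<phi> P) * \<delta> P) R"
proof -
 let ?L = "det_vb E" and ?\<phi> = "\<lambda>\<phi> P. mat 1 1 (\<lambda>_. det2 (\<phi> P))"
 have rL: "rk ?L = 1" by (simp add: det_vb_def)
 have c: "\<phi> P \<in> carrier_mat 2 2" "det2 (\<phi> P) \<noteq> 0" if "(U, \<phi>) \<in> atlas E" "P \<in> U" for U \<phi> P
  using p2.chart(3)[OF E that] invertible_2x2[OF p2.chart(4)[OF E that]] r by (auto simp: det2_def)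
 have L: "vector_bundle UNIV ?L"
 proof (rule p2.vector_bundle_rank1[OF rL])
  show "atlas ?L = (\<lambda>x. (fst x, \<lambda>P. mat 1 1 (\<lambda>_. det2 (snd x P)))) ` atlas E"
   by (simp add: det_vb_def split_def)
  show "(\<Union>x\<in>atlas E. fst x) = UNIV" using E by (simp add: vector_bundle_def split_def)
  show "p2.zopen (fst x)" if "x \<in> atlas E" for x by (rule p2.chart(1)[OF E, of _ "snd x"]) (simp add: that)
  show "det2 (snd x P) \<noteq> 0" if "x \<in> atlas E" "P \<in> fst x" for x P by (rule c(2)[of "fst x"]) (simp_all add: that)
  fix x y P assume xy: "x \<in> atlas E" "y \<in> atlas E" and P: "P \<in> fst x \<inter> fst y"
  have U: "(fst x, snd x) \<in> atlas E" "(fst y, snd y) \<in> atlas E" using xy by simp_all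
  obtain G where G: "\<And>P. P \<in> fst x \<inter> fst y ==> G P \<in> carrier_mat 2 2" "\<And>P. P \<in> fst x \<inter> fst y ==> snd y P = G P * snd x P"
   "\<And>P i j. P \<in> fst x \<inter> fst y ==> i < 2 ==> j < 2 ==> p2.lreg 0 (fst x \<inter> fst y) (\<lambda>Q. G Q $$ (i, j)) P"
   by (rule p2.transition[OF E U, unfolded r]) (rule that)
  have "p2.lreg 0 (fst x \<inter> fst y) (\<lambda>P. det2 (G P)) P"
   unfolding det2_def by (intro p2.lreg_diff p2.lreg_times[OF G(3) G(3)] P) auto
  then show "p2.lreg 0 (fst x \<inter> fst y) (\<lambda>P. det2 (snd y P) / det2 (snd x P)) P"
  proof (rule p2.lreg_cong)
   fix Q assume Q: "Q \<in> fst x \<inter> fst y"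
   then show "det2 (G Q) = det2 (snd y Q) / det2 (snd x Q)"
    using det2_mult[OF G(1)[OF Q] c(1)[OF U(1)]] c(2)[OF U(1)] by (simp add: G(2)[OF Q])
  qed
 qed
 obtain k t where t: "t \<in> p2.secs ?L k" "\<And>P. t (P, 0) \<noteq> 0" by (rule line_bundle_frame[OF L rL]) (rule that)
 show ?thesis
 proof (rule that[of "\<lambda>P. t (P, 0)" "- k"])
  fix U \<phi> R assume U: "(U, \<phi>) \<in> atlas E" "R \<in> U"
  then have "(U, ?\<phi> \<phi>) \<in> atlas ?L" by (auto simp: det_vb_def)
  moreover have "app (?\<phi> \<phi>) 1 t 0 = (\<lambda>P. det2 (\<phi> P) * t (P, 0))" by (simp add: fun_eq_iff app_1[unfolded One_nat_def])
  ultimately show "p2.lreg (- (- k)) U (\<lambda>P. det2 (\<phi> P) * t (P, 0)) R"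
   using p2.secsD(2)[OF L t(1) _ U(2), of "?\<phi> \<phi>" 0] rL by simp
 qed (rule t(2))
qed

lemma dim_secs_line_O: "fs.dim (p2.secs (line_O d) k) = fs.dim (pforms (k + d))"
 unfolding secs_line_O
proof (rule dim_inj_image[OF _ subspace_pforms fd_pforms])
 show "lin_map line_sec" by (rule lin_mapI) (auto simp: line_sec_def fun_eq_iff fun_ops cscale_apply)
 fix v assume "line_sec v = 0"
 then have "line_sec v (P, 0) = 0" for P by (simp add: zero_fun_apply)
 then show "v = 0" by (simp add: line_sec_def fun_eq_iff fun_ops)
qed

text \<open>The homogeneous ideal of the point is generated by a and b in every degree, whereas
  \<open>secs_through_eq\<close> speaks of large degrees. For the trivial bundle all dimensions are
  known, and the count can be made exactly.\<close>

lemma forms_through_point: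
 assumes ab: "indep a b" "lin a P = 0" "lin b P = 0" and g: "pform d g" "g P = 0"
 obtains x y where "pform (d - 1) x" "pform (d - 1) y" "g = lin a * x + lin b * y"
proof (cases "d \<ge> 1")
 case False
 have "g = 0"
 proof (cases "d < 0")
  case False
  then have "d = 0" using \<open>\<not> d \<ge> 1\<close> by linarith
  then have "pform 0 g" using g(1) by simp
  then obtain c where "g = kk c" using pform_const by blast
  then show ?thesis using g(2) by (simp add: kk_apply kk_simps)
 qed (rule pform_neg[OF g(1)])
 then show ?thesis by (intro that[of 0 0] pform_0) simp
next
 case d: True
 let ?L = "line_O 0" and ?W = "{u + v | u v. u \<in> (\<lambda>\<sigma>. lift (lin a) * \<sigma>) ` p2.secs (line_O 0) (d - 1) \<and>
  v \<in> (\<lambda>\<sigma>. lift (lin b) * \<sigma>) ` p2.secs (line_O 0) (d - 1)}"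
 let ?T = "{\<sigma> \<in> p2.secs ?L d. \<forall>j<rk ?L. \<sigma> (P, j) = 0}"
 note vb = vector_bundle_line_O
 have sub: "?W \<subseteq> ?T" using lin_sums_through[OF vb ab(2,3), of 0 "d - 1"] by simp
 have TM: "?T \<subseteq> p2.secs ?L d" by (rule Collect_restrict)
 have fdT: "fd ?T" by (rule fd_subset[OF secs_finite_dim[OF vb] TM])
 have "fs.dim ?T < fs.dim (p2.secs ?L d)"
 proof (rule ccontr)
  assume "\<not> fs.dim ?T < fs.dim (p2.secs ?L d)"
  then have le: "fs.dim (p2.secs ?L d) \<le> fs.dim ?T" by simp
  have eq: "?T = p2.secs ?L d" by (rule dim_eq_fd[OF secs_finite_dim[OF vb] subspace_secs_through[OF vb] TM le])
  obtain f where f: "pform (int (nat d)) f" "f P \<noteq> 0" using nonvanishing_form by blast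
  then have "line_sec f \<in> p2.secs ?L d" using d by (intro line_sec_secs) simp
  then have "line_sec f \<in> ?T" unfolding eq .
  then show False using f(2) by (simp add: line_sec_def rk_line_O)
 qed
 moreover have "2 * int (fs.dim ?W) = 2 * (2 * int (fs.dim (p2.secs ?L (d - 1)))) - 2 * int (fs.dim (p2.secs ?L (d - 1 - 1)))"
  using lin_sums(2)[OF vb ab(1), of 0 "d - 1"] by linarith
 moreover have "2 * int (fs.dim (p2.secs ?L (d - 1 - 1))) = d * (d - 1)"
  using dim_pforms[of "d - 1 - 1"] d by (cases "d = 1") (simp_all add: dim_secs_line_O algebra_simps)
 moreover have "2 * int (fs.dim (p2.secs ?L (d - 1))) = d * (d + 1)" "2 * int (fs.dim (p2.secs ?L d)) = (d + 1) * (d + 2)"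
  using dim_pforms[of "d - 1"] dim_pforms[of d] d by (simp_all add: dim_secs_line_O algebra_simps)
 ultimately have "fs.dim ?T \<le> fs.dim ?W" by (simp add: algebra_simps)
 from dim_eq_fd[OF fdT lin_sums(1)[OF vb ab(1)] sub this] have W: "?W = ?T" .
 have "line_sec g \<in> ?T" using g line_sec_secs[of d 0 g] by (simp add: line_sec_def rk_line_O)
 then have "line_sec g \<in> ?W" unfolding W .
 then obtain u v where uv: "u \<in> p2.secs ?L (d - 1)" "v \<in> p2.secs ?L (d - 1)" "line_sec g = lift (lin a) * u + lift (lin b) * v"
  by (elim CollectE exE conjE imageE) simp
 obtain x where x: "pform (d - 1) x" "u = line_sec x" using uv(1) unfolding secs_line_O by (elim imageE) (simp add: mem_pforms)
 obtain y where y: "pform (d - 1) y" "v = line_sec y" using uv(2) unfolding secs_line_O by (elim imageE) (simp add: mem_pforms)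
 have "g = lin a * x + lin b * y"
 proof
  fix Q show "g Q = (lin a * x + lin b * y) Q"
   using fun_cong[OF uv(3), of "(Q, 0)"] by (simp add: line_sec_def x(2) y(2) fun_ops lift_simps)
 qed
 with x(1) y(1) show ?thesis by (rule that)
qed

text \<open>Take the lines with coefficients (1, t, t^2): a given point lies on finitely many of
  them, for t among the roots of a nonzero polynomial.\<close>

lemma line_missing_points:
 assumes "finite Z"
 obtains a where "a \<noteq> 0" "\<And>P. P \<in> Z ==> lin a P \<noteq> 0"
proof -
 define p where "p P = [:coords P $ 1, coords P $ 2, coords P $ 3:]" for P
 have "finite {t. poly (p P) t = 0}" for P
 proof (rule poly_roots_finite)
  show "p P \<noteq> 0" using coords_nonzero[of P] by (auto simp: p_def Finite_Cartesian_Product.vec_eq_iff forall_3)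
 qed
 then have "finite (\<Union>P\<in>Z. {t. poly (p P) t = 0})" using assms by blast
 then obtain t where t: "t \<notin> (\<Union>P\<in>Z. {t. poly (p P) t = 0})" using ex_new_if_finite infinite_UNIV_char_0 by blast
 define a :: "complex ^ 3" where "a = vector [1, t, t * t]"
 have "lin a P = poly (p P) t" for P by (simp add: lin_def a_def vector_3 p_def algebra_simps)
 moreover have "a \<noteq> 0" by (auto simp: a_def Finite_Cartesian_Product.vec_eq_iff forall_3 vector_3)
 ultimately show ?thesis using t by (intro that[of a]) auto
qed

lemma (in coord_space) lreg_wedge:
 assumes E: "vector_bundle X E" and r: "rk E = 2" and \<delta>: "\<And>P. P \<in> X ==> \<delta> P \<noteq> 0"
  and \<delta>reg: "\<And>U \<phi> R. (U, \<phi>) \<in> atlas E ==> R \<in> U ==> lreg (- e) U (\<lambda>P. det2 (\<phi> P) * \<delta> P) R"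
  and \<sigma>: "\<sigma> \<in> secs E k" "\<tau> \<in> secs E l" and R: "R \<in> X"
 shows "lreg (k + l + e) X (\<lambda>P. wedge \<sigma> \<tau> P / \<delta> P) R"
proof -
 obtain U \<phi> where U: "(U, \<phi>) \<in> atlas E" "R \<in> U" using chart_ex[OF E R] by blast
 have det: "det2 (\<phi> Q) \<noteq> 0" if "Q \<in> U" for Q
  using chart(3)[OF E U(1) that] invertible_2x2[OF chart(4)[OF E U(1) that]] r by (simp add: det2_def)
 have a: "lreg k U (app \<phi> 2 \<sigma> i) R" "lreg l U (app \<phi> 2 \<tau> i) R" if "i < 2" for i
  using secsD(2)[OF E \<sigma>(1) U] secsD(2)[OF E \<sigma>(2) U] that r by auto
 have "lreg (k + l) U (\<lambda>Q. det2 (\<phi> Q) * wedge \<sigma> \<tau> Q) R"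
  unfolding det2_wedge by (intro lreg_diff lreg_times[OF a(1) a(2)]) auto
 then have 1: "lreg (k + l + e) U (\<lambda>Q. det2 (\<phi> Q) * wedge \<sigma> \<tau> Q / (det2 (\<phi> Q) * \<delta> Q)) R"
  by (rule lreg_divide[OF _ \<delta>reg[OF U] U(2)]) (use det[OF U(2)] \<delta>[OF R] in simp_all)
 obtain d h where h: "H d h" "h R \<noteq> 0" "\<And>Q. Q \<in> X ==> h Q \<noteq> 0 ==> Q \<in> U"
  by (rule zopenD[OF chart(1)[OF E U(1)] U(2)]) (rule that)
 show ?thesis by (rule lreg_local[OF 1 h(1,2)]) (use h(3) det in auto)
qed

context
 fixes E :: vb and e :: int and \<delta> :: "P2 => complex"
 assumes E: "vector_bundle UNIV E" and r: "rk E = 2" and \<delta>: "\<And>P. \<delta> P \<noteq> 0"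
  and \<delta>reg: "\<And>U \<phi> R. (U, \<phi>) \<in> atlas E ==> R \<in> U ==> p2.lreg (- e) U (\<lambda>P. det2 (\<phi> P) * \<delta> P) R"
begin

text \<open>The wedge is a section of a twist of det E; relative to the frame
  \<open>\<delta>\<close> it becomes a form.\<close>

definition wf :: "(P2 \<times> nat => complex) => (P2 \<times> nat => complex) => P2 => complex" where
 "wf \<sigma> \<tau> P = wedge \<sigma> \<tau> P / \<delta> P"

lemma wf_pform:
 assumes "\<sigma> \<in> p2.secs E k" "\<tau> \<in> p2.secs E l"
 shows "pform (k + l + e) (wf \<sigma> \<tau>)"
proof -
 have "p2.lreg (k + l + e) {Q. (1 :: P2 => complex) Q \<noteq> 0} (wf \<sigma> \<tau>) R" for R
  unfolding wf_def[abs_def] by (rule p2.lreg_mono[OF p2.lreg_wedge[OF E r \<delta> \<delta>reg assms UNIV_I]]) simp_all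
 from global_form[OF pform_one one_neq_zero this] obtain p where
  "pform (k + l + e) p" "\<And>Q. (1 :: P2 => complex) Q \<noteq> 0 ==> wf \<sigma> \<tau> Q = p Q" by blast
 then have "wf \<sigma> \<tau> = p" by (simp add: fun_eq_iff fun_ops)
 then show ?thesis using \<open>pform (k + l + e) p\<close> by simp
qed

lemma wf_simps: "wf \<sigma> (lift g * \<tau>) = g * wf \<sigma> \<tau>" "wf \<sigma> (\<tau> + \<tau>') = wf \<sigma> \<tau> + wf \<sigma> \<tau>'" "wf \<sigma> \<sigma> = 0"
  "wf \<sigma> (\<tau> - \<tau>') = wf \<sigma> \<tau> - wf \<sigma> \<tau>'" "wf \<sigma> (cscale c \<tau>) = cscale c (wf \<sigma> \<tau>)"
 by (simp_all add: wf_def wedge_def fun_eq_iff fun_ops lift_simps cscale_apply algebra_simps add_divide_distrib diff_divide_distrib)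

lemma lin_map_wf: "lin_map (wf \<sigma>)"
 by (rule lin_mapI) (simp_all add: wf_simps)

context
 fixes k :: int and s :: "P2 \<times> nat => complex"
 assumes s: "minimal_section E k s"
begin

lemma sM: "s \<in> p2.secs E k" and s0: "s \<noteq> 0" and smin: "l < k ==> p2.secs E l = {0}"
 using s unfolding minimal_section_def by auto

lemma zeros_s: "finite {P. s (P, 0) = 0 \<and> s (P, Suc 0) = 0}"
 by (rule finite_subset[OF _ minimal_section_zeros[OF E s]]) (auto simp: r less_2_cases_iff)

text \<open>Off the zeros of s the factor of proportionality between t and s is a regular function;
  as there are finitely many zeros, it is a form by \<open>global_form_finite\<close>.\<close>

lemma wf_kernel:
 assumes t: "t \<in> p2.secs E l" "wf s t = 0"
 obtains g where "pform (l - k) g" "t = lift g * s"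
proof -
 let ?Z = "{P. s (P, 0) = 0 \<and> s (P, Suc 0) = 0}"
 define g where "g Q = (if s (Q, 0) \<noteq> 0 then t (Q, 0) / s (Q, 0) else t (Q, Suc 0) / s (Q, Suc 0))" for Q
 have w: "s (Q, 0) * t (Q, Suc 0) = s (Q, Suc 0) * t (Q, 0)" for Q
  using fun_cong[OF t(2), of Q] \<delta>[of Q] by (simp add: wf_def wedge_def fun_ops)
 have tg: "t (Q, j) = g Q * s (Q, j)" if Q: "Q \<notin> ?Z" and j: "j < 2" for Q j
  using Q j w[of Q] by (auto simp: g_def less_2_cases_iff field_simps)
 obtain P0 j0 where P0: "j0 < rk E" "s (P0, j0) \<noteq> 0" by (rule section_nonzero_at[OF E sM s0])
 then have "P0 \<notin> ?Z" using r by (auto simp: less_2_cases_iff)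
 then obtain F where F: "pform (int (card ?Z)) F" "F P0 \<noteq> 0" "\<forall>R\<in>?Z. F R = 0" using separating_form[OF zeros_s] by blast
 have Fnz: "F \<noteq> 0" using F(2) by (rule pform_nonzero)
 have reg: "p2.lreg (l - k) {Q. F Q \<noteq> 0} g R" if R: "R \<notin> ?Z" for R
 proof -
  obtain U \<phi> where U: "(U, \<phi>) \<in> atlas E" "R \<in> U" using p2.chart_ex[OF E, of R] by blast
  have "\<exists>i<2. app \<phi> 2 s i R \<noteq> 0"
  proof (rule ccontr)
   assume "\<not> (\<exists>i<2. app \<phi> 2 s i R \<noteq> 0)"
   then have "app \<phi> (rk E) s i R = 0" if "i < rk E" for i using that r by auto
   from p2.fibre_eq_0[OF E U this] R show False using r by auto
  qed
  then obtain i where i: "i < 2" "app \<phi> 2 s i R \<noteq> 0" by blast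
  have ls: "p2.lreg k U (app \<phi> 2 s i) R" and lt: "p2.lreg l U (app \<phi> 2 t i) R"
   using p2.secsD(2)[OF E sM U, of i] p2.secsD(2)[OF E t(1) U, of i] i(1) r by auto
  have q: "p2.lreg (l - k) U (\<lambda>Q. app \<phi> 2 t i Q / app \<phi> 2 s i Q) R"
   by (rule p2.lreg_divide[OF lt ls U(2) i(2)]) simp
  obtain d h where h: "pform d h" "h R \<noteq> 0" "\<forall>Q\<in>U. h Q \<noteq> 0 --> app \<phi> 2 s i Q \<noteq> 0"
   using p2.lreg_nonzero_near[OF ls U(2) i(2)] by blast
  obtain d' h' where h': "pform d' h'" "h' R \<noteq> 0" "\<And>Q. Q \<in> UNIV ==> h' Q \<noteq> 0 ==> Q \<in> U"
   by (rule p2.zopenD[OF p2.chart(1)[OF E U(1)] U(2)]) (rule that)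
  show ?thesis
  proof (rule p2.lreg_local[OF q pform_mult[OF h(1) h'(1)]])
   show "(h * h') R \<noteq> 0" using h(2) h'(2) by (simp add: fun_ops)
   fix Q assume Q: "Q \<in> {Q. F Q \<noteq> 0}" "(h * h') Q \<noteq> 0"
   then have QU: "Q \<in> U" "app \<phi> 2 s i Q \<noteq> 0" using h(3) h'(3) by (auto simp: fun_ops)
   have "Q \<notin> ?Z" using Q(1) F(3) by blast
   then have "app \<phi> 2 t i Q = g Q * app \<phi> 2 s i Q" using tg by (simp add: app_2 algebra_simps)
   then show "Q \<in> U \<and> app \<phi> 2 t i Q / app \<phi> 2 s i Q = g Q" using QU by simp
  qed
 qed
 have "finite {R. \<not> p2.lreg (l - k) {Q. F Q \<noteq> 0} g R}"
  by (rule finite_subset[OF _ zeros_s]) (use reg in blast)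
 from global_form_finite[OF F(1) Fnz this] obtain p where p: "pform (l - k) p"
  "\<And>Q. F Q \<noteq> 0 ==> p2.lreg (l - k) {Q. F Q \<noteq> 0} g Q ==> g Q = p Q" by blast
 have "lift p * s \<in> p2.secs E l" using p2.secs_mult[OF E sM p(1)] by simp
 then have "t = lift p * s"
 proof (rule p2.secs_identity[OF E t(1) _ F(1) UNIV_I F(2)])
  fix Q j assume Q: "F Q \<noteq> 0" and j: "j < rk E"
  have "Q \<notin> ?Z" using F(3) Q by blast
  then show "t (Q, j) = (lift p * s) (Q, j)" using tg[of Q j] p(2)[OF Q reg] j r by (simp add: fun_ops lift_simps)
 qed
 with p(1) show ?thesis by (rule that)
qed

text \<open>The ideal of the zero scheme of s in degree n. Wedging with s raises degrees by k + e,
  whence the index of the sections.\<close>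

definition J :: "int => (P2 => complex) set" where
 "J n = wf s ` p2.secs E (n - k - e)"

lemma J_pforms: "J n \<subseteq> pforms n"
 unfolding J_def
proof (rule image_subsetI)
 fix t assume "t \<in> p2.secs E (n - k - e)"
 from wf_pform[OF sM this] show "wf s t \<in> pforms n" by (simp add: mem_pforms)
qed

lemma subspace_J: "fs.subspace (J n)" and fd_J: "fd (J n)"
 unfolding J_def
 by (rule subspace_image[OF lin_map_wf p2.subspace_secs[OF E]], rule rank_nullity(1)[OF lin_map_wf p2.subspace_secs[OF E] secs_finite_dim[OF E]])

lemma J_mult:
 assumes "f \<in> J n" "pform d g"
 shows "g * f \<in> J (d + n)"
proof -
 obtain t where t: "t \<in> p2.secs E (n - k - e)" "f = wf s t" using assms(1) unfolding J_def by (elim imageE)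
 have "lift g * t \<in> p2.secs E (d + n - k - e)" using p2.secs_mult[OF E t(1) assms(2)] by (simp add: algebra_simps)
 then show ?thesis unfolding J_def t(2) wf_simps(1)[symmetric] by (rule imageI)
qed

text \<open>Rank-nullity for wedging with s, whose kernel consists of the multiples of s by
  \<open>wf_kernel\<close>.\<close>

lemma dim_J: "fs.dim (J n) + fs.dim (pforms (n - 2 * k - e)) = fs.dim (p2.secs E (n - k - e))"
proof -
 let ?m = "n - k - e" and ?f = "\<lambda>g. lift g * s"
 have "{t \<in> p2.secs E ?m. wf s t = 0} = ?f ` pforms (?m - k)"
 proof (rule equalityI; rule subsetI)
  fix t assume "t \<in> {t \<in> p2.secs E ?m. wf s t = 0}"
  then have "t \<in> p2.secs E ?m" "wf s t = 0" by simp_all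
  from wf_kernel[OF this] obtain g where "pform (?m - k) g" "t = ?f g" .
  then show "t \<in> ?f ` pforms (?m - k)" by (simp add: mem_pforms)
 next
  fix t assume "t \<in> ?f ` pforms (?m - k)"
  then obtain g where g: "pform (?m - k) g" "t = ?f g" by (elim imageE) (simp add: mem_pforms)
  have "?m - k + k = ?m" by simp
  with p2.secs_mult[OF E sM g(1)] have "?f g \<in> p2.secs E ?m" by metis
  then show "t \<in> {t \<in> p2.secs E ?m. wf s t = 0}" using g(2) by (simp add: wf_simps)
 qed
 moreover have "fs.dim (?f ` pforms (?m - k)) = fs.dim (pforms (?m - k))"
 proof (rule dim_inj_image[OF _ subspace_pforms fd_pforms])
  show "lin_map ?f" by (rule lin_mapI) (simp_all add: fun_eq_iff lift_def fun_ops cscale_apply algebra_simps split_beta)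
  fix g assume g: "g \<in> pforms (?m - k)" "?f g = 0"
  show "g = 0"
  proof (rule ccontr)
   assume "g \<noteq> 0"
   then obtain P where "g P \<noteq> 0" by (auto simp: fun_eq_iff fun_ops)
   from p2.secs_torsion_free[OF E sM _ UNIV_I this g(2)] g(1) s0 show False by (simp add: mem_pforms)
  qed
 qed
 moreover have "?m - k = n - 2 * k - e" by simp
 ultimately show ?thesis
  using rank_nullity(2)[OF lin_map_wf[of s] p2.subspace_secs[OF E] secs_finite_dim[OF E], of ?m] by (simp add: J_def)
qed

text \<open>This is where freeness of \<open>E\<close> enters.\<close>

lemma J_saturated:
 assumes ab: "indep a b" "lin a P = 0" "lin b P = 0" and P: "s (P, 0) \<noteq> 0 \<or> s (P, Suc 0) \<noteq> 0"
  and f0: "pform n f" and f: "lin a * f \<in> J (n + 1)" "lin b * f \<in> J (n + 1)"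
 shows "f \<in> J n"
proof -
 let ?m = "n + 1 - k - e" and ?a = "lift (lin a)" and ?b = "lift (lin b)"
 obtain t1 where t1: "t1 \<in> p2.secs E ?m" "lin a * f = wf s t1" using f(1) unfolding J_def by (elim imageE)
 obtain t2 where t2: "t2 \<in> p2.secs E ?m" "lin b * f = wf s t2" using f(2) unfolding J_def by (elim imageE)
 \<comment> \<open>Wedging with s kills b t1 - a t2, so this section is g s. At P it vanishes and s
   does not, so g vanishes there and equals a x + b y; correcting t1 and t2 by multiples of s then
   makes the difference 0.\<close>
 define t where "t = ?b * t1 - ?a * t2"
 have tM: "t \<in> p2.secs E (1 + ?m)" unfolding t_def
  by (rule fs.subspace_diff[OF p2.subspace_secs[OF E] p2.secs_mult[OF E t1(1) pform_lin] p2.secs_mult[OF E t2(1) pform_lin]])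
 have "wf s t = 0" unfolding t_def wf_simps t1(2)[symmetric] t2(2)[symmetric] by (simp add: mult_ac)
 from wf_kernel[OF tM this] obtain g where g: "pform (1 + ?m - k) g" "t = lift g * s" .
 have "g P * s (P, j) = 0" for j
  using fun_cong[OF g(2), of "(P, j)"] ab(2,3) by (simp add: t_def fun_ops lift_simps)
 then have "g P = 0" using P by (metis mult_eq_0_iff)
 from forms_through_point[OF ab g(1) this] obtain x y where
  xy: "pform (1 + ?m - k - 1) x" "pform (1 + ?m - k - 1) y" "g = lin a * x + lin b * y" .
 have "1 + ?m - k - 1 + k = ?m" by simp
 then have ys: "lift y * s \<in> p2.secs E ?m"
  using p2.secs_mult[OF E sM xy(2)] by metis
 have "?a * (t2 + lift x * s) = ?b * (t1 - lift y * s)"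
  using g(2) unfolding t_def xy(3) by (simp add: lift_simps algebra_simps)
 then have eq: "?b * (t1 - lift y * s) = ?a * (t2 + lift x * s)" by simp
 have ba: "indep b a" using ab(1) unfolding indep_def by (metis add.commute)
 have "t1 - lift y * s \<in> p2.secs E ?m"
  by (rule fs.subspace_diff[OF p2.subspace_secs[OF E] t1(1) ys])
 \<comment> \<open>Since b (t1 - y s) = a (t2 + x s), the Koszul lemma yields t1 - y s = a
   \<open>\<rho>\<close>; the wedge of s with \<open>\<rho>\<close> is f, because wedging with s
   kills y s.\<close>
 from koszul[OF E ba this eq] obtain \<rho> where \<rho>: "\<rho> \<in> p2.secs E (?m - 1)" "t1 - lift y * s = ?a * \<rho>" .
 have "wf s (t1 - lift y * s) = lin a * f" unfolding wf_simps t1(2) by simp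
 then have "lin a * f = lin a * wf s \<rho>" unfolding \<rho>(2) wf_simps by simp
 moreover have "lin a \<noteq> 0" using ab(1)[unfolded indep_def, rule_format, of 1 0] lin_eq_0_iff by auto
 moreover have "k + (?m - 1) + e = n" by simp
 then have "pform n (wf s \<rho>)" using wf_pform[OF sM \<rho>(1)] by metis
 ultimately have "f = wf s \<rho>" using pform_cancel[OF pform_lin[of a] _ f0, of "wf s \<rho>"] by simp
 moreover have "?m - 1 = n - k - e" by simp
 ultimately show ?thesis using \<rho>(1) unfolding J_def by (metis imageI)
qed

lemma J_lin:
 assumes "f \<in> J n"
 shows "lin a * f \<in> J (n + 1)"
 using J_mult[OF assms pform_lin[of a]] by (simp add: add.commute)

text \<open>The line a0 avoids the zeros of s, so J and a0 have no common zero, and S/(J + a0 S)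
  vanishes in large degrees by \<open>eventually_eq_3\<close>. For that criterion it is enough to
  find, at each point, an element of J + a0 S that is nonzero there.\<close>

lemma J_plus_line:
 assumes a0: "\<And>P. s (P, 0) = 0 \<and> s (P, Suc 0) = 0 ==> lin a0 P \<noteq> 0"
 shows "\<exists>K. \<forall>n\<ge>K. \<forall>f. pform (int n) f --> (\<exists>x y. x \<in> J (int n) \<and> pform (int n - 1) y \<and> f = x + lin a0 * y)"
proof -
 let ?V = "\<lambda>n. pforms (int n)"
 let ?W = "\<lambda>n. {x + y | x y. x \<in> J (int n) \<and> y \<in> (\<lambda>y. lin a0 * y) ` pforms (int n - 1)}"
 have WI: "x + lin a0 * y \<in> ?W n" if "x \<in> J (int n)" "pform (int n - 1) y" for x y n
  using that by (intro CollectI exI[of _ x] exI[of _ "lin a0 * y"] conjI imageI) (simp_all add: mem_pforms)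
 have WE: "\<exists>x y. w = x + lin a0 * y \<and> x \<in> J (int n) \<and> pform (int n - 1) y" if "w \<in> ?W n" for w n
  using that by (elim CollectE exE conjE imageE) (auto simp: mem_pforms)
 have subW: "fs.subspace (?W n)" for n
  by (rule subspace_sum[OF subspace_J subspace_image[OF lin_map_mult subspace_pforms]])
 have WV: "?W n \<subseteq> ?V n" for n
 proof
  fix w assume "w \<in> ?W n"
  then obtain x y where w: "w = x + lin a0 * y" "x \<in> J (int n)" "pform (int n - 1) y" using WE by blast
  have "pform (int n) x" using w(2) J_pforms mem_pforms by blast
  moreover have "pform (int n) (lin a0 * y)" using pform_mult[OF pform_lin w(3)] by simp
  ultimately show "w \<in> ?V n" unfolding w(1) mem_pforms by (rule pform_add)
 qed
 interpret g: graded_pair3 ?V ?W lin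
 proof unfold_locales
  show "lin a * v \<in> ?V (Suc k)" if "v \<in> ?V k" for v k a
   using pform_mult[OF pform_lin, of "int k" v a] that by (simp add: mem_pforms)
  show "lin a * w \<in> ?W (Suc k)" if "w \<in> ?W k" for w k a
  proof -
   obtain x y where w: "w = x + lin a0 * y" "x \<in> J (int k)" "pform (int k - 1) y" using WE[OF \<open>w \<in> _\<close>] by blast
   have "lin a * x \<in> J (int (Suc k))" using J_lin[OF w(2)] by (simp add: add.commute)
   moreover have "pform (int (Suc k) - 1) (lin a * y)" using pform_mult[OF pform_lin w(3)] by simp
   ultimately have "lin a * x + lin a0 * (lin a * y) \<in> ?W (Suc k)" by (rule WI)
   moreover have "lin a * w = lin a * x + lin a0 * (lin a * y)" unfolding w(1) by (simp add: algebra_simps)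
   ultimately show ?thesis by metis
  qed
  show "lin (a + b) = lin a + lin b" for a b by (rule lin_add)
  show "lin (c *s a) = kk c * lin a" for c a by (rule lin_scale)
 qed (rule subspace_pforms fd_pforms subW WV)+
 have "\<exists>K. \<forall>n\<ge>K. ?V n = ?W n"
 proof (rule g.eventually_eq_3)
  fix a b assume ab: "indep a b"
  obtain P where P: "lin a P = 0" "lin b P = 0" by (rule common_zero[OF ab])
  obtain K where K: "\<forall>k\<ge>K. \<forall>y. \<exists>\<sigma>\<in>p2.secs E (int k). \<forall>j<rk E. \<sigma> (P, j) = y j" using generated_at[OF E, of P] by blast
  have unit: "\<exists>w. w \<in> ?W (Suc n) \<and> w P \<noteq> 0" if n: "n \<ge> nat (int K + k + e)" for n
  proof (cases "lin a0 P = 0")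
   case False
   obtain F where F: "pform (int n) F" "F P \<noteq> 0" using nonvanishing_form by blast
   have "0 + lin a0 * F \<in> ?W (Suc n)" by (rule WI) (use F(1) fs.subspace_0[OF subspace_J] in simp_all)
   moreover have "(0 + lin a0 * F) P \<noteq> 0" using False F(2) by (simp add: fun_ops)
   ultimately show ?thesis by blast
  next
   case True
   define l where "l = nat (int (Suc n) - k - e)"
   have l: "int l = int (Suc n) - k - e" "l \<ge> K" using n unfolding l_def by auto
   \<comment> \<open>The prescribed value of t makes its wedge with s at P equal to |s_0|^2 +
     |s_1|^2, which is positive because s is nonzero on the line a0.\<close>
   obtain t where t: "t \<in> p2.secs E (int l)" "\<forall>j<rk E. t (P, j) = (if j = 0 then - cnj (s (P, Suc 0)) else cnj (s (P, 0)))"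
    using K[rule_format, OF l(2), of "\<lambda>j. if j = 0 then - cnj (s (P, Suc 0)) else cnj (s (P, 0))"] by blast
   have "wf s t \<in> J (int (Suc n))" unfolding J_def l(1)[symmetric] by (rule imageI[OF t(1)])
   then have "wf s t + lin a0 * 0 \<in> ?W (Suc n)" by (rule WI[OF _ pform_0])
   moreover have "wedge s t P \<noteq> 0"
   proof -
    have w: "wedge s t P = s (P, 0) * cnj (s (P, 0)) + s (P, Suc 0) * cnj (s (P, Suc 0))"
     using t(2) r by (simp add: wedge_def)
    have "wedge s t P = of_real ((cmod (s (P, 0)))\<^sup>2 + (cmod (s (P, Suc 0)))\<^sup>2)"
     unfolding w complex_norm_square[symmetric] by (simp only: of_real_add of_real_power)
    moreover have "(cmod (s (P, 0)))\<^sup>2 + (cmod (s (P, Suc 0)))\<^sup>2 \<noteq> 0"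
     using a0[of P] True by (simp add: sum_power2_eq_zero_iff) blast
    ultimately show ?thesis by (simp only: of_real_eq_0_iff not_False_eq_True)
   qed
   then have "(wf s t + lin a0 * 0) P \<noteq> 0" using \<delta> by (simp add: wf_def fun_ops)
   ultimately show ?thesis by blast
  qed
  show "\<exists>K. \<forall>n\<ge>K. \<forall>v\<in>?V (Suc n). \<exists>u\<in>?V n. \<exists>u'\<in>?V n. \<exists>w\<in>?W (Suc n). v = lin a * u + lin b * u' + w"
  proof (intro exI[of _ "nat (int K + k + e)"] allI impI ballI)
   fix n v assume n: "nat (int K + k + e) \<le> n" and v: "v \<in> ?V (Suc n)"
   obtain w where w: "w \<in> ?W (Suc n)" "w P \<noteq> 0" using unit[OF n] by blast
   \<comment> \<open>The multiple of w with the value of v at P; the difference vanishes at P and is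
     a combination of a and b by \<open>forms_through_point\<close>.\<close>
   define w' where "w' = cscale (v P / w P) w"
   have w'W: "w' \<in> ?W (Suc n)" unfolding w'_def by (rule fs.subspace_scale[OF subW w(1)])
   then have "w' \<in> ?V (Suc n)" using WV by blast
   from fs.subspace_diff[OF subspace_pforms v this] have "pform (int (Suc n)) (v - w')" by (simp only: mem_pforms)
   moreover have "(v - w') P = 0" using w(2) by (simp add: w'_def fun_ops cscale_apply)
   ultimately obtain x y where xy: "pform (int (Suc n) - 1) x" "pform (int (Suc n) - 1) y" "v - w' = lin a * x + lin b * y"
    by (rule forms_through_point[OF ab P])
   have xV: "x \<in> ?V n" and yV: "y \<in> ?V n" using xy by (simp_all add: mem_pforms)
   show "\<exists>u\<in>?V n. \<exists>u'\<in>?V n. \<exists>w\<in>?W (Suc n). v = lin a * u + lin b * u' + w"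
    by (rule bexI[OF _ xV], rule bexI[OF _ yV], rule bexI[OF _ w'W]) (simp add: xy(3)[symmetric])
  qed
 qed
 then obtain K where K: "\<forall>n\<ge>K. ?V n = ?W n" by blast
 show ?thesis
 proof (intro exI[of _ K] allI impI)
  fix n f assume n: "K \<le> n" and f: "pform (int n) f"
  have "f \<in> ?V n" using f by (simp only: mem_pforms)
  then have "f \<in> ?W n" using K[rule_format, OF n] by (simp only:)
  then show "\<exists>x y. x \<in> J (int n) \<and> pform (int n - 1) y \<and> f = x + lin a0 * y" using WE by blast
 qed
qed

text \<open>The line a0 is a nonzerodivisor on S/J. If a0 f lies in J, then so does g f for every g
  of large degree, because such a g lies in J + a0 S; saturation then lowers the degree of g one by
  one down to 0.\<close>

lemma J_line_injective:
 assumes a0: "\<And>P. s (P, 0) = 0 \<and> s (P, Suc 0) = 0 ==> lin a0 P \<noteq> 0" and a0nz: "a0 \<noteq> 0"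
  and f: "pform n f" "lin a0 * f \<in> J (n + 1)"
 shows "f \<in> J n"
proof -
 obtain K where K: "\<forall>n\<ge>K. \<forall>f. pform (int n) f --> (\<exists>x y. x \<in> J (int n) \<and> pform (int n - 1) y \<and> f = x + lin a0 * y)"
  using J_plus_line[OF a0] by blast
 obtain b c where bc: "\<forall>x y z. x *s a0 + y *s b + z *s c = 0 --> x = 0 \<and> y = 0 \<and> z = 0"
  using basis_extension[OF a0nz] by blast
 have ab: "indep a0 b" unfolding indep_def using bc[rule_format, of _ _ 0] by simp
 \<comment> \<open>A point of the line a0; there s is nonzero, as \<open>J_saturated\<close>
   requires.\<close>
 obtain P where P: "lin a0 P = 0" "lin b P = 0" by (rule common_zero[OF ab])
 have sP: "s (P, 0) \<noteq> 0 \<or> s (P, Suc 0) \<noteq> 0" using a0[of P] P(1) by blast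
 have all: "\<forall>g. pform (int N) g --> g * f \<in> J (int N + n)" if N: "N \<le> K" for N
  using N
 proof (induction N rule: inc_induct)
  case base
  show ?case
  proof (intro allI impI)
   fix g assume "pform (int K) g"
   then obtain x y where g: "x \<in> J (int K)" "pform (int K - 1) y" "g = x + lin a0 * y" using K by blast
   have "f * x \<in> J (int K + n)" using J_mult[OF g(1) f(1)] by (simp add: add.commute)
   moreover have "y * (lin a0 * f) \<in> J (int K + n)" using J_mult[OF f(2) g(2)] by (simp add: add.commute)
   ultimately have "f * x + y * (lin a0 * f) \<in> J (int K + n)" by (rule fs.subspace_add[OF subspace_J])
   then show "g * f \<in> J (int K + n)" unfolding g(3) by (simp add: algebra_simps)
  qed
 next
  case (step N)
  show ?case
  proof (intro allI impI)
   fix g assume g: "pform (int N) g"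
   have *: "lin x * (g * f) \<in> J (int N + n + 1)" for x
   proof -
    have "pform (int (Suc N)) (lin x * g)" using pform_mult[OF pform_lin g] by simp
    then have "lin x * g * f \<in> J (int (Suc N) + n)" using step.IH by blast
    moreover have "int (Suc N) + n = int N + n + 1" by simp
    ultimately show ?thesis unfolding mult.assoc by metis
   qed
   show "g * f \<in> J (int N + n)" by (rule J_saturated[OF ab P sP pform_mult[OF g f(1)] * *])
  qed
 qed
 show ?thesis using all[of 0] pform_one by fastforce
qed

text \<open>The Hilbert function of S/J.\<close>

definition cod :: "int => int" where
 "cod n = int (fs.dim (pforms n)) - int (fs.dim (J n))"

text \<open>Multiplication by a line that misses the zeros of s is injective on S/J in all degrees
  and surjective in large ones.\<close>

lemma cod_mono: "cod n \<le> cod (n + 1)" and cod_eventually_antimono: "\<exists>K. \<forall>n\<ge>K. cod (int n + 1) \<le> cod (int n)"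
proof -
 obtain a0 where a0nz: "a0 \<noteq> 0" and "\<And>P. P \<in> {P. s (P, 0) = 0 \<and> s (P, Suc 0) = 0} ==> lin a0 P \<noteq> 0"
  by (rule line_missing_points[OF zeros_s]) (rule that)
 then have a0: "\<And>P. s (P, 0) = 0 \<and> s (P, Suc 0) = 0 ==> lin a0 P \<noteq> 0" by blast
 have le: "fs.dim (J n) \<le> fs.dim (pforms n)" for n by (rule dim_mono_fd[OF fd_pforms J_pforms])
 have lV: "lin a0 * v \<in> pforms (n + 1)" if "v \<in> pforms n" for v n
  using pform_mult[OF pform_lin, of n v a0] that by (simp add: mem_pforms add.commute)
 obtain p :: "(P2 => complex) => P2 => complex" where p: "lin_map p" "\<And>v. p v = 0 \<longleftrightarrow> v \<in> J (n + 1)"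
  by (rule quotient_map[OF subspace_J]) (rule that)
 let ?f = "\<lambda>u. p (lin a0 * u)"
 have f: "lin_map ?f" by (rule lin_map_comp[OF lin_map_mult p(1)])
 have "{u \<in> pforms n. ?f u = 0} = J n"
 proof (rule equalityI; rule subsetI)
  fix u assume "u \<in> {u \<in> pforms n. ?f u = 0}"
  then show "u \<in> J n" using J_line_injective[OF a0 a0nz] p(2) by (simp add: mem_pforms)
 next
  fix u assume "u \<in> J n"
  then have "lin a0 * u \<in> J (n + 1)" "u \<in> pforms n" by (rule J_lin, rule subsetD[OF J_pforms])
  then show "u \<in> {u \<in> pforms n. ?f u = 0}" using p(2) by simp
 qed
 then have 1: "fs.dim (pforms n) = fs.dim (J n) + fs.dim (?f ` pforms n)"
  using rank_nullity(2)[OF f subspace_pforms fd_pforms, of n] by (simp only:)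
 have "?f ` pforms n \<subseteq> p ` pforms (n + 1)" by (rule image_subsetI) (rule imageI, rule lV)
 from dim_mono_fd[OF rank_nullity(1)[OF p(1) subspace_pforms fd_pforms] this]
 have "fs.dim (?f ` pforms n) \<le> fs.dim (pforms (n + 1)) - fs.dim (J (n + 1))"
  using dim_quotient[OF p subspace_pforms fd_pforms J_pforms] by simp
 then show "cod n \<le> cod (n + 1)" unfolding cod_def using 1 le[of "n + 1"] by linarith
 obtain K where K: "\<forall>n\<ge>K. \<forall>f. pform (int n) f --> (\<exists>x y. x \<in> J (int n) \<and> pform (int n - 1) y \<and> f = x + lin a0 * y)"
  using J_plus_line[OF a0] by blast
 show "\<exists>K. \<forall>n\<ge>K. cod (int n + 1) \<le> cod (int n)"
 proof (intro exI[of _ K] allI impI)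
  fix n assume n: "K \<le> n"
  have "fs.dim (pforms (int n + 1)) - fs.dim (J (int n + 1)) \<le> fs.dim (pforms (int n)) - fs.dim (J (int n))"
  proof (rule mult_surj_quotient(1)[OF subspace_pforms fd_pforms subspace_J J_pforms subspace_pforms fd_pforms subspace_J J_pforms lV J_lin])
   fix v assume v: "v \<in> pforms (int n + 1)"
   then have "pform (int (Suc n)) v" by (simp add: mem_pforms add.commute)
   moreover have "Suc n \<ge> K" using n by simp
   ultimately obtain x y where xy: "x \<in> J (int (Suc n))" "pform (int (Suc n) - 1) y" "v = x + lin a0 * y" using K by blast
   have "y \<in> pforms (int n)" "x \<in> J (int n + 1)" using xy by (simp_all add: mem_pforms add.commute)
   then show "\<exists>u\<in>pforms (int n). \<exists>w\<in>J (int n + 1). v = lin a0 * u + w"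
    by (intro bexI[of _ y] bexI[of _ x]) (simp_all add: xy(3) add.commute)
  qed
  then show "cod (int n + 1) \<le> cod (int n)" unfolding cod_def using le[of "int n"] le[of "int n + 1"] by linarith
 qed
qed

text \<open>By \<open>dim_J\<close> and the Hilbert polynomial of E, \<open>cod\<close> is in large
  degrees a linear function with slope e - c. Since it is eventually constant, e = c; its final
  value k (k + c) bounds the others by monotonicity.\<close>

lemma cod_value:
 assumes h: "hilb (hsecs E) 2 c (c * c + 3 * c)"
 shows "e = c" "cod n \<le> k * (k + c)"
proof -
 obtain K where K: "\<forall>m\<ge>K. 2 * hsecs E m = 2 * (int m + 1) * (int m + 2) + 2 * c * int m + (c * c + 3 * c)"
  using h unfolding hilb_def by blast
 obtain L where L: "\<forall>n\<ge>L. cod (int n + 1) \<le> cod (int n)" using cod_eventually_antimono by blast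
 \<comment> \<open>With the degree written as m + k + e, the ideal comes from sections of degree m,
   and the kernel of the wedge from forms of degree m - k.\<close>
 have val: "2 * cod (int m + k + e) = 2 * int m * (e - c) + ((k + e) * (k + e) + k * k + 3 * e - c * c - 3 * c)"
  if m: "m \<ge> K" "int m \<ge> k" "int m + k + e \<ge> 0" for m
 proof -
  let ?n = "int m + k + e"
  have "?n - 2 * k - e = int m - k" "?n - k - e = int m" by simp_all
  then have "2 * int (fs.dim (J ?n)) = 2 * hsecs E m - 2 * int (fs.dim (pforms (int m - k)))"
   using dim_J[of ?n] by simp
  then have "2 * cod ?n = (?n + 1) * (?n + 2) + (int m - k + 1) * (int m - k + 2) - 2 * hsecs E m"
   unfolding cod_def using dim_pforms[of ?n] dim_pforms[of "int m - k"] m by simp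
  then show ?thesis using K m(1) by (simp add: algebra_simps)
 qed
 define M where "M = K + nat \<bar>k\<bar> + nat \<bar>int L - k - e\<bar>"
 have M: "M \<ge> K" "int M \<ge> k" "int M + k + e \<ge> int L" unfolding M_def by auto
 have const: "cod (int m + k + e + 1) = cod (int m + k + e)" if "m \<ge> M" for m
 proof (rule antisym)
  have "nat (int m + k + e) \<ge> L" "int (nat (int m + k + e)) = int m + k + e" using M(3) that by auto
  then show "cod (int m + k + e + 1) \<le> cod (int m + k + e)" using L by metis
 qed (rule cod_mono)
 have "2 * cod (int (Suc M) + k + e) = 2 * cod (int M + k + e)" using const[of M] by (simp add: algebra_simps)
 then show ec: "e = c" using val[of M] val[of "Suc M"] M by (simp add: algebra_simps)
 have mono: "cod n \<le> cod (n + int j)" for n j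
 proof (induction j)
  case (Suc j)
  then show ?case using cod_mono[of "n + int j"] by (simp add: algebra_simps)
 qed simp
 define j where "j = nat (max 0 (int M + k + e - n))"
 define m where "m = nat (n + int j - k - e)"
 have "int m = n + int j - k - e" "m \<ge> M" unfolding m_def j_def by auto
 then have "n + int j = int m + k + e" "m \<ge> K" "int m \<ge> k" "int m + k + e \<ge> 0" using M by auto
 then have "2 * cod (n + int j) = 2 * (k * (k + c))" using val[of m] ec by (simp add: algebra_simps)
 then show "cod n \<le> k * (k + c)" using mono[of n j] by linarith
qed

lemma minimal_degree:
 assumes h: "hilb (hsecs E) 2 c (c * c + 3 * c)"
 shows "k \<le> 0" "k = 0 ==> \<exists>t\<in>p2.secs E (- c). \<forall>P. wedge s t P = \<delta> P"
proof -
 note ec = cod_value(1)[OF h] and le = cod_value(2)[OF h]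
 show "k \<le> 0"
 proof (rule ccontr)
  assume "\<not> k \<le> 0"
  then have k: "k > 0" by simp
  let ?n = "2 * k + c - 1"
  have sq: "x * x + x \<ge> 0" for x :: int
  proof (cases "x \<ge> 0")
   case False
   then have "x * (x + 1) \<ge> 0" by (intro mult_nonpos_nonpos) auto
   then show ?thesis by (simp add: algebra_simps)
  qed simp
  have "p2.secs E (?n - k - e) = {0}" by (rule smin) (simp add: ec)
  then have "J ?n = {0}" unfolding J_def using lin_mapD(3)[OF lin_map_wf] by simp
  then have J0: "fs.dim (J ?n) = 0" using dim_0_fd[OF subspace_J fd_J] by blast
  \<comment> \<open>Nonnegativity of \<open>cod\<close> already forces this; it puts
    \<open>?n\<close> in the range of the dimension formula.\<close>
  have "k + c \<ge> 0"
  proof -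
   have "cod ?n \<ge> 0" unfolding cod_def J0 by simp
   then have "0 \<le> k * (k + c)" using le[of ?n] by linarith
   then show ?thesis using k by (simp add: zero_le_mult_iff)
  qed
  then have "2 * cod ?n = (?n + 1) * (?n + 2)" unfolding cod_def J0 using dim_pforms[of ?n] k by simp
  then have "(2 * k + c) * (2 * k + c + 1) \<le> 2 * (k * (k + c))" using le[of ?n] by (simp add: algebra_simps)
  \<comment> \<open>With x = k + c the inequality is k^2 + k + x^2 + x <= 0, which is impossible
    because x^2 + x >= 0 for every integer x.\<close>
  then have "(k * k + k) + ((k + c) * (k + c) + (k + c)) \<le> 0" by (simp add: algebra_simps)
  moreover have "k * k + k > 0" using k by (simp add: add_pos_pos)
  ultimately show False using sq[of "k + c"] by linarith
 qed
 assume k0: "k = 0"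
 have "fs.dim (pforms 0) \<le> fs.dim (J 0)" 
 proof -
  have "k * (k + c) = 0" using k0 by simp
  then have "cod 0 \<le> 0" using le[of 0] by linarith
  then show ?thesis unfolding cod_def by linarith
 qed
 from dim_eq_fd[OF fd_pforms subspace_J J_pforms this] have "J 0 = pforms 0" .
 then have "1 \<in> J 0" using pform_one by (simp add: mem_pforms)
 then obtain t where t: "t \<in> p2.secs E (0 - k - e)" "1 = wf s t" unfolding J_def by (elim imageE)
 have "wedge s t P = \<delta> P" for P
  using fun_cong[OF t(2), of P] \<delta>[of P] by (simp add: wf_def fun_ops field_simps)
 moreover have "t \<in> p2.secs E (- c)" using t(1) by (simp add: k0 ec)
 ultimately show "\<exists>t\<in>p2.secs E (- c). \<forall>P. wedge s t P = \<delta> P" by blast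
qed

end

end

text \<open>What the conic has to know about the plane: the determinant frame has twist c, and there
  is a section of degree k <= 0 with finitely many zeros, where k = 0 is the split case.\<close>

theorem rank_two_structure:
 assumes E: "vector_bundle UNIV E" "rk E = 2" "chern_numbers E c 0"
 obtains \<delta> k s where "\<And>P. \<delta> P \<noteq> 0"
  "\<And>U \<phi> R. (U, \<phi>) \<in> atlas E ==> R \<in> U ==> p2.lreg (- c) U (\<lambda>P. det2 (\<phi> P) * \<delta> P) R"
  "s \<in> p2.secs E k" "finite {P. s (P, 0) = 0 \<and> s (P, Suc 0) = 0}" "k \<le> 0"
  "k = 0 ==> \<exists>t\<in>p2.secs E (- c). \<forall>P. wedge s t P = \<delta> P"
proof -
 obtain e \<delta> where \<delta>: "\<And>P. \<delta> P \<noteq> 0"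
  "\<And>U \<phi> R. (U, \<phi>) \<in> atlas E ==> R \<in> U ==> p2.lreg (- e) U (\<lambda>P. det2 (\<phi> P) * \<delta> P) R"
  by (rule determinant_frame[OF E(1,2)]) (rule that)
 obtain k s where s: "minimal_section E k s" using minimal_section_exists[OF E(1)] E(2) by auto
 have h: "hilb (hsecs E) 2 c (c * c + 3 * c)" using chern_numbers_hilb[OF E(3)] E(2) by simp
 note prem = E(1,2) \<delta> s
 have ec: "e = c" by (rule cod_value(1)[OF prem h]; assumption)
 show ?thesis
 proof (rule that[of \<delta> s k])
  show "s \<in> p2.secs E k" using s unfolding minimal_section_def by blast
  show "finite {P. s (P, 0) = 0 \<and> s (P, Suc 0) = 0}" by (rule zeros_s[OF prem]; assumption)
  show "k \<le> 0" by (rule minimal_degree(1)[OF prem h]; assumption)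
  show "\<exists>t\<in>p2.secs E (- c). \<forall>P. wedge s t P = \<delta> P" if "k = 0" by (rule minimal_degree(2)[OF prem h that]; assumption)
 qed (use \<delta> ec in simp_all)
qed

section \<open>Smooth conics\<close>

definition hom :: "nat => complex poly => complex => complex => complex" where
 "hom d p x y = (\<Sum>i\<le>d. coeff p i * x ^ i * y ^ (d - i))"

lemma hom_nonzero: "degree p \<le> d ==> y \<noteq> 0 ==> hom d p x y = y ^ d * poly p (x / y)"
proof -
 assume "degree p \<le> d" and y: "y \<noteq> 0"
 then have "y ^ d * poly p (x / y) = (\<Sum>i\<le>d. y ^ d * (coeff p i * (x / y) ^ i))"
  by (simp add: poly_eq_sum sum_distrib_left)
 also have "\<dots> = hom d p x y" unfolding hom_def
 proof (rule sum.cong)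
  fix i assume "i \<in> {..d}"
  then have "y ^ d = y ^ i * y ^ (d - i)" by (simp flip: power_add)
  then show "y ^ d * (coeff p i * (x / y) ^ i) = coeff p i * x ^ i * y ^ (d - i)"
   using y by (simp add: power_divide)
 qed simp
 finally show ?thesis ..
qed

lemma hom_zero: "hom d p x 0 = coeff p d * x ^ d"
proof -
 have "hom d p x 0 = (\<Sum>i\<le>d. if i = d then coeff p i * x ^ i else 0)"
  unfolding hom_def by (rule sum.cong) (auto simp: power_0_left)
 then show ?thesis by simp
qed

lemma hom_mult:
 assumes "degree p \<le> d" "degree q \<le> e"
 shows "hom d p x y * hom e q x y = hom (d + e) (p * q) x y"
proof (cases "y = 0")
 case False
 have "degree (p * q) \<le> d + e" using assms degree_mult_le[of p q] by linarith
 then show ?thesis using assms False by (simp add: hom_nonzero power_add)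
next
 case True
 \<comment> \<open>At y = 0 only the coefficients at the nominal degrees d and e count, whether or
   not they are zero.\<close>
 have "coeff (p * q) (d + e) = (\<Sum>i\<le>d + e. if i = d then coeff p d * coeff q e else 0)"
  unfolding coeff_mult
 proof (rule sum.cong)
  fix i assume "i \<in> {..d + e}"
  show "coeff p i * coeff q (d + e - i) = (if i = d then coeff p d * coeff q e else 0)"
  proof (cases "i < d")
   case True
   then have "coeff q (d + e - i) = 0" using assms(2) by (intro coeff_eq_0) simp
   then show ?thesis using True by simp
  next
   case False
   then have "i \<noteq> d ==> coeff p i = 0" using assms(1) by (intro coeff_eq_0) simp
   then show ?thesis by auto
  qed
 qed simp
 then show ?thesis unfolding True hom_zero by (simp add: power_add)
qed

lemma hom_scale: "hom d p (c * x) (c * y) = c ^ d * hom d p x y"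
 unfolding hom_def sum_distrib_left
proof (rule sum.cong)
 fix i assume "i \<in> {..d}"
 then have "c ^ d = c ^ i * c ^ (d - i)" by (simp flip: power_add)
 then show "coeff p i * (c * x) ^ i * (c * y) ^ (d - i) = c ^ d * (coeff p i * x ^ i * y ^ (d - i))"
  by (simp add: power_mult_distrib)
qed simp

lemma hom_linear: "hom (Suc 0) [:u, v:] x y = u * y + v * x"
 by (simp add: hom_def)

definition bform :: "nat => (complex => complex => complex) => bool" where
 "bform d F \<longleftrightarrow> (\<exists>p. degree p \<le> d \<and> F = hom d p)"

lemma bform_hom: "degree p \<le> d ==> bform d (hom d p)"
 unfolding bform_def by blast

lemma bform_const: "bform 0 (\<lambda>x y. c)"
 unfolding bform_def by (rule exI[of _ "[:c:]"]) (simp add: hom_def fun_eq_iff)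

lemma bform_mult: "bform d F ==> bform e G ==> bform (d + e) (\<lambda>x y. F x y * G x y)"
proof -
 assume "bform d F" "bform e G"
 then obtain p q where *: "degree p \<le> d" "F = hom d p" "degree q \<le> e" "G = hom e q" unfolding bform_def by blast
 have "degree (p * q) \<le> d + e" using * degree_mult_le[of p q] by linarith
 then show ?thesis unfolding bform_def using hom_mult[OF *(1,3)] *(2,4) by (intro exI[of _ "p * q"]) (simp add: fun_eq_iff)
qed

lemma bform_add: "bform d F ==> bform d G ==> bform d (\<lambda>x y. F x y + G x y)"
proof -
 assume "bform d F" "bform d G"
 then obtain p q where *: "degree p \<le> d" "F = hom d p" "degree q \<le> d" "G = hom d q" unfolding bform_def by blast
 then show ?thesis unfolding bform_def
  by (intro exI[of _ "p + q"]) (auto simp: degree_add_le hom_def fun_eq_iff algebra_simps sum.distrib)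
qed

lemma bform_0: "bform d (\<lambda>x y. 0)"
 unfolding bform_def by (rule exI[of _ 0]) (simp add: hom_def fun_eq_iff)

lemma bform_sum: "(\<And>i. i \<in> I ==> bform d (F i)) ==> bform d (\<lambda>x y. \<Sum>i\<in>I. F i x y)"
proof (induction I rule: infinite_finite_induct)
 case (insert i I)
 then show ?case using bform_add[of d "F i" "\<lambda>x y. \<Sum>i\<in>I. F i x y"] by simp
qed (auto intro: bform_0)

lemma bform_power: "bform d F ==> bform (d * n) (\<lambda>x y. F x y ^ n)"
proof (induction n)
 case 0
 then show ?case using bform_const[of 1] by simp
next
 case (Suc n)
 then show ?case using bform_mult[of d F "d * n"] by simp
qed

lemma bform_factor:
 assumes "bform d F" "(a, b) \<noteq> (0, 0)" "F a b = 0" "d \<ge> 1"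
 obtains G where "bform (d - 1) G" "\<And>x y. F x y = (b * x - a * y) * G x y"
proof -
 obtain p where p: "degree p \<le> d" "F = hom d p" using assms(1) unfolding bform_def by blast
 have d: "d = Suc 0 + (d - 1)" using assms(4) by simp
 show ?thesis
 proof (cases "b = 0")
  case False
  have "poly p (a / b) = 0" using assms(3) p False by (simp add: hom_nonzero)
  then obtain q where q: "p = [:- (a / b), 1:] * q" using poly_eq_0_iff_dvd by (metis dvdE)
  have dq: "degree q \<le> d - 1"
  proof (cases "q = 0")
   case False
   then have "degree p = 1 + degree q" unfolding q by (subst degree_mult_eq) auto
   then show ?thesis using p(1) by simp
  qed simp
  have "hom d p x y = (x - a / b * y) * hom (d - 1) q x y" for x y
   using hom_mult[of "[:- (a / b), 1:]" "Suc 0" q "d - 1" x y] dq d unfolding q by (simp add: hom_linear)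
  moreover have "(x - a / b * y) * h = (b * x - a * y) * (1 / b * h)" for x y h
   using False by (simp add: diff_divide_distrib left_diff_distrib)
  ultimately have "F x y = (b * x - a * y) * (1 / b * hom (d - 1) q x y)" for x y
   unfolding p(2) by simp
  moreover have "bform (d - 1) (\<lambda>x y. 1 / b * hom (d - 1) q x y)"
   using bform_mult[OF bform_const[of "1 / b"] bform_hom[OF dq]] by (simp only: add_0)
  ultimately show ?thesis by (intro that)
 next
  \<comment> \<open>The zero lies at infinity: the top coefficient vanishes and y factors
    out.\<close>
  case True
  then have a: "a \<noteq> 0" using assms(2) by simp
  have "coeff p d = 0" using assms(3) a unfolding p(2) True hom_zero by simp
  then have dp: "degree p \<le> d - 1" using p(1) assms(4)
   by (metis One_nat_def Suc_pred' degree_0 eq_zero_or_degree_less le0 le_eq_less_or_eq less_Suc_eq_le less_le_trans zero_less_one)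
  have "hom d p x y = y * hom (d - 1) p x y" for x y
   using hom_mult[of "[:1:]" "Suc 0" p "d - 1" x y] dp d by (simp add: hom_def[of "Suc 0"])
  then have "F x y = (b * x - a * y) * (- 1 / a * hom (d - 1) p x y)" for x y
   using a True unfolding p(2) by simp
  moreover have "bform (d - 1) (\<lambda>x y. - 1 / a * hom (d - 1) p x y)"
   using bform_mult[OF bform_const[of "- 1 / a"] bform_hom[OF dp]] by (simp only: add_0)
  ultimately show ?thesis by (intro that)
 qed
qed

lemma bform_zero:
 assumes "bform d F" "d \<ge> 1"
 shows "\<exists>a b. (a, b) \<noteq> (0, 0) \<and> F a b = 0"
proof -
 obtain p where p: "degree p \<le> d" "F = hom d p" using assms(1) unfolding bform_def by blast
 show ?thesis
 proof (cases "degree p = 0")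
  case True
  then have "coeff p d = 0" using assms(2) by (intro coeff_eq_0) simp
  then have "F 1 0 = 0" unfolding p(2) hom_zero by simp
  then show ?thesis by (intro exI[of _ 1] exI[of _ 0]) simp
 next
  case False
  then have "\<not> constant (poly p)" by (simp add: constant_degree)
  then obtain z where "poly p z = 0" using fundamental_theorem_of_algebra by blast
  then have "F z 1 = 0" using p by (simp add: hom_nonzero)
  then show ?thesis by (intro exI[of _ z] exI[of _ 1]) simp
 qed
qed

text \<open>The lowest two powers of x are separated from the rest. Iterating, a binary form of even
  degree becomes a polynomial in x^2, x y and y^2, which come from linear forms on the
  plane.\<close>

lemma bform_split:
 assumes "bform (n + 2) F"
 obtains F0 F1 F2 where "bform n F0" "bform n F1" "bform n F2"
  "\<And>x y. F x y = x ^ 2 * F0 x y + x * y * F1 x y + y ^ 2 * F2 x y"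
proof -
 obtain p where p: "degree p \<le> n + 2" "F = hom (n + 2) p" using assms unfolding bform_def by blast
 let ?q = "poly_shift 2 p"
 have dq: "degree ?q \<le> n"
  by (rule degree_le) (use p(1) in \<open>auto simp: coeff_poly_shift intro!: coeff_eq_0\<close>)
 have y: "bform n (\<lambda>x y. c * y ^ n)" for c
 proof -
  have "hom n [:c:] x y = c * y ^ n" for x y by (simp add: hom_def coeff_pCons split: nat.splits) (simp add: sum.atMost_shift)
  then have "hom n [:c:] = (\<lambda>x y. c * y ^ n)" by (intro ext)
  then show ?thesis using bform_hom[of "[:c:]" n] by simp
 qed
 have *: "F x y = x ^ 2 * hom n ?q x y + x * y * (coeff p 1 * y ^ n) + y ^ 2 * (coeff p 0 * y ^ n)" for x y
  unfolding p(2) hom_def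
  by (simp add: numeral_2_eq_2 sum.atMost_Suc_shift coeff_poly_shift sum_distrib_left mult_ac del: sum.atMost_Suc)
 show ?thesis by (rule that[OF bform_hom[OF dq] y y *])
qed

subsection \<open>Parametrisation\<close>

text \<open>The parametrisation of C by the projective line. The chosen representative of a point P
  equals the value at the parameters (w1 P, w2 P) exactly, not only up to a factor, so plane forms
  become binary forms in w1 and w2; the linear forms L0, L1, L2 recover the quadratic
  monomials.\<close>

locale conic =
 fixes C :: "P2 set" and w1 w2 :: "P2 => complex" and v0 v1 v2 :: "complex ^ 3" and L0 L1 L2 :: "complex ^ 3 => complex"
 assumes L: "form 1 L0" "form 1 L1" "form 1 L2"
  and L_w: "P \<in> C ==> L0 (coords P) = w1 P ^ 2" "P \<in> C ==> L1 (coords P) = w1 P * w2 P" "P \<in> C ==> L2 (coords P) = w2 P ^ 2"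
  and coords_w: "P \<in> C ==> coords P = (w1 P ^ 2) *s v0 + (w1 P * w2 P) *s v1 + (w2 P ^ 2) *s v2"
  and w_onto: "(a, b) \<noteq> (0, 0) ==> \<exists>P\<in>C. \<exists>c. c \<noteq> 0 \<and> w1 P = c * a \<and> w2 P = c * b"
begin

lemma w_nonzero: "P \<in> C ==> w1 P \<noteq> 0 \<or> w2 P \<noteq> 0"
 using coords_w[of P] coords_nonzero[of P] by auto

lemma w_injective:
 assumes P: "P \<in> C" "Q \<in> C" and eq: "w1 P * w2 Q = w2 P * w1 Q"
 shows "P = Q"
proof -
 obtain c where c: "w1 P = c * w1 Q" "w2 P = c * w2 Q"
 proof (cases "w1 Q = 0")
  case True
  then show ?thesis using that[of "w2 P / w2 Q"] eq w_nonzero[OF P(2)] by auto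
 next
  case False
  then show ?thesis using that[of "w1 P / w1 Q"] eq by (simp add: field_simps)
 qed
 have "coords P = c ^ 2 *s coords Q"
  unfolding coords_w[OF P(1)] coords_w[OF P(2)] c
  by (simp add: Finite_Cartesian_Product.vec_eq_iff power2_eq_square algebra_simps)
 then show ?thesis by (rule coords_eqI)
qed

text \<open>Degrees are those of the projective line, so a plane form of degree d has degree 2 d
  here. Only values on C count.\<close>

definition H :: "int => (P2 => complex) => bool" where
 "H k f \<longleftrightarrow> (if k < 0 then \<forall>P\<in>C. f P = 0 else \<exists>F. bform (nat k) F \<and> (\<forall>P\<in>C. f P = F (w1 P) (w2 P)))"

lemma H_zero: "(\<And>P. P \<in> C ==> f P = 0) ==> H k f"
 unfolding H_def using bform_0 by auto

lemma HI: "bform d F ==> (\<And>P. P \<in> C ==> f P = F (w1 P) (w2 P)) ==> H (int d) f"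
 unfolding H_def by auto

lemma HE:
 assumes "H k f" "P \<in> C" "f P \<noteq> 0"
 obtains d F where "k = int d" "bform d F" "\<And>P. P \<in> C ==> f P = F (w1 P) (w2 P)"
proof -
 have k: "k \<ge> 0" using assms by (auto simp: H_def split: if_splits)
 then obtain F where "bform (nat k) F" "\<forall>P\<in>C. f P = F (w1 P) (w2 P)" using assms(1) by (auto simp: H_def)
 with k show ?thesis by (intro that[of "nat k" F]) auto
qed

lemma H_w: "H 1 w1" "H 1 w2"
proof -
 have "bform 1 (\<lambda>x y. x)" "bform 1 (\<lambda>x y. y)"
  using bform_hom[of "[:0, 1:]" "Suc 0"] bform_hom[of "[:1:]" "Suc 0"] by (simp_all add: hom_def[abs_def])
 then show "H 1 w1" "H 1 w2" using HI[of 1] by force+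
qed

lemma coord_ring_H: "coord_ring C H"
proof
 show "H k 0" for k by (rule H_zero) (simp add: fun_ops)
 show "H k (f + g)" if fg: "H k f" "H k g" for k f g
 proof (cases "k < 0")
  case False
  then obtain F G where "bform (nat k) F" "\<forall>P\<in>C. f P = F (w1 P) (w2 P)" "bform (nat k) G" "\<forall>P\<in>C. g P = G (w1 P) (w2 P)"
   using fg by (auto simp: H_def)
  then show ?thesis using False bform_add[of "nat k" F G] by (auto simp: H_def fun_ops intro!: exI[of _ "\<lambda>x y. F x y + G x y"])
 qed (use fg in \<open>simp add: H_def fun_ops\<close>)
 show "H (k + l) (f * g)" if fg: "H k f" "H l g" for k l f g
 proof (cases "k < 0 \<or> l < 0")
  case True
  then show ?thesis using fg by (intro H_zero) (auto simp: H_def fun_ops)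
 next
  case False
  then obtain F G where FG: "bform (nat k) F" "\<forall>P\<in>C. f P = F (w1 P) (w2 P)" "bform (nat l) G" "\<forall>P\<in>C. g P = G (w1 P) (w2 P)"
   using fg by (auto simp: H_def)
  have "k + l = int (nat k + nat l)" using False by simp
  then show ?thesis using HI[OF bform_mult[OF FG(1,3)], of "f * g"] FG(2,4) by (simp add: fun_ops)
 qed
 show "H 0 (kk c)" for c using HI[OF bform_const[of c], of "kk c"] by (simp add: kk_apply)
 show "f P = 0" if "H k f" "k < 0" "P \<in> C" for k f P using that by (simp add: H_def)
 show "\<exists>f. H 1 f \<and> f P \<noteq> 0" if "P \<in> C" for P using w_nonzero[OF that] H_w by blast
 show "\<exists>R\<in>C. f R \<noteq> 0 \<and> g R \<noteq> 0" if fg: "H k f" "H l g" "P \<in> C" "f P \<noteq> 0" "Q \<in> C" "g Q \<noteq> 0" for k l f g P Q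
 proof -
  obtain d F where F: "bform d F" "\<And>P. P \<in> C ==> f P = F (w1 P) (w2 P)" by (rule HE[OF fg(1,3,4)]) (rule that)
  obtain e G where G: "bform e G" "\<And>P. P \<in> C ==> g P = G (w1 P) (w2 P)" by (rule HE[OF fg(2,5,6)]) (rule that)
  obtain p q where p: "degree p \<le> d" "F = hom d p" and q: "degree q \<le> e" "G = hom e q"
   using F(1) G(1) unfolding bform_def by blast
  have "p \<noteq> 0" "q \<noteq> 0" using F(2)[OF fg(3)] fg(4) G(2)[OF fg(5)] fg(6) p(2) q(2) by (auto simp: hom_def)
  then have "finite {t. poly (p * q) t = 0}" by (intro poly_roots_finite) simp
  then obtain t where t: "poly (p * q) t \<noteq> 0" using ex_new_if_finite infinite_UNIV_char_0 by blast
  obtain R c where R: "R \<in> C" "c \<noteq> 0" "w1 R = c * t" "w2 R = c * 1" using w_onto[of t 1] by auto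
  have "f R \<noteq> 0" "g R \<noteq> 0" unfolding F(2)[OF R(1)] G(2)[OF R(1)] p(2) q(2) R(3,4) hom_scale
   using R(2) t p(1) q(1) by (simp_all add: hom_nonzero)
  with R(1) show ?thesis by blast
 qed
qed

lemma form_bform: "form d p ==> bform (2 * d) (\<lambda>x y. p (x ^ 2 *s v0 + (x * y) *s v1 + y ^ 2 *s v2))"
proof -
 assume "form d p"
 then obtain a where a: "p = (\<lambda>v. \<Sum>i\<le>d. \<Sum>j\<le>d - i. a i j * (v $ 1) ^ i * (v $ 2) ^ j * (v $ 3) ^ (d - i - j))"
  unfolding form_def by blast
 let ?v = "\<lambda>x y. x ^ 2 *s v0 + (x * y) *s v1 + y ^ 2 *s v2"
 have l: "bform 2 (\<lambda>x y. ?v x y $ l)" for l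
 proof -
  have "bform 2 (hom 2 [:v2 $ l, v1 $ l, v0 $ l:])" by (rule bform_hom) simp
  moreover have "hom 2 [:v2 $ l, v1 $ l, v0 $ l:] = (\<lambda>x y. ?v x y $ l)"
   by (simp add: fun_eq_iff hom_def numeral_2_eq_2 algebra_simps)
  ultimately show ?thesis by simp
 qed
 show ?thesis unfolding a
 proof (intro bform_sum)
  fix i j assume "i \<in> {..d}" "j \<in> {..d - i}"
  then have e: "0 + 2 * i + 2 * j + 2 * (d - i - j) = 2 * d" by simp
  show "bform (2 * d) (\<lambda>x y. a i j * (?v x y $ 1) ^ i * (?v x y $ 2) ^ j * (?v x y $ 3) ^ (d - i - j))"
   using bform_mult[OF bform_mult[OF bform_mult[OF bform_const[of "a i j"] bform_power[OF l[of 1], of i]]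
    bform_power[OF l[of 2], of j]] bform_power[OF l[of 3], of "d - i - j"]] unfolding e .
 qed
qed

lemma bform_form: "bform (2 * d) F ==> \<exists>p. form d p \<and> (\<forall>P\<in>C. F (w1 P) (w2 P) = p (coords P))"
proof (induction d arbitrary: F)
 case 0
 then obtain p where "F = hom 0 p" unfolding bform_def by auto
 then show ?case by (intro exI[of _ "kk (coeff p 0)"] conjI form_kk) (simp add: hom_def kk_apply)
next
 case (Suc d)
 then have "bform (2 * d + 2) F" by simp
 then obtain F0 F1 F2 where F: "bform (2 * d) F0" "bform (2 * d) F1" "bform (2 * d) F2"
  "\<And>x y. F x y = x ^ 2 * F0 x y + x * y * F1 x y + y ^ 2 * F2 x y" by (rule bform_split) (rule that)
 obtain p0 p1 p2 where p: "form d p0" "\<forall>P\<in>C. F0 (w1 P) (w2 P) = p0 (coords P)" "form d p1" "\<forall>P\<in>C. F1 (w1 P) (w2 P) = p1 (coords P)"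
  "form d p2" "\<forall>P\<in>C. F2 (w1 P) (w2 P) = p2 (coords P)" using Suc.IH[OF F(1)] Suc.IH[OF F(2)] Suc.IH[OF F(3)] by blast
 have "form (1 + d) (L0 * p0 + L1 * p1 + L2 * p2)" by (intro form_add form_mult L p)
 moreover have "F (w1 P) (w2 P) = (L0 * p0 + L1 * p1 + L2 * p2) (coords P)" if "P \<in> C" for P
  unfolding F(4) using p that by (simp add: fun_ops L_w)
 ultimately show ?case by (intro exI[of _ "L0 * p0 + L1 * p1 + L2 * p2"]) simp
qed

end

sublocale conic \<subseteq> coord_ring C H
 by (rule coord_ring_H)

sublocale conic \<subseteq> coord_space C H
proof (rule coord_spaceI[of 2])
 show "\<exists>f. H (2 * int d) f \<and> (\<forall>P\<in>C. f P = p (coords P))" if "form d p" for d p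
 proof -
  have "H (int (2 * d)) (\<lambda>P. p (coords P))" by (rule HI[OF form_bform[OF that]]) (simp add: coords_w[symmetric])
  then show ?thesis by (intro exI[of _ "\<lambda>P. p (coords P)"]) simp
 qed
 show "\<exists>p. form d p \<and> (\<forall>P\<in>C. f P = p (coords P))" if Hf: "H (2 * int d) f" for d f
 proof -
  have "nat (2 * int d) = 2 * d" by simp
  then obtain F where F: "bform (2 * d) F" "\<forall>P\<in>C. f P = F (w1 P) (w2 P)"
   using Hf by (auto simp: H_def)
  then show ?thesis using bform_form[of d F] by auto
 qed
qed simp

section \<open>The normal form of a smooth conic\<close>

lemma quadratic_polar:
 assumes "form 2 q"
 obtains b :: "complex ^ 3 => complex ^ 3 => complex" where "\<And>u v. b u v = b v u" "\<And>u v v'. b u (v + v') = b u v + b u v'" "\<And>u c v. b u (c *s v) = c * b u v"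
  "\<And>u t v. q (u + t *s v) = q u + t * b u v + t ^ 2 * q v" "\<And>u. b u u = 2 * q u" "\<And>u. form 1 (\<lambda>v. b v u)"
proof -
 obtain a where a: "\<And>v. q v = (\<Sum>i\<le>2. \<Sum>j\<le>2 - i. a i j * (v $ 1) ^ i * (v $ 2) ^ j * (v $ 3) ^ (2 - i - j))"
  using assms unfolding form_def by blast
 have q: "q v = a 0 0 * (v $ 3) ^ 2 + a 0 1 * (v $ 2) * (v $ 3) + a 0 2 * (v $ 2) ^ 2 + a 1 0 * (v $ 1) * (v $ 3)
   + a 1 1 * (v $ 1) * (v $ 2) + a 2 0 * (v $ 1) ^ 2" for v :: "complex ^ 3"
  unfolding a by (simp add: numeral_2_eq_2)
 define b where "b u v = 2 * a 0 0 * (u $ 3) * (v $ 3) + a 0 1 * (u $ 2 * v $ 3 + v $ 2 * u $ 3) + 2 * a 0 2 * (u $ 2) * (v $ 2)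
   + a 1 0 * (u $ 1 * v $ 3 + v $ 1 * u $ 3) + a 1 1 * (u $ 1 * v $ 2 + v $ 1 * u $ 2) + 2 * a 2 0 * (u $ 1) * (v $ 1)" for u v :: "complex ^ 3"
 show ?thesis
 proof (rule that[of b])
  show "q (u + t *s v) = q u + t * b u v + t ^ 2 * q v" for u t v
   by (simp add: q b_def power2_eq_square algebra_simps)
  show "form 1 (\<lambda>v. b v u)" for u
  proof -
   have m: "form 1 (\<lambda>v. c * v $ i)" for c i
    using form_mult[OF form_kk[of c] form_coord[of i]] by (simp add: times_fun_def kk_def)
   have "(\<lambda>v. b v u) = (\<lambda>v. (2 * a 0 0 * u $ 3 + a 0 1 * u $ 2 + a 1 0 * u $ 1) * v $ 3) +
     ((\<lambda>v. (a 0 1 * u $ 3 + 2 * a 0 2 * u $ 2 + a 1 1 * u $ 1) * v $ 2) +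
     (\<lambda>v. (a 1 0 * u $ 3 + a 1 1 * u $ 2 + 2 * a 2 0 * u $ 1) * v $ 1))"
    by (simp add: fun_eq_iff fun_ops b_def algebra_simps)
   then show ?thesis by (simp only:) (intro form_add m)
  qed
 qed (simp_all add: b_def q power2_eq_square algebra_simps)
qed

lemma three_independent_span:
 fixes v0 v1 v2 :: "complex ^ 3"
 assumes "\<And>x y z. x *s v0 + y *s v1 + z *s v2 = 0 ==> x = 0 \<and> y = 0 \<and> z = 0"
 shows "\<exists>x y z. v = x *s v0 + y *s v1 + z *s v2"
proof -
 define A :: "complex ^ 3 ^ 3" where "A = (\<chi> i j. if j = 1 then v0 $ i else if j = 2 then v1 $ i else v2 $ i)"
 have col: "Finite_Cartesian_Product.column 1 A = v0" "Finite_Cartesian_Product.column 2 A = v1" "Finite_Cartesian_Product.column 3 A = v2"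
  by (simp_all add: Finite_Cartesian_Product.column_def A_def Finite_Cartesian_Product.vec_eq_iff three_distinct)
 have "\<forall>c. sum (\<lambda>i. c i *s Finite_Cartesian_Product.column i A) UNIV = 0 --> (\<forall>i. c i = 0)"
  unfolding sum_3 col using assms by (metis (full_types) exhaust_3)
 then obtain B where "B ** A = Finite_Cartesian_Product.mat 1" using matrix_left_invertible_independent_columns[of A] by blast
 then have "A ** B = Finite_Cartesian_Product.mat 1" by (simp add: matrix_left_right_inverse)
 then have "v = A *v (B *v v)" by (simp add: matrix_vector_mul_assoc)
 also have "\<dots> = (B *v v) $ 1 *s v0 + (B *v v) $ 2 *s v1 + (B *v v) $ 3 *s v2"
  unfolding matrix_mult_sum sum_3 col ..
 finally show ?thesis by blast
qed

text \<open>A basis is found in which q is y^2 - x z: v0 and v2 are isotropic with b v0 v2 = -1, and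
  v1 is orthogonal to both with q v1 = 1. Points of C then have coordinates (w1^2, w1 w2, w2^2),
  with the square roots chosen point by point.\<close>

lemma smooth_conic_parametrisation:
 assumes "smooth_conic C"
 shows "\<exists>w1 w2 v0 v1 v2 L0 L1 L2. conic C w1 w2 v0 v1 v2 L0 L1 L2"
proof -
 obtain q where q: "form 2 q" "C = {P. q (coords P) = 0}" "\<forall>P\<in>C. \<exists>i. partial_deriv i q (coords P) \<noteq> 0"
  using assms unfolding smooth_conic_def by blast
 obtain b :: "complex ^ 3 => complex ^ 3 => complex" where b: "\<And>u v. b u v = b v u" "\<And>u v v'. b u (v + v') = b u v + b u v'" "\<And>u c v. b u (c *s v) = c * b u v"
  "\<And>u t v. q (u + t *s v) = q u + t * b u v + t ^ 2 * q v" "\<And>u. b u u = 2 * q u" "\<And>u. form 1 (\<lambda>v. b v u)"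
  by (rule quadratic_polar[OF q(1)]) (rule that)
 have bl: "b (u + u') v = b u v + b u' v" "b (c *s u) v = c * b u v" for u u' v c
  using b(2)[of v u u'] b(3)[of v c u] by (simp_all add: b(1)[of v])
 have smooth: "\<exists>i. b (coords P) (axis i 1) \<noteq> 0" if P: "P \<in> C" for P
 proof -
  have "partial_deriv i q u = b u (axis i 1)" for i u
  proof -
   have "((\<lambda>t. q u + t * b u (axis i 1) + t ^ 2 * q (axis i 1)) has_field_derivative b u (axis i 1)) (at 0)"
    by (auto intro!: derivative_eq_intros)
   then show ?thesis unfolding partial_deriv_def b(4) by (rule DERIV_imp_deriv)
  qed
  then show ?thesis using q(3) P by simp
 qed
 have "pform (int 2) (\<lambda>P. q (coords P))" by (rule pform_of_form[OF q(1)])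
 from zeros_infinite[OF this] have infC: "infinite C" unfolding q(2) by simp
 then obtain P0 where P0: "P0 \<in> C" using infinite_imp_nonempty by blast
 define v0 where "v0 = coords P0"
 have qv0: "q v0 = 0" using P0 by (simp add: v0_def q(2))
 obtain i where i: "b v0 (axis i 1) \<noteq> 0" using smooth[OF P0] v0_def by blast
 \<comment> \<open>By smoothness some coordinate vector is off the tangent at v0; moving it along v0
   makes it isotropic.\<close>
 define u where "u = axis i 1 + (- q (axis i 1) / b v0 (axis i 1)) *s v0"
 have qu: "q u = 0" unfolding u_def b(4) qv0 using i b(1)[of v0 "axis i 1"] by simp
 have b00: "b v0 v0 = 0" using b(5)[of v0] qv0 by simp
 have bu: "b v0 u = b v0 (axis i 1)" unfolding u_def b(2) b(3) b00 by simp
 define v2 where "v2 = (- 1 / b v0 u) *s u"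
 have b02: "b v0 v2 = - 1" unfolding v2_def b(3) using i bu by simp
 have qv2: "q v2 = 0"
 proof -
  have "b v2 v2 = 0" unfolding v2_def b(3) bl using b(5)[of u] qu by simp
  then show ?thesis using b(5)[of v2] by simp
 qed
 have b22: "b v2 v2 = 0" using b(5)[of v2] qv2 by simp
 have sub: "\<exists>\<alpha>. \<forall>P. lin \<alpha> P = b w (coords P)" for w
 proof -
  define \<alpha> :: "complex ^ 3" where "\<alpha> = vector [b w (axis 1 1), b w (axis 2 1), b w (axis 3 1)]"
  have *: "b w v = v $ 1 * b w (axis 1 1) + v $ 2 * b w (axis 2 1) + v $ 3 * b w (axis 3 1)" for v
  proof -
   have "v = v $ 1 *s axis 1 1 + v $ 2 *s axis 2 1 + v $ 3 *s axis 3 1"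
    by (simp add: Finite_Cartesian_Product.vec_eq_iff forall_3 axis_def three_distinct)
   then have "b w v = b w (v $ 1 *s axis 1 1 + v $ 2 *s axis 2 1 + v $ 3 *s axis 3 1)" by simp
   then show ?thesis by (simp add: b(2,3))
  qed
  have "lin \<alpha> P = b w (coords P)" for P
   unfolding *[of "coords P"] lin_def \<alpha>_def by (simp only: vector_3 mult.commute)
  then show ?thesis by blast
 qed
 obtain \<alpha> where \<alpha>: "\<forall>P. lin \<alpha> P = b v0 (coords P)" using sub by blast
 obtain \<gamma> where \<gamma>: "\<forall>P. lin \<gamma> P = b v2 (coords P)" using sub by blast
 have v2nz: "v2 \<noteq> 0" using b02 b(3)[of v0 0 v2] by auto
 obtain c where c: "c \<noteq> 0" "coords (abs_P2 v2) = c *s v2" using coords_abs[OF v2nz] by blast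
 have ind: "indep \<alpha> \<gamma>" unfolding indep_def
 proof (intro allI impI)
  fix s t assume eq: "s *s \<alpha> + t *s \<gamma> = 0"
  have "s * b v0 (coords P) + t * b v2 (coords P) = 0" for P
  proof -
   have "lin (s *s \<alpha> + t *s \<gamma>) P = 0" unfolding eq by (simp add: lin_def)
   then show ?thesis by (simp add: lin_add lin_scale fun_ops kk_apply \<alpha> \<gamma>)
  qed
  from this[of P0] this[of "abs_P2 v2"] show "s = 0 \<and> t = 0"
   using c b00 b02 b22 b(1)[of v2 v0] by (simp add: v0_def[symmetric] b(3))
 qed
 \<comment> \<open>The intersection of the tangents at v0 and v2, that is, the pole of the line
   joining these points.\<close>
 obtain P1 where P1: "lin \<alpha> P1 = 0" "lin \<gamma> P1 = 0" by (rule common_zero[OF ind])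
 define u1 where "u1 = coords P1"
 have b0u: "b v0 u1 = 0" "b v2 u1 = 0" using P1 \<alpha> \<gamma> by (simp_all add: u1_def)
 have u1nz: "u1 \<noteq> 0" unfolding u1_def by (rule coords_nonzero)
 have b0: "b w 0 = 0" for w using b(3)[of w 0 0] by simp
 have indep3: "x = 0 \<and> y = 0 \<and> z = 0" if v: "x *s v0 + y *s u1 + z *s v2 = 0" for x y z
 proof -
  have "b v2 (x *s v0 + y *s u1 + z *s v2) = 0" "b v0 (x *s v0 + y *s u1 + z *s v2) = 0" unfolding v by (rule b0)+
  then have "x = 0" "z = 0" using b00 b02 b22 b0u b(1)[of v2 v0] by (simp_all add: b(2,3))
  then show ?thesis using v u1nz by simp
 qed
 \<comment> \<open>Otherwise P1 would be a point of C that is orthogonal to the whole basis, hence a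
   singular point.\<close>
 have qu1: "q u1 \<noteq> 0"
 proof
  assume "q u1 = 0"
  then have "P1 \<in> C" by (simp add: q(2) u1_def)
  then obtain i where i: "b u1 (axis i 1) \<noteq> 0" using smooth u1_def by blast
  obtain x y z where "axis i 1 = x *s v0 + y *s u1 + z *s v2" using three_independent_span[OF indep3] by blast
  then have "b u1 (axis i 1) = 0" using b0u b(1)[of u1 v0] b(1)[of u1 v2] b(5)[of u1] \<open>q u1 = 0\<close> by (simp add: b(2,3))
  with i show False by blast
 qed
 define v1 where "v1 = (1 / csqrt (q u1)) *s u1"
 have cs: "csqrt (q u1) \<noteq> 0" using qu1 by simp
 have b1: "b v0 v1 = 0" "b v2 v1 = 0" unfolding v1_def b(3) b0u by simp_all
 have b11: "b v1 v1 = 2"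
 proof -
  have "b v1 v1 = (1 / csqrt (q u1)) ^ 2 * b u1 u1" unfolding v1_def b(3) bl by (simp add: power2_eq_square)
  also have "\<dots> = 2" unfolding b(5) using qu1 by (simp add: power_divide)
  finally show ?thesis .
 qed
 have indv: "x = 0 \<and> y = 0 \<and> z = 0" if v: "x *s v0 + y *s v1 + z *s v2 = 0" for x y z
  using indep3[of x "y / csqrt (q u1)" z] v cs by (simp add: v1_def vector_smult_assoc)
 define L0 where "L0 = (\<lambda>v. b v (- 1 *s v2))"
 define L1 where "L1 = (\<lambda>v. b v ((1 / 2) *s v1))"
 define L2 where "L2 = (\<lambda>v. b v (- 1 *s v0))"
 have form: "form 1 L0" "form 1 L1" "form 1 L2" unfolding L0_def L1_def L2_def by (rule b(6))+
 have Lv: "L0 (x *s v0 + y *s v1 + z *s v2) = x" "L1 (x *s v0 + y *s v1 + z *s v2) = y" "L2 (x *s v0 + y *s v1 + z *s v2) = z" for x y z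
  unfolding L0_def L1_def L2_def b(2,3) bl using b00 b02 b22 b1 b11 b(1)[of v2 v0] b(1)[of v1 v0] b(1)[of v1 v2] by simp_all
 have qv: "q (x *s v0 + y *s v1 + z *s v2) = y ^ 2 - x * z" for x y z
 proof -
  let ?v = "x *s v0 + y *s v1 + z *s v2"
  have "b ?v ?v = 2 * (y ^ 2 - x * z)" unfolding b(2,3) bl
   using b00 b02 b22 b1 b11 b(1)[of v2 v0] b(1)[of v1 v0] b(1)[of v1 v2] by (simp add: power2_eq_square algebra_simps)
  then have "2 * q ?v = 2 * (y ^ 2 - x * z)" using b(5)[of ?v] by (simp only:)
  then show ?thesis by (metis mult_cancel_left zero_neq_numeral)
 qed
 have "\<exists>a. coords P = (fst a ^ 2) *s v0 + (fst a * snd a) *s v1 + (snd a ^ 2) *s v2" if P: "P \<in> C" for P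
 proof -
  obtain x y z where v: "coords P = x *s v0 + y *s v1 + z *s v2" using three_independent_span[OF indv] by blast
  have yz: "y ^ 2 = x * z" using P qv[of x y z] by (simp add: q(2) v)
  show ?thesis
  proof (cases "x = 0")
   case True
   then have "coords P = (0 ^ 2) *s v0 + (0 * csqrt z) *s v1 + (csqrt z ^ 2) *s v2" using v yz by simp
   then show ?thesis by (intro exI[of _ "(0, csqrt z)"]) simp
  next
   case False
   then have "csqrt x \<noteq> 0" "(y / csqrt x) ^ 2 = z" using yz by (simp_all add: power_divide)
   then have "coords P = (csqrt x ^ 2) *s v0 + (csqrt x * (y / csqrt x)) *s v1 + ((y / csqrt x) ^ 2) *s v2" using v by simp
   then show ?thesis by (intro exI[of _ "(csqrt x, y / csqrt x)"]) simp
  qed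
 qed
 then have "\<forall>P\<in>C. \<exists>a. coords P = (fst a ^ 2) *s v0 + (fst a * snd a) *s v1 + (snd a ^ 2) *s v2" by blast
 from bchoice[OF this] obtain w where w: "\<forall>P\<in>C. coords P = (fst (w P) ^ 2) *s v0 + (fst (w P) * snd (w P)) *s v1 + (snd (w P) ^ 2) *s v2" ..
 have "conic C (\<lambda>P. fst (w P)) (\<lambda>P. snd (w P)) v0 v1 v2 L0 L1 L2"
 proof
  show "coords P = (fst (w P) ^ 2) *s v0 + (fst (w P) * snd (w P)) *s v1 + (snd (w P) ^ 2) *s v2" if "P \<in> C" for P using w that by blast
  show "L0 (coords P) = fst (w P) ^ 2" "L1 (coords P) = fst (w P) * snd (w P)" "L2 (coords P) = snd (w P) ^ 2" if "P \<in> C" for P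
   unfolding w[rule_format, OF that] by (rule Lv)+
  fix a b :: complex assume ab: "(a, b) \<noteq> (0, 0)"
  define v where "v = (a ^ 2) *s v0 + (a * b) *s v1 + (b ^ 2) *s v2"
  have v: "v \<noteq> 0"
  proof
   assume "v = 0"
   from indv[OF this[unfolded v_def]] ab show False by simp
  qed
  obtain c where c: "c \<noteq> 0" "coords (abs_P2 v) = c *s v" using coords_abs[OF v] by blast
  let ?P = "abs_P2 v"
  have cP: "coords ?P = (c * a ^ 2) *s v0 + (c * (a * b)) *s v1 + (c * b ^ 2) *s v2"
  proof -
   have "c *s v = (c * a ^ 2) *s v0 + (c * (a * b)) *s v1 + (c * b ^ 2) *s v2"
    by (simp add: v_def Finite_Cartesian_Product.vec_eq_iff algebra_simps)
   then show ?thesis unfolding c(2) .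
  qed
  have P: "?P \<in> C" unfolding q(2) mem_Collect_eq cP qv by (simp add: power2_eq_square)
  have W: "fst (w ?P) ^ 2 = c * a ^ 2" "fst (w ?P) * snd (w ?P) = c * (a * b)" "snd (w ?P) ^ 2 = c * b ^ 2"
   using arg_cong[OF trans[OF w[rule_format, OF P, symmetric] cP], of L0] arg_cong[OF trans[OF w[rule_format, OF P, symmetric] cP], of L1]
    arg_cong[OF trans[OF w[rule_format, OF P, symmetric] cP], of L2] unfolding Lv by simp_all
  show "\<exists>P\<in>C. \<exists>c. c \<noteq> 0 \<and> fst (w P) = c * a \<and> snd (w P) = c * b"
  proof (cases "a = 0")
   case True
   then have "fst (w ?P) = 0" "b \<noteq> 0" "snd (w ?P) \<noteq> 0" using W ab c(1) by auto
   then show ?thesis using P True by (intro bexI[of _ ?P] exI[of _ "snd (w ?P) / b"]) auto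
  next
   case False
   then have f: "fst (w ?P) \<noteq> 0" using W(1) c(1) by auto
   have "fst (w ?P) * snd (w ?P) * a = fst (w ?P) * fst (w ?P) * b" using W(1,2) by (simp add: power2_eq_square algebra_simps)
   then have "snd (w ?P) = fst (w ?P) / a * b" using f False by (simp add: field_simps)
   then show ?thesis using P f False by (intro bexI[of _ ?P] exI[of _ "fst (w ?P) / a"]) auto
  qed
 qed (rule form)+
 then show ?thesis by blast
qed

section \<open>Divisibility and splitting on the conic\<close>

context coord_ring
begin

lemma H_identity:
 assumes "H k f" "H k f'" and h: "H l h" "P \<in> X" "h P \<noteq> 0" and eq: "\<And>Q. Q \<in> X ==> h Q \<noteq> 0 ==> f Q = f' Q"
  and Q: "Q \<in> X"
 shows "f Q = f' Q"
proof (rule ccontr)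
 assume "f Q \<noteq> f' Q"
 then have "(f + kk (- 1) * f') Q \<noteq> 0" by (simp add: fun_ops kk_apply)
 from H_dom[OF H_add[OF assms(1) H_kk_mult[OF assms(2)]] h(1) Q this h(2,3)]
 obtain R where "R \<in> X" "(f + kk (- 1) * f') R \<noteq> 0" "h R \<noteq> 0" by blast
 with eq[of R] show False by (simp add: fun_ops kk_apply)
qed

lemma lreg_prod:
 assumes "\<And>i. i \<in> I ==> lreg (k i) A (g i) R"
 shows "lreg (\<Sum>i\<in>I. k i) A (\<lambda>Q. \<Prod>i\<in>I. g i Q) R"
 using assms
proof (induction I rule: infinite_finite_induct)
 case (insert i I)
 then have "lreg (k i + sum k I) A (\<lambda>Q. g i Q * (\<Prod>i\<in>I. g i Q)) R" by (intro lreg_times[of "k i" A "g i" R "sum k I"]) auto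
 then show ?case using insert by simp
qed (simp_all add: lreg_const)

lemma H_prod: "(\<And>i. i \<in> I ==> H (k i) (f i)) ==> H (\<Sum>i\<in>I. k i) (\<lambda>Q. \<Prod>i\<in>I. f i Q)"
proof (induction I rule: infinite_finite_induct)
 case (insert i I)
 then have "H (k i + sum k I) (f i * (\<lambda>Q. \<Prod>i\<in>I. f i Q))" by (intro H_mult) auto
 then show ?case using insert by (simp add: times_fun_def)
qed (use H_one in \<open>simp_all add: one_fun_def\<close>)

end

lemma (in coord_ring) zopen_nonzero: "H d h ==> zopen {Q \<in> X. h Q \<noteq> 0}"
 unfolding zopen_def by (auto intro!: exI[of _ d] exI[of _ h])

context conic
begin

text \<open>The binary linear form in Q whose only zero is P, by which functions and sections
  vanishing at P are divided.\<close>

definition ell :: "P2 => P2 => complex" where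
 "ell P Q = w2 P * w1 Q - w1 P * w2 Q"

lemma ell_eq_0: "P \<in> C ==> Q \<in> C ==> ell P Q = 0 \<longleftrightarrow> Q = P"
 using w_injective[of Q P] by (auto simp: ell_def mult.commute)

lemma H_ell: "H 1 (ell P)"
proof -
 have "ell P = kk (w2 P) * w1 + kk (- w1 P) * w2" by (simp add: fun_eq_iff fun_ops kk_apply ell_def)
 then show ?thesis using H_add[OF H_kk_mult[OF H_w(1)] H_kk_mult[OF H_w(2)]] by simp
qed

lemma H_divide:
 assumes f: "H d f" and P: "P \<in> C" "f P = 0"
 obtains g where "H (d - 1) g" "\<And>Q. Q \<in> C ==> f Q = ell P Q * g Q"
proof (cases "\<exists>Q\<in>C. f Q \<noteq> 0")
 case False
 then show ?thesis by (intro that[of 0] H_zero) (auto simp: fun_ops)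
next
 case True
 then obtain Q where Q: "Q \<in> C" "f Q \<noteq> 0" by blast
 obtain n F where F: "d = int n" "bform n F" "\<And>P. P \<in> C ==> f P = F (w1 P) (w2 P)" by (rule HE[OF f Q]) (rule that)
 have n: "n \<ge> 1"
 proof (rule ccontr)
  assume "\<not> n \<ge> 1"
  then have n0: "n = 0" by simp
  obtain p where "F = hom 0 p" using F(2) unfolding bform_def n0 by blast
  then have "f P = f Q" using F(3) P(1) Q(1) by (simp add: hom_def)
  with P(2) Q(2) show False by simp
 qed
 have nz: "(w1 P, w2 P) \<noteq> (0, 0)" using w_nonzero[OF P(1)] by auto
 have "F (w1 P) (w2 P) = 0" using F(3) P by simp
 from bform_factor[OF F(2) nz this n] obtain G where G: "bform (n - 1) G" "\<And>x y. F x y = (w2 P * x - w1 P * y) * G x y" by blast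
 have "H (d - 1) (\<lambda>Q. G (w1 Q) (w2 Q))" using HI[OF G(1), of "\<lambda>Q. G (w1 Q) (w2 Q)"] F(1) n by (simp add: of_nat_diff)
 then show ?thesis by (rule that) (simp add: F(3) G(2) ell_def)
qed

lemma H_vanishes:
 assumes "H d f" "d \<ge> 1"
 obtains P where "P \<in> C" "f P = 0"
proof -
 obtain F where F: "bform (nat d) F" "\<forall>P\<in>C. f P = F (w1 P) (w2 P)" using assms by (auto simp: H_def)
 have "nat d \<ge> 1" using assms(2) by simp
 then obtain a b where ab: "(a, b) \<noteq> (0, 0)" "F a b = 0" using bform_zero[OF F(1)] by blast
 obtain P c where P: "P \<in> C" "w1 P = c * a" "w2 P = c * b" using w_onto[OF ab(1)] by blast
 obtain p where "F = hom (nat d) p" using F(1) unfolding bform_def by blast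
 then have "f P = 0" using F(2) P ab(2) by (simp add: hom_scale)
 with P(1) show ?thesis by (rule that)
qed

lemma C_point: obtains P where "P \<in> C"
 using w_onto[of 1 0] by auto

text \<open>In a fraction of forms with denominator of least degree, the denominator has no zeros.\<close>

lemma lreg_negative:
 assumes g: "\<And>R. R \<in> C ==> lreg D C g R" and D: "D < 0" and R: "R \<in> C"
 shows "g R = 0"
proof -
 define frac where "frac d \<longleftrightarrow> (\<exists>p q. H (int d + D) p \<and> H (int d) q \<and> (\<exists>R\<in>C. q R \<noteq> 0) \<and> (\<forall>Q\<in>C. q Q \<noteq> 0 --> g Q = p Q / q Q))" for d
 have deg: "\<exists>n. d = int n" if "H d q" "R \<in> C" "q R \<noteq> 0" for d q R using HE[OF that] by blast
 obtain d0 p0 q0 where 0: "H (d0 + D) p0" "H d0 q0" "q0 R \<noteq> 0" "\<forall>Q\<in>C. q0 Q \<noteq> 0 --> g Q = p0 Q / q0 Q"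
  using g[OF R] unfolding lreg_def by blast
 obtain n0 where n0: "d0 = int n0" using deg[OF 0(2) R 0(3)] by blast
 have "frac n0" unfolding frac_def using 0 R n0 by blast
 then have "frac (LEAST d. frac d)" by (rule LeastI)
 moreover define d where "d = (LEAST d. frac d)"
 ultimately obtain p q R0 where pq: "H (int d + D) p" "H (int d) q" "R0 \<in> C" "q R0 \<noteq> 0" "\<forall>Q\<in>C. q Q \<noteq> 0 --> g Q = p Q / q Q"
  unfolding frac_def by blast
 have "d = 0"
 proof (rule ccontr)
  assume "d \<noteq> 0"
  then have "int d \<ge> 1" by simp
  from H_vanishes[OF pq(2) this] obtain S where S: "S \<in> C" "q S = 0" .
  obtain d' p' q' where 1: "H (d' + D) p'" "H d' q'" "q' S \<noteq> 0" "\<forall>Q\<in>C. q' Q \<noteq> 0 --> g Q = p' Q / q' Q"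
   using g[OF S(1)] unfolding lreg_def by blast
  have H1: "H (int d + D + d') (p * q')" by (rule H_mult[OF pq(1) 1(2)])
  have H2: "H (int d + D + d') (p' * q)" using H_mult[OF 1(1) pq(2)] by (simp add: ac_simps)
  obtain T where T: "T \<in> C" "q T \<noteq> 0" "q' T \<noteq> 0" using H_dom[OF pq(2) 1(2) pq(3,4) S(1) 1(3)] by blast
  then have Tnz: "(q * q') T \<noteq> 0" by (simp add: fun_ops)
  have eq: "(p * q') Q = (p' * q) Q" if "Q \<in> C" for Q
  proof (rule H_identity[OF H1 H2 H_mult[OF pq(2) 1(2)] T(1) Tnz _ that])
   fix Q assume Q: "Q \<in> C" "(q * q') Q \<noteq> 0"
   then have "p Q / q Q = p' Q / q' Q" using pq(5) 1(4) by (auto simp: fun_ops)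
   then show "(p * q') Q = (p' * q) Q" using Q(2) by (simp add: fun_ops field_simps)
  qed
  \<comment> \<open>At a zero S of the denominator, comparison with a fraction p' / q' that is valid
    at S makes the numerator vanish too, so \<open>ell S\<close> can be cancelled.\<close>
  from eq[OF S(1)] S(2) 1(3) have "p S = 0" by (simp add: fun_ops)
  from H_divide[OF pq(1) S(1) this] obtain p1 where p1: "H (int d + D - 1) p1" "\<And>Q. Q \<in> C ==> p Q = ell S Q * p1 Q" by blast
  from H_divide[OF pq(2) S] obtain q1 where q1: "H (int d - 1) q1" "\<And>Q. Q \<in> C ==> q Q = ell S Q * q1 Q" by blast
  have ellT: "ell S T \<noteq> 0" using q1(2)[OF T(1)] T(2) by auto
  have H1': "H (int d + D - 1 + d') (p1 * q')" by (rule H_mult[OF p1(1) 1(2)])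
  have H2': "H (int d + D - 1 + d') (p' * q1)" using H_mult[OF 1(1) q1(1)] by (simp add: algebra_simps)
  have eq1: "(p1 * q') Q = (p' * q1) Q" if "Q \<in> C" for Q
  proof (rule H_identity[OF H1' H2' H_ell T(1) ellT _ that])
   fix Q assume Q: "Q \<in> C" "ell S Q \<noteq> 0"
   then show "(p1 * q') Q = (p' * q1) Q" using eq[OF Q(1)] p1(2)[OF Q(1)] q1(2)[OF Q(1)] by (simp add: fun_ops)
  qed
  have "frac (d - 1)" unfolding frac_def
  proof (rule exI[of _ p1], rule exI[of _ q1], intro conjI ballI impI)
   show "H (int (d - 1) + D) p1" "H (int (d - 1)) q1" using p1(1) q1(1) \<open>d \<noteq> 0\<close> by (simp_all add: of_nat_diff algebra_simps)
   show "\<exists>R\<in>C. q1 R \<noteq> 0" using pq(3,4) q1(2)[OF pq(3)] by auto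
   fix Q assume Q: "Q \<in> C" "q1 Q \<noteq> 0"
   show "g Q = p1 Q / q1 Q"
   proof (cases "Q = S")
    \<comment> \<open>At S the old fraction said nothing about g; the local fraction p' / q' shows
      that the shortened one represents g there as well.\<close>
    case True
    have gS: "g S * q' S = p' S" using 1(3,4) S(1) by simp
    have "q' S * (g S * q1 S) = (g S * q' S) * q1 S" by (simp add: mult_ac)
    also have "\<dots> = q' S * p1 S" unfolding gS using eq1[OF S(1)] by (simp add: fun_ops mult.commute)
    finally have "q' S * (g S * q1 S) = q' S * p1 S" .
    then show ?thesis using 1(3) Q(2) True by (simp add: field_simps)
   next
    case False
    then have "ell S Q \<noteq> 0" using ell_eq_0[OF S(1) Q(1)] by simp
    then show ?thesis using pq(5) p1(2)[OF Q(1)] q1(2)[OF Q(1)] Q by simp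
   qed
  qed
  then have "d \<le> d - 1" unfolding d_def by (rule Least_le)
  then show False using \<open>d \<noteq> 0\<close> by simp
 qed
 have "int d + D < 0" using \<open>d = 0\<close> D by simp
 then have p0: "p Q = 0" if "Q \<in> C" for Q using H_neg[OF pq(1)] that by blast
 obtain p where p: "\<And>Q. Q \<in> C ==> q Q = hom 0 p (w1 Q) (w2 Q)"
 proof -
  obtain n F where F: "int d = int n" "bform n F" "\<And>P. P \<in> C ==> q P = F (w1 P) (w2 P)" by (rule HE[OF pq(2,3,4)]) (rule that)
  then obtain p where "F = hom 0 p" using \<open>d = 0\<close> unfolding bform_def by auto
  with F(3) that show ?thesis by blast
 qed
 have "q R \<noteq> 0" using p[OF R] p[OF pq(3)] pq(4) by (simp add: hom_def)
 then show ?thesis using pq(5) p0 R by simp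
qed

text \<open>If D were nonzero, g or its inverse would have negative degree and vanish by
  \<open>lreg_negative\<close>.\<close>

lemma lreg_unit_degree:
 assumes "\<And>R. R \<in> C ==> lreg D C g R" "\<And>R. R \<in> C ==> g R \<noteq> 0"
 shows "D = 0"
proof (rule ccontr)
 assume "D \<noteq> 0"
 obtain P where P: "P \<in> C" by (rule C_point)
 consider "D < 0" | "- D < 0" using \<open>D \<noteq> 0\<close> by linarith
 then show False
 proof cases
  case 1
  then show ?thesis using lreg_negative[OF assms(1) 1 P] assms(2)[OF P] by blast
 next
  case 2
  have "lreg (- D) C (\<lambda>Q. inverse (g Q)) R" if "R \<in> C" for R by (rule lreg_inverse[OF assms(1)[OF that] that assms(2)[OF that]])
  from lreg_negative[OF this 2 P] show ?thesis using assms(2)[OF P] by simp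
 qed
qed

lemma secs_vanish_divide:
 assumes E: "vector_bundle C E" and \<sigma>: "\<sigma> \<in> secs E k" and P: "P \<in> C" "\<And>j. j < rk E ==> \<sigma> (P, j) = 0"
 obtains \<tau> where "\<tau> \<in> secs E (k - 1)" "\<sigma> = lift (ell P) * \<tau>"
proof -
 obtain Q0 where Q0: "Q0 \<in> C" "ell P Q0 \<noteq> 0"
 proof -
  obtain Q where Q: "Q \<in> C" "Q \<noteq> P" using w_onto[of 1 0] w_onto[of 0 1] by (metis mult_zero_right mult_cancel_left mult_1_right prod.inject zero_neq_one)
  then show ?thesis using ell_eq_0[OF P(1)] that by blast
 qed
 show ?thesis
 proof (rule secs_divisible[OF E \<sigma> H_ell Q0])
  fix U \<phi> R i d p q
  assume U: "(U, \<phi>) \<in> atlas E" "R \<in> U" and "i < rk E" and R: "ell P R = 0"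
   and 1: "H (d + k) p" "H d q" "q R \<noteq> 0" "\<forall>Q\<in>U. q Q \<noteq> 0 --> app \<phi> (rk E) \<sigma> i Q = p Q / q Q"
  have "R \<in> C" using chart(2)[OF E U(1)] U(2) by blast
  then have RP: "R = P" using ell_eq_0[OF P(1), of R] R by blast
  have "app \<phi> (rk E) \<sigma> i P = 0" using P(2) by (simp add: app_def)
  moreover have "app \<phi> (rk E) \<sigma> i P = p P / q P" using 1(3,4) U(2) unfolding RP by blast
  ultimately have "p P = 0" using 1(3) unfolding RP by simp
  from H_divide[OF 1(1) P(1) this] obtain x where x: "H (d + k - 1) x" "\<And>Q. Q \<in> C ==> p Q = ell P Q * x Q" by blast
  show "\<exists>x. H (d + k - 1) x \<and> (\<forall>Q\<in>C. p Q = ell P Q * x Q)" by (intro exI[of _ x] conjI ballI x)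
 qed (rule that)
qed

lemma int_least:
 fixes B :: int
 assumes "Q n" "\<And>l. l < B ==> \<not> Q l"
 obtains k where "Q k" "\<And>l. l < k ==> \<not> Q l"
proof -
 define N where "N = (LEAST m. Q (B + int m))"
 have "n = B + int (nat (n - B))" using assms(2)[of n] assms(1) by force
 then have "Q (B + int (nat (n - B)))" using assms(1) by simp
 then have Q: "Q (B + int N)" unfolding N_def by (rule LeastI)
 show ?thesis
 proof (rule that[OF Q])
  fix l assume l: "l < B + int N"
  show "\<not> Q l"
  proof (cases "l < B")
   case False
   then have "l = B + int (nat (l - B))" "nat (l - B) < N" using l by auto
   then show ?thesis using not_less_Least[of "nat (l - B)" "\<lambda>m. Q (B + int m)"] unfolding N_def by simp
  qed (rule assms(2))
 qed
qed

text \<open>Degrees of nonzero sections are bounded below, so e1 and e2 can be chosen by minimality.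
  At a zero P of e1, or a point P where e2 is a multiple of e1, a factor \<open>ell P\<close> could
  be divided out and would lower the degree. The wedge of e1 and e2 over \<open>\<delta>\<close> is
  then a function without zeros of degree d1 + d2 + e, so this degree is 0.\<close>

lemma splitting:
 assumes E: "vector_bundle C E" and r: "rk E = 2" and \<delta>: "\<And>P. P \<in> C ==> \<delta> P \<noteq> 0"
  and \<delta>reg: "\<And>U \<phi> R. (U, \<phi>) \<in> atlas E ==> R \<in> U ==> lreg (- e) U (\<lambda>P. det2 (\<phi> P) * \<delta> P) R"
  and \<sigma>: "\<sigma>1 \<in> secs E k1" "\<sigma>2 \<in> secs E k2" and P0: "P0 \<in> C" "wedge \<sigma>1 \<sigma>2 P0 \<noteq> 0"
 obtains d1 d2 e1 e2 where "e1 \<in> secs E d1" "e2 \<in> secs E d2" "\<And>P. P \<in> C ==> wedge e1 e2 P \<noteq> 0" "d1 + d2 + e = 0"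
  "\<And>l \<sigma>. l < d1 ==> \<sigma> \<in> secs E l ==> \<sigma> = 0"
proof -
 have lw: "lreg (k + l + e) C (\<lambda>P. wedge \<sigma> \<tau> P / \<delta> P) R" if "\<sigma> \<in> secs E k" "\<tau> \<in> secs E l" "R \<in> C" for \<sigma> \<tau> k l R
  by (rule lreg_wedge[OF E r \<delta> \<delta>reg that])
 \<comment> \<open>The wedges of a section of very negative degree with \<open>\<sigma>1\<close> and
   \<open>\<sigma>2\<close> have negative degree and vanish; where these two are independent, the
   section is then 0.\<close>
 have zero: "\<sigma> = 0" if s: "\<sigma> \<in> secs E l" and l: "l < - \<bar>k1\<bar> - \<bar>k2\<bar> - \<bar>e\<bar>" for \<sigma> l
 proof -
  have w: "wedge \<sigma> \<sigma>1 Q = 0" "wedge \<sigma> \<sigma>2 Q = 0" if Q: "Q \<in> C" for Q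
  proof -
   have "wedge \<sigma> \<sigma>1 Q / \<delta> Q = 0" by (rule lreg_negative[OF lw[OF s \<sigma>(1)] _ Q]; (assumption | use l in linarith))
   moreover have "wedge \<sigma> \<sigma>2 Q / \<delta> Q = 0" by (rule lreg_negative[OF lw[OF s \<sigma>(2)] _ Q]; (assumption | use l in linarith))
   ultimately show "wedge \<sigma> \<sigma>1 Q = 0" "wedge \<sigma> \<sigma>2 Q = 0" using \<delta>[OF Q] by simp_all
  qed
  obtain d h where h: "H d h" "h P0 \<noteq> 0" "\<forall>Q\<in>C. h Q \<noteq> 0 --> wedge \<sigma>1 \<sigma>2 Q / \<delta> Q \<noteq> 0"
   using lreg_nonzero_near[OF lw[OF \<sigma> P0(1)] P0(1)] P0 \<delta> by auto
  show ?thesis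
  proof (rule secs_identity[OF E s secs_0[OF E] h(1) P0(1) h(2)])
   fix Q j assume Q: "Q \<in> C" "h Q \<noteq> 0" and j: "j < rk E"
   have nz: "wedge \<sigma>1 \<sigma>2 Q \<noteq> 0" using h(3) Q by auto
   \<comment> \<open>Cramer's rule for the section in terms of \<open>\<sigma>1\<close> and
     \<open>\<sigma>2\<close>.\<close>
   have "\<sigma> (Q, 0) * wedge \<sigma>1 \<sigma>2 Q = \<sigma>1 (Q, 0) * wedge \<sigma> \<sigma>2 Q - \<sigma>2 (Q, 0) * wedge \<sigma> \<sigma>1 Q"
    "\<sigma> (Q, Suc 0) * wedge \<sigma>1 \<sigma>2 Q = \<sigma>1 (Q, Suc 0) * wedge \<sigma> \<sigma>2 Q - \<sigma>2 (Q, Suc 0) * wedge \<sigma> \<sigma>1 Q"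
    by (simp_all add: wedge_def algebra_simps)
   then have "\<sigma> (Q, 0) = 0" "\<sigma> (Q, Suc 0) = 0" using nz w[OF Q(1)] by simp_all
   then show "\<sigma> (Q, j) = 0 (Q, j)" using j r by (auto simp: less_2_cases_iff fun_ops)
  qed
 qed
 have "\<sigma>1 \<noteq> 0" using P0(2) by (auto simp: wedge_def fun_ops)
 obtain d1 where d1: "\<exists>\<sigma>\<in>secs E d1. \<sigma> \<noteq> 0" "\<And>l. l < d1 ==> \<not> (\<exists>\<sigma>\<in>secs E l. \<sigma> \<noteq> 0)"
 proof (rule int_least[of "\<lambda>l. \<exists>\<sigma>\<in>secs E l. \<sigma> \<noteq> 0" k1 "- \<bar>k1\<bar> - \<bar>k2\<bar> - \<bar>e\<bar>"])
  show "\<exists>\<sigma>\<in>secs E k1. \<sigma> \<noteq> 0" using \<sigma>(1) \<open>\<sigma>1 \<noteq> 0\<close> by blast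
  show "\<not> (\<exists>\<sigma>\<in>secs E l. \<sigma> \<noteq> 0)" if "l < - \<bar>k1\<bar> - \<bar>k2\<bar> - \<bar>e\<bar>" for l using zero[OF _ that] by blast
 qed (rule that)
 obtain e1 where e1: "e1 \<in> secs E d1" "e1 \<noteq> 0" using d1(1) by blast
 have e1nz: "e1 (P, 0) \<noteq> 0 \<or> e1 (P, Suc 0) \<noteq> 0" if P: "P \<in> C" for P
 proof (rule ccontr)
  assume "\<not> ?thesis"
  then have "e1 (P, j) = 0" if "j < rk E" for j using that r by (auto simp: less_2_cases_iff)
  from secs_vanish_divide[OF E e1(1) P this] obtain \<tau> where \<tau>: "\<tau> \<in> secs E (d1 - 1)" "e1 = lift (ell P) * \<tau>" .
  have "\<tau> = 0" using d1(2)[of "d1 - 1"] \<tau>(1) by auto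
  with \<tau>(2) e1(2) show False by simp
 qed
 define multiple where "multiple l \<sigma> \<longleftrightarrow> (\<exists>g. H (l - d1) g \<and> \<sigma> = lift g * e1)" for l \<sigma>
 have "\<exists>l. \<exists>\<sigma>\<in>secs E l. \<not> multiple l \<sigma>"
 proof (rule ccontr)
  assume "\<not> ?thesis"
  then have "multiple k1 \<sigma>1" "multiple k2 \<sigma>2" using \<sigma> by blast+
  then obtain g1 g2 where "\<sigma>1 = lift g1 * e1" "\<sigma>2 = lift g2 * e1" unfolding multiple_def by blast
  then have "wedge \<sigma>1 \<sigma>2 P0 = 0" by (simp add: wedge_def fun_ops lift_simps)
  with P0(2) show False by simp
 qed
 then obtain l0 where l0: "\<exists>\<sigma>\<in>secs E l0. \<not> multiple l0 \<sigma>" by blast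
 have mult0: "multiple l 0" for l unfolding multiple_def by (intro exI[of _ 0] conjI H_0) (simp add: lift_simps)
 obtain d2 where d2: "\<exists>\<sigma>\<in>secs E d2. \<not> multiple d2 \<sigma>" "\<And>l. l < d2 ==> \<not> (\<exists>\<sigma>\<in>secs E l. \<not> multiple l \<sigma>)"
 proof (rule int_least[of "\<lambda>l. \<exists>\<sigma>\<in>secs E l. \<not> multiple l \<sigma>" l0 d1])
  show "\<not> (\<exists>\<sigma>\<in>secs E l. \<not> multiple l \<sigma>)" if "l < d1" for l using d1(2)[OF that] mult0 by auto
 qed (rule l0, rule that)
 obtain e2 where e2: "e2 \<in> secs E d2" "\<not> multiple d2 e2" using d2(1) by blast
 \<comment> \<open>This leaves room for a form g of degree d2 - d1 with prescribed value at a
   point.\<close>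
 have "d1 \<le> d2"
 proof (rule ccontr)
  assume "\<not> d1 \<le> d2"
  then have "e2 = 0" using d1(2)[of d2] e2(1) by auto
  with e2(2) mult0 show False by simp
 qed
 have nz: "wedge e1 e2 P \<noteq> 0" if P: "P \<in> C" for P
 proof
  assume w: "wedge e1 e2 P = 0"
  obtain \<gamma> where \<gamma>: "e2 (P, 0) = \<gamma> * e1 (P, 0)" "e2 (P, Suc 0) = \<gamma> * e1 (P, Suc 0)"
  proof (cases "e1 (P, 0) = 0")
   case True
   then show ?thesis using that[of "e2 (P, Suc 0) / e1 (P, Suc 0)"] w e1nz[OF P] by (auto simp: wedge_def)
  next
   case False
   then show ?thesis using that[of "e2 (P, 0) / e1 (P, 0)"] w by (auto simp: wedge_def field_simps)
  qed
  obtain f where f: "H (int (nat (d2 - d1))) f" "f P \<noteq> 0" using H_nonvan_nat[OF P] by blast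
  define g where "g = kk (\<gamma> / f P) * f"
  have g: "H (d2 - d1) g" unfolding g_def using H_kk_mult[OF f(1)] \<open>d1 \<le> d2\<close> by simp
  have gP: "g P = \<gamma>" using f(2) by (simp add: g_def fun_ops kk_apply)
  have ge: "lift g * e1 \<in> secs E d2" using secs_mult[OF E e1(1) g] by simp
  have "e2 - lift g * e1 \<in> secs E d2" by (rule fs.subspace_diff[OF subspace_secs[OF E] e2(1) ge])
  moreover have "(e2 - lift g * e1) (P, j) = 0" if "j < rk E" for j
   using that r \<gamma> gP by (auto simp: fun_ops lift_simps less_2_cases_iff)
  ultimately obtain \<tau> where \<tau>: "\<tau> \<in> secs E (d2 - 1)" "e2 - lift g * e1 = lift (ell P) * \<tau>"
   by (rule secs_vanish_divide[OF E _ P])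
  have "multiple (d2 - 1) \<tau>" using d2(2)[of "d2 - 1"] \<tau>(1) by auto
  then obtain x where x: "H (d2 - 1 - d1) x" "\<tau> = lift x * e1" unfolding multiple_def by blast
  have "H (d2 - d1) (g + ell P * x)"
   using H_add[OF g] H_mult[OF H_ell x(1)] by simp
  moreover have "e2 = lift (g + ell P * x) * e1"
   using \<tau>(2) unfolding x(2) by (simp add: lift_simps algebra_simps)
  ultimately have "multiple d2 e2" unfolding multiple_def by blast
  with e2(2) show False by blast
 qed
 have "d1 + d2 + e = 0"
  by (rule lreg_unit_degree[OF lw[OF e1(1) e2(1)]]) (use nz \<delta> in auto)
 then show ?thesis using d1(2) by (intro that[OF e1(1) e2(1) nz]) auto
qed

section \<open>Orders, degrees and line bundles on the conic\<close>

lemma lreg_vanish_divide: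
 assumes g: "lreg k A g P" and P: "P \<in> A" "g P = 0" and A: "A \<subseteq> C"
 obtains d p q where "H (d + k - 1) p" "H d q" "q P \<noteq> 0" "\<And>Q. Q \<in> A ==> q Q \<noteq> 0 ==> g Q = ell P Q * (p Q / q Q)"
proof -
 obtain d p q where 1: "H (d + k) p" "H d q" "q P \<noteq> 0" "\<forall>Q\<in>A. q Q \<noteq> 0 --> g Q = p Q / q Q"
  using g unfolding lreg_def by blast
 have PC: "P \<in> C" using P A by blast
 have "p P = 0" using 1(3,4) P by force
 from H_divide[OF 1(1) PC this] obtain x where x: "H (d + k - 1) x" "\<And>Q. Q \<in> C ==> p Q = ell P Q * x Q" by blast
 show ?thesis by (rule that[OF x(1) 1(2,3)]) (use 1(4) x(2) A in auto)
qed

text \<open>A function that vanishes at P has a numerator divisible by \<open>ell P\<close>; the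
  form m only brings the degree to 0.\<close>

lemma ell_local_parameter:
 assumes P: "P \<in> C" and m: "H 1 m" "m P \<noteq> 0"
 shows "local_parameter C P (\<lambda>Q. ell P Q / m Q)"
proof -
 let ?V = "{Q \<in> C. m Q \<noteq> 0}"
 have V: "zopen ?V" by (rule zopen_nonzero[OF m(1)])
 have "regular_on ?V (\<lambda>Q. ell P Q / m Q)"
  by (subst regular) (use lreg_frac[of 1 0 "ell P" m] H_ell m(1) in auto)
 moreover have "\<exists>W' h. zariski_open C W' \<and> P \<in> W' \<and> W' \<subseteq> ?V \<inter> W \<and> regular_on W' h \<and> (\<forall>R\<in>W'. g R = h R * (ell P R / m R))"
  if W: "zariski_open C W" "P \<in> W" "regular_on W g" "g P = 0" for W g
 proof -
  have zW: "zopen W" using W(1) zariski by simp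
  have WC: "W \<subseteq> C" using zW by (simp add: zopen_def)
  have "lreg 0 W g P" using W(2,3) regular[OF WC] by blast
  from lreg_vanish_divide[OF this W(2,4) WC] obtain d p q where
   1: "H (d + 0 - 1) p" "H d q" "q P \<noteq> 0" "\<And>Q. Q \<in> W ==> q Q \<noteq> 0 ==> g Q = ell P Q * (p Q / q Q)" by blast
  let ?W = "({Q \<in> C. q Q \<noteq> 0} \<inter> ?V) \<inter> W"
  have zW': "zopen ?W" by (intro zopen_inter zopen_nonzero[OF 1(2)] V zW)
  have "H (d + 0) (p * m)" using H_mult[OF 1(1) m(1)] by simp
  then have "regular_on ?W (\<lambda>Q. (p * m) Q / q Q)"
   by (subst regular) (use lreg_frac[of d 0 "p * m" q] 1(2) in auto)
  moreover have "\<forall>R\<in>?W. g R = (p * m) R / q R * (ell P R / m R)" using 1(4) by (simp add: fun_ops)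
  ultimately show ?thesis using zW' 1(3) P m(2) W(2)
   by (intro exI[of _ ?W] exI[of _ "\<lambda>Q. (p * m) Q / q Q"] conjI) (auto simp: zariski)
 qed
 ultimately show ?thesis unfolding local_parameter_def using V P m(2) ell_eq_0[OF P P]
  by (intro exI[of _ ?V]) (simp add: zariski)
qed

text \<open>Every local parameter is \<open>ell P\<close> times a unit of degree -1. It vanishes at
  P, hence is divisible by \<open>ell P\<close>; conversely \<open>ell P\<close> / m is a multiple
  of it, so the cofactor p / q is nonzero at P.\<close>

lemma local_parameterE:
 assumes t: "local_parameter C P t" and P: "P \<in> C"
 obtains v d h where "\<And>A. lreg (- 1) A v P" "v P \<noteq> 0" "H d h" "h P \<noteq> 0" "\<And>Q. Q \<in> C ==> h Q \<noteq> 0 ==> v Q \<noteq> 0 \<and> t Q = ell P Q * v Q"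
proof -
 obtain V where V: "zariski_open C V" "P \<in> V" "regular_on V t" "t P = 0" and
  gen: "\<And>W g. zariski_open C W ==> P \<in> W ==> regular_on W g ==> g P = 0 ==>
    \<exists>W' h. zariski_open C W' \<and> P \<in> W' \<and> W' \<subseteq> V \<inter> W \<and> regular_on W' h \<and> (\<forall>R\<in>W'. g R = h R * t R)"
  using t unfolding local_parameter_def by blast
 have zV: "zopen V" using V(1) zariski by simp
 then have VC: "V \<subseteq> C" by (simp add: zopen_def)
 have "lreg 0 V t P" using V(2,3) regular[OF VC] by blast
 from lreg_vanish_divide[OF this V(2,4) VC] obtain d p q where
  1: "H (d + 0 - 1) p" "H d q" "q P \<noteq> 0" "\<And>Q. Q \<in> V ==> q Q \<noteq> 0 ==> t Q = ell P Q * (p Q / q Q)" by blast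
 obtain m where m: "H 1 m" "m P \<noteq> 0" using H_nonvan[OF P] by blast
 let ?W = "{Q \<in> C. m Q \<noteq> 0}"
 have "regular_on ?W (\<lambda>Q. ell P Q / m Q)"
  by (subst regular) (use lreg_frac[of 1 0 "ell P" m] H_ell m(1) in auto)
 then obtain W' h where W': "zariski_open C W'" "P \<in> W'" "W' \<subseteq> V \<inter> ?W" "regular_on W' h" "\<forall>R\<in>W'. ell P R / m R = h R * t R"
  using gen[of ?W "\<lambda>Q. ell P Q / m Q"] P m zopen_nonzero[OF m(1)] ell_eq_0[OF P P] by (auto simp: zariski)
 have zW': "zopen W'" using W'(1) zariski by simp
 then have WC: "W' \<subseteq> C" by (simp add: zopen_def)
 have "lreg 0 W' h P" using W'(2,4) regular[OF WC] by blast
 then obtain d' p' q' where 2: "H (d' + 0) p'" "H d' q'" "q' P \<noteq> 0" "\<forall>Q\<in>W'. q' Q \<noteq> 0 --> h Q = p' Q / q' Q"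
  unfolding lreg_def by blast
 obtain dv hv where hv: "H dv hv" "hv P \<noteq> 0" "\<And>Q. Q \<in> C ==> hv Q \<noteq> 0 ==> Q \<in> W'" by (rule zopenD[OF zW' W'(2)]) (rule that)
 have pP: "p P \<noteq> 0"
 proof
  assume p0: "p P = 0"
  have H1: "H (d + d') (q * q')" by (rule H_mult[OF 1(2) 2(2)])
  have H2: "H (d + d') (p * m * p')" using H_mult[OF H_mult[OF 1(1) m(1)] 2(1)] by simp
  have hP: "(hv * (q * q')) P \<noteq> 0" using hv(2) 1(3) 2(3) by (simp add: fun_ops)
  obtain S where S: "S \<in> C" "(hv * (q * q')) S \<noteq> 0" "ell P S \<noteq> 0"
  proof -
   obtain Q where Q: "Q \<in> C" "ell P Q \<noteq> 0" using w_nonzero[OF P] w_onto[of 1 0] w_onto[of 0 1] by (fastforce simp: ell_def)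
   from H_dom[OF H_mult[OF hv(1) H1] H_ell P hP Q] that show ?thesis by blast
  qed
  then have Snz: "(hv * (q * q') * ell P) S \<noteq> 0" by (simp add: fun_ops)
  \<comment> \<open>The relation expressing \<open>ell P\<close> / m through the parameter, with
    \<open>ell P\<close> cancelled off P, extends to P by the identity principle.\<close>
  have "(q * q') P = (p * m * p') P"
  proof (rule H_identity[OF H1 H2 H_mult[OF H_mult[OF hv(1) H1] H_ell] S(1) Snz _ P])
   fix Q assume Q: "Q \<in> C" "(hv * (q * q') * ell P) Q \<noteq> 0"
   then have nz: "hv Q \<noteq> 0" "q Q \<noteq> 0" "q' Q \<noteq> 0" "ell P Q \<noteq> 0" by (auto simp: fun_ops)
   then have QW: "Q \<in> W'" using hv(3) Q(1) by blast
   then have "m Q \<noteq> 0" "Q \<in> V" using W'(3) by auto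
   have "ell P Q / m Q = p' Q / q' Q * (ell P Q * (p Q / q Q))" using W'(5) QW 2(4) 1(4) nz \<open>Q \<in> V\<close> by auto
   then have "ell P Q * (1 / m Q) = ell P Q * (p' Q / q' Q * (p Q / q Q))" by (simp add: mult_ac)
   then have "1 / m Q = p' Q / q' Q * (p Q / q Q)" using nz(4) by (metis mult_left_cancel)
   then show "(q * q') Q = (p * m * p') Q" using nz \<open>m Q \<noteq> 0\<close> by (simp add: fun_ops field_simps)
  qed
  then show False using p0 1(3) 2(3) by (simp add: fun_ops)
 qed
 show ?thesis
 proof (rule that[of "\<lambda>Q. p Q / q Q" _ "hv * (p * q)"])
  show "lreg (- 1) A (\<lambda>Q. p Q / q Q) P" for A using lreg_frac[of d "- 1" p q P A] 1 by simp
  show "H (dv + (d - 1 + d)) (hv * (p * q))" using H_mult[OF hv(1) H_mult[OF 1(1,2)]] by simp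
  fix Q assume "Q \<in> C" "(hv * (p * q)) Q \<noteq> 0"
  then show "p Q / q Q \<noteq> 0 \<and> t Q = ell P Q * (p Q / q Q)" using hv(3) W'(3) 1(4) by (auto simp: fun_ops)
 qed (use pP 1(3) hv(2) in \<open>simp_all add: fun_ops\<close>)
qed

lemma infinite_C: "infinite C"
proof
 assume fin: "finite C"
 let ?f = "\<lambda>Q. \<Prod>P\<in>C. ell P Q"
 have "H (\<Sum>P\<in>C. 1) ?f" by (rule H_prod) (rule H_ell)
 obtain t where t: "t \<notin> (\<lambda>Q. w1 Q / w2 Q) ` C" using ex_new_if_finite[OF infinite_UNIV_char_0] fin by blast
 obtain P c where "P \<in> C" "c \<noteq> 0" "w1 P = c * t" "w2 P = c * 1" using w_onto[of t 1] by auto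
 then have "t = w1 P / w2 P" by simp
 with t \<open>P \<in> C\<close> show False by blast
qed

text \<open>The rational section with divisor \<open>\<Sum> n P * P\<close> divided by the rational form
 \<open>\<Prod> ell P ^ n P\<close> has neither zeros nor poles.\<close>

lemma degree_section:
 assumes L: "vector_bundle C L" "rk L = 1" and deg: "has_degree C L d"
 obtains t where "t \<in> secs L (- d)" "\<And>P. P \<in> C ==> t (P, 0) \<noteq> 0"
proof -
 obtain W s n where W: "zariski_open C W" "\<exists>P\<in>W. s P \<noteq> 0"
  and reg: "\<forall>(U, \<phi>) \<in> atlas L. regular_on (U \<inter> W) (\<lambda>R. \<phi> R $$ (0, 0) * s R)"
  and ord: "\<forall>(U, \<phi>) \<in> atlas L. \<forall>P\<in>U. has_order C P (U \<inter> W) (\<lambda>R. \<phi> R $$ (0, 0) * s R) (n P)"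
  and N: "finite {P \<in> C. n P \<noteq> 0}" "d = (\<Sum>P | P \<in> C \<and> n P \<noteq> 0. n P)"
  using deg unfolding has_degree_def by (elim exE conjE) (rule that)
 define N where "N = {P \<in> C. n P \<noteq> 0}"
 have finN: "finite N" and d: "d = (\<Sum>P\<in>N. n P)" using N by (simp_all add: N_def)
 have zW: "zopen W" using W(1) zariski by simp
 then have WC: "W \<subseteq> C" by (simp add: zopen_def)
 \<comment> \<open>For A = \<open>N\<close> this is the rational form with the divisor of the
   section; A is variable so that the factor at one point can be split off.\<close>
 define g where "g A Q = (\<Prod>P\<in>A. ell P Q powi n P)" for A Q
 have greg: "lreg (\<Sum>P\<in>A. n P) C (g A) R" and gnz: "g A R \<noteq> 0" if A: "A \<subseteq> N" "R \<notin> A" and R: "R \<in> C" for A R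
 proof -
  have nz: "ell P R \<noteq> 0" if "P \<in> A" for P using that A ell_eq_0[of P R] R by (auto simp: N_def)
  show "lreg (\<Sum>P\<in>A. n P) C (g A) R" unfolding g_def[abs_def]
  proof (rule lreg_prod)
   fix P assume "P \<in> A"
   from lreg_powi[OF lreg_H[OF H_ell] R nz[OF this], of "n P"] show "lreg (n P) C (\<lambda>Q. ell P Q powi n P) R" by simp
  qed
  show "g A R \<noteq> 0" unfolding g_def using nz finite_subset[OF A(1) finN] by (simp add: power_int_eq_0_iff)
 qed
 have gsplit: "g N Q = ell R Q powi n R * g (N - {R}) Q" if "R \<in> C" for R Q
 proof (cases "R \<in> N")
  case True
  then show ?thesis unfolding g_def using finN by (simp add: prod.remove)
 next
  case False
  then have "n R = 0" using that by (simp add: N_def)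
  then show ?thesis using False by (simp add: g_def)
 qed
 have dsplit: "d = n R + (\<Sum>P\<in>N - {R}. n P)" if "R \<in> C" for R
 proof (cases "R \<in> N")
  case True
  then show ?thesis unfolding d using finN by (simp add: sum.remove)
 next
  case False
  then have "n R = 0" using that by (simp add: N_def)
  then show ?thesis using False by (simp add: d)
 qed
 obtain P0 where P0: "P0 \<in> W" using W(2) by blast
 obtain e hW where hW: "H e hW" "hW P0 \<noteq> 0" "\<And>Q. Q \<in> C ==> hW Q \<noteq> 0 ==> Q \<in> W" by (rule zopenD[OF zW P0]) (rule that)
 \<comment> \<open>Nonzero only where the section s is defined and \<open>g N\<close> has neither a
   zero nor a pole.\<close>
 define f where "f = hW * (\<lambda>Q. \<Prod>P\<in>N. ell P Q)"
 have f: "H (e + (\<Sum>P\<in>N. 1)) f" unfolding f_def by (intro H_mult hW(1) H_prod H_ell)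
 have fD: "Q \<in> W" "Q \<notin> N" if "Q \<in> C" "f Q \<noteq> 0" for Q
 proof -
  show "Q \<in> W" using that hW(3) by (auto simp: f_def fun_ops)
  have "\<And>P. P \<in> N ==> ell P Q \<noteq> 0" using that finN by (simp add: f_def fun_ops)
  then show "Q \<notin> N" using ell_eq_0[OF that(1,1)] by blast
 qed
 obtain P1 where P1: "P1 \<in> C" "f P1 \<noteq> 0"
 proof -
  obtain Q where Q: "Q \<in> C" "Q \<notin> N" using infinite_C finN by (meson finite_subset subsetI)
  have "(\<Prod>P\<in>N. ell P Q) \<noteq> 0" using ell_eq_0[of _ Q] Q finN by (auto simp: N_def)
  moreover have "H (\<Sum>P\<in>N. 1) (\<lambda>Q. \<Prod>P\<in>N. ell P Q)" by (intro H_prod H_ell)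
  moreover have "P0 \<in> C" using P0 WC by blast
  ultimately obtain R where "R \<in> C" "hW R \<noteq> 0" "(\<Prod>P\<in>N. ell P R) \<noteq> 0" using H_dom[OF hW(1)] hW(2) Q(1) by meson
  then show ?thesis by (intro that[of R]) (simp_all add: f_def fun_ops)
 qed
 define t0 where "t0 = (\<lambda>(Q, j :: nat). s Q / g N Q)"
 have t0: "app \<phi> (rk L) t0 0 Q = \<phi> Q $$ (0, 0) * s Q / g N Q" for \<phi> Q by (simp add: app_def L(2) t0_def)
 \<comment> \<open>Near R the quotient of s by \<open>g N\<close> agrees, off R, with a unit z: the
   n-th power of the local parameter cancels against that of \<open>ell R\<close> and leaves the
   n-th power of the unit v from \<open>local_parameterE\<close>.\<close>
 have key: "\<exists>z. lreg (- d) U z R \<and> z R \<noteq> 0 \<and> (\<exists>l h. H l h \<and> h R \<noteq> 0 \<and>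
   (\<forall>Q\<in>U. f Q \<noteq> 0 --> h Q \<noteq> 0 --> Q \<noteq> R --> app \<phi> (rk L) t0 0 Q = z Q))"
  if U: "(U, \<phi>) \<in> atlas L" "R \<in> U" for U \<phi> R
 proof -
  have UC: "U \<subseteq> C" by (rule chart(2)[OF L(1) U(1)])
  have R: "R \<in> C" using U(2) UC by blast
  have "has_order C R (U \<inter> W) (\<lambda>R. \<phi> R $$ (0, 0) * s R) (n R)" using ord U by blast
  then obtain t V u where t: "local_parameter C R t" and V: "zariski_open C V" "R \<in> V" "regular_on V u" "u R \<noteq> 0"
   and eq: "\<forall>Q \<in> V \<inter> (U \<inter> W). t Q \<noteq> 0 --> \<phi> Q $$ (0, 0) * s Q = t Q powi n R * u Q" unfolding has_order_def by blast
  obtain v l h where v: "\<And>A. lreg (- 1) A v R" "v R \<noteq> 0" and h: "H l h" "h R \<noteq> 0"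
   "\<And>Q. Q \<in> C ==> h Q \<noteq> 0 ==> v Q \<noteq> 0 \<and> t Q = ell R Q * v Q" by (rule local_parameterE[OF t R]) (rule that)
  have zV: "zopen V" using V(1) zariski by simp
  then have VC: "V \<subseteq> C" by (simp add: zopen_def)
  have lu: "lreg 0 V u R" using V(2,3) regular[OF VC] by blast
  obtain l' h' where h': "H l' h'" "h' R \<noteq> 0" "\<And>Q. Q \<in> C ==> h' Q \<noteq> 0 ==> Q \<in> V" by (rule zopenD[OF zV V(2)]) (rule that)
  have lu': "lreg 0 U u R" by (rule lreg_local[OF lu h'(1,2)]) (use h'(3) UC in blast)
  let ?z = "\<lambda>Q. v Q powi n R * u Q / g (N - {R}) Q"
  have "lreg (- n R) U (\<lambda>Q. v Q powi n R * u Q) R"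
   by (rule lreg_times[OF lreg_powi[OF v(1) U(2) v(2)] lu']) simp
  moreover have lg: "lreg (\<Sum>P\<in>N - {R}. n P) U (g (N - {R})) R" by (rule lreg_mono[OF greg UC]) (use R in auto)
  moreover have gR: "g (N - {R}) R \<noteq> 0" by (rule gnz) (use R in auto)
  ultimately have "lreg (- d) U ?z R" by (rule lreg_divide[OF _ _ U(2)]) (use dsplit[OF R] in simp)
  moreover have "?z R \<noteq> 0" using v(2) V(4) gR by (simp add: power_int_eq_0_iff)
  moreover have "H (l + l') (h * h')" "(h * h') R \<noteq> 0" using H_mult[OF h(1) h'(1)] h(2) h'(2) by (simp_all add: fun_ops)
  moreover have "app \<phi> (rk L) t0 0 Q = ?z Q" if Q: "Q \<in> U" "f Q \<noteq> 0" "(h * h') Q \<noteq> 0" "Q \<noteq> R" for Q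
  proof -
   have QC: "Q \<in> C" using Q(1) UC by blast
   have el: "ell R Q \<noteq> 0" using ell_eq_0[OF R QC] Q(4) by simp
   have vt: "v Q \<noteq> 0" "t Q = ell R Q * v Q" using h(3)[OF QC] Q(3) by (auto simp: fun_ops)
   have "Q \<in> V \<inter> (U \<inter> W)" using h'(3)[OF QC] Q(1,3) fD(1)[OF QC Q(2)] by (auto simp: fun_ops)
   then have "\<phi> Q $$ (0, 0) * s Q = (ell R Q * v Q) powi n R * u Q" using eq vt el by auto
   then show ?thesis unfolding t0 gsplit[OF R] using el by (simp add: power_int_mult_distrib power_int_eq_0_iff)
  qed
  ultimately show ?thesis by (intro exI[of _ ?z]) blast
 qed
 have "\<exists>(U, \<phi>) \<in> atlas L. R \<in> U \<and> (\<forall>i<rk L. lreg (- d) (U \<inter> {Q \<in> C. f Q \<noteq> 0}) (app \<phi> (rk L) t0 i) R)" if R: "R \<in> C" for R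
 proof -
  obtain U \<phi> where U: "(U, \<phi>) \<in> atlas L" "R \<in> U" by (rule chart_ex[OF L(1) R])
  have UC: "U \<subseteq> C" by (rule chart(2)[OF L(1) U(1)])
  have "lreg (- d) (U \<inter> {Q \<in> C. f Q \<noteq> 0}) (app \<phi> (rk L) t0 0) R"
  proof (cases "f R = 0")
   case True
   obtain z l h where z: "lreg (- d) U z R" "H l h" "h R \<noteq> 0"
    "\<forall>Q\<in>U. f Q \<noteq> 0 --> h Q \<noteq> 0 --> Q \<noteq> R --> app \<phi> (rk L) t0 0 Q = z Q" using key[OF U] by blast
   show ?thesis by (rule lreg_local[OF z(1-3)]) (use z(4) True in auto)
  next
   case False
   have RW: "R \<in> W" "R \<notin> N" using fD[OF R False] by auto
   have sub: "U \<inter> W \<subseteq> C" "U \<inter> {Q \<in> C. f Q \<noteq> 0} \<subseteq> U \<inter> W" using UC fD(1) by auto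
   have "regular_on (U \<inter> W) (\<lambda>R. \<phi> R $$ (0, 0) * s R)" using reg U(1) by blast
   then have "lreg 0 (U \<inter> W) (\<lambda>R. \<phi> R $$ (0, 0) * s R) R" using regular[OF sub(1)] U(2) RW(1) by blast
   then have "lreg (- d) (U \<inter> W) (\<lambda>Q. \<phi> Q $$ (0, 0) * s Q / g N Q) R"
    by (rule lreg_divide[OF _ lreg_mono[OF greg[OF subset_refl RW(2) R] sub(1)] _ gnz[OF subset_refl RW(2) R]]) (use U(2) RW(1) d in auto)
   from lreg_mono[OF this sub(2)] show ?thesis by (rule lreg_cong) (simp add: t0)
  qed
  with U show ?thesis using L(2) by auto
 qed
 from secs_extend[OF L(1) f P1 this] obtain t where t: "t \<in> secs L (- d)"
  "\<And>Q j. Q \<in> C ==> f Q \<noteq> 0 ==> j < rk L ==> t (Q, j) = t0 (Q, j)" by blast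
 have "t (R, 0) \<noteq> 0" if R: "R \<in> C" for R
 proof
  assume tR: "t (R, 0) = 0"
  obtain U \<phi> where U: "(U, \<phi>) \<in> atlas L" "R \<in> U" by (rule chart_ex[OF L(1) R])
  have UC: "U \<subseteq> C" by (rule chart(2)[OF L(1) U(1)])
  obtain z l h where z: "lreg (- d) U z R" "z R \<noteq> 0" "H l h" "h R \<noteq> 0"
   "\<forall>Q\<in>U. f Q \<noteq> 0 --> h Q \<noteq> 0 --> Q \<noteq> R --> app \<phi> (rk L) t0 0 Q = z Q" using key[OF U] by blast
  obtain S where S: "S \<in> C" "(f * ell R * h) S \<noteq> 0"
  proof -
   obtain Q where Q: "Q \<in> C" "ell R Q \<noteq> 0" using w_nonzero[OF R] w_onto[of 1 0] w_onto[of 0 1] by (fastforce simp: ell_def)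
   obtain T where T: "T \<in> C" "f T \<noteq> 0" "ell R T \<noteq> 0" using H_dom[OF f H_ell P1 Q] by blast
   then have "(f * ell R) T \<noteq> 0" by (simp add: fun_ops)
   from H_dom[OF H_mult[OF f H_ell] z(3) T(1) this R z(4)] show ?thesis using that by (auto simp: fun_ops)
  qed
  \<comment> \<open>Agreement with z is known only off R; the identity principle extends it to R,
    where z is nonzero.\<close>
  have "app \<phi> (rk L) t 0 R = z R"
  proof (rule lreg_identity[OF secsD(2)[OF L(1) t(1) U] z(1) U(2) chart(1)[OF L(1) U(1)] H_mult[OF H_mult[OF f H_ell] z(3)] S])
   show "0 < rk L" using L(2) by simp
   fix Q assume Q: "Q \<in> U" "(f * ell R * h) Q \<noteq> 0"
   then have nz: "f Q \<noteq> 0" "h Q \<noteq> 0" "Q \<in> C" "Q \<noteq> R" using UC ell_eq_0[OF R R] by (auto simp: fun_ops)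
   have "app \<phi> (rk L) t 0 Q = app \<phi> (rk L) t0 0 Q" by (rule app_cong) (rule t(2)[OF nz(3,1)])
   then show "app \<phi> (rk L) t 0 Q = z Q" using z(5) Q(1) nz by simp
  qed
  then show False using tR z(2) L(2) by (simp add: app_def)
 qed
 with t(1) show ?thesis by (rule that)
qed

text \<open>An explicit line bundle of degree d, the witness that the choice in
  \<open>conic_O\<close> has something to choose from.\<close>

definition conic_line :: "int => vb" where
 "conic_line d = \<lparr>rk = 1, atlas = {({P \<in> C. w1 P \<noteq> 0}, \<lambda>P. mat 1 1 (\<lambda>_. w1 P powi (- d))),
   ({P \<in> C. w2 P \<noteq> 0}, \<lambda>P. mat 1 1 (\<lambda>_. w2 P powi (- d)))}\<rparr>"

lemma vector_bundle_conic_line: "vector_bundle C (conic_line d)"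
proof (rule vector_bundle_rank1)
 have w: "w \<in> {w1, w2} ==> H 1 w" for w using H_w by auto
 show "rk (conic_line d) = 1" by (simp add: conic_line_def)
 show "atlas (conic_line d) = (\<lambda>w. ({P \<in> C. w P \<noteq> 0}, \<lambda>P. mat 1 1 (\<lambda>_. w P powi (- d)))) ` {w1, w2}"
  by (simp add: conic_line_def)
 show "(\<Union>w\<in>{w1, w2}. {P \<in> C. w P \<noteq> 0}) = C" using w_nonzero by auto
 show "zopen {P \<in> C. w P \<noteq> 0}" if "w \<in> {w1, w2}" for w by (rule zopen_nonzero[OF w[OF that]])
 fix u v P assume uv: "u \<in> {w1, w2}" "v \<in> {w1, w2}" and P: "P \<in> {P \<in> C. u P \<noteq> 0} \<inter> {P \<in> C. v P \<noteq> 0}"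
 show "lreg 0 ({P \<in> C. u P \<noteq> 0} \<inter> {P \<in> C. v P \<noteq> 0}) (\<lambda>P. v P powi (- d) / u P powi (- d)) P"
  by (rule lreg_divide[OF lreg_powi[OF lreg_H[OF w[OF uv(2)]] P] lreg_powi[OF lreg_H[OF w[OF uv(1)]] P] P]) (use P in auto)
qed auto

text \<open>The rational section is the d-th power of w2, whose divisor is d times the point where
  w2 vanishes.\<close>

lemma has_degree_conic_line: "has_degree C (conic_line d) d"
proof -
 let ?W = "{P \<in> C. w2 P \<noteq> 0}"
 define s where "s P = w2 P powi d" for P
 define n where "n P = (if w2 P = 0 then d else 0)" for P
 have quot: "lreg 0 A (\<lambda>R. w R powi (- d) * s R) P" if "H 1 w" "P \<in> A" "w P \<noteq> 0" "w2 P \<noteq> 0" for w A P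
  unfolding s_def by (rule lreg_times[OF lreg_powi[OF lreg_H[OF that(1)] that(2,3)] lreg_powi[OF lreg_H[OF H_w(2)] that(2,4)]]) simp
 have reg: "regular_on ({P \<in> C. w P \<noteq> 0} \<inter> ?W) (\<lambda>R. w R powi (- d) * s R)" if "H 1 w" for w
  by (subst regular) (use quot[OF that] in auto)
 have ord: "has_order C P ({P \<in> C. w P \<noteq> 0} \<inter> ?W) (\<lambda>R. w R powi (- d) * s R) (n P)"
  if w: "w = w1 \<or> w = w2" and P: "P \<in> C" "w P \<noteq> 0" for w P
 proof -
  have Hw: "H 1 w" using w H_w by blast
  note t = ell_local_parameter[OF P(1) Hw P(2)]
  show ?thesis
  proof (cases "w2 P = 0")
   case True
   then have "w = w1" "w1 P \<noteq> 0" using w P by auto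
   \<comment> \<open>As w2 P = 0, \<open>ell P\<close> is - w1 P times w2; the constant unit makes
     up for this factor.\<close>
   let ?u = "\<lambda>_. (- 1 / w1 P) powi d"
   have eq: "w1 R powi (- d) * s R = (ell P R / w1 R) powi n P * ?u R" if "w1 R \<noteq> 0" for R
   proof -
    have "(ell P R / w1 R) * (- 1 / w1 P) = w2 R / w1 R" using \<open>w1 P \<noteq> 0\<close> True by (simp add: ell_def)
    then have "(ell P R / w1 R) powi d * (- 1 / w1 P) powi d = (w2 R / w1 R) powi d"
     by (simp only: power_int_mult_distrib[symmetric])
    then show ?thesis using that True by (simp add: n_def s_def power_int_divide_distrib power_int_minus field_simps)
   qed
   show ?thesis unfolding has_order_def
   proof (rule exI[of _ "\<lambda>Q. ell P Q / w Q"], rule exI[of _ "{P \<in> C. w1 P \<noteq> 0}"], rule exI[of _ ?u], intro conjI ballI impI)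
    show "zariski_open C {P \<in> C. w1 P \<noteq> 0}" using zopen_nonzero[OF H_w(1)] by (simp add: zariski)
    show "regular_on {P \<in> C. w1 P \<noteq> 0} ?u" by (subst regular) (auto intro: lreg_const)
    show "P \<in> {P \<in> C. w1 P \<noteq> 0}" "(- 1 / w1 P) powi d \<noteq> 0" using P(1) \<open>w1 P \<noteq> 0\<close> by (simp_all add: power_int_eq_0_iff)
    fix R assume "R \<in> {P \<in> C. w1 P \<noteq> 0} \<inter> ({P \<in> C. w P \<noteq> 0} \<inter> ?W)"
    then show "w R powi (- d) * s R = (ell P R / w R) powi n P * (- 1 / w1 P) powi d"
     unfolding \<open>w = w1\<close> by (intro eq) simp
   qed (rule t)
  next
   case False
   let ?V = "{P \<in> C. w P \<noteq> 0} \<inter> ?W" and ?u = "\<lambda>R. w R powi (- d) * s R"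
   show ?thesis unfolding has_order_def
   proof (rule exI[of _ "\<lambda>Q. ell P Q / w Q"], rule exI[of _ ?V], rule exI[of _ ?u], intro conjI ballI impI)
    show "zariski_open C ?V" using zopen_inter[OF zopen_nonzero[OF Hw] zopen_nonzero[OF H_w(2)]] by (simp add: zariski)
    show "P \<in> ?V" "?u P \<noteq> 0" using P False by (simp_all add: s_def power_int_eq_0_iff)
    show "?u R = (ell P R / w R) powi n P * ?u R" for R using False by (simp add: n_def)
   qed (rule t reg[OF Hw])+
  qed
 qed
 obtain P0 where P0: "P0 \<in> C" "w2 P0 = 0" using w_onto[of 1 0] by auto
 have uniq: "P = P0" if "P \<in> C" "w2 P = 0" for P using w_injective[OF that(1) P0(1)] that(2) P0(2) by simp
 have N: "{P \<in> C. n P \<noteq> 0} = (if d = 0 then {} else {P0})"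
 proof (cases "d = 0")
  case True
  then show ?thesis by (simp add: n_def)
 next
  case False
  have "{P \<in> C. n P \<noteq> 0} \<subseteq> {P0}"
  proof
   fix P assume P: "P \<in> {P \<in> C. n P \<noteq> 0}"
   then have "w2 P = 0" by (simp add: n_def split: if_splits)
   with P have "P = P0" by (intro uniq) simp_all
   then show "P \<in> {P0}" by (simp only: singleton_iff)
  qed
  moreover have "P0 \<in> {P \<in> C. n P \<noteq> 0}" using P0 False by (simp add: n_def)
  ultimately show ?thesis using False by (simp only: if_False) blast
 qed
 obtain P1 where P1: "P1 \<in> C" "w2 P1 \<noteq> 0" using w_onto[of 0 1] by auto
 show ?thesis unfolding has_degree_def
 proof (rule exI[of _ ?W], rule exI[of _ s], rule exI[of _ n], intro conjI)
  show "zariski_open C ?W" using zopen_nonzero[OF H_w(2)] by (simp add: zariski)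
  show "\<exists>P\<in>?W. s P \<noteq> 0" using P1 by (intro bexI[of _ P1]) (auto simp: s_def power_int_eq_0_iff)
  show "\<forall>(U, \<phi>)\<in>atlas (conic_line d). regular_on (U \<inter> ?W) (\<lambda>R. \<phi> R $$ (0, 0) * s R)"
   using reg[OF H_w(1)] reg[OF H_w(2)] by (simp add: conic_line_def)
  show "\<forall>(U, \<phi>)\<in>atlas (conic_line d). \<forall>P\<in>U. has_order C P (U \<inter> ?W) (\<lambda>R. \<phi> R $$ (0, 0) * s R) (n P)"
   using ord[of w1] ord[of w2] by (simp add: conic_line_def)
  show "finite {P \<in> C. n P \<noteq> 0}" unfolding N by simp
  show "d = (\<Sum>P | P \<in> C \<and> n P \<noteq> 0. n P)" unfolding N using P0 by (simp add: n_def)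
 qed
qed

lemma conic_O: "vector_bundle C (conic_O C d)" "rk (conic_O C d) = 1" "has_degree C (conic_O C d) d"
proof -
 have "vector_bundle C (conic_line d) \<and> rk (conic_line d) = 1 \<and> has_degree C (conic_line d) d"
  using vector_bundle_conic_line has_degree_conic_line by (simp add: conic_line_def)
 then have "vector_bundle C (conic_O C d) \<and> rk (conic_O C d) = 1 \<and> has_degree C (conic_O C d) d"
  unfolding conic_O_def by (rule someI)
 then show "vector_bundle C (conic_O C d)" "rk (conic_O C d) = 1" "has_degree C (conic_O C d) d" by simp_all
qed

section \<open>Restriction from the plane to the conic\<close>

lemma pform_H: "pform d f ==> H (2 * d) f"
proof (cases "f = 0")
 case False
 assume "pform d f"
 from pformE[OF this False] obtain n p where p: "d = int n" "form n p" "f = (\<lambda>P. p (coords P))" .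
 have "H (int (2 * n)) f" by (rule HI[OF form_bform[OF p(2)]]) (simp add: p(3) coords_w[symmetric])
 then show ?thesis using p(1) by simp
qed (simp add: H_0)

lemma lreg_restrict: "p2.lreg k A g R ==> lreg (2 * k) A g R"
proof -
 assume "p2.lreg k A g R"
 then obtain d p q where 1: "pform (d + k) p" "pform d q" "q R \<noteq> 0" "\<forall>Q\<in>A. q Q \<noteq> 0 --> g Q = p Q / q Q"
  unfolding p2.lreg_def by blast
 have "H (2 * d + 2 * k) p" using pform_H[OF 1(1)] by (simp only: distrib_left)
 then show ?thesis unfolding lreg_def using pform_H[OF 1(2)] 1(3,4)
  by (intro exI[of _ "2 * d"] exI[of _ p] exI[of _ q] conjI)
qed

definition cut :: "(P2 \<times> nat => complex) => P2 \<times> nat => complex" where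
 "cut \<sigma> = (\<lambda>(P, j). if P \<in> C then \<sigma> (P, j) else 0)"

lemma wedge_cut: "P \<in> C ==> wedge (cut \<sigma>) (cut \<tau>) P = wedge \<sigma> \<tau> P"
 by (simp add: wedge_def cut_def)

context
 fixes E :: vb
 assumes E: "vector_bundle UNIV E"
begin

lemma atlas_restrict: "x \<in> atlas (restrict_vb E C) ==> \<exists>U \<phi>. (U, \<phi>) \<in> atlas E \<and> x = (U \<inter> C, \<phi>)"
 by (auto simp: restrict_vb_def)

lemma rk_restrict: "rk (restrict_vb E C) = rk E"
 by (simp add: restrict_vb_def)

lemma vector_bundle_restrict: "vector_bundle C (restrict_vb E C)"
 unfolding vector_bundle_def rk_restrict
proof (intro conjI ballI)
 fix x assume "x \<in> atlas (restrict_vb E C)"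
 then obtain U \<phi> where U: "(U, \<phi>) \<in> atlas E" and x: "x = (U \<inter> C, \<phi>)" using atlas_restrict by blast
 have "zopen (U \<inter> C)" unfolding zopen_def
 proof (intro conjI ballI)
  fix R assume R: "R \<in> U \<inter> C"
  then have RU: "R \<in> U" by blast
  obtain d h where h: "pform d h" "h R \<noteq> 0" "\<And>Q. Q \<in> UNIV ==> h Q \<noteq> 0 ==> Q \<in> U"
   by (rule p2.zopenD[OF p2.chart(1)[OF E U] RU]) (rule that)
  show "\<exists>d h. H d h \<and> h R \<noteq> 0 \<and> (\<forall>Q\<in>C. h Q \<noteq> 0 --> Q \<in> U \<inter> C)"
   by (rule exI[of _ "2 * d"], rule exI[of _ h]) (use pform_H[OF h(1)] h(2,3) in simp)
 qed simp
 then show "case x of (U, \<phi>) => zariski_open C U \<and> (\<forall>P\<in>U. \<phi> P \<in> carrier_mat (rk E) (rk E) \<and> invertible_mat (\<phi> P))"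
  unfolding x prod.case using p2.chart(3,4)[OF E U] by (simp add: zariski)
 show "case x of (U, \<phi>) => \<forall>(V, \<psi>)\<in>atlas (restrict_vb E C). \<exists>G. regular_mat_on (U \<inter> V) (rk E) (rk E) G \<and> (\<forall>P\<in>U \<inter> V. \<psi> P = G P * \<phi> P)"
  unfolding x prod.case
 proof (rule ballI)
  fix y assume "y \<in> atlas (restrict_vb E C)"
  then obtain V \<psi> where V: "(V, \<psi>) \<in> atlas E" and y: "y = (V \<inter> C, \<psi>)" using atlas_restrict by blast
  obtain G where G: "\<And>P. P \<in> U \<inter> V ==> G P \<in> carrier_mat (rk E) (rk E)" "\<And>P. P \<in> U \<inter> V ==> \<psi> P = G P * \<phi> P"
   "\<And>P i j. P \<in> U \<inter> V ==> i < rk E ==> j < rk E ==> p2.lreg 0 (U \<inter> V) (\<lambda>Q. G Q $$ (i, j)) P"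
   by (rule p2.transition[OF E U V]) (rule that)
  have "regular_mat_on ((U \<inter> C) \<inter> (V \<inter> C)) (rk E) (rk E) G"
  proof (rule regular_matI)
   fix P i j assume P: "P \<in> (U \<inter> C) \<inter> (V \<inter> C)" and ij: "i < rk E" "j < rk E"
   have "lreg (2 * 0) (U \<inter> V) (\<lambda>Q. G Q $$ (i, j)) P" by (rule lreg_restrict[OF G(3)]) (use P ij in auto)
   then have "lreg 0 (U \<inter> V) (\<lambda>Q. G Q $$ (i, j)) P" by simp
   then show "lreg 0 ((U \<inter> C) \<inter> (V \<inter> C)) (\<lambda>Q. G Q $$ (i, j)) P" by (rule lreg_mono) blast
  qed (use G(1) in auto)
  then show "case y of (V, \<psi>) => \<exists>G. regular_mat_on (U \<inter> C \<inter> V) (rk E) (rk E) G \<and> (\<forall>P\<in>U \<inter> C \<inter> V. \<psi> P = G P * \<phi> P)"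
   unfolding y prod.case by (intro exI[of _ G] conjI ballI) (simp_all only: Int_assoc Int_left_commute Int_iff, rule G(2), simp)
 qed
next
 have "(\<Union>(U, \<phi>)\<in>atlas (restrict_vb E C). U) = (\<Union>(U, \<phi>)\<in>atlas E. U) \<inter> C" by (auto simp: restrict_vb_def)
 then show "(\<Union>(U, \<phi>)\<in>atlas (restrict_vb E C). U) = C" using E by (simp add: vector_bundle_def)
qed

lemma cut_secs:
 assumes \<sigma>: "\<sigma> \<in> p2.secs E k"
 shows "cut \<sigma> \<in> secs (restrict_vb E C) (2 * k)"
proof (rule secsI[OF vector_bundle_restrict])
 show "cut \<sigma> (P, j) = 0" if "rk (restrict_vb E C) \<le> j \<or> P \<notin> C" for P j
  using that p2.secsD(1)[OF E \<sigma>] by (auto simp: cut_def rk_restrict)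
 fix R assume R: "R \<in> C"
 obtain U \<phi> where U: "(U, \<phi>) \<in> atlas E" "R \<in> U" using p2.chart_ex[OF E, of R] by blast
 have "lreg (2 * k) (U \<inter> C) (app \<phi> (rk E) (cut \<sigma>) i) R" if "i < rk E" for i
  by (rule lreg_cong[OF lreg_mono[OF lreg_restrict[OF p2.secsD(2)[OF E \<sigma> U that]]]]) (auto simp: cut_def app_def)
 moreover have "(U \<inter> C, \<phi>) \<in> atlas (restrict_vb E C)" using U by (auto simp: restrict_vb_def)
 ultimately show "\<exists>(U, \<phi>)\<in>atlas (restrict_vb E C). R \<in> U \<and> (\<forall>i<rk (restrict_vb E C). lreg (2 * k) U (app \<phi> (rk (restrict_vb E C)) (cut \<sigma>) i) R)"
  using R U(2) unfolding rk_restrict by (intro bexI[of _ "(U \<inter> C, \<phi>)"]) simp_all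
qed

text \<open>By \<open>degree_section\<close> a line bundle of degree - d1 has, after a twist by d1,
  a section without zeros. So the frame e1, e2 fits \<open>isomorphic_direct_sum\<close> whichever
  bundles \<open>conic_O\<close> selects.\<close>

lemma restriction_splits:
 assumes r: "rk E = 2" and e1: "e1 \<in> secs (restrict_vb E C) d1" and e2: "e2 \<in> secs (restrict_vb E C) d2"
  and nz: "\<And>P. P \<in> C ==> wedge e1 e2 P \<noteq> 0"
 shows "isomorphic_vb C (restrict_vb E C) (direct_sum_vb (conic_O C (- d1)) (conic_O C (- d2)))"
proof -
 obtain t1 where t1: "t1 \<in> secs (conic_O C (- d1)) (- (- d1))" "\<And>P. P \<in> C ==> t1 (P, 0) \<noteq> 0"
  by (rule degree_section[OF conic_O]) (rule that)
 obtain t2 where t2: "t2 \<in> secs (conic_O C (- d2)) (- (- d2))" "\<And>P. P \<in> C ==> t2 (P, 0) \<noteq> 0"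
  by (rule degree_section[OF conic_O]) (rule that)
 show ?thesis
  by (rule isomorphic_direct_sum[OF vector_bundle_restrict _ conic_O(1,2) conic_O(1,2) e1 e2 _ t1[unfolded minus_minus] t2[unfolded minus_minus]])
    (use nz r in \<open>simp_all add: rk_restrict wedge_def\<close>)
qed

end

end

lemma (in conic) restriction_type:
 assumes "vector_bundle UNIV E" "rk E = 2" "chern_numbers E c 0"
 shows "\<exists>r::nat. isomorphic_vb C (restrict_vb E C) (direct_sum_vb (conic_O C (int r)) (conic_O C (2 * c - int r))) \<and>
    (r = 0 \<and> isomorphic_vb UNIV E (direct_sum_vb (line_O 0) (line_O c)) \<or> r \<ge> 2)"
proof -
 note E = assms(1,2)
 obtain \<delta> k s where \<delta>: "\<And>P. \<delta> P \<noteq> 0"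
  "\<And>U \<phi> R. (U, \<phi>) \<in> atlas E ==> R \<in> U ==> p2.lreg (- c) U (\<lambda>P. det2 (\<phi> P) * \<delta> P) R"
  and s: "s \<in> p2.secs E k" "finite {P. s (P, 0) = 0 \<and> s (P, Suc 0) = 0}" "k \<le> 0"
  and k0: "k = 0 ==> \<exists>t\<in>p2.secs E (- c). \<forall>P. wedge s t P = \<delta> P"
  by (rule rank_two_structure[OF assms(1-3)]) (rule that)
 show ?thesis
 proof (cases "k = 0")
  case True
  then obtain t where t: "t \<in> p2.secs E (- c)" "\<forall>P. wedge s t P = \<delta> P" using k0 by blast
  have s0: "s \<in> p2.secs E 0" using s(1) True by simp
  \<comment> \<open>The constant 1 is a section without zeros of O(d) twisted by - d.\<close>
  have l: "line_sec 1 \<in> p2.secs (line_O 0) 0" "line_sec 1 \<in> p2.secs (line_O c) (- c)"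
   by (rule line_sec_secs; use pform_one in simp)+
  have "isomorphic_vb UNIV E (direct_sum_vb (line_O 0) (line_O c))"
   by (rule p2.isomorphic_direct_sum[OF E vector_bundle_line_O rk_line_O vector_bundle_line_O rk_line_O s0 t(1) _ l(1) _ l(2)])
     (use t(2) \<delta>(1) in \<open>simp_all add: wedge_def line_sec_def fun_ops\<close>)
  moreover have "isomorphic_vb C (restrict_vb E C) (direct_sum_vb (conic_O C (- (2 * 0))) (conic_O C (- (2 * - c))))"
   by (rule restriction_splits[OF E cut_secs[OF E(1) s0] cut_secs[OF E(1) t(1)]]) (use t(2) \<delta>(1) in \<open>simp add: wedge_cut\<close>)
  ultimately show ?thesis by (intro exI[of _ 0]) simp
 next
  case False
  then have k: "k \<le> - 1" using s(3) by simp
  let ?F = "restrict_vb E C"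
  have F: "vector_bundle C ?F" "rk ?F = 2" using vector_bundle_restrict[OF E(1)] rk_restrict[OF E(1)] E(2) by simp_all
  have reg: "lreg (- (2 * c)) U (\<lambda>P. det2 (\<phi> P) * \<delta> P) R" if U: "(U, \<phi>) \<in> atlas ?F" "R \<in> U" for U \<phi> R
  proof -
   obtain V where V: "(V, \<phi>) \<in> atlas E" "U = V \<inter> C" using U(1) by (auto simp: restrict_vb_def)
   have "lreg (2 * (- c)) V (\<lambda>P. det2 (\<phi> P) * \<delta> P) R" by (rule lreg_restrict[OF \<delta>(2)[OF V(1)]]) (use U(2) V(2) in simp)
   then have "lreg (- (2 * c)) V (\<lambda>P. det2 (\<phi> P) * \<delta> P) R" by simp
   then show ?thesis by (rule lreg_mono) (simp add: V(2))
  qed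
  obtain P0 where P0: "P0 \<in> C" by (rule C_point)
  obtain K where K: "\<forall>k\<ge>K. \<forall>y. \<exists>\<sigma>\<in>p2.secs E (int k). \<forall>j<rk E. \<sigma> (P0, j) = y j" using generated_at[OF E(1), of P0] by blast
  \<comment> \<open>As input for \<open>splitting\<close> any two sections that are independent at
    one point of C will do; these two are the unit vectors at P0.\<close>
  obtain \<sigma>1 where \<sigma>1: "\<sigma>1 \<in> p2.secs E (int K)" "\<forall>j<rk E. \<sigma>1 (P0, j) = (if j = 0 then 1 else 0)"
   using K[rule_format, OF order_refl, of "\<lambda>j. if j = 0 then 1 else 0"] by blast
  obtain \<sigma>2 where \<sigma>2: "\<sigma>2 \<in> p2.secs E (int K)" "\<forall>j<rk E. \<sigma>2 (P0, j) = (if j = 0 then 0 else 1)"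
   using K[rule_format, OF order_refl, of "\<lambda>j. if j = 0 then 0 else 1"] by blast
  have w: "wedge (cut \<sigma>1) (cut \<sigma>2) P0 \<noteq> 0"
   unfolding wedge_cut[OF P0] using \<sigma>1(2) \<sigma>2(2) E(2) by (simp add: wedge_def)
  obtain d1 d2 e1 e2 where e: "e1 \<in> secs ?F d1" "e2 \<in> secs ?F d2" "\<And>P. P \<in> C ==> wedge e1 e2 P \<noteq> 0" "d1 + d2 + 2 * c = 0"
   and min: "\<And>l \<sigma>. l < d1 ==> \<sigma> \<in> secs ?F l ==> \<sigma> = 0"
  proof (rule splitting[where \<delta> = \<delta> and e = "2 * c", OF F _ _ cut_secs[OF E(1) \<sigma>1(1)] cut_secs[OF E(1) \<sigma>2(1)] P0 w])
   show "\<delta> P \<noteq> 0" for P by (rule \<delta>(1))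
   show "lreg (- (2 * c)) U (\<lambda>P. det2 (\<phi> P) * \<delta> P) R" if U: "(U, \<phi>) \<in> atlas ?F" "R \<in> U" for U \<phi> R
    by (rule reg[OF U])
  qed (rule that)
  \<comment> \<open>The section s has finitely many zeros, so it is not zero on C, where its degree
    is 2 k; minimality of d1 gives the bound.\<close>
  have "d1 \<le> 2 * k"
  proof (rule ccontr)
   assume "\<not> d1 \<le> 2 * k"
   then have z: "cut s = 0" using min[OF _ cut_secs[OF E(1) s(1)]] by simp
   have "C \<subseteq> {P. s (P, 0) = 0 \<and> s (P, Suc 0) = 0}"
   proof
    fix P assume "P \<in> C"
    then show "P \<in> {P. s (P, 0) = 0 \<and> s (P, Suc 0) = 0}"
     using fun_cong[OF z, of "(P, 0)"] fun_cong[OF z, of "(P, Suc 0)"] by (simp add: cut_def fun_ops)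
   qed
   then show False using s(2) infinite_C finite_subset by blast
  qed
  then have d1: "int (nat (- d1)) = - d1" "nat (- d1) \<ge> 2" using k by auto
  have "isomorphic_vb C ?F (direct_sum_vb (conic_O C (- d1)) (conic_O C (- d2)))"
   by (rule restriction_splits[OF E e(1-3)])
  moreover have "- d2 = 2 * c - int (nat (- d1))" using e(4) d1(1) by simp
  ultimately show ?thesis using d1 by (intro exI[of _ "nat (- d1)"]) simp
 qed
qed

theorem theoremC:
  fixes E :: vb and c :: int
  assumes "vector_bundle UNIV E" and "rk E = 2"
    and "chern_numbers E c 0" and "c \<le> 0"
  shows "\<forall>C. smooth_conic C \<longrightarrow>
    (\<exists>r::nat.
       isomorphic_vb C (restrict_vb E C)
         (direct_sum_vb (conic_O C (int r)) (conic_O C (2 * c - int r))) \<and>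
       (r = 0 \<and> isomorphic_vb UNIV E (direct_sum_vb (line_O 0) (line_O c)) \<or> r \<ge> 2))"
proof (intro allI impI)
 fix C assume "smooth_conic C"
 from smooth_conic_parametrisation[OF this] obtain w1 w2 v0 v1 v2 L0 L1 L2 where C: "conic C w1 w2 v0 v1 v2 L0 L1 L2"
  by (elim exE) (rule that)
 show "\<exists>r::nat. isomorphic_vb C (restrict_vb E C) (direct_sum_vb (conic_O C (int r)) (conic_O C (2 * c - int r))) \<and>
    (r = 0 \<and> isomorphic_vb UNIV E (direct_sum_vb (line_O 0) (line_O c)) \<or> r \<ge> 2)"
  by (rule conic.restriction_type[OF C assms(1-3)])
qed

end
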